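(* Assume that for each $n$, $U$ is the permutation matrix of a uniformly random permutation of $\{1,\dots,n\}$. Then, as $n\to\infty$, the following convergences in distribution hold in $D([0,1]^2)$: $$n^{-1/2}\left(T^{(n)}-\mathbb E\,T^{(n)}\right)\longrightarrow W^{(\infty)},$$ $$n^{-1/2}\left(\mathcal T^{(n)}-\mathbb E\,\mathcal T^{(n)}\right)\longrightarrow B_{0,0},$$ $$n^{-1/2}\mathcal Z^{(n)}\longrightarrow W^{(\infty)}.$$
   Context: The permutation matrix of a permutation $\pi$ of $\{1,\dots,n\}$ is $U_{ij}=\mathbf 1_{j=\pi(i)}$. $R_1,\dots,R_n$ and $C_1,\dots,C_n$ are two independent families of independent random variables uniformly distributed on $[0,1]$, and $(R_i,C_j)_{i,j}$ is independent of $U$. Define the processes indexed by $(s,t)\in[0,1]^2$: $$T^{(n)}_{s,t}=\sum_{i\le\lfloor ns\rfloor,\ j\le\lfloor nt\rfloor}|U_{ij}|^2,\qquad \mathcal T^{(n)}_{s,t}=\sum_{i,j=1}^n|U_{ij}|^2\mathbf 1_{R_i\le s}\mathbf 1_{C_j\le t},$$ $$\mathcal Z^{(n)}_{s,t}=\sum_{i,j=1}^n|U_{ij}|^2\left[\mathbf 1_{R_i\le s}-s\right]\left[\mathbf 1_{C_j\le t}-t\right].$$ $W^{(\infty)}$ (tied-down bivariate Brownian bridge) and $B_{0,0}$ (bivariate Brownian bridge) are the centered Gaussian processes with continuous paths on $[0,1]^2$ with respective covariances $$\mathbb E[W^{(\infty)}(s,t)W^{(\infty)}(s',t')]=(s\wedge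 s'-ss')(t\wedge t'-tt'),$$ $$\mathbb E[B_{0,0}(s,t)B_{0,0}(s',t')]=(s\wedge s')(t\wedge t')-ss'tt'.$$ $D([0,1]^2)$ is the Skorokhod space of functions $[0,1]^2\to\mathbb R$ which at each point are right continuous (with respect to the natural partial order of $[0,1]^2$) and admit limits in all orthants, endowed with the (Bickel–Wichura) Skorokhod topology. *)

theory Defs
  imports "HOL-Probability.Probability" "HOL-Combinatorics.Permutations"
begin

section \<open>The Skorokhod space on the unit square\<close>

definition unit_square :: "(real \<times> real) set" where
  "unit_square = {0..1} \<times> {0..1}"

text \<open>The flag \<open>True\<close> selects the coordinates that are at least that of \<open>p\<close>, \<open>False\<close> those
  that are strictly smaller, so that the four quadrants at \<open>p\<close> partition the square and
  \<open>quadrant True True p\<close> is the set of points above \<open>p\<close> in the natural partial order.\<close>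

definition quadrant :: "bool \<Rightarrow> bool \<Rightarrow> real \<times> real \<Rightarrow> (real \<times> real) set" where
  "quadrant a b p = {q \<in> unit_square.
     (if a then fst p \<le> fst q else fst q < fst p) \<and>
     (if b then snd p \<le> snd q else snd q < snd p)}"

text \<open>Paths are extensional (equal to \<open>undefined\<close> off the square), so that equality in
  the space is equality on the square. At boundary points a quadrant may be empty, or contain
  only \<open>p\<close>; the corresponding limit condition is then void.\<close>

definition skorokhod_space :: "(real \<times> real \<Rightarrow> real) set" where
  "skorokhod_space = {x \<in> extensional unit_square. \<forall>p \<in> unit_square.
     (x \<longlongrightarrow> x p) (at p within quadrant True True p) \<and>
     (\<forall>a b. \<exists>l. (x \<longlongrightarrow> l) (at p within quadrant a b p))}"

definition time_changes :: "(real \<Rightarrow> real) set" where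
  "time_changes = {l. continuous_on {0..1} l \<and> strict_mono_on {0..1} l \<and> l 0 = 0 \<and> l 1 = 1}"

text \<open>The Bickel--Wichura metric: only coordinatewise time changes
  \<open>(s, t) \<mapsto> (l s, m t)\<close> are allowed.\<close>

definition skorokhod_cost ::
  "(real \<times> real \<Rightarrow> real) \<Rightarrow> (real \<times> real \<Rightarrow> real) \<Rightarrow> (real \<Rightarrow> real) \<Rightarrow> (real \<Rightarrow> real) \<Rightarrow> real" where
  "skorokhod_cost x y l m =
     max (SUP (s, t)\<in>unit_square. \<bar>x (s, t) - y (l s, m t)\<bar>)
         (max (SUP s\<in>{0..1}. \<bar>l s - s\<bar>) (SUP t\<in>{0..1}. \<bar>m t - t\<bar>))"

definition skorokhod_dist ::
  "(real \<times> real \<Rightarrow> real) \<Rightarrow> (real \<times> real \<Rightarrow> real) \<Rightarrow> real" where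
  "skorokhod_dist x y = (INF (l, m)\<in>time_changes \<times> time_changes. skorokhod_cost x y l m)"

definition skorokhod_topology :: "(real \<times> real \<Rightarrow> real) topology" where
  "skorokhod_topology = Metric_space.mtopology skorokhod_space skorokhod_dist"

lemma id_time_change: "(\<lambda>t. t) \<in> time_changes"
  by (simp add: time_changes_def strict_mono_on_def)

lemma time_change_image:
  assumes "l \<in> time_changes" shows "l ` {0..1} = {0..1}"
proof
  have l: "continuous_on {0..1} l" "strict_mono_on {0..1} l" "l 0 = 0" "l 1 = 1"
    using assms by (auto simp: time_changes_def)
  have mono: "l s \<le> l t" if "0 \<le> s" "s \<le> t" "t \<le> 1" for s t
    by (rule strict_mono_on_leD[OF l(2)]) (use that in auto)
  show "l ` {0..1} \<subseteq> {0..1}"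
  proof
    fix y assume "y \<in> l ` {0..1}"
    then obtain t where "y = l t" "0 \<le> t" "t \<le> 1" by auto
    then show "y \<in> {0..1}" using mono[of 0 t] mono[of t 1] l(3,4) by simp
  qed
  show "{0..1} \<subseteq> l ` {0..1}"
  proof
    fix y :: real assume "y \<in> {0..1}"
    then have "\<exists>x\<ge>0. x \<le> 1 \<and> l x = y"
      using l by (intro IVT') auto
    then show "y \<in> l ` {0..1}" by auto
  qed
qed

lemma time_change_inj: "l \<in> time_changes \<Longrightarrow> inj_on l {0..1}"
  by (auto simp: time_changes_def strict_mono_on_imp_inj_on)

lemma time_change_range: "l \<in> time_changes \<Longrightarrow> t \<in> {0..1} \<Longrightarrow> l t \<in> {0..1}"
  using time_change_image by blast

lemma time_change_comp:
  assumes "l \<in> time_changes" "m \<in> time_changes" shows "l \<circ> m \<in> time_changes"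
  using assms time_change_image[OF assms(2)] time_change_range[OF assms(2)]
  by (auto simp: time_changes_def strict_mono_on_def 
      intro!: continuous_on_compose[of "{0..1}" m l, unfolded o_def])

lemma time_change_inverse:
  assumes l: "l \<in> time_changes"
  obtains k where "k \<in> time_changes"
    "\<And>t. t \<in> {0..1} \<Longrightarrow> l (k t) = t" "\<And>t. t \<in> {0..1} \<Longrightarrow> k (l t) = t"
proof
  define k where "k = inv_into {0..1} l"
  note im = time_change_image[OF l] and inj = time_change_inj[OF l]
  show lk: "l (k t) = t" if "t \<in> {0..1}" for t
    unfolding k_def by (rule f_inv_into_f) (use that im in simp)
  show kl: "k (l t) = t" if "t \<in> {0..1}" for t
    unfolding k_def by (rule inv_into_f_f[OF inj that])
  have kr: "k t \<in> {0..1}" if "t \<in> {0..1}" for t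
    unfolding k_def using that im inv_into_into[of t l "{0..1}"] by simp
  have "continuous_on {0..1} l" using l by (simp add: time_changes_def)
  then have "continuous_on (l ` {0..1}) k"
    by (rule continuous_on_inv[OF _ compact_Icc]) (simp add: kl)
  then have "continuous_on {0..1} k" by (simp only: im)
  moreover have "strict_mono_on {0..1} k"
  proof (rule strict_mono_onI)
    fix r s :: real assume rs: "r \<in> {0..1}" "s \<in> {0..1}" "r < s"
    have sm: "strict_mono_on {0..1} l" using l by (simp add: time_changes_def)
    have "l (k s) \<le> l (k r)" if "k s \<le> k r"
      by (rule strict_mono_on_leD[OF sm kr[OF rs(2)] kr[OF rs(1)] that])
    then show "k r < k s" using lk[OF rs(1)] lk[OF rs(2)] rs(3) by linarith
  qed
  moreover have "k 0 = 0" "k 1 = 1"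
    using kl[of 0] kl[of 1] l by (simp_all add: time_changes_def)
  ultimately show "k \<in> time_changes" by (simp add: time_changes_def)
qed

lemma skorokhod_space_bounded:
  assumes x: "x \<in> skorokhod_space"
  shows "\<exists>B. \<forall>p\<in>unit_square. \<bar>x p\<bar> \<le> B"
proof -
  have "\<exists>U B. open U \<and> p \<in> U \<and> (\<forall>q\<in>unit_square \<inter> U. \<bar>x q\<bar> \<le> B)" if p: "p \<in> unit_square" for p
  proof -
    have "\<exists>d B. d > 0 \<and> (\<forall>q\<in>quadrant a b p. dist q p < d \<longrightarrow> \<bar>x q\<bar> \<le> B)" for a b
    proof -
      obtain l where "(x \<longlongrightarrow> l) (at p within quadrant a b p)"
        using x p unfolding skorokhod_space_def by blast
      then have "\<forall>\<^sub>F q in at p within quadrant a b p. dist (x q) l < 1"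
        by (rule tendstoD) simp
      then obtain d where d: "d > 0"
        "\<And>q. q \<in> quadrant a b p \<Longrightarrow> q \<noteq> p \<Longrightarrow> dist q p < d \<Longrightarrow> dist (x q) l < 1"
        unfolding eventually_at by auto
      have "\<bar>x q\<bar> \<le> max (\<bar>l\<bar> + 1) \<bar>x p\<bar>" if "q \<in> quadrant a b p" "dist q p < d" for q
        using d(2)[of q] that by (cases "q = p") (auto simp: dist_real_def)
      with d(1) show ?thesis by blast
    qed
    then obtain d B where dB: "\<And>a b. d a b > 0"
      "\<And>a b q. q \<in> quadrant a b p \<Longrightarrow> dist q p < d a b \<Longrightarrow> \<bar>x q\<bar> \<le> B a b" by metis
    define e where "e = Min (range (\<lambda>(a, b). d a b))"
    define C where "C = Max (range (\<lambda>(a, b). B a b))"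
    have e: "e > 0" "e \<le> d a b" and C: "B a b \<le> C" for a b
      using dB(1) by (auto simp: e_def C_def intro!: Min_le Max_ge)
    have "\<bar>x q\<bar> \<le> C" if "q \<in> unit_square \<inter> ball p e" for q
    proof -
      have "q \<in> quadrant (fst p \<le> fst q) (snd p \<le> snd q) p"
        using that by (auto simp: quadrant_def)
      then show ?thesis
        using dB(2)[of q "fst p \<le> fst q" "snd p \<le> snd q"] that
          e(2)[of "fst p \<le> fst q" "snd p \<le> snd q"] C[of "fst p \<le> fst q" "snd p \<le> snd q"]
        by (force simp: dist_commute)
    qed
    with e(1) show ?thesis by (intro exI[of _ "ball p e"] exI[of _ C]) auto
  qed
  then obtain U B where UB: "\<And>p. p \<in> unit_square \<Longrightarrow> open (U p) \<and> p \<in> U p"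
    "\<And>p q. p \<in> unit_square \<Longrightarrow> q \<in> unit_square \<inter> U p \<Longrightarrow> \<bar>x q\<bar> \<le> B p" by metis
  have "compact unit_square" by (simp add: unit_square_def compact_Times)
  then obtain F where F: "F \<subseteq> unit_square" "finite F" "unit_square \<subseteq> (\<Union>p\<in>F. U p)"
    by (rule compactE_image[of unit_square unit_square U]) (use UB in auto)
  have "\<bar>x q\<bar> \<le> Max (B ` F)" if q: "q \<in> unit_square" for q
  proof -
    obtain p where p: "p \<in> F" "q \<in> U p" using F(3) q by blast
    then have "\<bar>x q\<bar> \<le> B p" using UB(2)[of p q] F(1) q by blast
    also have "B p \<le> Max (B ` F)" using F(2) p(1) by simp
    finally show ?thesis .
  qed
  then show ?thesis by blast
qed

lemma skorokhod_cost_le_iff: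
  assumes "x \<in> skorokhod_space" "y \<in> skorokhod_space" "l \<in> time_changes" "m \<in> time_changes"
  shows "skorokhod_cost x y l m \<le> e \<longleftrightarrow>
    (\<forall>s\<in>{0..1}. \<forall>t\<in>{0..1}. \<bar>x (s, t) - y (l s, m t)\<bar> \<le> e) \<and>
    (\<forall>s\<in>{0..1}. \<bar>l s - s\<bar> \<le> e) \<and> (\<forall>t\<in>{0..1}. \<bar>m t - t\<bar> \<le> e)"
proof -
  obtain B C where B: "\<And>p. p \<in> unit_square \<Longrightarrow> \<bar>x p\<bar> \<le> B" and C: "\<And>p. p \<in> unit_square \<Longrightarrow> \<bar>y p\<bar> \<le> C"
    using skorokhod_space_bounded assms(1,2) by metis
  have 1: "bdd_above ((\<lambda>s. \<bar>k s - s\<bar>) ` {0..1})" if "k \<in> time_changes" for k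
    using time_change_range[OF that] by (intro bdd_aboveI2[of _ _ 1]) (force simp: abs_le_iff)
  have 2: "bdd_above ((\<lambda>(s, t). \<bar>x (s, t) - y (l s, m t)\<bar>) ` unit_square)"
  proof (rule bdd_aboveI2[of _ _ "B + C"])
    fix p assume "p \<in> unit_square"
    then obtain s t where p: "p = (s, t)" "s \<in> {0..1}" "t \<in> {0..1}" by (auto simp: unit_square_def)
    then have "(s, t) \<in> unit_square" "(l s, m t) \<in> unit_square"
      using time_change_range assms by (auto simp: unit_square_def)
    from B[OF this(1)] C[OF this(2)]
    show "(case p of (s, t) \<Rightarrow> \<bar>x (s, t) - y (l s, m t)\<bar>) \<le> B + C" by (simp add: p)
  qed
  have "unit_square \<noteq> {}" by (simp add: unit_square_def)
  then show ?thesis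
    using 1[OF assms(3)] 1[OF assms(4)] 2
    by (simp add: skorokhod_cost_def cSUP_le_iff) (auto simp: unit_square_def)
qed

lemma skorokhod_cost_nonneg:
  assumes "l \<in> time_changes" shows "0 \<le> skorokhod_cost x y l m"
proof -
  have "bdd_above ((\<lambda>s. \<bar>l s - s\<bar>) ` {0..1})"
    using time_change_range[OF assms] by (intro bdd_aboveI2[of _ _ 1]) (force simp: abs_le_iff)
  then have "\<bar>l 0 - 0\<bar> \<le> (SUP s\<in>{0..1}. \<bar>l s - s\<bar>)" by (intro cSUP_upper) auto
  then show ?thesis by (simp add: skorokhod_cost_def)
qed

lemma skorokhod_dist_less_iff:
  "skorokhod_dist x y < e \<longleftrightarrow>
    (\<exists>l\<in>time_changes. \<exists>m\<in>time_changes. skorokhod_cost x y l m < e)"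
proof -
  have "bdd_below ((\<lambda>(l, m). skorokhod_cost x y l m) ` (time_changes \<times> time_changes))"
    by (intro bdd_belowI2[of _ 0]) (auto simp: skorokhod_cost_nonneg)
  then show ?thesis
    unfolding skorokhod_dist_def using id_time_change by (subst cINF_less_iff) auto
qed

lemma skorokhod_dist_commute_le: "skorokhod_dist x y \<le> skorokhod_dist y x"
proof (rule dense_ge)
  fix e assume "skorokhod_dist y x < e"
  then obtain l m where lm: "l \<in> time_changes" "m \<in> time_changes" "skorokhod_cost y x l m < e"
    by (auto simp: skorokhod_dist_less_iff)
  obtain l' where l': "l' \<in> time_changes" "\<And>t. t \<in> {0..1} \<Longrightarrow> l (l' t) = t" "\<And>t. t \<in> {0..1} \<Longrightarrow> l' (l t) = t"
    using time_change_inverse[OF lm(1)] by blast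
  obtain m' where m': "m' \<in> time_changes" "\<And>t. t \<in> {0..1} \<Longrightarrow> m (m' t) = t" "\<And>t. t \<in> {0..1} \<Longrightarrow> m' (m t) = t"
    using time_change_inverse[OF lm(2)] by blast
  have 1: "(\<lambda>s. \<bar>k' s - s\<bar>) ` {0..1} = (\<lambda>s. \<bar>k s - s\<bar>) ` {0..1}"
    if "k \<in> time_changes" "k' \<in> time_changes" "\<And>t. t \<in> {0..1} \<Longrightarrow> k' (k t) = t" for k k'
  proof -
    have "(\<lambda>s. \<bar>k' s - s\<bar>) ` {0..1} = (\<lambda>s. \<bar>k' s - s\<bar>) ` (k ` {0..1})"
      using time_change_image[OF that(1)] by simp
    also have "\<dots> = (\<lambda>s. \<bar>k s - s\<bar>) ` {0..1}"
      unfolding image_image using that(3) by (intro image_cong) auto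
    finally show ?thesis .
  qed
  have "unit_square = (\<lambda>(s, t). (l s, m t)) ` unit_square"
    using time_change_image[OF lm(1)] time_change_image[OF lm(2)]
    by (simp add: unit_square_def image_paired_Times)
  then have "(\<lambda>(s, t). \<bar>x (s, t) - y (l' s, m' t)\<bar>) ` unit_square =
      (\<lambda>(s, t). \<bar>x (s, t) - y (l' s, m' t)\<bar>) ` (\<lambda>(s, t). (l s, m t)) ` unit_square" by simp
  also have "\<dots> = (\<lambda>(s, t). \<bar>y (s, t) - x (l s, m t)\<bar>) ` unit_square"
    unfolding image_image using l'(3) m'(3)
    by (intro image_cong) (auto simp: unit_square_def abs_minus_commute)
  finally have "skorokhod_cost x y l' m' = skorokhod_cost y x l m"
    using 1[OF lm(1) l'(1,3)] 1[OF lm(2) m'(1,3)] by (simp add: skorokhod_cost_def)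
  with lm l' m' show "skorokhod_dist x y \<le> e"
    by (metis less_imp_le skorokhod_dist_less_iff)
qed

lemma skorokhod_dist_triangle:
  assumes D: "x \<in> skorokhod_space" "y \<in> skorokhod_space" "z \<in> skorokhod_space"
  shows "skorokhod_dist x z \<le> skorokhod_dist x y + skorokhod_dist y z"
proof (rule field_le_epsilon)
  fix e :: real assume "e > 0"
  then have "skorokhod_dist x y < skorokhod_dist x y + e / 2" "skorokhod_dist y z < skorokhod_dist y z + e / 2"
    by auto
  then obtain l m l' m' where
    lm: "l \<in> time_changes" "m \<in> time_changes" "skorokhod_cost x y l m \<le> skorokhod_dist x y + e / 2" and
    lm': "l' \<in> time_changes" "m' \<in> time_changes" "skorokhod_cost y z l' m' \<le> skorokhod_dist y z + e / 2"
    unfolding skorokhod_dist_less_iff by (meson less_imp_le)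
  define a b where "a = skorokhod_dist x y + e / 2" and "b = skorokhod_dist y z + e / 2"
  have 1: "\<bar>x (s, t) - y (l s, m t)\<bar> \<le> a" "\<bar>l s - s\<bar> \<le> a" "\<bar>m t - t\<bar> \<le> a"
    "\<bar>y (s, t) - z (l' s, m' t)\<bar> \<le> b" "\<bar>l' s - s\<bar> \<le> b" "\<bar>m' t - t\<bar> \<le> b"
    if "s \<in> {0..1}" "t \<in> {0..1}" for s t
    using lm lm' that D by (auto simp: skorokhod_cost_le_iff a_def b_def)
  have "skorokhod_cost x z (l' \<circ> l) (m' \<circ> m) \<le> a + b"
    using lm lm' D
  proof (simp add: skorokhod_cost_le_iff time_change_comp, intro conjI ballI)
    fix s :: real assume s: "s \<in> {0..1}"
    show "\<bar>l' (l s) - s\<bar> \<le> a + b" "\<bar>m' (m s) - s\<bar> \<le> a + b"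
      using 1(2,3)[OF s s] 1(5,6)[of "l s" "m s"] time_change_range s lm by force+
    fix t :: real assume t: "t \<in> {0..1}"
    show "\<bar>x (s, t) - z (l' (l s), m' (m t))\<bar> \<le> a + b"
      using 1(1)[OF s t] 1(4)[of "l s" "m t"] time_change_range s t lm by force
  qed
  then have "\<not> a + b < skorokhod_dist x z"
    using lm lm' time_change_comp skorokhod_dist_less_iff
    by (meson leD order_le_less_trans order_less_irrefl)
  then show "skorokhod_dist x z \<le> skorokhod_dist x y + skorokhod_dist y z + e"
    by (simp add: a_def b_def)
qed

lemma skorokhod_dist_zero:
  assumes D: "x \<in> skorokhod_space" "y \<in> skorokhod_space"
  shows "skorokhod_dist x y = 0 \<longleftrightarrow> x = y"
proof
  assume "x = y"
  have "skorokhod_cost x x (\<lambda>t. t) (\<lambda>t. t) \<le> 0"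
    using D id_time_change by (simp add: skorokhod_cost_le_iff)
  then have "skorokhod_dist x x < e" if "e > 0" for e
    using that id_time_change skorokhod_dist_less_iff by (meson order_le_less_trans)
  moreover have "\<not> skorokhod_dist x x < 0"
    unfolding skorokhod_dist_less_iff by (auto simp: not_less skorokhod_cost_nonneg)
  ultimately show "skorokhod_dist x y = 0" using \<open>x = y\<close> by (metis linorder_neqE order_less_irrefl)
next
  assume zero: "skorokhod_dist x y = 0"
  have "x p = y p" if p: "p \<in> unit_square" for p
  proof -
    have "\<bar>x p - y p\<bar> \<le> e" if e: "e > 0" for e
    proof -
      have near: "\<exists>d>0. \<forall>q\<in>quadrant True True p. dist q p < d \<longrightarrow> \<bar>z q - z p\<bar> < e / 3"
        if "z \<in> skorokhod_space" for z
      proof -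
        have "(z \<longlongrightarrow> z p) (at p within quadrant True True p)"
          using that p unfolding skorokhod_space_def by blast
        then have "\<forall>\<^sub>F q in at p within quadrant True True p. dist (z q) (z p) < e / 3"
          using e by (intro tendstoD) auto
        then obtain d where d: "d > 0"
          "\<And>q. q \<in> quadrant True True p \<Longrightarrow> q \<noteq> p \<Longrightarrow> dist q p < d \<Longrightarrow> dist (z q) (z p) < e / 3"
          unfolding eventually_at by auto
        have "\<bar>z q - z p\<bar> < e / 3" if "q \<in> quadrant True True p" "dist q p < d" for q
          using d(2)[of q] that e by (cases "q = p") (auto simp: dist_real_def)
        with d(1) show ?thesis by blast
      qed
      obtain d1 d2 where d12: "d1 > 0" "d2 > 0"
        "\<And>q. q \<in> quadrant True True p \<Longrightarrow> dist q p < d1 \<Longrightarrow> \<bar>x q - x p\<bar> < e / 3"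
        "\<And>q. q \<in> quadrant True True p \<Longrightarrow> dist q p < d2 \<Longrightarrow> \<bar>y q - y p\<bar> < e / 3"
        using near[OF D(1)] near[OF D(2)] by blast
      define d where "d = min d1 d2 / 5"
      have d: "d > 0" "5 * d \<le> d1" "5 * d \<le> d2" using d12(1,2) by (simp_all add: d_def)
      obtain s t where st: "p = (s, t)" "s \<in> {0..1}" "t \<in> {0..1}"
        using p by (auto simp: unit_square_def)
      define up where "up u = min 1 (u + d)" for u :: real
      \<comment> \<open>\<open>up u\<close> leaves enough room for a small time change, or is the endpoint \<open>1\<close>, which is fixed\<close>
      define g where "g = min (e / 3) d"
      have "skorokhod_dist x y < g" using zero e d by (simp add: g_def)
      then obtain l m where lm: "l \<in> time_changes" "m \<in> time_changes" "skorokhod_cost x y l m \<le> g"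
        unfolding skorokhod_dist_less_iff by (meson less_imp_le)
      have C: "\<bar>x (s, t) - y (l s, m t)\<bar> \<le> e / 3" "\<bar>l s - s\<bar> \<le> d" "\<bar>m t - t\<bar> \<le> d"
        if "s \<in> {0..1}" "t \<in> {0..1}" for s t
      proof -
        have "skorokhod_cost x y l m \<le> e / 3" "skorokhod_cost x y l m \<le> d"
          using lm(3) by (auto simp: g_def)
        then show "\<bar>x (s, t) - y (l s, m t)\<bar> \<le> e / 3" "\<bar>l s - s\<bar> \<le> d" "\<bar>m t - t\<bar> \<le> d"
          unfolding skorokhod_cost_le_iff[OF D lm(1,2)] using that by blast+
      qed
      have up: "up u \<in> {0..1}" "u \<le> up u" "up u \<le> u + d" if "u \<in> {0..1}" for u
        using that d by (auto simp: up_def)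
      have k: "u \<le> k (up u) \<and> k (up u) \<le> u + 2 * d \<and> k (up u) \<in> {0..1}"
        if "k \<in> time_changes" "\<And>s. s \<in> {0..1} \<Longrightarrow> \<bar>k s - s\<bar> \<le> d" "u \<in> {0..1}" for k u
      proof -
        have r: "k (up u) \<in> {0..1}" using time_change_range that up by blast
        have "\<bar>k (up u) - up u\<bar> \<le> d" using that up by blast
        moreover have "u \<le> k (up u)"
        proof (cases "u + d \<le> 1")
          case True
          then show ?thesis using calculation by (auto simp: up_def)
        next
          case False
          then have "up u = 1" by (simp add: up_def)
          then show ?thesis using that by (auto simp: time_changes_def)
        qed
        ultimately show ?thesis using r up[OF that(3)] by auto
      qed
      have L: "s \<le> l (up s) \<and> l (up s) \<le> s + 2 * d \<and> l (up s) \<in> {0..1}"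
        using C(2) st lm by (intro k) auto
      have M: "t \<le> m (up t) \<and> m (up t) \<le> t + 2 * d \<and> m (up t) \<in> {0..1}"
        using C(3) st lm by (intro k) auto
      have close: "(a, b) \<in> quadrant True True p \<and> dist (a, b) p < 5 * d"
        if "s \<le> a" "a \<le> s + 2 * d" "a \<in> {0..1}" "t \<le> b" "b \<le> t + 2 * d" "b \<in> {0..1}" for a b
      proof -
        have "dist (a, b) p \<le> \<bar>a - s\<bar> + \<bar>b - t\<bar>"
          by (simp add: st dist_Pair_Pair dist_real_def sqrt_sum_squares_le_sum_abs)
        then have "dist (a, b) p < 5 * d" using that(1,2,4,5) d(1) by linarith
        moreover have "(a, b) \<in> quadrant True True p"
          using that by (simp add: quadrant_def unit_square_def st)
        ultimately show ?thesis by blast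
      qed
      have "\<bar>x (up s, up t) - x p\<bar> < e / 3"
      proof (rule d12(3))
        have "(up s, up t) \<in> quadrant True True p \<and> dist (up s, up t) p < 5 * d"
          by (rule close) (use up[OF st(2)] up[OF st(3)] d(1) in simp_all)
        then show "(up s, up t) \<in> quadrant True True p" "dist (up s, up t) p < d1"
          using d(2) by linarith+
      qed
      moreover have "\<bar>y (l (up s), m (up t)) - y p\<bar> < e / 3"
      proof (rule d12(4))
        have "(l (up s), m (up t)) \<in> quadrant True True p \<and> dist (l (up s), m (up t)) p < 5 * d"
          by (rule close) (use L M in simp_all)
        then show "(l (up s), m (up t)) \<in> quadrant True True p" "dist (l (up s), m (up t)) p < d2"
          using d(3) by linarith+
      qed
      moreover have "\<bar>x (up s, up t) - y (l (up s), m (up t))\<bar> \<le> e / 3"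
        by (rule C(1)[OF up(1)[OF st(2)] up(1)[OF st(3)]])
      ultimately show ?thesis by linarith
    qed
    then have "\<bar>x p - y p\<bar> \<le> 0" using dense_ge[of 0] by blast
    then show ?thesis by simp
  qed
  moreover have "x \<in> extensional unit_square" "y \<in> extensional unit_square"
    using D by (auto simp: skorokhod_space_def)
  ultimately show "x = y" by (intro extensionalityI)
qed

lemma Metric_space_skorokhod: "Metric_space skorokhod_space skorokhod_dist"
proof
  fix x y z :: "real \<times> real \<Rightarrow> real"
  have "\<not> skorokhod_dist x y < 0"
    unfolding skorokhod_dist_less_iff by (auto simp: not_less skorokhod_cost_nonneg)
  then show "0 \<le> skorokhod_dist x y" by simp
  show "skorokhod_dist x y = skorokhod_dist y x"
    by (intro antisym skorokhod_dist_commute_le)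
qed (simp_all add: skorokhod_dist_zero skorokhod_dist_triangle)


section \<open>Convergence in distribution and Gaussian processes\<close>

definition borel_of_topology :: "'s topology \<Rightarrow> 's measure" where
  "borel_of_topology S = sigma (topspace S) {U. openin S U}"

text \<open>The variables \<open>X n\<close> may live on different probability spaces \<open>M n\<close>.\<close>

definition converges_in_distribution ::
  "'s topology \<Rightarrow> (nat \<Rightarrow> 'a measure) \<Rightarrow> (nat \<Rightarrow> 'a \<Rightarrow> 's) \<Rightarrow> 'b measure \<Rightarrow> ('b \<Rightarrow> 's) \<Rightarrow> bool" where
  "converges_in_distribution S M X N Y \<longleftrightarrow>
     (\<forall>n. X n \<in> M n \<rightarrow>\<^sub>M borel_of_topology S) \<and> Y \<in> N \<rightarrow>\<^sub>M borel_of_topology S \<and>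
     (\<forall>f. continuous_map S euclideanreal f \<and> (\<exists>B. \<forall>x\<in>topspace S. \<bar>f x\<bar> \<le> B) \<longrightarrow>
        (\<lambda>n. \<integral>\<omega>. f (X n \<omega>) \<partial>M n) \<longlonglongrightarrow> (\<integral>\<omega>. f (Y \<omega>) \<partial>N))"

definition gaussian_variable :: "'b measure \<Rightarrow> ('b \<Rightarrow> real) \<Rightarrow> bool" where
  "gaussian_variable N X \<longleftrightarrow> X \<in> borel_measurable N \<and>
     (\<exists>\<mu> \<sigma>. \<sigma> \<ge> 0 \<and> distr N borel X =
        (if \<sigma> = 0 then return borel \<mu> else density lborel (normal_density \<mu> \<sigma>)))"

definition gaussian_process :: "'b measure \<Rightarrow> 'i set \<Rightarrow> ('b \<Rightarrow> 'i \<Rightarrow> real) \<Rightarrow> bool" where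
  "gaussian_process N I G \<longleftrightarrow> prob_space N \<and>
     (\<forall>F c. finite F \<and> F \<subseteq> I \<longrightarrow> gaussian_variable N (\<lambda>\<omega>. \<Sum>p\<in>F. c p * G \<omega> p))"

definition continuous_centered_gaussian ::
  "'b measure \<Rightarrow> (real \<times> real \<Rightarrow> real \<times> real \<Rightarrow> real) \<Rightarrow> ('b \<Rightarrow> real \<times> real \<Rightarrow> real) \<Rightarrow> bool" where
  "continuous_centered_gaussian N K G \<longleftrightarrow> gaussian_process N unit_square G \<and>
     (\<forall>p\<in>unit_square. (\<integral>\<omega>. G \<omega> p \<partial>N) = 0) \<and>
     (\<forall>p\<in>unit_square. \<forall>q\<in>unit_square. (\<integral>\<omega>. G \<omega> p * G \<omega> q \<partial>N) = K p q) \<and>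
     (\<forall>\<omega>\<in>space N. continuous_on unit_square (G \<omega>))"

definition tied_down_bridge :: "'b measure \<Rightarrow> ('b \<Rightarrow> real \<times> real \<Rightarrow> real) \<Rightarrow> bool" where
  "tied_down_bridge N = continuous_centered_gaussian N
     (\<lambda>(s, t) (s', t'). (min s s' - s * s') * (min t t' - t * t'))"

definition bivariate_bridge :: "'b measure \<Rightarrow> ('b \<Rightarrow> real \<times> real \<Rightarrow> real) \<Rightarrow> bool" where
  "bivariate_bridge N = continuous_centered_gaussian N
     (\<lambda>(s, t) (s', t'). min s s' * min t t' - s * s' * t * t')"


text \<open>Independence of two random variables with possibly different value types; the library's
  \<open>indep_var\<close> is the case of equal value types.\<close>

definition independent_variables ::
  "'a measure \<Rightarrow> 's measure \<Rightarrow> ('a \<Rightarrow> 's) \<Rightarrow> 't measure \<Rightarrow> ('a \<Rightarrow> 't) \<Rightarrow> bool" where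
  "independent_variables M S X T Y \<longleftrightarrow> X \<in> M \<rightarrow>\<^sub>M S \<and> Y \<in> M \<rightarrow>\<^sub>M T \<and>
     prob_space.indep_set M {X -` A \<inter> space M |A. A \<in> sets S} {Y -` A \<inter> space M |A. A \<in> sets T}"


section \<open>The processes\<close>

definition perm_matrix :: "(nat \<Rightarrow> nat) \<Rightarrow> nat \<Rightarrow> nat \<Rightarrow> complex" where
  "perm_matrix \<pi> i j = (if j = \<pi> i then 1 else 0)"

definition T_process :: "nat \<Rightarrow> (nat \<Rightarrow> nat \<Rightarrow> complex) \<Rightarrow> real \<times> real \<Rightarrow> real" where
  "T_process n U = (\<lambda>(s, t). \<Sum>i = 1..nat \<lfloor>real n * s\<rfloor>. \<Sum>j = 1..nat \<lfloor>real n * t\<rfloor>. (cmod (U i j))\<^sup>2)"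

definition calT_process ::
  "nat \<Rightarrow> (nat \<Rightarrow> nat \<Rightarrow> complex) \<Rightarrow> (nat \<Rightarrow> real) \<Rightarrow> (nat \<Rightarrow> real) \<Rightarrow> real \<times> real \<Rightarrow> real" where
  "calT_process n U r c = (\<lambda>(s, t).
     \<Sum>i = 1..n. \<Sum>j = 1..n. (cmod (U i j))\<^sup>2 * of_bool (r i \<le> s) * of_bool (c j \<le> t))"

definition calZ_process ::
  "nat \<Rightarrow> (nat \<Rightarrow> nat \<Rightarrow> complex) \<Rightarrow> (nat \<Rightarrow> real) \<Rightarrow> (nat \<Rightarrow> real) \<Rightarrow> real \<times> real \<Rightarrow> real" where
  "calZ_process n U r c = (\<lambda>(s, t).
     \<Sum>i = 1..n. \<Sum>j = 1..n. (cmod (U i j))\<^sup>2 * (of_bool (r i \<le> s) - s) * (of_bool (c j \<le> t) - t))"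

text \<open>Restriction to the square turns a random function into a random element of
  \<open>skorokhod_space\<close>.\<close>

definition path_on_square :: "(real \<times> real \<Rightarrow> real) \<Rightarrow> real \<times> real \<Rightarrow> real" where
  "path_on_square x = restrict x unit_square"

definition centered :: "'a measure \<Rightarrow> ('a \<Rightarrow> 'i \<Rightarrow> real) \<Rightarrow> 'a \<Rightarrow> 'i \<Rightarrow> real" where
  "centered M X \<omega> p = X \<omega> p - (\<integral>\<omega>'. X \<omega>' p \<partial>M)"

end

theory Submission
  imports Defs "HOL-Real_Asymp.Real_Asymp"
begin

text \<open>If \<open>(R, C)\<close> is independent of the uniform permutation \<open>\<pi>\<close>, then the points \<open>(R\<^sub>i, C\<^sub>\<pi>\<^sub>(\<^sub>i\<^sub>))\<close> are
  independent and uniform on the square. Hence the second process is the empirical process of \<open>n\<close> independent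
  uniform points and the third one is the sum of the independent centered fields
  \<open>(1[R\<^sub>i \<le> s] - s) (1[C\<^sub>\<pi>\<^sub>(\<^sub>i\<^sub>) \<le> t] - t)\<close>. For such sums the characteristic functions give convergence of
  the finite-dimensional distributions, and dyadic chaining with exponential bounds controls the modulus of
  continuity; discretization to a grid then yields convergence of bounded Lipschitz functionals, which is enough.

  For the first process, the relative ranks of independent uniform points form a uniform permutation, and at the
  order statistics \<open>q\<close>, \<open>q'\<close> of the sample its process differs from the third process by
  \<open>n\<^sup>-\<^sup>1\<^sup>/\<^sup>2\<close> times a product of two one-dimensional empirical processes, which is negligible.\<close>


text \<open>Random paths are measured by the Borel sets of the Skorokhod topology, so even the
  measurability of a jump path has to be proved. Rounding the sample points to a lattice leaves
  countably many paths, and time changes close to the identity move the jumps back to their places.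
  All other comparisons are made in supremum distance, which suffices because the limits are
  continuous.

  The chaining has to stop at mesh \<open>1 / n\<close>: an increment over distance \<open>d\<close>
  needs a Chernoff parameter of order \<open>1 / sqrt d\<close>, which bounded summands admit only
  while \<open>n * d \<ge> 1\<close>. Inside the finest cells the increment is bounded by the number
  of sample points in a strip, which is far below \<open>sqrt n\<close>.

  The summands of the first process are dependent and its jumps sit at fixed places. The centering
  \<open>k * l / n\<close> is, at the order statistics, \<open>n\<close> times a product of two
  empirical distribution functions; expanding it around the uniform distribution produces the
  product correction.\<close>

section \<open>Borel sets of a topology and convergence in distribution in metric spaces\<close>

lemma space_borel_of_topology [simp]: "space (borel_of_topology S) = topspace S"
  unfolding borel_of_topology_def by (rule space_measure_of) (auto dest: openin_subset)

lemma sets_borel_of_topology_open: "openin S U \<Longrightarrow> U \<in> sets (borel_of_topology S)"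
  unfolding borel_of_topology_def by (auto simp: sets_measure_of_conv dest: openin_subset)

lemma measurable_borel_of_topologyI:
  assumes "X \<in> space M \<rightarrow> topspace S"
    and "\<And>U. openin S U \<Longrightarrow> X -` U \<inter> space M \<in> sets M"
  shows "X \<in> M \<rightarrow>\<^sub>M borel_of_topology S"
  unfolding borel_of_topology_def using assms
  by (intro measurable_measure_of) (auto dest: openin_subset)

lemma continuous_map_borel_measurable:
  fixes f :: "'s \<Rightarrow> real"
  assumes "continuous_map S euclideanreal f"
  shows "f \<in> borel_measurable (borel_of_topology S)"
proof (rule borel_measurableI)
  fix U :: "real set" assume "open U"
  then have "openin S {x \<in> topspace S. f x \<in> U}"
    using assms by (simp add: continuous_map_def)
  moreover have "{x \<in> topspace S. f x \<in> U} = f -` U \<inter> space (borel_of_topology S)" by auto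
  ultimately show "f -` U \<inter> space (borel_of_topology S) \<in> sets (borel_of_topology S)"
    using sets_borel_of_topology_open by metis
qed

context Metric_space
begin

lemma lipschitz_continuous_map:
  fixes f :: "'a \<Rightarrow> real"
  assumes f: "\<And>x y. x \<in> M \<Longrightarrow> y \<in> M \<Longrightarrow> \<bar>f x - f y\<bar> \<le> L * d x y"
  shows "continuous_map mtopology euclideanreal f"
  unfolding continuous_map_def
proof (intro conjI allI impI)
  fix U :: "real set" assume "openin euclideanreal U"
  then have U: "open U" by simp
  show "openin mtopology {x \<in> topspace mtopology. f x \<in> U}"
    unfolding openin_mtopology
  proof (intro conjI allI impI)
    fix x assume x: "x \<in> {x \<in> topspace mtopology. f x \<in> U}"
    then obtain e where e: "e > 0" "\<And>z. \<bar>z - f x\<bar> < e \<Longrightarrow> z \<in> U"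
      using U by (auto simp: open_dist dist_real_def)
    have "mball x (e / (\<bar>L\<bar> + 1)) \<subseteq> {x \<in> topspace mtopology. f x \<in> U}"
    proof
      fix y assume y: "y \<in> mball x (e / (\<bar>L\<bar> + 1))"
      then have xy: "x \<in> M" "y \<in> M" "d y x < e / (\<bar>L\<bar> + 1)" by (auto simp: commute)
      have "\<bar>f y - f x\<bar> \<le> L * d y x" using f xy by simp
      also have "\<dots> \<le> (\<bar>L\<bar> + 1) * d y x"
        by (rule mult_right_mono) auto
      also have "\<dots> < e" using xy(3) by (simp add: field_simps add_pos_nonneg)
      finally show "y \<in> {x \<in> topspace mtopology. f x \<in> U}" using e(2) xy by simp
    qed
    then show "\<exists>r>0. mball x r \<subseteq> {x \<in> topspace mtopology. f x \<in> U}"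
      using e(1) by (intro exI[of _ "e / (\<bar>L\<bar> + 1)"]) auto
  qed auto
qed auto

text \<open>An open set is the union of the open sets \<open>V m\<close> of points having a ball of
  radius above \<open>1 / (m + 1)\<close> inside it. The limit lies in \<open>U\<close> exactly when
  for some \<open>m\<close> the approximations eventually lie in \<open>V m\<close>, which is a
  countable combination of measurable events.\<close>

lemma measurable_mlimit:
  assumes X: "\<And>k::nat. X k \<in> N \<rightarrow>\<^sub>M borel_of_topology mtopology"
    and Y: "\<And>w. w \<in> space N \<Longrightarrow> Y w \<in> M"
    and lim: "\<And>w. w \<in> space N \<Longrightarrow> (\<lambda>k. d (X k w) (Y w)) \<longlonglongrightarrow> 0"
  shows "Y \<in> N \<rightarrow>\<^sub>M borel_of_topology mtopology"
proof (rule measurable_borel_of_topologyI)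
  show "Y \<in> space N \<rightarrow> topspace mtopology" using Y by auto
  fix U assume U: "openin mtopology U"
  \<comment> \<open>The strict inequality is what makes \<open>V m\<close> open: each of its points
    has some slack in the radius, and half of it may be spent on moving the centre.\<close>
  define V where "V m = {y \<in> M. \<exists>r > 1 / real (Suc m). mball y r \<subseteq> U}" for m
  have XM: "X k w \<in> M" if "w \<in> space N" for k w
    using measurable_space[OF X that] by simp
  have V: "openin mtopology (V m)" for m
    unfolding openin_mtopology
  proof (intro conjI allI impI)
    fix y assume "y \<in> V m"
    then obtain r where r: "y \<in> M" "r > 1 / real (Suc m)" "mball y r \<subseteq> U" by (auto simp: V_def)
    define s where "s = (r + 1 / real (Suc m)) / 2"
    have "c < (r + c) / 2 \<and> (r + c) / 2 < r" if "c < r" for c :: real using that by auto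
    from this[OF r(2)] have s: "s > 1 / real (Suc m)" "s < r" unfolding s_def by blast+
    have "mball y (r - s) \<subseteq> V m"
    proof
      fix z assume z: "z \<in> mball y (r - s)"
      then have "mball z s \<subseteq> mball y r" by (intro mball_subset) (auto simp: commute)
      then have "mball z s \<subseteq> U" using r(3) by blast
      with s(1) z show "z \<in> V m" by (auto simp: V_def)
    qed
    with s(2) show "\<exists>r>0. mball y r \<subseteq> V m" by (intro exI[of _ "r - s"]) auto
  qed (auto simp: V_def)
  have "Y -` U \<inter> space N = (\<Union>m. \<Union>k0. \<Inter>k\<in>{k0..}. X k -` V m \<inter> space N)"
  proof (intro equalityI subsetI)
    fix w assume w: "w \<in> Y -` U \<inter> space N"
    then obtain r where r: "r > 0" "mball (Y w) r \<subseteq> U" using U by (auto simp: openin_mtopology)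
    obtain m where m: "1 / real (Suc m) < r / 2"
      using r(1) reals_Archimedean[of "r / 2"] by (auto simp: inverse_eq_divide)
    have "\<forall>\<^sub>F k in sequentially. d (X k w) (Y w) < r / 2"
      using order_tendstoD(2)[OF lim, of w "r / 2"] w r(1) by simp
    then obtain k0 where k0: "\<And>k. k \<ge> k0 \<Longrightarrow> d (X k w) (Y w) < r / 2"
      by (auto simp: eventually_sequentially)
    have "X k w \<in> V m" if "k \<ge> k0" for k
    proof -
      have "mball (X k w) (r / 2) \<subseteq> mball (Y w) r"
        using k0[OF that] w Y by (intro mball_subset) auto
      with r(2) m XM w show ?thesis unfolding V_def by blast
    qed
    then show "w \<in> (\<Union>m. \<Union>k0. \<Inter>k\<in>{k0..}. X k -` V m \<inter> space N)" using w by blast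
  next
    fix w assume "w \<in> (\<Union>m. \<Union>k0. \<Inter>k\<in>{k0..}. X k -` V m \<inter> space N)"
    then obtain m k0 where w: "\<And>k. k \<ge> k0 \<Longrightarrow> X k w \<in> V m" "w \<in> space N" by fastforce
    have "\<forall>\<^sub>F k in sequentially. d (X k w) (Y w) < 1 / real (Suc m)"
      by (rule order_tendstoD(2)[OF lim]) (use w in auto)
    then obtain k1 where k1: "\<And>k. k \<ge> k1 \<Longrightarrow> d (X k w) (Y w) < 1 / real (Suc m)"
      by (auto simp: eventually_sequentially)
    define k where "k = max k0 k1"
    obtain r where r: "r > 1 / real (Suc m)" "mball (X k w) r \<subseteq> U"
      using w(1)[of k] by (auto simp: V_def k_def)
    have "Y w \<in> mball (X k w) r" using k1[of k] r(1) XM w Y by (auto simp: k_def)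
    with r(2) w(2) show "w \<in> Y -` U \<inter> space N" by blast
  qed
  also have "\<dots> \<in> sets N"
  proof (intro sets.countable_UN'' sets.countable_INT' countableI_type image_subsetI)
    show "X k -` V m \<inter> space N \<in> sets N" for k m
      by (rule measurable_sets[OF X sets_borel_of_topology_open[OF V]])
  qed auto
  finally show "Y -` U \<inter> space N \<in> sets N" .
qed

end

text \<open>Off \<open>A\<close> the integrands differ by at most \<open>2 * K\<close>, and this
  happens with probability at most \<open>e\<close>. Closeness with high probability is turned into
  closeness of expectations by this bound.\<close>

lemma (in prob_space) integral_diff_le_on:
  fixes f g :: "'a \<Rightarrow> real"
  assumes f: "f \<in> borel_measurable M" "\<And>w. w \<in> space M \<Longrightarrow> \<bar>f w\<bar> \<le> K"
    and g: "g \<in> borel_measurable M" "\<And>w. w \<in> space M \<Longrightarrow> \<bar>g w\<bar> \<le> K"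
    and A: "A \<in> events" "prob A \<ge> 1 - e"
    and fg: "\<And>w. w \<in> A \<Longrightarrow> \<bar>f w - g w\<bar> \<le> e'" and e': "e' \<ge> 0"
  shows "\<bar>expectation f - expectation g\<bar> \<le> e' + 2 * K * e"
proof -
  obtain w where "w \<in> space M" using not_empty by blast
  then have K: "K \<ge> 0" using f(2)[of w] by linarith
  have int: "integrable M f" "integrable M g"
    using f g by (auto intro!: integrable_const_bound[of _ K] AE_I2)
  have "\<bar>expectation f - expectation g\<bar> = \<bar>expectation (\<lambda>w. f w - g w)\<bar>"
    using int by simp
  also have "\<dots> \<le> expectation (\<lambda>w. \<bar>f w - g w\<bar>)"
    by (rule integral_abs_bound)
  also have "\<dots> \<le> expectation (\<lambda>w. e' + 2 * K * indicator (space M - A) w)"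
  proof (rule integral_mono)
    show "integrable M (\<lambda>w. \<bar>f w - g w\<bar>)" using int by auto
    show "integrable M (\<lambda>w. e' + 2 * K * indicator (space M - A) w)"
      using A by (intro Bochner_Integration.integrable_add integrable_mult_right integrable_real_indicator)
        (auto simp: emeasure_eq_measure)
    fix w assume w: "w \<in> space M"
    show "\<bar>f w - g w\<bar> \<le> e' + 2 * K * indicator (space M - A) w"
      using fg[of w] f(2)[OF w] g(2)[OF w] e' w K by (cases "w \<in> A") (auto simp: indicator_def)
  qed
  also have "\<dots> = e' + 2 * K * (1 - prob A)"
    using A
    by (subst Bochner_Integration.integral_add, (intro integrable_mult_right integrable_real_indicator)?)
      (auto simp: prob_space prob_compl emeasure_eq_measure)
  also have "\<dots> \<le> e' + 2 * K * e"
    using A(2) K by (intro add_left_mono mult_left_mono) auto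
  finally show ?thesis .
qed

context Metric_space
begin

text \<open>The bounded Lipschitz functions \<open>x \<mapsto> INF y. f y + k * d x y\<close> increase to \<open>f\<close>, which gives
  the lower bound for the limit inferior; the upper bound is the lower bound for \<open>- f\<close>.\<close>

lemma converges_in_distribution_lipschitzI:
  assumes pr: "\<And>n. prob_space (P n)" "prob_space Q"
    and X: "\<And>n. X n \<in> P n \<rightarrow>\<^sub>M borel_of_topology mtopology"
    and Y: "Y \<in> Q \<rightarrow>\<^sub>M borel_of_topology mtopology"
    and lim: "\<And>f L K. (\<And>x y. x \<in> M \<Longrightarrow> y \<in> M \<Longrightarrow> \<bar>f x - f y\<bar> \<le> L * d x y) \<Longrightarrow> L > 0 \<Longrightarrow>
       (\<And>x. x \<in> M \<Longrightarrow> \<bar>f x\<bar> \<le> K) \<Longrightarrow>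
       (\<lambda>n. \<integral>w. f (X n w) \<partial>P n) \<longlonglongrightarrow> (\<integral>w. f (Y w) \<partial>Q)"
  shows "converges_in_distribution mtopology P X Q Y"
proof -
  have XM: "X n w \<in> M" if "w \<in> space (P n)" for n w
    using measurable_space[OF X that] by simp
  have YM: "Y w \<in> M" if "w \<in> space Q" for w
    using measurable_space[OF Y that] by simp
  have low: "\<forall>\<^sub>F n in sequentially. (\<integral>w. f (X n w) \<partial>P n) \<ge> (\<integral>w. f (Y w) \<partial>Q) - e"
    if f: "continuous_map mtopology euclideanreal f" and fK: "\<And>x. x \<in> M \<Longrightarrow> \<bar>f x\<bar> \<le> K" and e: "e > 0"
    for f :: "'a \<Rightarrow> real" and K e
  proof -
    interpret Q: prob_space Q by (rule pr)
    obtain w0 where "w0 \<in> space Q" using Q.not_empty by blast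
    then have ne: "M \<noteq> {}" and K: "K \<ge> 0" using YM[of w0] fK[of "Y w0"] by auto
    define g where "g k x = (INF y\<in>M. f y + real (Suc k) * d x y)" for k :: nat and x
    have bdd: "bdd_below ((\<lambda>y. f y + real (Suc k) * d x y) ` M)" for k x
    proof (rule bdd_belowI2)
      fix y assume "y \<in> M"
      have "0 \<le> real (Suc k) * d x y" by (intro mult_nonneg_nonneg) auto
      then show "- K \<le> f y + real (Suc k) * d x y" using fK[OF \<open>y \<in> M\<close>] by linarith
    qed
    have g_le: "g k x \<le> f y + real (Suc k) * d x y" if "y \<in> M" for k x y
      unfolding g_def by (rule cINF_lower[OF bdd that])
    have g_ge: "c \<le> g k x" if "\<And>y. y \<in> M \<Longrightarrow> c \<le> f y + real (Suc k) * d x y" for c k x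
      unfolding g_def by (rule cINF_greatest[OF ne that])
    have g_f: "g k x \<le> f x" if "x \<in> M" for k x using g_le[OF that, of k x] that by simp
    have g_K: "\<bar>g k x\<bar> \<le> K" if "x \<in> M" for k x
    proof -
      have "- K \<le> g k x"
      proof (rule g_ge)
        fix y assume "y \<in> M"
        have "0 \<le> real (Suc k) * d x y" by (intro mult_nonneg_nonneg) auto
        then show "- K \<le> f y + real (Suc k) * d x y" using fK[OF \<open>y \<in> M\<close>] by linarith
      qed
      then show ?thesis using g_f[OF that, of k] fK[OF that] by linarith
    qed
    have g_half: "g k x \<le> g k y + real (Suc k) * d x y" if "x \<in> M" "y \<in> M" for k x y
    proof -
      have "g k x - real (Suc k) * d x y \<le> g k y"
      proof (rule g_ge)
        fix z assume z: "z \<in> M"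
        have "real (Suc k) * d x z \<le> real (Suc k) * (d x y + d y z)"
          using that z triangle by (intro mult_left_mono) auto
        then show "g k x - real (Suc k) * d x y \<le> f z + real (Suc k) * d y z"
          using g_le[OF z, of k x] by (simp add: algebra_simps)
      qed
      then show ?thesis by simp
    qed
    have g_lip: "\<bar>g k x - g k y\<bar> \<le> real (Suc k) * d x y" if "x \<in> M" "y \<in> M" for k x y
      using g_half[OF that, of k] g_half[OF that(2,1), of k] by (simp add: commute abs_le_iff)
    have g_meas: "g k \<in> borel_measurable (borel_of_topology mtopology)" for k
      by (intro continuous_map_borel_measurable lipschitz_continuous_map[of _ "real (Suc k)"] g_lip)
    have f_meas: "f \<in> borel_measurable (borel_of_topology mtopology)"
      by (rule continuous_map_borel_measurable[OF f])
    have g_lim: "(\<lambda>k. g k x) \<longlonglongrightarrow> f x" if x: "x \<in> M" for x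
    proof (rule LIMSEQ_I)
      fix r :: real assume r: "r > 0"
      have "openin mtopology {y \<in> topspace mtopology. f y \<in> {f x - r / 2<..}}"
        by (rule openin_continuous_map_preimage[OF f]) auto
      then have "openin mtopology {y \<in> M. f y \<in> {f x - r / 2<..}}" by (simp only: topspace_mtopology)
      then obtain \<delta> where \<delta>: "\<delta> > 0" "mball x \<delta> \<subseteq> {y \<in> M. f y \<in> {f x - r / 2<..}}"
      proof -
        have "x \<in> {y \<in> M. f y \<in> {f x - r / 2<..}}" using x r by simp
        then show ?thesis
          using that \<open>openin mtopology {y \<in> M. f y \<in> {f x - r / 2<..}}\<close>
          unfolding openin_mtopology by blast
      qed
      \<comment> \<open>From this index on, the penalty outside the \<delta>-ball exceeds
        \<open>2 * K\<close>, the largest possible variation of \<open>f\<close>, so only points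
        near \<open>x\<close> can bring the infimum down.\<close>
      obtain k0 where k0: "real k0 > 2 * K / \<delta>" using reals_Archimedean2 by blast
      have "norm (g k x - f x) < r" if "k \<ge> k0" for k
      proof -
        have "f x - r / 2 \<le> g k x"
        proof (rule g_ge)
          fix y assume y: "y \<in> M"
          show "f x - r / 2 \<le> f y + real (Suc k) * d x y"
          proof (cases "d x y < \<delta>")
            case True
            then have "f y > f x - r / 2" using \<delta>(2) x y by auto
            moreover have "0 \<le> real (Suc k) * d x y" by (intro mult_nonneg_nonneg) auto
            ultimately show ?thesis by linarith
          next
            case False
            have "2 * K \<le> real k0 * \<delta>" using k0 \<delta>(1) by (simp add: pos_divide_less_eq)
            also have "\<dots> \<le> real (Suc k) * \<delta>" using that \<delta>(1) by (intro mult_right_mono) auto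
            also have "\<dots> \<le> real (Suc k) * d x y" using False by (intro mult_left_mono) auto
            finally show ?thesis using fK[OF x] fK[OF y] r by linarith
          qed
        qed
        then show ?thesis using g_f[OF x, of k] r by simp
      qed
      then show "\<exists>no. \<forall>k\<ge>no. norm (g k x - f x) < r" by blast
    qed
    have "(\<lambda>k. \<integral>w. g k (Y w) \<partial>Q) \<longlonglongrightarrow> (\<integral>w. f (Y w) \<partial>Q)"
    proof (rule integral_dominated_convergence[where w="\<lambda>_. K"])
      show "(\<lambda>w. f (Y w)) \<in> borel_measurable Q" by (rule measurable_compose[OF Y f_meas])
      show "(\<lambda>w. g k (Y w)) \<in> borel_measurable Q" for k by (rule measurable_compose[OF Y g_meas])
    qed (use g_lim g_K YM in auto)
    then have "\<forall>\<^sub>F k in sequentially. (\<integral>w. f (Y w) \<partial>Q) - e / 2 < (\<integral>w. g k (Y w) \<partial>Q)"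
      using e by (intro order_tendstoD(1)) auto
    then obtain k where k: "(\<integral>w. f (Y w) \<partial>Q) - e / 2 < (\<integral>w. g k (Y w) \<partial>Q)"
      by (auto simp: eventually_sequentially)
    have "(\<lambda>n. \<integral>w. g k (X n w) \<partial>P n) \<longlonglongrightarrow> (\<integral>w. g k (Y w) \<partial>Q)"
      by (rule lim[of _ "real (Suc k)" K]) (use g_lip g_K in auto)
    then have "\<forall>\<^sub>F n in sequentially. (\<integral>w. g k (Y w) \<partial>Q) - e / 2 < (\<integral>w. g k (X n w) \<partial>P n)"
      using e by (intro order_tendstoD(1)) auto
    then show ?thesis
    proof eventually_elim
      case (elim n)
      interpret P: prob_space "P n" by (rule pr)
      have "(\<integral>w. g k (X n w) \<partial>P n) \<le> (\<integral>w. f (X n w) \<partial>P n)"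
      proof (rule integral_mono)
        show "integrable (P n) (\<lambda>w. g k (X n w))"
          using g_K XM by (intro P.integrable_const_bound[of _ K] AE_I2 measurable_compose[OF X g_meas]) auto
        show "integrable (P n) (\<lambda>w. f (X n w))"
          using fK XM by (intro P.integrable_const_bound[of _ K] AE_I2 measurable_compose[OF X f_meas]) auto
      qed (use g_f XM in auto)
      then show ?case using elim k by linarith
    qed
  qed
  show ?thesis
    unfolding converges_in_distribution_def
  proof (intro conjI allI impI)
    fix f :: "'a \<Rightarrow> real"
    assume "continuous_map mtopology euclideanreal f \<and> (\<exists>B. \<forall>x\<in>topspace mtopology. \<bar>f x\<bar> \<le> B)"
    then obtain K where f: "continuous_map mtopology euclideanreal f" "\<And>x. x \<in> M \<Longrightarrow> \<bar>f x\<bar> \<le> K" by auto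
    have f': "continuous_map mtopology euclideanreal (\<lambda>x. - f x)" using f(1) by (rule continuous_map_minus)
    show "(\<lambda>n. \<integral>w. f (X n w) \<partial>P n) \<longlonglongrightarrow> (\<integral>w. f (Y w) \<partial>Q)"
    proof (rule tendstoI)
      fix e :: real assume "e > 0"
      then have e: "e / 2 > 0" by simp
      have "\<forall>\<^sub>F n in sequentially. (\<integral>w. - f (X n w) \<partial>P n) \<ge> (\<integral>w. - f (Y w) \<partial>Q) - e / 2"
        by (rule low[OF f' _ e, of K]) (use f(2) in auto)
      moreover have "\<forall>\<^sub>F n in sequentially. (\<integral>w. f (X n w) \<partial>P n) \<ge> (\<integral>w. f (Y w) \<partial>Q) - e / 2"
        by (rule low[OF f(1) _ e, of K]) (use f(2) in auto)
      ultimately show "\<forall>\<^sub>F n in sequentially. dist (\<integral>w. f (X n w) \<partial>P n) (\<integral>w. f (Y w) \<partial>Q) < e"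
        by eventually_elim (use e in \<open>auto simp: dist_real_def\<close>)
    qed
  qed (use X Y in auto)
qed

text \<open>This takes the place of tightness and relative compactness. For fixed \<open>k\<close>
  the approximations converge as \<open>n\<close> grows; the error of the approximation is small
  with high probability uniformly in large \<open>n\<close> on one side, and vanishes pointwise on
  the side of the limit.\<close>

lemma converges_in_distribution_approxI:
  assumes pr: "\<And>n. prob_space (P n)" "prob_space Q"
    and X: "\<And>n. X n \<in> P n \<rightarrow>\<^sub>M borel_of_topology mtopology"
    and Y: "Y \<in> Q \<rightarrow>\<^sub>M borel_of_topology mtopology"
    and X': "\<And>n k. X' k n \<in> P n \<rightarrow>\<^sub>M borel_of_topology mtopology"
    and Y': "\<And>k. Y' k \<in> Q \<rightarrow>\<^sub>M borel_of_topology mtopology"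
    and lim: "\<And>f L K k. (\<And>x y. x \<in> M \<Longrightarrow> y \<in> M \<Longrightarrow> \<bar>f x - f y\<bar> \<le> L * d x y) \<Longrightarrow> L > 0 \<Longrightarrow>
       (\<And>x. x \<in> M \<Longrightarrow> \<bar>f x\<bar> \<le> K) \<Longrightarrow>
       (\<lambda>n. \<integral>w. f (X' k n w) \<partial>P n) \<longlonglongrightarrow> (\<integral>w. f (Y' k w) \<partial>Q)"
    and limY: "\<And>w. w \<in> space Q \<Longrightarrow> (\<lambda>k. d (Y' k w) (Y w)) \<longlonglongrightarrow> 0"
    and approx: "\<And>e::real. e > 0 \<Longrightarrow> \<exists>k0::nat. \<forall>k\<ge>k0. \<exists>n0. \<forall>n\<ge>n0. \<exists>A\<in>sets (P n).
       measure (P n) A \<ge> 1 - e \<and> (\<forall>w\<in>A. d (X n w) (X' k n w) \<le> e)"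
  shows "converges_in_distribution mtopology P X Q Y"
proof (rule converges_in_distribution_lipschitzI[OF pr X Y])
  fix f :: "'a \<Rightarrow> real" and L K
  assume f: "\<And>x y. x \<in> M \<Longrightarrow> y \<in> M \<Longrightarrow> \<bar>f x - f y\<bar> \<le> L * d x y" "L > 0" "\<And>x. x \<in> M \<Longrightarrow> \<bar>f x\<bar> \<le> K"
  interpret Q: prob_space Q by (rule pr)
  have XM: "X n w \<in> M" "X' k n w \<in> M" if "w \<in> space (P n)" for n k w
    using measurable_space[OF X that] measurable_space[OF X' that] by auto
  have YM: "Y w \<in> M" "Y' k w \<in> M" if "w \<in> space Q" for k w
    using measurable_space[OF Y that] measurable_space[OF Y' that] by auto
  obtain w0 where "w0 \<in> space Q" using Q.not_empty by blast
  then have K: "K \<ge> 0" using YM[of w0] f(3)[of "Y w0"] by auto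
  have f_meas: "f \<in> borel_measurable (borel_of_topology mtopology)"
    by (intro continuous_map_borel_measurable lipschitz_continuous_map[of _ L] f)
  have Ylim: "(\<lambda>k. \<integral>w. f (Y' k w) \<partial>Q) \<longlonglongrightarrow> (\<integral>w. f (Y w) \<partial>Q)"
  proof (rule integral_dominated_convergence[where w="\<lambda>_. K"])
    show "(\<lambda>w. f (Y w)) \<in> borel_measurable Q" by (rule measurable_compose[OF Y f_meas])
    show "(\<lambda>w. f (Y' k w)) \<in> borel_measurable Q" for k by (rule measurable_compose[OF Y' f_meas])
    show "AE w in Q. (\<lambda>k. f (Y' k w)) \<longlonglongrightarrow> f (Y w)"
    proof (rule AE_I2)
      fix w assume w: "w \<in> space Q"
      have "(\<lambda>k. f (Y' k w) - f (Y w)) \<longlonglongrightarrow> 0"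
      proof (rule Lim_null_comparison)
        show "\<forall>\<^sub>F k in sequentially. norm (f (Y' k w) - f (Y w)) \<le> L * d (Y' k w) (Y w)"
          using f(1) YM w by auto
        show "(\<lambda>k. L * d (Y' k w) (Y w)) \<longlonglongrightarrow> 0" using tendsto_mult_right_zero[OF limY[OF w]] by simp
      qed
      then show "(\<lambda>k. f (Y' k w)) \<longlonglongrightarrow> f (Y w)" using LIM_zero_iff by blast
    qed
  qed (use f(3) YM in auto)
  show "(\<lambda>n. \<integral>w. f (X n w) \<partial>P n) \<longlonglongrightarrow> (\<integral>w. f (Y w) \<partial>Q)"
  proof (rule tendstoI)
    fix e :: real assume e: "e > 0"
    \<comment> \<open>The Lipschitz error \<open>L * e'\<close> and the contribution
      \<open>2 * K * e'\<close> of the exceptional event together stay below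
      \<open>e / 4\<close>.\<close>
    define e' where "e' = e / (4 * (L + 2 * K + 1))"
    have e': "e' > 0" "(L + 2 * K) * e' \<le> e / 4"
      using e f(2) K by (auto simp: e'_def field_simps)
    obtain k0 where k0: "\<forall>k\<ge>k0. \<exists>n0. \<forall>n\<ge>n0. \<exists>A\<in>sets (P n).
       measure (P n) A \<ge> 1 - e' \<and> (\<forall>w\<in>A. d (X n w) (X' k n w) \<le> e')" using approx[OF e'(1)] by blast
    have "\<forall>\<^sub>F k in sequentially. dist (\<integral>w. f (Y' k w) \<partial>Q) (\<integral>w. f (Y w) \<partial>Q) < e / 4"
      using Ylim e by (intro tendstoD) auto
    then obtain k where k: "k \<ge> k0" "dist (\<integral>w. f (Y' k w) \<partial>Q) (\<integral>w. f (Y w) \<partial>Q) < e / 4"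
      using eventually_happens'[OF sequentially_bot eventually_conj[OF eventually_ge_at_top[of k0]]] by blast
    obtain n0 where n0: "\<And>n. n \<ge> n0 \<Longrightarrow> \<exists>A\<in>sets (P n).
       measure (P n) A \<ge> 1 - e' \<and> (\<forall>w\<in>A. d (X n w) (X' k n w) \<le> e')" using k0 k(1) by blast
    have "\<forall>\<^sub>F n in sequentially. dist (\<integral>w. f (X' k n w) \<partial>P n) (\<integral>w. f (Y' k w) \<partial>Q) < e / 4"
      using lim[OF f] e by (intro tendstoD) auto
    then show "\<forall>\<^sub>F n in sequentially. dist (\<integral>w. f (X n w) \<partial>P n) (\<integral>w. f (Y w) \<partial>Q) < e"
      using eventually_ge_at_top[of n0]
    proof eventually_elim
      case (elim n)
      interpret P: prob_space "P n" by (rule pr)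
      obtain A where A: "A \<in> sets (P n)" "measure (P n) A \<ge> 1 - e'" "\<forall>w\<in>A. d (X n w) (X' k n w) \<le> e'"
        using n0[OF elim(2)] by blast
      have "\<bar>(\<integral>w. f (X n w) \<partial>P n) - (\<integral>w. f (X' k n w) \<partial>P n)\<bar> \<le> L * e' + 2 * K * e'"
      proof (rule P.integral_diff_le_on[OF _ _ _ _ A(1,2)])
        show "(\<lambda>w. f (X n w)) \<in> borel_measurable (P n)" by (rule measurable_compose[OF X f_meas])
        show "(\<lambda>w. f (X' k n w)) \<in> borel_measurable (P n)" by (rule measurable_compose[OF X' f_meas])
        fix w assume w: "w \<in> A"
        then have "w \<in> space (P n)" using A(1) sets.sets_into_space by blast
        then have "\<bar>f (X n w) - f (X' k n w)\<bar> \<le> L * d (X n w) (X' k n w)" using f(1) XM by blast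
        also have "\<dots> \<le> L * e'" using A(3) w f(2) by (intro mult_left_mono) auto
        finally show "\<bar>f (X n w) - f (X' k n w)\<bar> \<le> L * e'" .
      qed (use f(2,3) XM e' in auto)
      then have "\<bar>(\<integral>w. f (X n w) \<partial>P n) - (\<integral>w. f (X' k n w) \<partial>P n)\<bar> \<le> e / 4"
        using e'(2) by (simp add: algebra_simps)
      with elim(1) k(2) e show ?case unfolding dist_real_def by linarith
    qed
  qed
qed

end

section \<open>Functions with limits in the four quadrants\<close>

text \<open>The path condition of \<open>skorokhod_space\<close> without extensionality, which sums
  and products need not preserve. Paths are built from total functions and restricted to the square
  only at the end.\<close>

definition quadrant_limits :: "(real \<times> real \<Rightarrow> real) \<Rightarrow> bool" where
  "quadrant_limits x \<longleftrightarrow> (\<forall>p\<in>unit_square. (x \<longlongrightarrow> x p) (at p within quadrant True True p) \<and>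
     (\<forall>a b. \<exists>l. (x \<longlongrightarrow> l) (at p within quadrant a b p)))"

lemma quadrant_limits_cong:
  assumes "quadrant_limits x" "\<And>p. p \<in> unit_square \<Longrightarrow> x p = z p"
  shows "quadrant_limits z"
proof -
  have "(z \<longlongrightarrow> l) (at p within quadrant a b p)" if "(x \<longlongrightarrow> l) (at p within quadrant a b p)" for a b l p
    using that by (rule Lim_transform_eventually)
      (auto simp: eventually_at_filter quadrant_def assms(2) intro!: always_eventually)
  then show ?thesis using assms unfolding quadrant_limits_def by metis
qed

lemma path_on_square_in_skorokhod_space:
  assumes "quadrant_limits x" shows "path_on_square x \<in> skorokhod_space"
proof -
  have "quadrant_limits (path_on_square x)"
    by (rule quadrant_limits_cong[OF assms]) (simp add: path_on_square_def)
  then show ?thesis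
    by (auto simp: skorokhod_space_def quadrant_limits_def path_on_square_def)
qed

lemma quadrant_limits_continuous:
  assumes "continuous_on unit_square x" shows "quadrant_limits x"
proof -
  have "(x \<longlongrightarrow> x p) (at p within quadrant a b p)" if "p \<in> unit_square" for a b p
    using assms that by (auto simp: continuous_on_def intro: tendsto_within_subset simp: quadrant_def)
  then show ?thesis unfolding quadrant_limits_def by blast
qed

lemma quadrant_limits_add:
  assumes "quadrant_limits x" "quadrant_limits z" shows "quadrant_limits (\<lambda>p. x p + z p)"
  unfolding quadrant_limits_def
proof (intro ballI conjI allI)
  fix p a b assume p: "p \<in> unit_square"
  show "((\<lambda>p. x p + z p) \<longlongrightarrow> x p + z p) (at p within quadrant True True p)"
    using assms p by (auto simp: quadrant_limits_def intro: tendsto_add)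
  obtain l l' where "(x \<longlongrightarrow> l) (at p within quadrant a b p)" "(z \<longlongrightarrow> l') (at p within quadrant a b p)"
    using assms p unfolding quadrant_limits_def by meson
  then show "\<exists>l. ((\<lambda>p. x p + z p) \<longlongrightarrow> l) (at p within quadrant a b p)"
    by (intro exI[of _ "l + l'"] tendsto_add)
qed

lemma quadrant_limits_mult:
  assumes "quadrant_limits x" "quadrant_limits z" shows "quadrant_limits (\<lambda>p. x p * z p)"
  unfolding quadrant_limits_def
proof (intro ballI conjI allI)
  fix p a b assume p: "p \<in> unit_square"
  show "((\<lambda>p. x p * z p) \<longlongrightarrow> x p * z p) (at p within quadrant True True p)"
    using assms p by (auto simp: quadrant_limits_def intro: tendsto_mult)
  obtain l l' where "(x \<longlongrightarrow> l) (at p within quadrant a b p)" "(z \<longlongrightarrow> l') (at p within quadrant a b p)"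
    using assms p unfolding quadrant_limits_def by meson
  then show "\<exists>l. ((\<lambda>p. x p * z p) \<longlongrightarrow> l) (at p within quadrant a b p)"
    by (intro exI[of _ "l * l'"] tendsto_mult)
qed

lemma quadrant_limits_const: "quadrant_limits (\<lambda>_. c)"
  by (auto simp: quadrant_limits_def)

lemma quadrant_limits_sum:
  "(\<And>i. i \<in> I \<Longrightarrow> quadrant_limits (x i)) \<Longrightarrow> quadrant_limits (\<lambda>p. \<Sum>i\<in>I. x i p)"
  by (induction I rule: infinite_finite_induct) (auto intro: quadrant_limits_const quadrant_limits_add)

lemma quadrant_limits_diff:
  assumes "quadrant_limits x" "quadrant_limits z" shows "quadrant_limits (\<lambda>p. x p - z p)"
  using quadrant_limits_add[OF assms(1) quadrant_limits_mult[OF quadrant_limits_const[of "-1"] assms(2)]]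
  by simp

text \<open>A jump function is constant on a small interval on either side of \<open>u\<close>, and
  on the right its constant is the value at \<open>u\<close>. Limits of indicators thus reduce to
  eventual equalities.\<close>

lemma of_bool_le_one_sided_limits:
  fixes a u :: real
  shows "\<forall>\<^sub>F v in nhds u. u \<le> v \<longrightarrow> of_bool (a \<le> v) = (of_bool (a \<le> u) :: real)"
    "\<exists>l::real. \<forall>\<^sub>F v in nhds u. v < u \<longrightarrow> of_bool (a \<le> v) = l"
proof -
  show "\<forall>\<^sub>F v in nhds u. u \<le> v \<longrightarrow> of_bool (a \<le> v) = (of_bool (a \<le> u) :: real)"
  proof (cases "a \<le> u")
    case False
    then have "\<forall>\<^sub>F v in nhds u. v \<in> {..<a}" by (intro eventually_nhds_in_open) auto
    then show ?thesis by eventually_elim (use False in auto)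
  qed (auto intro!: always_eventually)
  show "\<exists>l::real. \<forall>\<^sub>F v in nhds u. v < u \<longrightarrow> of_bool (a \<le> v) = l"
  proof (cases "a < u")
    case True
    then have "\<forall>\<^sub>F v in nhds u. v \<in> {a<..}" by (intro eventually_nhds_in_open) auto
    then show ?thesis by (intro exI[of _ 1], eventually_elim) auto
  next
    case False
    then show ?thesis by (intro exI[of _ 0]) (auto intro!: always_eventually)
  qed
qed

lemma eventually_nhds_projections:
  assumes "\<forall>\<^sub>F v in nhds (fst p). P v" shows "\<forall>\<^sub>F q in nhds p. P (fst q)"
  using assms by (rule eventually_compose_filterlim)
    (metis tendsto_fst[OF filterlim_ident] prod.collapse)

lemma eventually_nhds_projections':
  assumes "\<forall>\<^sub>F v in nhds (snd p). P v" shows "\<forall>\<^sub>F q in nhds p. P (snd q)"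
  using assms by (rule eventually_compose_filterlim)
    (metis tendsto_snd[OF filterlim_ident] prod.collapse)

lemma quadrant_limits_jump_fst: "quadrant_limits (\<lambda>p. of_bool (a \<le> fst p))"
  unfolding quadrant_limits_def
proof (intro ballI conjI allI)
  fix p :: "real \<times> real" and b b'
  have 1: "((\<lambda>p. of_bool (a \<le> fst p)) \<longlongrightarrow> (of_bool (a \<le> fst p) :: real)) (at p within quadrant True b' p)" for b'
    by (rule tendsto_eventually)
      (use eventually_nhds_projections[OF of_bool_le_one_sided_limits(1)[of "fst p" a]] in
        \<open>auto simp: eventually_at_filter quadrant_def elim!: eventually_mono\<close>)
  then show "((\<lambda>p. of_bool (a \<le> fst p)) \<longlongrightarrow> (of_bool (a \<le> fst p) :: real)) (at p within quadrant True True p)" .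
  obtain l :: real where l: "\<forall>\<^sub>F v in nhds (fst p). v < fst p \<longrightarrow> of_bool (a \<le> v) = l"
    using of_bool_le_one_sided_limits(2) by blast
  have "((\<lambda>p. of_bool (a \<le> fst p)) \<longlongrightarrow> l) (at p within quadrant False b' p)"
    by (rule tendsto_eventually)
      (use eventually_nhds_projections[OF l] in
        \<open>auto simp: eventually_at_filter quadrant_def elim!: eventually_mono\<close>)
  note 0 = this
  show "\<exists>l::real. ((\<lambda>p. of_bool (a \<le> fst p)) \<longlongrightarrow> l) (at p within quadrant b b' p)"
  proof (cases b)
    case True
    then have c: "b = True" by simp
    show ?thesis unfolding c using 1 by blast
  next
    case False
    then have c: "b = False" by simp
    show ?thesis unfolding c using 0 by blast
  qed
qed

lemma quadrant_limits_jump_snd: "quadrant_limits (\<lambda>p. of_bool (a \<le> snd p))"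
  unfolding quadrant_limits_def
proof (intro ballI conjI allI)
  fix p :: "real \<times> real" and b b'
  have 1: "((\<lambda>p. of_bool (a \<le> snd p)) \<longlongrightarrow> (of_bool (a \<le> snd p) :: real)) (at p within quadrant b True p)" for b
    by (rule tendsto_eventually)
      (use eventually_nhds_projections'[OF of_bool_le_one_sided_limits(1)[of "snd p" a]] in
        \<open>auto simp: eventually_at_filter quadrant_def elim!: eventually_mono\<close>)
  then show "((\<lambda>p. of_bool (a \<le> snd p)) \<longlongrightarrow> (of_bool (a \<le> snd p) :: real)) (at p within quadrant True True p)" .
  obtain l :: real where l: "\<forall>\<^sub>F v in nhds (snd p). v < snd p \<longrightarrow> of_bool (a \<le> v) = l"
    using of_bool_le_one_sided_limits(2) by blast
  have "((\<lambda>p. of_bool (a \<le> snd p)) \<longlongrightarrow> l) (at p within quadrant b False p)"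
    by (rule tendsto_eventually)
      (use eventually_nhds_projections'[OF l] in
        \<open>auto simp: eventually_at_filter quadrant_def elim!: eventually_mono\<close>)
  note 0 = this
  show "\<exists>l::real. ((\<lambda>p. of_bool (a \<le> snd p)) \<longlongrightarrow> l) (at p within quadrant b b' p)"
  proof (cases b')
    case True
    then have c: "b' = True" by simp
    show ?thesis unfolding c using 1 by blast
  next
    case False
    then have c: "b' = False" by simp
    show ?thesis unfolding c using 0 by blast
  qed
qed

section \<open>Bounds for the Skorokhod distance\<close>

interpretation skorokhod: Metric_space skorokhod_space skorokhod_dist
  rewrites "Metric_space.mtopology skorokhod_space skorokhod_dist = skorokhod_topology"
  by (simp_all add: Metric_space_skorokhod skorokhod_topology_def)

lemma skorokhod_dist_le:
  assumes "x \<in> skorokhod_space" "z \<in> skorokhod_space" "l \<in> time_changes" "m \<in> time_changes"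
    and "\<And>s t. s \<in> {0..1} \<Longrightarrow> t \<in> {0..1} \<Longrightarrow> \<bar>x (s, t) - z (l s, m t)\<bar> \<le> e"
    and "\<And>s. s \<in> {0..1} \<Longrightarrow> \<bar>l s - s\<bar> \<le> e" "\<And>t. t \<in> {0..1} \<Longrightarrow> \<bar>m t - t\<bar> \<le> e"
  shows "skorokhod_dist x z \<le> e"
proof (rule dense_ge)
  fix e' assume "e < e'"
  moreover have "skorokhod_cost x z l m \<le> e"
    using assms by (subst skorokhod_cost_le_iff) auto
  ultimately have "skorokhod_dist x z < e'"
    using assms(3,4) unfolding skorokhod_dist_less_iff by (meson le_less_trans)
  then show "skorokhod_dist x z \<le> e'" by simp
qed

text \<open>Almost all comparisons below use only the identity time changes; genuine ones occur only
  when sample points are rounded.\<close>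

lemma skorokhod_dist_le_sup:
  assumes "path_on_square x \<in> skorokhod_space" "path_on_square z \<in> skorokhod_space"
    and "\<And>p. p \<in> unit_square \<Longrightarrow> \<bar>x p - z p\<bar> \<le> e"
  shows "skorokhod_dist (path_on_square x) (path_on_square z) \<le> e"
proof (rule skorokhod_dist_le[OF assms(1,2) id_time_change id_time_change])
  have "(0, 0) \<in> unit_square" by (simp add: unit_square_def)
  from assms(3)[OF this] have "e \<ge> 0" by linarith
  then show "\<bar>s - s\<bar> \<le> e" "\<bar>s - s\<bar> \<le> e" for s :: real by auto
qed (use assms(3) in \<open>auto simp: path_on_square_def unit_square_def\<close>)

subsection \<open>Discretization to a grid\<close>

text \<open>Constant on half-open cells of side \<open>1 / k\<close>. The index \<open>k\<close>
  occurs exactly where a coordinate equals \<open>1\<close>, so the relevant indices are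
  \<open>{..k}\<close> and not \<open>{..<k}\<close>.\<close>

definition grid_path :: "nat \<Rightarrow> (nat \<times> nat \<Rightarrow> real) \<Rightarrow> real \<times> real \<Rightarrow> real" where
  "grid_path k u = (\<lambda>(s, t). u (nat \<lfloor>real k * s\<rfloor>, nat \<lfloor>real k * t\<rfloor>))"

text \<open>The truncation at \<open>1\<close> sends every pair of indices into the square, so that
  the values at grid points form a vector over the whole type
  \<open>nat \<times> nat\<close>.\<close>

definition grid_point :: "nat \<Rightarrow> nat \<times> nat \<Rightarrow> real \<times> real" where
  "grid_point k = (\<lambda>(a, b). (min 1 (real a / real k), min 1 (real b / real k)))"

lemma grid_point_in [simp]: "grid_point k i \<in> unit_square"
  by (auto simp: grid_point_def unit_square_def split: prod.splits)

text \<open>The indicator of a cell as a difference of two jumps reduces grid paths to functions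
  whose quadrant limits are known.\<close>

lemma nat_floor_eq_iff_jumps:
  assumes "s \<ge> 0" "k > 0"
  shows "of_bool (nat \<lfloor>real k * s\<rfloor> = a) =
    (of_bool (real a / real k \<le> s) - of_bool (real (Suc a) / real k \<le> s) :: real)"
proof -
  have "nat \<lfloor>real k * s\<rfloor> = a \<longleftrightarrow> real a \<le> real k * s \<and> real k * s < real (Suc a)"
    using assms by (simp add: nat_eq_iff floor_eq_iff ac_simps)
  moreover have "real a / real k \<le> s \<longleftrightarrow> real a \<le> real k * s"
    "real (Suc a) / real k \<le> s \<longleftrightarrow> real (Suc a) \<le> real k * s"
    using assms by (simp_all add: pos_divide_le_eq mult.commute)
  ultimately show ?thesis by auto
qed

lemma nat_floor_le:
  assumes "s \<le> 1" shows "nat \<lfloor>real k * s\<rfloor> \<le> k"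
proof -
  have "real k * s \<le> real k * 1" using assms by (intro mult_left_mono) auto
  then show ?thesis by linarith
qed

lemma quadrant_limits_grid_path:
  assumes "k > 0" shows "quadrant_limits (grid_path k u)"
proof (rule quadrant_limits_cong)
  let ?f = "\<lambda>p. \<Sum>a\<in>{..k}. \<Sum>b\<in>{..k}. u (a, b) *
    ((of_bool (real a / real k \<le> fst p) - of_bool (real (Suc a) / real k \<le> fst p)) *
     (of_bool (real b / real k \<le> snd p) - of_bool (real (Suc b) / real k \<le> snd p)))"
  show "quadrant_limits ?f"
    by (intro quadrant_limits_sum quadrant_limits_mult quadrant_limits_const quadrant_limits_diff
        quadrant_limits_jump_fst quadrant_limits_jump_snd)
  fix p assume "p \<in> unit_square"
  then obtain s t where p: "p = (s, t)" "0 \<le> s" "s \<le> 1" "0 \<le> t" "t \<le> 1" by (auto simp: unit_square_def)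
  have "?f p = (\<Sum>a\<in>{..k}. \<Sum>b\<in>{..k}. u (a, b) *
    (of_bool (nat \<lfloor>real k * s\<rfloor> = a) * of_bool (nat \<lfloor>real k * t\<rfloor> = b)))"
    using p assms by (simp only: nat_floor_eq_iff_jumps fst_conv snd_conv)
  also have "\<dots> = (\<Sum>a\<in>{..k}. \<Sum>b\<in>{..k}. if b = nat \<lfloor>real k * t\<rfloor> then
      u (a, nat \<lfloor>real k * t\<rfloor>) * of_bool (nat \<lfloor>real k * s\<rfloor> = a) else 0)"
    by (intro sum.cong) auto
  also have "\<dots> = (\<Sum>a\<in>{..k}. if a = nat \<lfloor>real k * s\<rfloor> then u (nat \<lfloor>real k * s\<rfloor>, nat \<lfloor>real k * t\<rfloor>) else 0)"
    using nat_floor_le[OF p(5), of k] by (intro sum.cong) (auto simp: sum.delta')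
  also have "\<dots> = grid_path k u p"
    using nat_floor_le[OF p(3), of k] by (simp add: p(1) grid_path_def)
  finally show "?f p = grid_path k u p" .
qed

text \<open>The sum dominates the maximum over the relevant indices and is visibly continuous for
  the product topology; this gives both measurability and continuity of functionals of grid
  paths.\<close>

lemma grid_path_dist_le:
  assumes "k > 0"
  shows "skorokhod_dist (path_on_square (grid_path k u)) (path_on_square (grid_path k v)) \<le>
    (\<Sum>i\<in>{..k} \<times> {..k}. \<bar>u i - v i\<bar>)"
proof (rule skorokhod_dist_le_sup)
  fix p assume "p \<in> unit_square"
  then obtain s t where p: "p = (s, t)" "0 \<le> s" "s \<le> 1" "0 \<le> t" "t \<le> 1" by (auto simp: unit_square_def)
  show "\<bar>grid_path k u p - grid_path k v p\<bar> \<le> (\<Sum>i\<in>{..k} \<times> {..k}. \<bar>u i - v i\<bar>)"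
    unfolding grid_path_def p(1) prod.case
    by (rule member_le_sum) (use p nat_floor_le in auto)
qed (intro path_on_square_in_skorokhod_space quadrant_limits_grid_path assms)+

text \<open>Only finitely many coordinates influence the path, and they do so continuously, so
  preimages of open sets are open. Discretized processes therefore need measurable coordinates and
  nothing more.\<close>

lemma measurable_grid_path:
  assumes k: "k > 0"
  shows "(\<lambda>u. path_on_square (grid_path k u)) \<in> borel \<rightarrow>\<^sub>M borel_of_topology skorokhod_topology"
proof (rule measurable_borel_of_topologyI)
  show "(\<lambda>u. path_on_square (grid_path k u)) \<in> space borel \<rightarrow> topspace skorokhod_topology"
    by (auto intro!: path_on_square_in_skorokhod_space quadrant_limits_grid_path k)
  fix U assume U: "openin skorokhod_topology U"
  have "open ((\<lambda>u. path_on_square (grid_path k u)) -` U)"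
    unfolding open_subopen[of "_ -` _"]
  proof (intro ballI)
    fix u assume "u \<in> (\<lambda>u. path_on_square (grid_path k u)) -` U"
    then obtain r where r: "r > 0" "skorokhod.mball (path_on_square (grid_path k u)) r \<subseteq> U"
      using U unfolding skorokhod.openin_mtopology by auto
    let ?T = "{v. (\<Sum>i\<in>{..k} \<times> {..k}. \<bar>u i - v i\<bar>) < r}"
    have "open ?T"
      by (intro open_Collect_less continuous_intros continuous_on_product_coordinates)
    moreover have "u \<in> ?T" using r(1) by simp
    moreover have "?T \<subseteq> (\<lambda>u. path_on_square (grid_path k u)) -` U"
    proof
      fix v assume "v \<in> ?T"
      then have "path_on_square (grid_path k v) \<in> skorokhod.mball (path_on_square (grid_path k u)) r"
        using grid_path_dist_le[OF k, of u v]
        by (simp add: path_on_square_in_skorokhod_space quadrant_limits_grid_path k)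
      with r(2) show "v \<in> (\<lambda>u. path_on_square (grid_path k u)) -` U" by blast
    qed
    ultimately show "\<exists>T. open T \<and> u \<in> T \<and> T \<subseteq> (\<lambda>u. path_on_square (grid_path k u)) -` U" by blast
  qed
  then show "(\<lambda>u. path_on_square (grid_path k u)) -` U \<inter> space borel \<in> sets borel" by auto
qed

definition discretize :: "nat \<Rightarrow> (real \<times> real \<Rightarrow> real) \<Rightarrow> real \<times> real \<Rightarrow> real" where
  "discretize k x = grid_path k (\<lambda>i. x (grid_point k i))"

text \<open>The witness is the lower left corner of the cell that contains \<open>p\<close>.\<close>

lemma discretize_eq:
  assumes "p \<in> unit_square" "k > 0"
  obtains q where "q \<in> unit_square" "discretize k x p = x q"
    "fst q \<le> fst p" "fst p \<le> fst q + 1 / real k" "snd q \<le> snd p" "snd p \<le> snd q + 1 / real k"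
proof -
  obtain s t where p: "p = (s, t)" "0 \<le> s" "s \<le> 1" "0 \<le> t" "t \<le> 1"
    using assms by (auto simp: unit_square_def)
  have 1: "min 1 (real (nat \<lfloor>real k * v\<rfloor>) / real k) \<le> v \<and> v \<le> min 1 (real (nat \<lfloor>real k * v\<rfloor>) / real k) + 1 / real k"
    if "0 \<le> v" "v \<le> 1" for v
  proof -
    have "real (nat \<lfloor>real k * v\<rfloor>) = of_int \<lfloor>real k * v\<rfloor>" using that by simp
    then have "real (nat \<lfloor>real k * v\<rfloor>) \<le> real k * v" "real k * v \<le> real (nat \<lfloor>real k * v\<rfloor>) + 1" by linarith+
    then have "real (nat \<lfloor>real k * v\<rfloor>) / real k \<le> v" "v \<le> real (nat \<lfloor>real k * v\<rfloor>) / real k + 1 / real k"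
      using assms(2) by (simp_all add: field_simps)
    moreover have "0 < 1 / real k" using assms(2) by simp
    ultimately show ?thesis using that by linarith
  qed
  show ?thesis
    by (rule that[OF grid_point_in, of k "(nat \<lfloor>real k * s\<rfloor>, nat \<lfloor>real k * t\<rfloor>)"])
      (use 1[of s] 1[of t] p in \<open>auto simp: discretize_def grid_path_def grid_point_def\<close>)
qed

lemma measurable_discretize:
  assumes X: "\<And>p. p \<in> unit_square \<Longrightarrow> (\<lambda>w. X w p) \<in> borel_measurable M" and k: "k > 0"
  shows "(\<lambda>w. path_on_square (discretize k (X w))) \<in> M \<rightarrow>\<^sub>M borel_of_topology skorokhod_topology"
  unfolding discretize_def
  by (rule measurable_compose[OF _ measurable_grid_path[OF k]])
    (intro measurable_coordinatewise_then_product X grid_point_in)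

lemma discretize_continuous_tendsto:
  assumes x: "continuous_on unit_square x"
  shows "(\<lambda>k. skorokhod_dist (path_on_square (discretize (Suc k) x)) (path_on_square x)) \<longlonglongrightarrow> 0"
proof (rule LIMSEQ_I)
  fix r :: real assume r: "r > 0"
  have "compact unit_square" by (simp add: unit_square_def compact_Times)
  then have "uniformly_continuous_on unit_square x" by (rule compact_uniformly_continuous[OF x])
  then obtain d where d: "d > 0"
    "\<And>p q. p \<in> unit_square \<Longrightarrow> q \<in> unit_square \<Longrightarrow> dist q p < d \<Longrightarrow> dist (x q) (x p) < r / 2"
    using half_gt_zero[OF r] unfolding uniformly_continuous_on_def by metis
  obtain k0 where k0: "1 / real (Suc k0) < d / 2"
    using d(1) reals_Archimedean[of "d / 2"] by (auto simp: inverse_eq_divide)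
  have "norm (skorokhod_dist (path_on_square (discretize (Suc k) x)) (path_on_square x) - 0) < r" if k: "k \<ge> k0" for k
  proof -
    have "skorokhod_dist (path_on_square (discretize (Suc k) x)) (path_on_square x) \<le> r / 2"
    proof (rule skorokhod_dist_le_sup)
      fix p assume p: "p \<in> unit_square"
      obtain q where q: "q \<in> unit_square" "discretize (Suc k) x p = x q"
        "fst q \<le> fst p" "fst p \<le> fst q + 1 / real (Suc k)" "snd q \<le> snd p" "snd p \<le> snd q + 1 / real (Suc k)"
        using discretize_eq[OF p zero_less_Suc] by blast
      have "1 / real (Suc k) \<le> 1 / real (Suc k0)" using k by (intro divide_left_mono) auto
      then have "\<bar>fst q - fst p\<bar> < d / 2" "\<bar>snd q - snd p\<bar> < d / 2" using q k0 by linarith+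
      moreover have "dist q p \<le> \<bar>fst q - fst p\<bar> + \<bar>snd q - snd p\<bar>"
        unfolding dist_prod_def dist_real_def by (rule order_trans[OF sqrt_sum_squares_le_sum_abs]) simp
      ultimately have "dist q p < d" by linarith
      from d(2)[OF p q(1) this] show "\<bar>discretize (Suc k) x p - x p\<bar> \<le> r / 2"
        by (simp add: q(2) dist_real_def)
    qed (auto intro!: path_on_square_in_skorokhod_space quadrant_limits_continuous[OF x] quadrant_limits_grid_path simp: discretize_def)
    then show ?thesis using r skorokhod.nonneg[of "path_on_square (discretize (Suc k) x)" "path_on_square x"] by simp
  qed
  then show "\<exists>no. \<forall>k\<ge>no. norm (skorokhod_dist (path_on_square (discretize (Suc k) x)) (path_on_square x) - 0) < r" by blast
qed

text \<open>A continuous path is the limit of its discretizations, each of which depends on finitely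
  many coordinates.\<close>

lemma measurable_continuous_path:
  assumes X: "\<And>p. p \<in> unit_square \<Longrightarrow> (\<lambda>w. X w p) \<in> borel_measurable M"
    and c: "\<And>w. w \<in> space M \<Longrightarrow> continuous_on unit_square (X w)"
  shows "(\<lambda>w. path_on_square (X w)) \<in> M \<rightarrow>\<^sub>M borel_of_topology skorokhod_topology"
proof (rule skorokhod.measurable_mlimit)
  show "(\<lambda>w. path_on_square (discretize (Suc k) (X w))) \<in> M \<rightarrow>\<^sub>M borel_of_topology skorokhod_topology" for k
    by (rule measurable_discretize[OF X]) auto
qed (auto intro: discretize_continuous_tendsto c path_on_square_in_skorokhod_space quadrant_limits_continuous)

subsection \<open>Time changes that move finitely many points\<close>

text \<open>The time change is the identity plus a tent of height \<open>v a - a\<close> over each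
  \<open>a\<close>. The half-width \<eta> of the tents is at most every gap between two points and
  to the end points, so a tent vanishes at the other points and at \<open>0\<close> and
  \<open>1\<close>. Small heights keep the total slope of the tents below \<open>1\<close> and hence
  the sum strictly increasing.\<close>

lemma time_change_perturbation:
  assumes F: "finite F" "F \<subseteq> {0<..<1::real}" and e: "e > 0"
  obtains \<delta> where "\<delta> > 0" "\<And>v. (\<And>a. a \<in> F \<Longrightarrow> \<bar>v a - a\<bar> \<le> \<delta>) \<Longrightarrow>
    \<exists>l\<in>time_changes. (\<forall>a\<in>F. l a = v a) \<and> (\<forall>s\<in>{0..1}. \<bar>l s - s\<bar> \<le> e)"
proof -
  \<comment> \<open>The inserted \<open>1\<close> keeps the set of gaps nonempty when
    \<open>F\<close> is empty.\<close>
  define G where "G = insert 1 (F \<union> (\<lambda>a. 1 - a) ` F \<union> (\<lambda>(a, b). \<bar>a - b\<bar>) ` {(a, b) \<in> F \<times> F. a \<noteq> b})"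
  define \<eta> where "\<eta> = Min G"
  have fin: "finite G" unfolding G_def using F(1)
    by (intro finite.insertI finite_UnI finite_imageI finite_subset[of "{(a, b) \<in> F \<times> F. a \<noteq> b}" "F \<times> F"]) auto
  have "\<forall>g\<in>G. g > 0" using F(2) by (auto simp: G_def)
  moreover have "\<eta> \<in> G" unfolding \<eta>_def by (rule Min_in[OF fin]) (simp add: G_def)
  ultimately have \<eta>: "\<eta> > 0" by blast
  have \<eta>_le: "\<eta> \<le> g" if "g \<in> G" for g unfolding \<eta>_def using fin that by simp
  have \<eta>1: "\<eta> \<le> a" "\<eta> \<le> 1 - a" if "a \<in> F" for a by (rule \<eta>_le, use that in \<open>auto simp: G_def\<close>)+
  have \<eta>2: "\<eta> \<le> \<bar>a - b\<bar>" if "a \<in> F" "b \<in> F" "a \<noteq> b" for a b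
    by (rule \<eta>_le) (use that in \<open>auto simp: G_def\<close>)
  \<comment> \<open>All tents together then have height at most \<open>min e \<eta> / 2\<close>.
    This bounds the displacement by \<open>e\<close> and the slope
    \<open>card F * \<delta> / \<eta>\<close> strictly by \<open>1\<close>.\<close>
  define \<delta> where "\<delta> = min e \<eta> / (2 * (real (card F) + 1))"
  have \<delta>: "\<delta> > 0" using e \<eta> by (simp add: \<delta>_def)
  have "real (card F) * \<delta> \<le> (2 * (real (card F) + 1)) / 2 * \<delta>" using \<delta> by (intro mult_right_mono) auto
  also have "\<dots> = min e \<eta> / 2"
  proof -
    have half: "c / 2 * (m / c) = m / 2" if "c > 0" for c m :: real using that by simp
    show ?thesis unfolding \<delta>_def by (rule half[of "2 * (real (card F) + 1)"]) simp
  qed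
  finally have \<delta>2: "real (card F) * \<delta> \<le> e" "real (card F) * \<delta> < \<eta>" using e \<eta> by auto
  show ?thesis
  proof (rule that[OF \<delta>])
    fix v assume v: "\<And>a. a \<in> F \<Longrightarrow> \<bar>v a - a\<bar> \<le> \<delta>"
    define h where "h a s = max 0 (1 - \<bar>s - a\<bar> / \<eta>)" for a s
    define l where "l s = s + (\<Sum>a\<in>F. (v a - a) * h a s)" for s
    have h01: "0 \<le> h a s" "h a s \<le> 1" for a s using \<eta> by (auto simp: h_def)
    have h_lip: "\<bar>h a s - h a t\<bar> \<le> \<bar>s - t\<bar> / \<eta>" for a s t
    proof -
      have "\<bar>h a s - h a t\<bar> \<le> \<bar>\<bar>s - a\<bar> / \<eta> - \<bar>t - a\<bar> / \<eta>\<bar>"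
      proof -
        have "\<bar>max 0 (1 - x) - max 0 (1 - y)\<bar> \<le> \<bar>x - y\<bar>" for x y :: real by (auto simp: max_def)
        then show ?thesis unfolding h_def .
      qed
      also have "\<dots> = \<bar>\<bar>s - a\<bar> - \<bar>t - a\<bar>\<bar> / \<eta>" using \<eta> by (simp add: diff_divide_distrib[symmetric])
      also have "\<dots> \<le> \<bar>s - t\<bar> / \<eta>" using \<eta> by (intro divide_right_mono) auto
      finally show ?thesis .
    qed
    have h_zero: "h a s = 0" if "\<eta> \<le> \<bar>s - a\<bar>" for a s using that \<eta> by (simp add: h_def)
    have "strict_mono_on {0..1} l"
    proof (rule strict_mono_onI)
      fix s t :: real assume st: "s < t"
      have "\<bar>\<Sum>a\<in>F. (v a - a) * (h a t - h a s)\<bar> \<le> (\<Sum>a\<in>F. \<bar>(v a - a) * (h a t - h a s)\<bar>)"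
        by (rule sum_abs)
      also have "\<dots> \<le> (\<Sum>a\<in>F. \<delta> * (\<bar>t - s\<bar> / \<eta>))"
        unfolding abs_mult using v h_lip \<delta> by (intro sum_mono mult_mono) auto
      also have "\<dots> = (real (card F) * \<delta> / \<eta>) * (t - s)" using st by simp
      also have "\<dots> < 1 * (t - s)" using st \<delta>2 \<eta> by (intro mult_strict_right_mono) auto
      finally show "l s < l t" unfolding l_def by (simp add: right_diff_distrib sum_subtractf)
    qed
    moreover have "continuous_on {0..1} l"
      unfolding l_def h_def by (intro continuous_intros) (use \<eta> in auto)
    moreover have "h a 0 = 0" "h a 1 = 0" if "a \<in> F" for a
      using \<eta>1[OF that] by (auto intro!: h_zero)
    then have "l 0 = 0" "l 1 = 1" by (simp_all add: l_def)
    ultimately have "l \<in> time_changes" by (simp add: time_changes_def)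
    moreover have "l b = v b" if b: "b \<in> F" for b
    proof -
      have "(\<Sum>a\<in>F. (v a - a) * h a b) = (\<Sum>a\<in>F. if a = b then v b - b else 0)"
        using \<eta>2 b by (intro sum.cong refl) (auto simp: h_zero, simp add: h_def)
      then show ?thesis using F(1) b by (simp add: l_def)
    qed
    moreover have "\<bar>l s - s\<bar> \<le> e" for s
    proof -
      have "\<bar>\<Sum>a\<in>F. (v a - a) * h a s\<bar> \<le> (\<Sum>a\<in>F. \<bar>(v a - a) * h a s\<bar>)" by (rule sum_abs)
      also have "\<dots> \<le> (\<Sum>a\<in>F. \<delta> * 1)"
        unfolding abs_mult using v h01 \<delta> by (intro sum_mono mult_mono) auto
      finally show ?thesis using \<delta>2(1) by (simp add: l_def)
    qed
    ultimately show "\<exists>l\<in>time_changes. (\<forall>a\<in>F. l a = v a) \<and> (\<forall>s\<in>{0..1}. \<bar>l s - s\<bar> \<le> e)" by blast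
  qed
qed

text \<open>Rounding up respects the end points at every level: nonpositive numbers stay
  nonpositive, \<open>1\<close> is fixed, and numbers above \<open>1\<close> stay above it. Only
  numbers strictly between \<open>0\<close> and \<open>1\<close> call for a fine level.\<close>

definition round_up :: "nat \<Rightarrow> real \<Rightarrow> real" where
  "round_up k a = of_int \<lceil>real (Suc k) * a\<rceil> / real (Suc k)"

lemma round_up_bounds: "a \<le> round_up k a" "round_up k a \<le> a + 1 / real (Suc k)"
proof -
  have "real (Suc k) * a \<le> of_int \<lceil>real (Suc k) * a\<rceil>" "of_int \<lceil>real (Suc k) * a\<rceil> \<le> real (Suc k) * a + 1" by linarith+
  then show "a \<le> round_up k a" "round_up k a \<le> a + 1 / real (Suc k)"
    unfolding round_up_def by (simp_all add: field_simps del: of_nat_Suc)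
qed

lemma round_up_nonpos: "a \<le> 0 \<Longrightarrow> round_up k a \<le> 0"
  unfolding round_up_def by (intro divide_nonpos_nonneg) (auto simp: ceiling_le_zero mult_nonneg_nonpos)

lemma round_up_1: "round_up k 1 = 1"
proof -
  have "\<lceil>real (Suc k) * 1\<rceil> = int (Suc k)" by (simp only: mult_1_right ceiling_of_nat)
  then show ?thesis by (simp add: round_up_def)
qed

text \<open>The indicators of the original points at \<open>s\<close> and of the rounded points at
  \<open>l s\<close> coincide exactly. No bound in supremum distance could achieve this, since a
  moved jump has full height.\<close>

lemma time_change_round_up:
  fixes r :: "nat \<Rightarrow> real"
  assumes e: "e > 0" and I: "finite I"
  shows "\<forall>\<^sub>F k in sequentially. \<exists>l\<in>time_changes. (\<forall>s\<in>{0..1}. \<bar>l s - s\<bar> \<le> e) \<and>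
    (\<forall>i\<in>I. \<forall>s\<in>{0..1}. r i \<le> s \<longleftrightarrow> round_up k (r i) \<le> l s)"
proof -
  define F where "F = r ` I \<inter> {0<..<1}"
  obtain \<delta> where \<delta>: "\<delta> > 0" "\<And>v. (\<And>a. a \<in> F \<Longrightarrow> \<bar>v a - a\<bar> \<le> \<delta>) \<Longrightarrow>
    \<exists>l\<in>time_changes. (\<forall>a\<in>F. l a = v a) \<and> (\<forall>s\<in>{0..1}. \<bar>l s - s\<bar> \<le> e)"
    using time_change_perturbation[of F e] e I unfolding F_def by blast
  obtain k0 where k0: "1 / real (Suc k0) < \<delta>"
    using \<delta>(1) reals_Archimedean[of \<delta>] by (auto simp: inverse_eq_divide)
  show ?thesis
    unfolding eventually_sequentially
  proof (intro exI[of _ k0] allI impI)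
    fix k assume k: "k0 \<le> k"
    have "1 / real (Suc k) \<le> 1 / real (Suc k0)" using k by (intro divide_left_mono) auto
    then have "\<bar>round_up k a - a\<bar> \<le> \<delta>" for a using round_up_bounds[where a=a and k=k] k0 by linarith
    then obtain l where l: "l \<in> time_changes" "\<And>a. a \<in> F \<Longrightarrow> l a = round_up k a" "\<And>s. s \<in> {0..1} \<Longrightarrow> \<bar>l s - s\<bar> \<le> e"
      using \<delta>(2)[of "round_up k"] by blast
    have sm: "strict_mono_on {0..1} l" and l1: "l 1 = 1" using l(1) by (auto simp: time_changes_def)
    have le_iff: "l a \<le> l s \<longleftrightarrow> a \<le> s" if "a \<in> {0..1}" "s \<in> {0..1}" for a s
      using that sm by (metis linorder_not_le order.order_iff_strict strict_mono_onD)
    have "r i \<le> s \<longleftrightarrow> round_up k (r i) \<le> l s" if i: "i \<in> I" and s: "s \<in> {0..1}" for i s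
    proof -
      have ls: "0 \<le> l s" "l s \<le> 1" using time_change_range[OF l(1) s] by auto
      \<comment> \<open>The time change moves only the points of \<open>F\<close>; for the other
        three cases the bounds of \<open>round_up\<close> and the fixed end points suffice.\<close>
      consider "r i \<le> 0" | "r i \<in> F" | "r i = 1" | "r i > 1" using i by (force simp: F_def)
      then show ?thesis
      proof cases
        case 1
        then show ?thesis using round_up_nonpos[OF 1, where k=k] ls s by auto
      next
        case 2
        then show ?thesis using l(2)[OF 2] le_iff[of "r i" s] s by (auto simp: F_def)
      next
        case 3
        then show ?thesis using le_iff[of 1 s] s l1 by (simp add: round_up_1)
      next
        case 4
        then show ?thesis using round_up_bounds(1)[where a="r i" and k=k] s ls by auto
      qed
    qed
    with l show "\<exists>l\<in>time_changes. (\<forall>s\<in>{0..1}. \<bar>l s - s\<bar> \<le> e) \<and>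
      (\<forall>i\<in>I. \<forall>s\<in>{0..1}. r i \<le> s \<longleftrightarrow> round_up k (r i) \<le> l s)" by blast
  qed
qed

subsection \<open>Weak convergence of random vectors\<close>

text \<open>The span of cosines of affine forms; the free phase \<open>d\<close> makes sines
  available too. The product formula for cosines turns the span into an algebra, as the
  approximation theorem requires, while expectations of its members are determined by those of
  single cosines.\<close>

inductive_set trig_poly :: "'i set \<Rightarrow> (('i \<Rightarrow> real) \<Rightarrow> real) set" for I :: "'i set" where
  cos: "(\<lambda>x. cos ((\<Sum>i\<in>I. c i * x i) + d)) \<in> trig_poly I"
| add: "p \<in> trig_poly I \<Longrightarrow> q \<in> trig_poly I \<Longrightarrow> (\<lambda>x. p x + q x) \<in> trig_poly I"
| scale: "p \<in> trig_poly I \<Longrightarrow> (\<lambda>x. a * p x) \<in> trig_poly I"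

lemma trig_poly_const: "(\<lambda>_. a) \<in> trig_poly I"
  using trig_poly.scale[OF trig_poly.cos[where c="\<lambda>_. 0" and d=0], of a] by simp

lemma trig_poly_mult_cos:
  assumes "p \<in> trig_poly I"
  shows "(\<lambda>x. p x * cos ((\<Sum>i\<in>I. c i * x i) + d)) \<in> trig_poly I"
  using assms
proof induction
  case (cos c' d')
  have "cos ((\<Sum>i\<in>I. c' i * x i) + d') * cos ((\<Sum>i\<in>I. c i * x i) + d) =
      1 / 2 * cos ((\<Sum>i\<in>I. (c' i - c i) * x i) + (d' - d)) + 1 / 2 * cos ((\<Sum>i\<in>I. (c' i + c i) * x i) + (d' + d))"
    for x :: "'a \<Rightarrow> real"
  proof -
    have 1: "(\<Sum>i\<in>I. (c' i - c i) * x i) + (d' - d) = ((\<Sum>i\<in>I. c' i * x i) + d') - ((\<Sum>i\<in>I. c i * x i) + d)"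
      by (simp add: left_diff_distrib sum_subtractf)
    have 2: "(\<Sum>i\<in>I. (c' i + c i) * x i) + (d' + d) = ((\<Sum>i\<in>I. c' i * x i) + d') + ((\<Sum>i\<in>I. c i * x i) + d)"
      by (simp add: distrib_right sum.distrib)
    show ?thesis unfolding 1 2 cos_times_cos by (simp add: add_divide_distrib)
  qed
  then show ?case by (simp only:) (intro trig_poly.intros)
next
  case (add p q)
  then show ?case by (simp only: distrib_right) (rule trig_poly.add)
next
  case (scale p a)
  then show ?case by (simp only: mult.assoc) (rule trig_poly.scale)
qed

lemma trig_poly_mult:
  assumes "q \<in> trig_poly I" "p \<in> trig_poly I"
  shows "(\<lambda>x. p x * q x) \<in> trig_poly I"
  using assms
proof induction
  case (scale q a)
  then have "(\<lambda>x. a * (p x * q x)) \<in> trig_poly I" by (intro trig_poly.scale) auto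
  then show ?case by (simp add: mult.left_commute)
next
  case (cos c d)
  then show ?case by (intro trig_poly_mult_cos)
next
  case (add q q')
  then have "(\<lambda>x. p x * q x + p x * q' x) \<in> trig_poly I" by (intro trig_poly.add) auto
  then show ?case by (simp add: distrib_left)
qed

lemma trig_poly_sin_coordinate:
  assumes "finite I" "j \<in> I"
  shows "(\<lambda>x. sin (a * x j)) \<in> trig_poly I"
proof -
  have "sin (a * x j) = cos ((\<Sum>i\<in>I. (if i = j then a else 0) * x i) + - (pi / 2))" for x :: "'a \<Rightarrow> real"
  proof -
    have "(\<Sum>i\<in>I. (if i = j then a else 0) * x i) = (\<Sum>i\<in>I. if i = j then a * x j else 0)"
      by (intro sum.cong) auto
    also have "\<dots> = a * x j" using assms by simp
    finally show ?thesis by (simp only:) (simp add: cos_diff)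
  qed
  then show ?thesis by (simp only: trig_poly.cos)
qed

lemma trig_poly_continuous:
  fixes p :: "('i::countable \<Rightarrow> real) \<Rightarrow> real"
  shows "p \<in> trig_poly I \<Longrightarrow> continuous_on UNIV p"
proof (induction rule: trig_poly.induct)
  case (cos c d)
  show ?case
    by (intro continuous_on_cos continuous_on_add continuous_on_sum continuous_on_mult continuous_on_const
        continuous_on_product_coordinates)
qed (intro continuous_on_add continuous_on_mult continuous_on_const; assumption)+

lemma trig_poly_bounded: "p \<in> trig_poly I \<Longrightarrow> \<exists>B. \<forall>x. \<bar>p x\<bar> \<le> B"
proof (induction rule: trig_poly.induct)
  case (cos c d)
  show ?case by (intro exI[of _ 1]) (simp add: abs_cos_le_one)
next
  case (add p q)
  then obtain A B where AB: "\<And>x. \<bar>p x\<bar> \<le> A" "\<And>x. \<bar>q x\<bar> \<le> B" by blast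
  have "\<bar>p x + q x\<bar> \<le> A + B" for x using AB[of x] by linarith
  then show ?case by blast
next
  case (scale p a)
  then obtain A where A: "\<And>x. \<bar>p x\<bar> \<le> A" by blast
  have "\<bar>a * p x\<bar> \<le> \<bar>a\<bar> * A" for x using A[of x] by (simp add: abs_mult mult_left_mono)
  then show ?case by blast
qed

text \<open>Stone--Weierstrass on the cube \<open>[-1,1]\<^sup>I\<close>, applied to \<open>u \<mapsto> g (l * arcsin u)\<close>: in the variables
  \<open>u i = sin (x i / l)\<close> the approximating polynomial is a trigonometric polynomial, and the
  approximation is uniform on the whole space rather than on a box.\<close>

lemma trig_poly_approx:
  fixes g :: "('i::countable \<Rightarrow> real) \<Rightarrow> real"
  assumes I: "finite I" and g: "continuous_on UNIV g"
    and dep: "\<And>x y. (\<And>i. i \<in> I \<Longrightarrow> x i = y i) \<Longrightarrow> g x = g y"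
    and l: "l > 0" and e: "e > 0"
  obtains p where "p \<in> trig_poly I" "\<And>x. \<bar>g (\<lambda>i. l * arcsin (sin (x i / l))) - p x\<bar> < e"
proof -
  \<comment> \<open>Coordinates outside \<open>I\<close> are pinned to \<open>0\<close>, so that
    \<open>S\<close> is compact and two of its points always differ in a coordinate from
    \<open>I\<close>.\<close>
  define S where "S = PiE UNIV (\<lambda>i::'i. if i \<in> I then {-1..1::real} else {0})"
  define R where "R = {p. continuous_on S p \<and> (\<lambda>x. p (\<lambda>i. if i \<in> I then sin (x i / l) else 0)) \<in> trig_poly I}"
  have "compactin (product_topology (\<lambda>i. euclidean) UNIV) S"
    unfolding S_def compactin_PiE by auto
  then have S: "compact S" by (simp add: euclidean_product_topology)
  interpret function_ring_on R S
  proof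
    show "compact S" by (rule S)
    show "f \<in> R \<Longrightarrow> continuous_on S f" for f by (simp add: R_def)
    show "f \<in> R \<Longrightarrow> h \<in> R \<Longrightarrow> (\<lambda>x. f x + h x) \<in> R" for f h
      unfolding R_def by (intro CollectI conjI continuous_on_add trig_poly.add) auto
    show "f \<in> R \<Longrightarrow> h \<in> R \<Longrightarrow> (\<lambda>x. f x * h x) \<in> R" for f h
      unfolding R_def by (intro CollectI conjI continuous_on_mult trig_poly_mult) auto
    show "(\<lambda>_. c) \<in> R" for c by (auto simp: R_def intro: trig_poly_const)
    show "\<exists>f\<in>R. f x \<noteq> f y" if xy: "x \<in> S" "y \<in> S" "x \<noteq> y" for x y
    proof -
      obtain j where j: "x j \<noteq> y j" using xy(3) by blast
      then have jI: "j \<in> I" using xy(1,2) by (fastforce simp: S_def PiE_iff split: if_splits)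
      have "continuous_on S (\<lambda>u. u j)"
        by (rule continuous_on_subset[OF continuous_on_product_coordinates]) auto
      moreover have "(\<lambda>x. sin (x j / l)) \<in> trig_poly I"
        using trig_poly_sin_coordinate[OF I jI, of "1 / l"] by simp
      ultimately have "(\<lambda>u. u j) \<in> R"
        unfolding R_def using jI by (intro CollectI conjI) (simp_all only: if_True)
      then show ?thesis using j by (auto intro!: bexI[of _ "\<lambda>u. u j"])
    qed
  qed
  have "continuous_on S (\<lambda>u. g (\<lambda>i. l * arcsin (u i)))"
  proof (rule continuous_on_compose2[OF g])
    show "continuous_on S (\<lambda>u i. l * arcsin (u i))"
    proof (intro continuous_on_coordinatewise_then_product continuous_on_mult continuous_on_const continuous_on_arcsin)
      show "continuous_on S (\<lambda>u. u i)" for i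
        by (rule continuous_on_subset[OF continuous_on_product_coordinates]) auto
      show "\<forall>u\<in>S. - 1 \<le> u i \<and> u i \<le> 1" for i
      proof
        fix u assume "u \<in> S"
        then have "u i \<in> (if i \<in> I then {-1..1} else {0})" unfolding S_def PiE_iff by blast
        then show "- 1 \<le> u i \<and> u i \<le> 1" by (auto split: if_splits)
      qed
    qed
  qed auto
  from Stone_Weierstrass_basic[OF this e] obtain p where
    p: "p \<in> R" "\<And>u. u \<in> S \<Longrightarrow> \<bar>g (\<lambda>i. l * arcsin (u i)) - p u\<bar> < e" by blast
  show ?thesis
  proof (rule that)
    show "(\<lambda>x. p (\<lambda>i. if i \<in> I then sin (x i / l) else 0)) \<in> trig_poly I" using p(1) by (simp add: R_def)
    fix x
    let ?u = "\<lambda>i. if i \<in> I then sin (x i / l) else 0"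
    have "?u \<in> S" by (auto simp: S_def)
    moreover have "g (\<lambda>i. l * arcsin (sin (x i / l))) = g (\<lambda>i. l * arcsin (?u i))" by (rule dep) auto
    ultimately show "\<bar>g (\<lambda>i. l * arcsin (sin (x i / l))) - p ?u\<bar> < e" using p(2) by metis
  qed
qed

lemma arcsin_sin_scaled:
  fixes l x :: real
  assumes "l > 0" "\<bar>x\<bar> \<le> l" shows "l * arcsin (sin (x / l)) = x"
proof -
  have "x / l \<le> 1" "- 1 \<le> x / l" using assms by (auto simp: field_simps)
  then have "arcsin (sin (x / l)) = x / l"
    using pi_gt3 by (intro arcsin_sin) linarith+
  then show ?thesis using assms by simp
qed

text \<open>A form of the continuity theorem for characteristic functions. Trigonometric polynomials
  converge by assumption, a folded version of \<open>g\<close> is a uniform limit of such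
  polynomials, and by tightness the folding is rarely noticed.\<close>

lemma random_vector_convergence:
  fixes X :: "nat \<Rightarrow> 'a \<Rightarrow> 'i::countable \<Rightarrow> real" and Y :: "'b \<Rightarrow> 'i \<Rightarrow> real" and g :: "('i \<Rightarrow> real) \<Rightarrow> real"
  assumes pr: "\<And>n. prob_space (P n)" "prob_space Q" and I: "finite I"
    and X: "\<And>n i. (\<lambda>w. X n w i) \<in> borel_measurable (P n)"
    and Y: "\<And>i. (\<lambda>w. Y w i) \<in> borel_measurable Q"
    and cos: "\<And>c d. (\<lambda>n. \<integral>w. cos ((\<Sum>i\<in>I. c i * X n w i) + d) \<partial>P n) \<longlonglongrightarrow>
       (\<integral>w. cos ((\<Sum>i\<in>I. c i * Y w i) + d) \<partial>Q)"
    and tight: "\<And>e. e > 0 \<Longrightarrow> \<exists>L. \<forall>n. \<exists>A\<in>sets (P n). measure (P n) A \<ge> 1 - e \<and> (\<forall>w\<in>A. \<forall>i\<in>I. \<bar>X n w i\<bar> \<le> L)"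
    and g: "continuous_on UNIV g" "\<And>x. \<bar>g x\<bar> \<le> K"
    and dep: "\<And>x y. (\<And>i. i \<in> I \<Longrightarrow> x i = y i) \<Longrightarrow> g x = g y"
  shows "(\<lambda>n. \<integral>w. g (X n w) \<partial>P n) \<longlonglongrightarrow> (\<integral>w. g (Y w) \<partial>Q)"
proof -
  interpret Q: prob_space Q by (rule pr)
  interpret P: prob_space "P n" for n by (rule pr)
  have K: "K \<ge> 0" using g(2)[of undefined] by linarith
  have Xm: "X n \<in> P n \<rightarrow>\<^sub>M borel" for n
    by (rule measurable_coordinatewise_then_product) (rule X)
  have Ym: "Y \<in> Q \<rightarrow>\<^sub>M borel"
    by (rule measurable_coordinatewise_then_product) (rule Y)
  have mX: "(\<lambda>w. f (X n w)) \<in> borel_measurable (P n)" if "continuous_on UNIV f" for f :: "_ \<Rightarrow> real" and n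
    by (rule measurable_compose[OF Xm borel_measurable_continuous_onI[OF that]])
  have mY: "(\<lambda>w. f (Y w)) \<in> borel_measurable Q" if "continuous_on UNIV f" for f :: "_ \<Rightarrow> real"
    by (rule measurable_compose[OF Ym borel_measurable_continuous_onI[OF that]])
  have intX: "integrable (P n) (\<lambda>w. p (X n w))" if p: "p \<in> trig_poly I" for p n
  proof -
    obtain B where "\<And>x. \<bar>p x\<bar> \<le> B" using trig_poly_bounded[OF p] by blast
    then show ?thesis
      by (intro P.integrable_const_bound[of _ B] mX trig_poly_continuous[OF p]) auto
  qed
  have intY: "integrable Q (\<lambda>w. p (Y w))" if p: "p \<in> trig_poly I" for p
  proof -
    obtain B where "\<And>x. \<bar>p x\<bar> \<le> B" using trig_poly_bounded[OF p] by blast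
    then show ?thesis
      by (intro Q.integrable_const_bound[of _ B] mY trig_poly_continuous[OF p]) auto
  qed
  have trig: "(\<lambda>n. \<integral>w. p (X n w) \<partial>P n) \<longlonglongrightarrow> (\<integral>w. p (Y w) \<partial>Q)" if "p \<in> trig_poly I" for p
    using that
  proof induction
    case (cos c d)
    show ?case by (rule assms(6))
  next
    case (add p q)
    then show ?case by (simp add: intX intY tendsto_add)
  next
    case (scale p a)
    then show ?case by (simp add: tendsto_mult_left)
  qed
  \<comment> \<open>Each coordinate is folded back into a bounded interval. On the cube of
    half-width \<open>l + 1\<close> nothing changes, because \<open>1 < pi / 2\<close>.\<close>
  define G where "G l x = g (\<lambda>i. real (Suc l) * arcsin (sin (x i / real (Suc l))))" for l x
  have GK: "\<bar>G l x\<bar> \<le> K" for l x by (simp add: G_def g(2))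
  have contG: "continuous_on UNIV (G l)" for l
    unfolding G_def
    by (rule continuous_on_compose2[OF g(1)])
      (auto intro!: continuous_on_coordinatewise_then_product continuous_intros continuous_on_product_coordinates)
  have G_eq: "G l x = g x" if "\<And>i. i \<in> I \<Longrightarrow> \<bar>x i\<bar> \<le> real (Suc l)" for l x
    unfolding G_def by (rule dep) (use that arcsin_sin_scaled in auto)
  have "(\<lambda>l. \<integral>w. G l (Y w) \<partial>Q) \<longlonglongrightarrow> (\<integral>w. g (Y w) \<partial>Q)"
  proof (rule integral_dominated_convergence[where w="\<lambda>_. K"])
    show "AE w in Q. (\<lambda>l. G l (Y w)) \<longlonglongrightarrow> g (Y w)"
    proof (rule AE_I2)
      fix w
      obtain l0 where l0: "(\<Sum>i\<in>I. \<bar>Y w i\<bar>) \<le> real l0" using real_arch_simple by blast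
      have "\<bar>Y w i\<bar> \<le> real (Suc l)" if "i \<in> I" "l \<ge> l0" for i l
        using member_le_sum[of i I "\<lambda>i. \<bar>Y w i\<bar>"] I that l0 by simp
      then have "\<forall>\<^sub>F l in sequentially. G l (Y w) = g (Y w)"
        unfolding eventually_sequentially by (intro exI[of _ l0]) (auto intro: G_eq)
      then show "(\<lambda>l. G l (Y w)) \<longlonglongrightarrow> g (Y w)" by (rule tendsto_eventually)
    qed
    show "AE w in Q. norm (G l (Y w)) \<le> K" for l by (simp add: GK)
  qed (auto intro: mY contG g)
  note Glim = this
  show ?thesis
  proof (rule tendstoI)
    fix e :: real assume e: "e > 0"
    define e' where "e' = e / (8 * (K + 1))"
    have e': "e' > 0" "2 * K * e' \<le> e / 4" using e K by (auto simp: e'_def field_simps)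
    obtain L where L: "\<And>n. \<exists>A\<in>sets (P n). measure (P n) A \<ge> 1 - e' \<and> (\<forall>w\<in>A. \<forall>i\<in>I. \<bar>X n w i\<bar> \<le> L)"
      using tight[OF e'(1)] by blast
    obtain l0 where l0: "L \<le> real l0" using real_arch_simple by blast
    have "\<forall>\<^sub>F l in sequentially. dist (\<integral>w. G l (Y w) \<partial>Q) (\<integral>w. g (Y w) \<partial>Q) < e / 8"
      using Glim e by (intro tendstoD) auto
    then obtain l where l: "l \<ge> l0" "dist (\<integral>w. G l (Y w) \<partial>Q) (\<integral>w. g (Y w) \<partial>Q) < e / 8"
      using eventually_happens'[OF sequentially_bot eventually_conj[OF eventually_ge_at_top[of l0]]] by blast
    obtain p where p: "p \<in> trig_poly I" "\<And>x. \<bar>G l x - p x\<bar> < e / 8"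
      using trig_poly_approx[OF I g(1) dep, of "real (Suc l)" "e / 8"] e unfolding G_def by auto
    have GX: "\<bar>(\<integral>w. G l (X n w) \<partial>P n) - (\<integral>w. g (X n w) \<partial>P n)\<bar> \<le> e / 4" for n
    proof -
      obtain A where A: "A \<in> sets (P n)" "measure (P n) A \<ge> 1 - e'" "\<forall>w\<in>A. \<forall>i\<in>I. \<bar>X n w i\<bar> \<le> L" using L by blast
      have "\<bar>(\<integral>w. G l (X n w) \<partial>P n) - (\<integral>w. g (X n w) \<partial>P n)\<bar> \<le> 0 + 2 * K * e'"
      proof (rule P.integral_diff_le_on[OF _ _ _ _ A(1,2)])
        fix w assume "w \<in> A"
        then have "G l (X n w) = g (X n w)" using A(3) l0 l(1) by (intro G_eq) fastforce
        then show "\<bar>G l (X n w) - g (X n w)\<bar> \<le> 0" by simp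
      qed (auto intro: mX contG g simp: g(2) GK)
      then show ?thesis using e'(2) by simp
    qed
    have GpX: "\<bar>(\<integral>w. G l (X n w) \<partial>P n) - (\<integral>w. p (X n w) \<partial>P n)\<bar> \<le> e / 8" for n
    proof -
      have "integrable (P n) (\<lambda>w. G l (X n w))"
        by (intro P.integrable_const_bound[of _ K] mX contG) (simp add: GK)
      then have "\<bar>(\<integral>w. G l (X n w) \<partial>P n) - (\<integral>w. p (X n w) \<partial>P n)\<bar> = \<bar>\<integral>w. G l (X n w) - p (X n w) \<partial>P n\<bar>"
        using intX[OF p(1)] by simp
      also have "\<dots> \<le> (\<integral>w. \<bar>G l (X n w) - p (X n w)\<bar> \<partial>P n)" by (rule integral_abs_bound)
      also have "\<dots> \<le> e / 8"
        using p(2) by (intro P.integral_le_const \<open>integrable (P n) (\<lambda>w. G l (X n w))\<close> integrable_abs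
            Bochner_Integration.integrable_diff intX[OF p(1)]) (auto intro: less_imp_le)
      finally show ?thesis .
    qed
    have GpY: "\<bar>(\<integral>w. G l (Y w) \<partial>Q) - (\<integral>w. p (Y w) \<partial>Q)\<bar> \<le> e / 8"
    proof -
      have "integrable Q (\<lambda>w. G l (Y w))"
        by (intro Q.integrable_const_bound[of _ K] mY contG) (simp add: GK)
      then have "\<bar>(\<integral>w. G l (Y w) \<partial>Q) - (\<integral>w. p (Y w) \<partial>Q)\<bar> = \<bar>\<integral>w. G l (Y w) - p (Y w) \<partial>Q\<bar>"
        using intY[OF p(1)] by simp
      also have "\<dots> \<le> (\<integral>w. \<bar>G l (Y w) - p (Y w)\<bar> \<partial>Q)" by (rule integral_abs_bound)
      also have "\<dots> \<le> e / 8"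
        using p(2) by (intro Q.integral_le_const \<open>integrable Q (\<lambda>w. G l (Y w))\<close> integrable_abs
            Bochner_Integration.integrable_diff intY[OF p(1)]) (auto intro: less_imp_le)
      finally show ?thesis .
    qed
    have "\<forall>\<^sub>F n in sequentially. dist (\<integral>w. p (X n w) \<partial>P n) (\<integral>w. p (Y w) \<partial>Q) < e / 8"
      using trig[OF p(1)] e by (intro tendstoD) auto
    \<comment> \<open>The folding of \<open>X n\<close> costs \<open>e / 4\<close>; the two
      polynomial approximations, the convergence of the polynomial and the folding of
      \<open>Y\<close> cost \<open>e / 8\<close> each.\<close>
    then show "\<forall>\<^sub>F n in sequentially. dist (\<integral>w. g (X n w) \<partial>P n) (\<integral>w. g (Y w) \<partial>Q) < e"
    proof eventually_elim
      case (elim n)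
      then show ?case using GX[of n] GpX[of n] GpY l(2) e unfolding dist_real_def by linarith
    qed
  qed
qed

subsection \<open>Gaussian variables\<close>

text \<open>Scaling by \<sigma> reduces this to the characteristic function of the standard normal
  law; a degenerate variable is the constant \<open>0\<close>. The phase \<open>d\<close> matches
  the generators of \<open>trig_poly\<close>.\<close>

lemma gaussian_variable_cos:
  assumes N: "prob_space N" and X: "gaussian_variable N X"
    and mean: "(\<integral>w. X w \<partial>N) = 0" and var: "(\<integral>w. (X w)\<^sup>2 \<partial>N) = v"
  shows "(\<integral>w. cos (X w + d) \<partial>N) = exp (- v / 2) * cos d"
proof -
  obtain \<mu> \<sigma> where m: "X \<in> borel_measurable N" and s: "\<sigma> \<ge> 0"
    and D: "distr N borel X = (if \<sigma> = 0 then return borel \<mu> else density lborel (normal_density \<mu> \<sigma>))"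
    using X unfolding gaussian_variable_def by blast
  have E: "(\<integral>w. f (X w) \<partial>N) = (\<integral>x. f x \<partial>distr N borel X)" if "f \<in> borel_measurable borel" for f :: "real \<Rightarrow> real"
    by (rule integral_distr[symmetric]) (use m that in auto)
  show ?thesis
  proof (cases "\<sigma> = 0")
    case True
    then have R: "(\<integral>w. f (X w) \<partial>N) = f \<mu>" if "f \<in> borel_measurable borel" for f :: "real \<Rightarrow> real"
      using E[OF that] D that by (simp add: integral_return)
    have "\<mu> = 0" using mean R[of "\<lambda>x. x"] by simp
    then show ?thesis using var R[of "\<lambda>x. x\<^sup>2"] R[of "\<lambda>x. cos (x + d)"] by simp
  next
    case False
    then have s: "\<sigma> > 0" using s by simp
    have R: "(\<integral>w. f (X w) \<partial>N) = (\<integral>x. normal_density \<mu> \<sigma> x * f x \<partial>lborel)" if "f \<in> borel_measurable borel" for f :: "real \<Rightarrow> real"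
      using E[OF that] D that False by (simp add: integral_density)
    have mu: "\<mu> = 0" using mean R[of "\<lambda>x. x"] integral_normal_moment_nz_1[OF s, of \<mu>] by simp
    have v: "v = \<sigma>\<^sup>2"
      using var R[of "\<lambda>x. x\<^sup>2"] integral_normal_moment_even[OF s, of 0 1] by (simp add: mu fact_numeral)
    interpret N: prob_space N by (rule N)
    have "distributed N lborel X (normal_density 0 \<sigma>)"
    proof -
      have "distr N lborel X = distr N borel X" by (rule distr_cong) auto
      then show ?thesis using D m False by (simp add: distributed_def mu)
    qed
    then have "distributed N lborel (\<lambda>w. X w / \<sigma>) std_normal_density"
      using N.normal_standard_normal_convert[OF s, of X 0] by simp
    then have "distr N lborel (\<lambda>w. X w / \<sigma>) = std_normal_distribution"
      unfolding distributed_def by simp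
    moreover have "distr N lborel (\<lambda>w. X w / \<sigma>) = distr N borel (\<lambda>w. X w / \<sigma>)" by (rule distr_cong) auto
    ultimately have D': "distr N borel (\<lambda>w. X w / \<sigma>) = std_normal_distribution" by simp
    have "(\<integral>w. iexp (X w) \<partial>N) = (\<integral>x. iexp (\<sigma> * x) \<partial>distr N borel (\<lambda>w. X w / \<sigma>))"
      using s m by (subst integral_distr) auto
    also have "\<dots> = char std_normal_distribution \<sigma>" by (simp add: D' char_def)
    also have "\<dots> = exp (- v / 2)" by (simp add: char_std_normal_distribution v)
    finally have ch: "(\<integral>w. iexp (X w) \<partial>N) = exp (- v / 2)" .
    have "(\<integral>w. cos (X w + d) \<partial>N) = (\<integral>w. Re (iexp d * iexp (X w)) \<partial>N)"
      by (simp add: exp_add[symmetric] distrib_left[symmetric] Re_exp add.commute)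
    also have "\<dots> = Re (iexp d * (\<integral>w. iexp (X w) \<partial>N))"
      using m by (subst integral_Re) (auto intro!: N.integrable_iexp)
    also have "\<dots> = exp (- v / 2) * cos d" by (simp add: ch Re_exp)
    finally show ?thesis .
  qed
qed

lemma gaussian_variable_integrable:
  assumes N: "prob_space N" and X: "gaussian_variable N X"
  shows "integrable N X" "integrable N (\<lambda>w. (X w)\<^sup>2)"
proof -
  obtain \<mu> \<sigma> where m: "X \<in> borel_measurable N" and s: "\<sigma> \<ge> 0"
    and D: "distr N borel X = (if \<sigma> = 0 then return borel \<mu> else density lborel (normal_density \<mu> \<sigma>))"
    using X unfolding gaussian_variable_def by blast
  have E: "integrable N (\<lambda>w. f (X w)) \<longleftrightarrow> integrable (distr N borel X) f" if "f \<in> borel_measurable borel" for f :: "real \<Rightarrow> real"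
    by (rule integrable_distr_eq[symmetric]) (use m that in auto)
  have "integrable (distr N borel X) (\<lambda>x. x) \<and> integrable (distr N borel X) (\<lambda>x. x\<^sup>2)"
  proof (cases "\<sigma> = 0")
    case True
    interpret R: prob_space "return borel \<mu>" by (rule prob_space_return) simp
    have "AE x in return borel \<mu>. x = \<mu>" by (simp add: AE_return)
    then have "AE x in return borel \<mu>. norm x \<le> \<bar>\<mu>\<bar>" "AE x in return borel \<mu>. norm (x\<^sup>2) \<le> \<mu>\<^sup>2"
      by (eventually_elim, simp)+
    note bds = this
    have "integrable (return borel \<mu>) (\<lambda>x. x)" by (rule R.integrable_const_bound[OF bds(1)]) simp
    moreover have "integrable (return borel \<mu>) (\<lambda>x. x\<^sup>2)" by (rule R.integrable_const_bound[OF bds(2)]) simp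
    ultimately show ?thesis by (simp add: D True)
  next
    case False
    then have s: "\<sigma> > 0" using s by simp
    have 1: "integrable lborel (\<lambda>x. normal_density \<mu> \<sigma> x * x)" by (rule integrable_normal_moment_nz_1[OF s])
    \<comment> \<open>The raw second moment is recovered from the central one by \<open>x\<^sup>2 =
      (x - \<mu>)\<^sup>2 + 2 * \<mu> * x - \<mu>\<^sup>2\<close>.\<close>
    have "integrable lborel (\<lambda>x. normal_density \<mu> \<sigma> x * (x - \<mu>)\<^sup>2 + (2 * \<mu> * (normal_density \<mu> \<sigma> x * x) - \<mu>\<^sup>2 * normal_density \<mu> \<sigma> x))"
      using s by (intro Bochner_Integration.integrable_add Bochner_Integration.integrable_diff integrable_mult_right
          1 integrable_normal_moment integrable_normal_density) auto
    also have "(\<lambda>x. normal_density \<mu> \<sigma> x * (x - \<mu>)\<^sup>2 + (2 * \<mu> * (normal_density \<mu> \<sigma> x * x) - \<mu>\<^sup>2 * normal_density \<mu> \<sigma> x)) =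
        (\<lambda>x. normal_density \<mu> \<sigma> x * x\<^sup>2)"
      by (simp add: fun_eq_iff power2_eq_square algebra_simps)
    finally have 2: "integrable lborel (\<lambda>x. normal_density \<mu> \<sigma> x * x\<^sup>2)" .
    show ?thesis using 1 2 False by (simp add: D integrable_density)
  qed
  moreover have "integrable N (\<lambda>w. X w) \<longleftrightarrow> integrable (distr N borel X) (\<lambda>x. x)" by (rule E) simp
  moreover have "integrable N (\<lambda>w. (X w)\<^sup>2) \<longleftrightarrow> integrable (distr N borel X) (\<lambda>x. x\<^sup>2)" by (rule E) simp
  ultimately show "integrable N X" "integrable N (\<lambda>w. (X w)\<^sup>2)" by blast+
qed

lemma gaussian_process_cos:
  assumes N: "gaussian_process N T G" and I: "finite I" "p ` I \<subseteq> T"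
    and mean: "\<And>q. q \<in> T \<Longrightarrow> (\<integral>w. G w q \<partial>N) = 0"
    and cov: "\<And>q q'. q \<in> T \<Longrightarrow> q' \<in> T \<Longrightarrow> (\<integral>w. G w q * G w q' \<partial>N) = K q q'"
  shows "(\<integral>w. cos ((\<Sum>i\<in>I. c i * G w (p i)) + d) \<partial>N) =
    exp (- (\<Sum>i\<in>I. \<Sum>j\<in>I. c i * c j * K (p i) (p j)) / 2) * cos d"
proof -
  have pr: "prob_space N" using N by (simp add: gaussian_process_def)
  interpret prob_space N by (rule pr)
  have gv: "gaussian_variable N (\<lambda>w. \<Sum>q\<in>F. b q * G w q)" if "finite F" "F \<subseteq> T" for F b
    using N that by (auto simp: gaussian_process_def)
  have int: "integrable N (\<lambda>w. G w q)" "integrable N (\<lambda>w. (G w q)\<^sup>2)" if "q \<in> T" for q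
    using gaussian_variable_integrable[OF pr gv[of "{q}" "\<lambda>_. 1"]] that by auto
  have int2: "integrable N (\<lambda>w. G w q * G w q')" if "q \<in> T" "q' \<in> T" for q q'
  proof (rule Bochner_Integration.integrable_bound)
    show "integrable N (\<lambda>w. (G w q)\<^sup>2 + (G w q')\<^sup>2)" using int that by auto
    show "(\<lambda>w. G w q * G w q') \<in> borel_measurable N"
      using int(1)[OF that(1)] int(1)[OF that(2)] by (intro borel_measurable_times) auto
    have "\<bar>a * b\<bar> \<le> \<bar>a\<^sup>2 + b\<^sup>2\<bar>" for a b :: real
    proof -
      have "2 * \<bar>a * b\<bar> \<le> a\<^sup>2 + b\<^sup>2" using sum_squares_bound[of "\<bar>a\<bar>" "\<bar>b\<bar>"] by (simp add: abs_mult)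
      then show ?thesis using abs_ge_zero[of "a * b"] by linarith
    qed
    then show "AE w in N. norm (G w q * G w q') \<le> norm ((G w q)\<^sup>2 + (G w q')\<^sup>2)" by simp
  qed
  \<comment> \<open>The family \<open>p\<close> may repeat points, whereas a Gaussian process is
    described by sums over sets of points, so coefficients of equal points are added up.\<close>
  define b where "b q = (\<Sum>i | i \<in> I \<and> p i = q. c i)" for q
  have regroup: "(\<Sum>i\<in>I. c i * G w (p i)) = (\<Sum>q\<in>p ` I. b q * G w q)" for w
  proof -
    have "(\<Sum>i\<in>I. c i * G w (p i)) = (\<Sum>q\<in>p ` I. \<Sum>i | i \<in> I \<and> p i = q. c i * G w (p i))"
      by (rule sum.image_gen[OF I(1)])
    also have "\<dots> = (\<Sum>q\<in>p ` I. b q * G w q)"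
      unfolding b_def sum_distrib_right by (intro sum.cong) auto
    finally show ?thesis .
  qed
  have pI: "p i \<in> T" if "i \<in> I" for i using I(2) that by blast
  have "gaussian_variable N (\<lambda>w. \<Sum>i\<in>I. c i * G w (p i))"
    unfolding regroup by (rule gv) (use I in auto)
  moreover have "(\<integral>w. (\<Sum>i\<in>I. c i * G w (p i)) \<partial>N) = 0"
    by (subst Bochner_Integration.integral_sum) (use pI int mean in auto)
  moreover have "(\<integral>w. (\<Sum>i\<in>I. c i * G w (p i))\<^sup>2 \<partial>N) = (\<Sum>i\<in>I. \<Sum>j\<in>I. c i * c j * K (p i) (p j))"
  proof -
    have "(\<integral>w. (\<Sum>i\<in>I. c i * G w (p i))\<^sup>2 \<partial>N) = (\<integral>w. (\<Sum>i\<in>I. \<Sum>j\<in>I. c i * c j * (G w (p i) * G w (p j))) \<partial>N)"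
      by (simp add: power2_eq_square sum_product ac_simps)
    also have "\<dots> = (\<Sum>i\<in>I. \<Sum>j\<in>I. c i * c j * (\<integral>w. G w (p i) * G w (p j) \<partial>N))"
    proof -
      have "(\<integral>w. (\<Sum>j\<in>I. c i * c j * (G w (p i) * G w (p j))) \<partial>N) = (\<Sum>j\<in>I. c i * c j * (\<integral>w. G w (p i) * G w (p j) \<partial>N))"
        if "i \<in> I" for i
        using int2[OF pI pI] that by (subst Bochner_Integration.integral_sum) auto
      moreover have "integrable N (\<lambda>w. \<Sum>j\<in>I. c i * c j * (G w (p i) * G w (p j)))" if "i \<in> I" for i
        using int2[OF pI pI] that by auto
      ultimately show ?thesis by (subst Bochner_Integration.integral_sum) auto
    qed
    finally show ?thesis using cov pI by simp
  qed
  ultimately show ?thesis by (rule gaussian_variable_cos[OF pr])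
qed

subsection \<open>The central limit theorem for characteristic functions\<close>

text \<open>The variable is not divided by its standard deviation, so variance \<open>0\<close> is
  included; linear combinations of field values can degenerate, for instance on the boundary of the
  square. The second order Taylor error is cubic in \<open>1 / sqrt n\<close>, and taking
  \<open>n\<close>-th powers costs only one factor \<open>n\<close>.\<close>

lemma (in prob_space) clt_characteristic_function:
  fixes \<eta> :: "'a \<Rightarrow> real"
  assumes m: "\<eta> \<in> borel_measurable M" and b: "\<And>w. w \<in> space M \<Longrightarrow> \<bar>\<eta> w\<bar> \<le> b"
    and mean: "expectation \<eta> = 0"
  shows "(\<lambda>n. (CLINT w|M. iexp (real n powr (-1/2) * \<eta> w)) ^ n) \<longlonglongrightarrow> exp (- (expectation (\<lambda>w. (\<eta> w)\<^sup>2)) / 2)"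
proof -
  define v where "v = expectation (\<lambda>w. (\<eta> w)\<^sup>2)"
  define \<phi> where "\<phi> n = (CLINT w|M. iexp (real n powr (-1/2) * \<eta> w))" for n
  define \<psi> where "\<psi> n = 1 + (- v / 2) / real n" for n
  obtain w0 where "w0 \<in> space M" using not_empty by blast
  then have b0: "b \<ge> 0" using b[of w0] by linarith
  have v: "v \<ge> 0" unfolding v_def by (rule Bochner_Integration.integral_nonneg) simp
  have int1: "integrable M \<eta>" using m b by (intro integrable_const_bound[of _ b]) auto
  have int2: "integrable M (\<lambda>w. (\<eta> w)\<^sup>2)"
    using m b b0 by (intro integrable_const_bound[of _ "b\<^sup>2"]) (auto simp: abs_le_square_iff[symmetric])
  have main: "norm (\<phi> n ^ n - of_real (\<psi> n) ^ n) \<le> b ^ 3 / 6 * real n powr (-1/2)"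
    if n: "n > 0" "real n \<ge> v" for n
  proof -
    define t where "t = real n powr (-1/2)"
    have t: "t > 0" "t\<^sup>2 = 1 / real n" "real n * t ^ 3 = t"
    proof -
      show "t > 0" using n by (simp add: t_def)
      show t2: "t\<^sup>2 = 1 / real n"
        using n by (simp add: t_def powr_minus_divide powr_half_sqrt power_divide)
      have "real n * t ^ 3 = real n * t\<^sup>2 * t" by (simp add: power3_eq_cube power2_eq_square)
      then show "real n * t ^ 3 = t" using n by (simp add: t2)
    qed
    have intI: "integrable M (\<lambda>w. iexp (t * \<eta> w))" by (intro integrable_iexp) (use m in auto)
    have intA: "integrable M (\<lambda>w. t * \<eta> w)" using int1 by (rule integrable_mult_right)
    have intB: "integrable M (\<lambda>w. (t * \<eta> w)\<^sup>2 / 2)" using int2 unfolding power_mult_distrib by simp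
    have intA': "integrable M (\<lambda>w. \<i> * of_real (t * \<eta> w))"
      by (intro integrable_mult_right integrable_of_real intA)
    have intB': "integrable M (\<lambda>w. of_real ((t * \<eta> w)\<^sup>2 / 2) :: complex)"
      by (rule integrable_of_real[OF intB])
    have intC: "integrable M (\<lambda>w. 1 + \<i> * of_real (t * \<eta> w))"
      by (rule Bochner_Integration.integrable_add[OF _ intA']) simp
    have intQ: "integrable M (\<lambda>w. 1 + \<i> * of_real (t * \<eta> w) - of_real ((t * \<eta> w)\<^sup>2 / 2))"
      by (rule Bochner_Integration.integrable_diff[OF intC intB'])
    have eA: "(CLINT w|M. \<i> * of_real (t * \<eta> w)) = 0"
      unfolding integral_mult_right_zero integral_of_real by (simp add: mean)
    have eB: "(CLINT w|M. of_real ((t * \<eta> w)\<^sup>2 / 2)) = complex_of_real (t\<^sup>2 * v / 2)"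
    proof -
      have "expectation (\<lambda>w. (t * \<eta> w)\<^sup>2 / 2) = t\<^sup>2 * v / 2" unfolding power_mult_distrib v_def by simp
      moreover have "(CLINT w|M. of_real ((t * \<eta> w)\<^sup>2 / 2)) = complex_of_real (expectation (\<lambda>w. (t * \<eta> w)\<^sup>2 / 2))"
        by (rule integral_of_real[OF intB])
      ultimately show ?thesis by (simp only:)
    qed
    have eC: "(CLINT w|M. 1 + \<i> * of_real (t * \<eta> w)) = 1"
      by (subst Bochner_Integration.integral_add[OF _ intA']) (simp_all only: eA, simp_all add: prob_space)
    have intQ_eq: "(CLINT w|M. 1 + \<i> * of_real (t * \<eta> w) - of_real ((t * \<eta> w)\<^sup>2 / 2)) = of_real (\<psi> n)"
      unfolding Bochner_Integration.integral_diff[OF intC intB'] eB eC by (simp add: \<psi>_def t(2))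
    have "norm (\<phi> n) \<le> expectation (\<lambda>w. norm (iexp (t * \<eta> w)))"
      unfolding \<phi>_def t_def[symmetric] by (rule integral_norm_bound)
    then have 1: "norm (\<phi> n) \<le> 1" by (simp add: prob_space)
    \<comment> \<open>Here \<open>n \<ge> v\<close> enters: it places \<open>1 - v / (2 * n)\<close>
      between \<open>1 / 2\<close> and \<open>1\<close>. The comparison of powers needs both bases
      in the unit disc.\<close>
    have 2: "norm (of_real (\<psi> n) :: complex) \<le> 1"
      unfolding norm_of_real \<psi>_def using v n by (auto simp: field_simps abs_le_iff)
    have "norm (\<phi> n ^ n - of_real (\<psi> n) ^ n) \<le> real n * norm (\<phi> n - of_real (\<psi> n))"
      by (rule norm_power_diff[OF 1 2])
    also have "\<phi> n - of_real (\<psi> n) = (CLINT w|M. iexp (t * \<eta> w) - (1 + \<i> * of_real (t * \<eta> w) - of_real ((t * \<eta> w)\<^sup>2 / 2)))"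
      using Bochner_Integration.integral_diff[OF intI intQ] intQ_eq by (simp only: \<phi>_def t_def[symmetric])
    also have "norm \<dots> \<le> expectation (\<lambda>w. norm (iexp (t * \<eta> w) - (1 + \<i> * of_real (t * \<eta> w) - of_real ((t * \<eta> w)\<^sup>2 / 2))))"
      by (rule integral_norm_bound)
    also have "\<dots> \<le> expectation (\<lambda>w. (t * b) ^ 3 / 6)"
    proof (rule integral_mono)
      show "integrable M (\<lambda>w. norm (iexp (t * \<eta> w) - (1 + \<i> * of_real (t * \<eta> w) - of_real ((t * \<eta> w)\<^sup>2 / 2))))"
        by (intro integrable_norm Bochner_Integration.integrable_diff intI intQ)
      fix w assume w: "w \<in> space M"
      have "norm (iexp (t * \<eta> w) - (1 + \<i> * of_real (t * \<eta> w) - of_real ((t * \<eta> w)\<^sup>2 / 2))) \<le> \<bar>t * \<eta> w\<bar> ^ 3 / 6"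
      proof -
        have "norm (iexp x - (1 + \<i> * of_real x - of_real (x\<^sup>2 / 2))) \<le> \<bar>x\<bar> ^ 3 / 6" for x
          using iexp_approx1[of x 2] by (simp add: numeral_eq_Suc power_mult_distrib algebra_simps)
        then show ?thesis .
      qed
      also have "\<dots> \<le> (t * b) ^ 3 / 6"
        using b[OF w] t(1) by (intro divide_right_mono power_mono) (auto simp: abs_mult)
      finally show "norm (iexp (t * \<eta> w) - (1 + \<i> * of_real (t * \<eta> w) - of_real ((t * \<eta> w)\<^sup>2 / 2))) \<le> (t * b) ^ 3 / 6" .
    qed auto
    also have "real n * expectation (\<lambda>w. (t * b) ^ 3 / 6) = b ^ 3 / 6 * t"
      using t(3) by (simp add: prob_space power_mult_distrib)
    finally show ?thesis using n by (simp add: t_def mult_left_mono)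
  qed
  have "(\<lambda>n. \<phi> n ^ n - of_real (\<psi> n) ^ n) \<longlonglongrightarrow> 0"
  proof (rule Lim_null_comparison)
    obtain n0 where n0: "v \<le> real n0" using real_arch_simple by blast
    show "\<forall>\<^sub>F n in sequentially. norm (\<phi> n ^ n - of_real (\<psi> n) ^ n) \<le> b ^ 3 / 6 * real n powr (-1/2)"
      using eventually_ge_at_top[of "max 1 n0"] by eventually_elim (rule main, use n0 in auto)
    have "(\<lambda>n. real n powr (-1/2)) \<longlonglongrightarrow> 0"
      by (rule tendsto_neg_powr) (auto intro: filterlim_real_sequentially)
    then show "(\<lambda>n. b ^ 3 / 6 * real n powr (-1/2)) \<longlonglongrightarrow> 0" by (rule tendsto_mult_right_zero)
  qed
  moreover have "(\<lambda>n. (of_real (\<psi> n) :: complex) ^ n) \<longlonglongrightarrow> of_real (exp (- v / 2))"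
    unfolding of_real_power[symmetric] \<psi>_def by (intro tendsto_of_real tendsto_exp_limit_sequentially)
  ultimately have "(\<lambda>n. (\<phi> n ^ n - of_real (\<psi> n) ^ n) + of_real (\<psi> n) ^ n) \<longlonglongrightarrow> 0 + of_real (exp (- v / 2))"
    by (rule tendsto_add)
  then show ?thesis unfolding \<phi>_def v_def by simp
qed

subsection \<open>Sums of independent identically distributed kernels\<close>

definition unif :: "real measure" where "unif = uniform_measure lborel {0..1}"

definition unif2 :: "(real \<times> real) measure" where "unif2 = unif \<Otimes>\<^sub>M unif"

text \<open>Rows and columns are kept as two vectors, in the shape of the given families, so that a
  permutation can act on the columns alone. The \<open>i\<close>-th random point of the square is
  \<open>(fst z i, snd z i)\<close>.\<close>

definition sample :: "nat \<Rightarrow> ((nat \<Rightarrow> real) \<times> (nat \<Rightarrow> real)) measure" where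
  "sample n = Pi\<^sub>M {1..n} (\<lambda>_. unif) \<Otimes>\<^sub>M Pi\<^sub>M {1..n} (\<lambda>_. unif)"

lemma sets_unif [simp, measurable_cong]: "sets unif = sets borel"
  by (simp add: unif_def)

lemma space_unif [simp]: "space unif = UNIV"
  by (simp add: unif_def)

lemma prob_space_unif: "prob_space unif"
  unfolding unif_def by (rule prob_space_uniform_measure) auto

lemma sets_unif2 [simp, measurable_cong]: "sets unif2 = sets borel"
  unfolding unif2_def borel_prod[symmetric] by (rule sets_pair_measure_cong) auto

lemma space_unif2 [simp]: "space unif2 = UNIV"
  by (simp add: unif2_def space_pair_measure)

lemma prob_space_unif2: "prob_space unif2"
  unfolding unif2_def by (intro prob_space_pair prob_space_unif)

lemma sets_sample [measurable_cong]:
  "sets (sample n) = sets (Pi\<^sub>M {1..n} (\<lambda>_. borel) \<Otimes>\<^sub>M Pi\<^sub>M {1..n} (\<lambda>_. borel))"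
  unfolding sample_def by (intro sets_pair_measure_cong sets_PiM_cong) auto

lemma prob_space_sample: "prob_space (sample n)"
  unfolding sample_def by (intro prob_space_pair prob_space_PiM prob_space_unif)

interpretation unif: prob_space unif by (rule prob_space_unif)
interpretation unif2: prob_space unif2 by (rule prob_space_unif2)
interpretation sample: prob_space "sample n" for n by (rule prob_space_sample)

lemma measurable_sample_coordinate [measurable]:
  assumes "i \<in> {1..n}"
  shows "(\<lambda>z. fst z i) \<in> borel_measurable (sample n)" "(\<lambda>z. snd z i) \<in> borel_measurable (sample n)"
  using assms by measurable

lemma measurable_sample_pair:
  assumes "i \<in> {1..n}"
  shows "(\<lambda>z. (fst z i, snd z i)) \<in> sample n \<rightarrow>\<^sub>M borel"
  unfolding borel_prod[symmetric] using measurable_sample_coordinate[OF assms] by (rule measurable_Pair)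

text \<open>Fubini, applied to the two vectors and then to each coordinate, regroups two products of
  \<open>n\<close> intervals into \<open>n\<close> squares. The independence of the \<open>n\<close>
  points is used below only through this formula, with exponentials, characters and indicators as
  factors.\<close>

lemma integral_sample_prod:
  fixes h :: "nat \<Rightarrow> real \<times> real \<Rightarrow> 'b::{real_normed_field, banach, second_countable_topology}"
  assumes h: "\<And>i. h i \<in> borel_measurable borel" and b: "\<And>i x. norm (h i x) \<le> b"
  shows "(\<integral>z. (\<Prod>i\<in>{1..n}. h i (fst z i, snd z i)) \<partial>sample n) = (\<Prod>i\<in>{1..n}. \<integral>x. h i x \<partial>unif2)"
    and "integrable (sample n) (\<lambda>z. \<Prod>i\<in>{1..n}. h i (fst z i, snd z i))"
proof -
  let ?P = "Pi\<^sub>M {1..n} (\<lambda>_. unif)"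
  interpret P: prob_space ?P by (intro prob_space_PiM prob_space_unif)
  interpret PP: pair_sigma_finite ?P ?P ..
  interpret UU: pair_sigma_finite unif unif ..
  interpret pr: product_sigma_finite "\<lambda>_::nat. unif" ..
  have h': "h i \<in> borel_measurable (unif \<Otimes>\<^sub>M unif)" for i
    using h[of i] by (simp add: measurable_cong_sets[OF sets_unif2[unfolded unif2_def] refl])
  have int_h: "integrable unif2 (h i)" for i
    using h b by (intro unif2.integrable_const_bound[of _ b]) (auto simp: measurable_cong_sets[OF sets_unif2 refl])
  have int_1: "integrable unif (\<lambda>y. h i (x, y))" for i x
    using b by (intro unif.integrable_const_bound[of _ b] measurable_compose[OF measurable_Pair1' h']) auto
  show int: "integrable (sample n) (\<lambda>z. \<Prod>i\<in>{1..n}. h i (fst z i, snd z i))"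
  proof (rule sample.integrable_const_bound[of _ "b ^ n"])
    show "AE z in sample n. norm (\<Prod>i\<in>{1..n}. h i (fst z i, snd z i)) \<le> b ^ n"
    proof (rule AE_I2)
      fix z
      have "norm (\<Prod>i\<in>{1..n}. h i (fst z i, snd z i)) \<le> (\<Prod>i\<in>{1..n}. b)"
        unfolding prod_norm[symmetric] by (rule prod_mono) (use b in auto)
      then show "norm (\<Prod>i\<in>{1..n}. h i (fst z i, snd z i)) \<le> b ^ n" by simp
    qed
    show "(\<lambda>z. \<Prod>i\<in>{1..n}. h i (fst z i, snd z i)) \<in> borel_measurable (sample n)"
      by (intro borel_measurable_prod measurable_compose[OF measurable_sample_pair h])
  qed
  have "(\<integral>z. (\<Prod>i\<in>{1..n}. h i (fst z i, snd z i)) \<partial>sample n) =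
      (\<integral>r. (\<integral>c. (\<Prod>i\<in>{1..n}. h i (r i, c i)) \<partial>?P) \<partial>?P)"
    using PP.integral_fst'[OF int[unfolded sample_def]] by (simp add: sample_def)
  also have "\<dots> = (\<integral>r. (\<Prod>i\<in>{1..n}. \<integral>y. h i (r i, y) \<partial>unif) \<partial>?P)"
    by (intro Bochner_Integration.integral_cong refl pr.product_integral_prod int_1) auto
  also have "\<dots> = (\<Prod>i\<in>{1..n}. \<integral>x. \<integral>y. h i (x, y) \<partial>unif \<partial>unif)"
    using UU.integrable_fst'[OF int_h[unfolded unif2_def]] by (intro pr.product_integral_prod) auto
  also have "\<dots> = (\<Prod>i\<in>{1..n}. \<integral>x. h i x \<partial>unif2)"
    using UU.integral_fst'[OF int_h[unfolded unif2_def]] by (simp add: unif2_def)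
  finally show "(\<integral>z. (\<Prod>i\<in>{1..n}. h i (fst z i, snd z i)) \<partial>sample n) = (\<Prod>i\<in>{1..n}. \<integral>x. h i x \<partial>unif2)" .
qed

text \<open>The product formula with all other factors equal to \<open>1\<close>.\<close>

lemma integral_sample_coordinate:
  fixes h :: "real \<times> real \<Rightarrow> real"
  assumes h: "h \<in> borel_measurable borel" and b: "\<And>x. \<bar>h x\<bar> \<le> b" and i: "i \<in> {1..n}"
  shows "(\<integral>z. h (fst z i, snd z i) \<partial>sample n) = (\<integral>x. h x \<partial>unif2)"
proof -
  let ?h = "\<lambda>j. if j = i then h else (\<lambda>_. 1)"
  have P: "(\<Prod>j\<in>{1..n}. ?h j (fst z j, snd z j)) = h (fst z i, snd z i)" for z :: "(nat \<Rightarrow> real) \<times> (nat \<Rightarrow> real)"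
  proof -
    have "(\<Prod>j\<in>{1..n}. ?h j (fst z j, snd z j)) = (\<Prod>j\<in>{1..n}. if j = i then h (fst z i, snd z i) else 1)"
      by (rule prod.cong) auto
    then show ?thesis using i by simp
  qed
  have "(\<Prod>j\<in>{1..n}. \<integral>x. ?h j x \<partial>unif2) = (\<Prod>j\<in>{1..n}. if j = i then (\<integral>x. h x \<partial>unif2) else 1)"
    using unif2.prob_space by (intro prod.cong) (auto)
  also have "\<dots> = (\<integral>x. h x \<partial>unif2)" using i by simp
  finally have 1: "(\<Prod>j\<in>{1..n}. \<integral>x. ?h j x \<partial>unif2) = (\<integral>x. h x \<partial>unif2)" .
  have "(\<integral>z. (\<Prod>j\<in>{1..n}. ?h j (fst z j, snd z j)) \<partial>sample n) = (\<Prod>j\<in>{1..n}. \<integral>x. ?h j x \<partial>unif2)"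
  proof (rule integral_sample_prod(1)[where b="max b 1"])
    show "?h j \<in> borel_measurable borel" for j using h by simp
    show "norm (?h j x) \<le> max b 1" for j x using b[of x] by auto
  qed
  then show ?thesis unfolding P 1 .
qed

text \<open>Chernoff bound with the parameter \<open>l / sqrt n\<close>, using \<open>exp x \<le> 1 + x + x\<^sup>2\<close> for \<open>\<bar>x\<bar> \<le> 1\<close>.\<close>

lemma sample_sum_tail:
  fixes \<eta> :: "real \<times> real \<Rightarrow> real"
  assumes m: "\<eta> \<in> borel_measurable borel" and b: "\<And>x. \<bar>\<eta> x\<bar> \<le> b"
    and mean: "(\<integral>x. \<eta> x \<partial>unif2) = 0" and var: "(\<integral>x. (\<eta> x)\<^sup>2 \<partial>unif2) \<le> v"
    and l: "l > 0" "l * b \<le> sqrt (real n)" and n: "n > 0"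
  shows "measure (sample n) {z \<in> space (sample n). \<bar>real n powr (-1/2) * (\<Sum>i=1..n. \<eta> (fst z i, snd z i))\<bar> \<ge> a} \<le>
    2 * exp (l\<^sup>2 * v - l * a)"
proof -
  define S where "S z = real n powr (-1/2) * (\<Sum>i=1..n. \<eta> (fst z i, snd z i))" for z
  have S_meas: "S \<in> borel_measurable (sample n)"
    unfolding S_def by (intro borel_measurable_times borel_measurable_const borel_measurable_sum
        measurable_compose[OF measurable_sample_pair m])
  have powr: "real n powr (-1/2) = 1 / sqrt (real n)"
    using n by (simp add: powr_minus_divide powr_half_sqrt)
  have one_sided: "measure (sample n) {z \<in> space (sample n). e * S z \<ge> a} \<le> exp (l\<^sup>2 * v - l * a)"
    if e: "\<bar>e\<bar> = 1" for e
  proof -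
    \<comment> \<open>The sign \<open>e\<close> handles both tails at once, and \<open>u\<close> is
      the exponent that each summand receives after normalization.\<close>
    define u where "u = l * e / sqrt (real n)"
    have u2: "u\<^sup>2 = l\<^sup>2 / real n" using e n by (simp add: u_def power_mult_distrib power_divide abs_square_eq_1)
    have ub: "\<bar>u * \<eta> x\<bar> \<le> 1" for x
    proof -
      have "\<bar>u * \<eta> x\<bar> = l * \<bar>\<eta> x\<bar> / sqrt (real n)" using e l(1) by (simp add: u_def abs_mult)
      also have "\<dots> \<le> l * b / sqrt (real n)" using b[of x] l(1) by (intro divide_right_mono mult_left_mono) auto
      also have "\<dots> \<le> 1" using l(2) n by simp
      finally show ?thesis .
    qed
    have int1: "integrable unif2 \<eta>"
      using m b by (intro unif2.integrable_const_bound[of _ b]) (auto simp: measurable_cong_sets[OF sets_unif2 refl])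
    have b0: "b \<ge> 0" using b[of undefined] by linarith
    have int2: "integrable unif2 (\<lambda>x. (\<eta> x)\<^sup>2)"
      using m b b0 by (intro unif2.integrable_const_bound[of _ "b\<^sup>2"])
        (auto simp: measurable_cong_sets[OF sets_unif2 refl] abs_le_square_iff[symmetric])
    have expb: "\<bar>exp (u * \<eta> x)\<bar> \<le> exp 1" for x using ub[of x] by simp
    have expm: "(\<lambda>x. exp (u * \<eta> x)) \<in> borel_measurable borel" using m by measurable
    have "(\<integral>x. exp (u * \<eta> x) \<partial>unif2) \<le> (\<integral>x. 1 + u * \<eta> x + u\<^sup>2 * (\<eta> x)\<^sup>2 \<partial>unif2)"
    proof (rule integral_mono)
      show "integrable unif2 (\<lambda>x. exp (u * \<eta> x))"
        using expb expm by (intro unif2.integrable_const_bound[of _ "exp 1"]) (auto simp: measurable_cong_sets[OF sets_unif2 refl])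
      show "integrable unif2 (\<lambda>x. 1 + u * \<eta> x + u\<^sup>2 * (\<eta> x)\<^sup>2)" using int1 int2 by auto
      fix x
      have "exp y \<le> 1 + y + y\<^sup>2" if "\<bar>y\<bar> \<le> 1" for y :: real
      proof (cases "y \<ge> 0")
        case True
        then show ?thesis using exp_bound[of y] that by simp
      next
        case False
        \<comment> \<open>For negative \<open>y\<close> the upper bound is the reciprocal of the
          quadratic lower bound for \<open>exp (- y)\<close>.\<close>
        have "exp y = 1 / exp (- y)" by (simp add: exp_minus inverse_eq_divide)
        also have "\<dots> \<le> 1 / (1 - y + y\<^sup>2 / 2)"
          using exp_lower_Taylor_quadratic[of "- y"] False by (intro divide_left_mono) (auto intro!: mult_pos_pos add_pos_nonneg)
        also have "\<dots> \<le> 1 + y + y\<^sup>2"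
        proof -
          have p: "1 - y + y\<^sup>2 / 2 > 0" using False by (intro add_pos_nonneg) auto
          have "(1 + y + y\<^sup>2) * (1 - y + y\<^sup>2 / 2) - 1 = y\<^sup>2 * (1 / 2 - y / 2 + y\<^sup>2 / 2)"
            by (simp add: power2_eq_square field_simps)
          also have "\<dots> \<ge> 0" using False by (intro mult_nonneg_nonneg add_nonneg_nonneg) auto
          finally show ?thesis using p by (simp add: pos_divide_le_eq)
        qed
        finally show ?thesis .
      qed
      from this[OF ub[of x]] show "exp (u * \<eta> x) \<le> 1 + u * \<eta> x + u\<^sup>2 * (\<eta> x)\<^sup>2"
        by (simp add: power_mult_distrib)
    qed
    also have "\<dots> = 1 + u\<^sup>2 * (\<integral>x. (\<eta> x)\<^sup>2 \<partial>unif2)" using int1 int2 mean unif2.prob_space by simp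
    also have "\<dots> \<le> 1 + u\<^sup>2 * v" using var by (intro add_left_mono mult_left_mono) auto
    also have "\<dots> \<le> exp (u\<^sup>2 * v)" by (rule exp_ge_add_one_self)
    finally have E1: "(\<integral>x. exp (u * \<eta> x) \<partial>unif2) \<le> exp (u\<^sup>2 * v)" .
    have prod: "exp (l * (e * S z)) = (\<Prod>i\<in>{1..n}. exp (u * \<eta> (fst z i, snd z i)))" for z
      unfolding exp_sum[OF finite_atLeastAtMost, symmetric] S_def powr u_def by (simp add: sum_distrib_left mult.assoc)
    have intE: "integrable (sample n) (\<lambda>z. exp (l * (e * S z)))"
      unfolding prod using expb expm by (intro integral_sample_prod(2)[where b="exp 1"]) auto
    have "(\<integral>z. exp (l * (e * S z)) \<partial>sample n) = (\<Prod>i\<in>{1..n}. \<integral>x. exp (u * \<eta> x) \<partial>unif2)"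
      unfolding prod using expb expm by (intro integral_sample_prod(1)[where b="exp 1"]) auto
    also have "\<dots> \<le> (\<Prod>i\<in>{1..n}. exp (u\<^sup>2 * v))"
      by (intro prod_mono conjI E1 Bochner_Integration.integral_nonneg) auto
    also have "\<dots> = exp (l\<^sup>2 * v)"
      using n by (simp add: exp_of_nat_mult[symmetric] u2)
    finally have E2: "(\<integral>z. exp (l * (e * S z)) \<partial>sample n) \<le> exp (l\<^sup>2 * v)" .
    have "measure (sample n) {z \<in> space (sample n). e * S z \<ge> a} =
        measure (sample n) {z \<in> space (sample n). exp (l * (e * S z)) \<ge> exp (l * a)}"
      using l(1) by (intro arg_cong[where f="measure _"]) auto
    also have "\<dots> \<le> (\<integral>z. exp (l * (e * S z)) \<partial>sample n) / exp (l * a)"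
      by (rule integral_Markov_inequality_measure[OF intE sets.top]) auto
    also have "\<dots> \<le> exp (l\<^sup>2 * v) / exp (l * a)" using E2 by (intro divide_right_mono) auto
    finally show ?thesis by (simp add: exp_diff)
  qed
  have "measure (sample n) {z \<in> space (sample n). \<bar>S z\<bar> \<ge> a} \<le>
      measure (sample n) ({z \<in> space (sample n). 1 * S z \<ge> a} \<union> {z \<in> space (sample n). - 1 * S z \<ge> a})"
    using S_meas by (intro sample.finite_measure_mono sets.Un) auto
  also have "\<dots> \<le> measure (sample n) {z \<in> space (sample n). 1 * S z \<ge> a} + measure (sample n) {z \<in> space (sample n). - 1 * S z \<ge> a}"
    using S_meas by (intro measure_Un_le) auto
  also have "\<dots> \<le> exp (l\<^sup>2 * v - l * a) + exp (l\<^sup>2 * v - l * a)"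
    by (intro add_mono one_sided) auto
  finally show ?thesis unfolding S_def by simp
qed

lemma measure_unif_interval:
  assumes "0 \<le> a" "a \<le> b" "b \<le> 1" shows "measure unif {a<..b} = b - a" 
proof -
  have "{0..1} \<inter> {a<..b} = {a<..b}" using assms by auto
  then show ?thesis using assms by (simp add: unif_def measure_uniform_measure)
qed

text \<open>Chernoff bound with the parameter \<open>1\<close>.\<close>

lemma sample_count_tail:
  assumes A: "A \<in> sets borel" and v: "measure unif2 A \<le> v"
  shows "measure (sample n) {z \<in> space (sample n). (\<Sum>i=1..n. indicator A (fst z i, snd z i)) \<ge> a} \<le> exp (2 * real n * v - a)"
proof -
  have m: "(\<lambda>x. exp (indicator A x) :: real) \<in> borel_measurable borel"
    by (rule measurable_compose[OF borel_measurable_indicator[OF A] borel_measurable_exp])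
  have b: "\<bar>exp (indicator A x) :: real\<bar> \<le> exp 1" for x :: "real \<times> real" by (auto simp: indicator_def)
  have prod: "exp (\<Sum>i=1..n. indicator A (fst z i, snd z i) :: real) = (\<Prod>i\<in>{1..n}. exp (indicator A (fst z i, snd z i)))"
    for z :: "(nat \<Rightarrow> real) \<times> (nat \<Rightarrow> real)"
    by (simp add: exp_sum)
  have intE: "integrable (sample n) (\<lambda>z. exp (\<Sum>i=1..n. indicator A (fst z i, snd z i)) :: real)"
    unfolding prod using b m by (intro integral_sample_prod(2)[where b="exp 1"]) auto
  have A': "A \<in> sets unif2" using A by simp
  have "(\<integral>x. exp (indicator A x :: real) \<partial>unif2) = (\<integral>x. 1 + (exp 1 - 1) * indicator A x \<partial>unif2)"
    by (intro Bochner_Integration.integral_cong) (auto simp: indicator_def)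
  also have "\<dots> = 1 + (exp 1 - 1) * measure unif2 A"
    using A' unif2.prob_space
    by (subst Bochner_Integration.integral_add) (auto simp: unif2.emeasure_eq_measure)
  also have "\<dots> \<le> 1 + 2 * v"
  proof -
    \<comment> \<open>This is the origin of the factor \<open>2\<close> in the exponent of the
      bound.\<close>
    have "exp (1::real) - 1 \<le> 2" using exp_le by simp
    then have "(exp 1 - 1) * measure unif2 A \<le> 2 * v" using v by (intro mult_mono) auto
    then show ?thesis by simp
  qed
  also have "\<dots> \<le> exp (2 * v)" by (rule exp_ge_add_one_self)
  finally have E1: "(\<integral>x. exp (indicator A x :: real) \<partial>unif2) \<le> exp (2 * v)" .
  have "(\<integral>z. exp (\<Sum>i=1..n. indicator A (fst z i, snd z i) :: real) \<partial>sample n) = (\<Prod>i\<in>{1..n}. \<integral>x. exp (indicator A x) \<partial>unif2)"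
    unfolding prod using b m by (intro integral_sample_prod(1)[where b="exp 1"]) auto
  also have "\<dots> \<le> (\<Prod>i\<in>{1..n}. exp (2 * v))"
    by (intro prod_mono conjI E1 Bochner_Integration.integral_nonneg) auto
  also have "\<dots> = exp (2 * real n * v)" by (simp add: exp_of_nat_mult[symmetric] ac_simps)
  finally have E2: "(\<integral>z. exp (\<Sum>i=1..n. indicator A (fst z i, snd z i) :: real) \<partial>sample n) \<le> exp (2 * real n * v)" .
  have "measure (sample n) {z \<in> space (sample n). (\<Sum>i=1..n. indicator A (fst z i, snd z i)) \<ge> a} =
      measure (sample n) {z \<in> space (sample n). exp (\<Sum>i=1..n. indicator A (fst z i, snd z i)) \<ge> exp a}"
    by simp
  also have "\<dots> \<le> (\<integral>z. exp (\<Sum>i=1..n. indicator A (fst z i, snd z i) :: real) \<partial>sample n) / exp a"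
    by (rule integral_Markov_inequality_measure[OF intE sets.top]) auto
  also have "\<dots> \<le> exp (2 * real n * v) / exp a" using E2 by (intro divide_right_mono) auto
  finally show ?thesis by (simp add: exp_diff)
qed

section \<open>Kernel fields: common properties and measurability\<close>

text \<open>A sample point enters only through its two comparisons with \<open>p\<close>. This one
  shape covers the summands of both processes with random locations.\<close>

definition kern :: "(bool \<Rightarrow> bool \<Rightarrow> real \<Rightarrow> real \<Rightarrow> real) \<Rightarrow> real \<times> real \<Rightarrow> real \<times> real \<Rightarrow> real" where
  "kern g x p = g (fst x \<le> fst p) (snd x \<le> snd p) (fst p) (snd p)"

definition field :: "(bool \<Rightarrow> bool \<Rightarrow> real \<Rightarrow> real \<Rightarrow> real) \<Rightarrow> nat \<Rightarrow> (nat \<Rightarrow> real) \<times> (nat \<Rightarrow> real) \<Rightarrow> real \<times> real \<Rightarrow> real" where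
  "field g n z p = real n powr (-1/2) * (\<Sum>i=1..n. kern g (fst z i, snd z i) p)"

lemma kern_measurable: "(\<lambda>x. kern g x p) \<in> borel_measurable borel"
proof -
  have "(\<lambda>x. kern g x p) = (\<lambda>x. if fst x \<le> fst p then (if snd x \<le> snd p then g True True (fst p) (snd p) else g True False (fst p) (snd p))
      else (if snd x \<le> snd p then g False True (fst p) (snd p) else g False False (fst p) (snd p)))"
    by (auto simp: kern_def fun_eq_iff)
  also have "\<dots> \<in> borel_measurable (borel \<Otimes>\<^sub>M borel)" by measurable
  finally show ?thesis by (simp add: borel_prod)
qed

lemma powr_minus_half_le_one: "real n powr (-1/2) \<le> 1"
  by (cases n) (auto simp: powr_minus_divide ge_one_powr_ge_zero divide_le_eq_1)

text \<open>The shared input of both limit theorems: \<open>lip\<close> and \<open>jump\<close>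
  control increments, \<open>bound\<close> allows exponential moments, \<open>mean\<close> and
  \<open>cov\<close> identify the Gaussian limit.\<close>

locale bridge_kernel =
  fixes g :: "bool \<Rightarrow> bool \<Rightarrow> real \<Rightarrow> real \<Rightarrow> real" and \<Gamma> :: "real \<times> real \<Rightarrow> real \<times> real \<Rightarrow> real"
  assumes lip: "\<lbrakk>s \<in> {0..1}; t \<in> {0..1}; s' \<in> {0..1}; t' \<in> {0..1}\<rbrakk> \<Longrightarrow>
      \<bar>g a b s t - g a b s' t'\<bar> \<le> \<bar>s - s'\<bar> + \<bar>t - t'\<bar>"
    and jump: "\<lbrakk>s \<in> {0..1}; t \<in> {0..1}\<rbrakk> \<Longrightarrow> \<bar>g a b s t - g a' b' s t\<bar> \<le> of_bool (a \<noteq> a') + of_bool (b \<noteq> b')"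
    and bound: "\<lbrakk>s \<in> {0..1}; t \<in> {0..1}\<rbrakk> \<Longrightarrow> \<bar>g a b s t\<bar> \<le> 1"
    and mean: "p \<in> unit_square \<Longrightarrow> (\<integral>x. kern g x p \<partial>unif2) = 0"
    and cov: "p \<in> unit_square \<Longrightarrow> q \<in> unit_square \<Longrightarrow> (\<integral>x. kern g x p * kern g x q \<partial>unif2) = \<Gamma> p q"
begin

lemma kern_bound: "p \<in> unit_square \<Longrightarrow> \<bar>kern g x p\<bar> \<le> 1"
  unfolding kern_def by (rule bound) (auto simp: unit_square_def)

text \<open>Splitting by the four truth values of the comparisons leaves products of jump functions
  and continuous functions.\<close>

lemma quadrant_limits_kern: "quadrant_limits (kern g x)"
proof -
  have cont: "quadrant_limits (\<lambda>p. g a b (fst p) (snd p))" for a b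
  proof (rule quadrant_limits_continuous)
    show "continuous_on unit_square (\<lambda>p. g a b (fst p) (snd p))"
      unfolding continuous_on_def
    proof
      fix p assume p: "p \<in> unit_square"
      have "((\<lambda>q. g a b (fst q) (snd q) - g a b (fst p) (snd p)) \<longlongrightarrow> 0) (at p within unit_square)"
      proof (rule Lim_null_comparison)
        show "\<forall>\<^sub>F q in at p within unit_square. norm (g a b (fst q) (snd q) - g a b (fst p) (snd p)) \<le>
            \<bar>fst q - fst p\<bar> + \<bar>snd q - snd p\<bar>"
          unfolding eventually_at_filter using lip p by (auto simp: unit_square_def intro!: always_eventually)
        show "((\<lambda>q. \<bar>fst q - fst p\<bar> + \<bar>snd q - snd p\<bar>) \<longlongrightarrow> 0) (at p within unit_square)"
          by (auto intro!: tendsto_eq_intros)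
      qed
      then show "((\<lambda>p. g a b (fst p) (snd p)) \<longlongrightarrow> g a b (fst p) (snd p)) (at p within unit_square)"
        using LIM_zero_iff by blast
    qed
  qed
  let ?A = "\<lambda>p. of_bool (fst x \<le> fst p) :: real" and ?B = "\<lambda>p. of_bool (snd x \<le> snd p) :: real"
  have "kern g x = (\<lambda>p. ?A p * ?B p * g True True (fst p) (snd p) + ?A p * (1 - ?B p) * g True False (fst p) (snd p)
     + ((1 - ?A p) * ?B p * g False True (fst p) (snd p) + (1 - ?A p) * (1 - ?B p) * g False False (fst p) (snd p)))"
    by (auto simp: kern_def fun_eq_iff)
  then show ?thesis
    by (simp only:) (intro quadrant_limits_add quadrant_limits_mult quadrant_limits_diff quadrant_limits_const
        quadrant_limits_jump_fst quadrant_limits_jump_snd cont)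
qed

lemma quadrant_limits_field: "quadrant_limits (field g n z)"
  unfolding field_def by (intro quadrant_limits_mult quadrant_limits_const quadrant_limits_sum quadrant_limits_kern)

lemma field_path_in: "path_on_square (field g n z) \<in> skorokhod_space"
  by (rule path_on_square_in_skorokhod_space[OF quadrant_limits_field])

lemma field_cong: "(\<And>i. i \<in> {1..n} \<Longrightarrow> fst z i = fst z' i \<and> snd z i = snd z' i) \<Longrightarrow> field g n z = field g n z'"
  by (auto simp: field_def fun_eq_iff intro!: sum.cong)

lemma measurable_field_coordinate: "(\<lambda>z. field g n z p) \<in> borel_measurable (sample n)"
  unfolding field_def
  by (intro borel_measurable_times borel_measurable_const borel_measurable_sum
      measurable_compose[OF measurable_sample_pair kern_measurable])

definition round_sample :: "nat \<Rightarrow> (nat \<Rightarrow> real) \<times> (nat \<Rightarrow> real) \<Rightarrow> (nat \<Rightarrow> real) \<times> (nat \<Rightarrow> real)" where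
  "round_sample k z = (\<lambda>i. round_up k (fst z i), \<lambda>i. round_up k (snd z i))"

text \<open>The time changes carry every jump onto its rounded position, so only the Lipschitz
  dependence of the kernel on the location contributes to the difference.\<close>

lemma round_sample_tendsto:
  "(\<lambda>k. skorokhod_dist (path_on_square (field g n (round_sample k z))) (path_on_square (field g n z))) \<longlonglongrightarrow> 0"
proof (rule LIMSEQ_I)
  fix r :: real assume r: "r > 0"
  \<comment> \<open>As \<open>n\<close> is fixed here, a crude bound suffices: each of the
    \<open>n\<close> summands changes by at most \<open>2 * e\<close>, and the normalizing factor is
    bounded by \<open>1\<close>.\<close>
  define e where "e = r / (4 * (real n + 1))"
  have e: "e > 0" "e \<le> r / 2" "real n * (2 * e) \<le> r / 2" using r by (auto simp: e_def field_simps)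
  have fin: "finite {1..n}" by simp
  have "\<forall>\<^sub>F k in sequentially. skorokhod_dist (path_on_square (field g n (round_sample k z))) (path_on_square (field g n z)) \<le> r / 2"
    using time_change_round_up[OF e(1) fin, of "fst z"] time_change_round_up[OF e(1) fin, of "snd z"]
  proof eventually_elim
    case (elim k)
    obtain l where l: "l \<in> time_changes" "\<And>s. s \<in> {0..1} \<Longrightarrow> \<bar>l s - s\<bar> \<le> e"
      "\<And>i s. i \<in> {1..n} \<Longrightarrow> s \<in> {0..1} \<Longrightarrow> (fst z i \<le> s \<longleftrightarrow> round_up k (fst z i) \<le> l s)"
      using elim(1) by blast
    obtain m where m: "m \<in> time_changes" "\<And>s. s \<in> {0..1} \<Longrightarrow> \<bar>m s - s\<bar> \<le> e"
      "\<And>i s. i \<in> {1..n} \<Longrightarrow> s \<in> {0..1} \<Longrightarrow> (snd z i \<le> s \<longleftrightarrow> round_up k (snd z i) \<le> m s)"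
      using elim(2) by blast
    have "skorokhod_dist (path_on_square (field g n z)) (path_on_square (field g n (round_sample k z))) \<le> r / 2"
    proof (rule skorokhod_dist_le[OF field_path_in field_path_in l(1) m(1)])
      fix s t :: real assume st: "s \<in> {0..1}" "t \<in> {0..1}"
      note ls = time_change_range[OF l(1) st(1)] and mt = time_change_range[OF m(1) st(2)]
      have 1: "\<bar>kern g (fst z i, snd z i) (s, t) - kern g (round_up k (fst z i), round_up k (snd z i)) (l s, m t)\<bar> \<le> 2 * e"
        if i: "i \<in> {1..n}" for i
      proof -
        have "\<bar>kern g (fst z i, snd z i) (s, t) - kern g (round_up k (fst z i), round_up k (snd z i)) (l s, m t)\<bar> \<le> \<bar>s - l s\<bar> + \<bar>t - m t\<bar>"
          unfolding kern_def fst_conv snd_conv l(3)[OF i st(1), symmetric] m(3)[OF i st(2), symmetric]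
          by (rule lip[OF st ls mt])
        then show ?thesis using l(2)[OF st(1)] m(2)[OF st(2)] by linarith
      qed
      have "\<bar>field g n z (s, t) - field g n (round_sample k z) (l s, m t)\<bar> =
         real n powr (-1/2) * \<bar>\<Sum>i=1..n. kern g (fst z i, snd z i) (s, t) - kern g (round_up k (fst z i), round_up k (snd z i)) (l s, m t)\<bar>"
        by (simp add: field_def round_sample_def right_diff_distrib[symmetric] sum_subtractf abs_mult)
      also have "\<dots> \<le> 1 * (\<Sum>i=1..n. 2 * e)"
        using 1 by (intro mult_mono powr_minus_half_le_one order_trans[OF sum_abs] sum_mono) auto
      also have "\<dots> \<le> r / 2" using e(3) by simp
      finally show "\<bar>path_on_square (field g n z) (s, t) - path_on_square (field g n (round_sample k z)) (l s, m t)\<bar> \<le> r / 2"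
        using st ls mt by (simp add: path_on_square_def unit_square_def)
    qed (use l(2) m(2) e(2) in force)+
    then show ?case by (simp add: skorokhod.commute)
  qed
  then obtain k0 where "\<And>k. k \<ge> k0 \<Longrightarrow> skorokhod_dist (path_on_square (field g n (round_sample k z))) (path_on_square (field g n z)) \<le> r / 2"
    unfolding eventually_sequentially by blast
  note k0 = this
  have "norm (skorokhod_dist (path_on_square (field g n (round_sample k z))) (path_on_square (field g n z)) - 0) < r" if "k \<ge> k0" for k
    using k0[OF that] r skorokhod.nonneg[of "path_on_square (field g n (round_sample k z))" "path_on_square (field g n z)"]
    by simp
  then show "\<exists>no. \<forall>k\<ge>no. norm (skorokhod_dist (path_on_square (field g n (round_sample k z))) (path_on_square (field g n z)) - 0) < r"
    by blast
qed

end

lemma measurable_PiE_count_space: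
  fixes f :: "'i \<Rightarrow> 'a \<Rightarrow> 'b::countable"
  assumes I: "finite I" and f: "\<And>i. i \<in> I \<Longrightarrow> f i \<in> M \<rightarrow>\<^sub>M count_space UNIV"
  shows "(\<lambda>w. \<lambda>i\<in>I. f i w) \<in> M \<rightarrow>\<^sub>M count_space (PiE I (\<lambda>_. UNIV))"
proof (subst measurable_count_space_eq_countable)
  show "countable (PiE I (\<lambda>_. UNIV :: 'b set))" by (rule countable_PiE[OF I]) auto
  show "(\<lambda>w. \<lambda>i\<in>I. f i w) \<in> space M \<rightarrow> PiE I (\<lambda>_. UNIV) \<and>
     (\<forall>a\<in>PiE I (\<lambda>_. UNIV). (\<lambda>w. \<lambda>i\<in>I. f i w) -` {a} \<inter> space M \<in> sets M)"
  proof (intro conjI ballI)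
    fix a assume a: "a \<in> PiE I (\<lambda>_. UNIV :: 'b set)"
    have "(\<lambda>w. \<lambda>i\<in>I. f i w) -` {a} \<inter> space M = {w \<in> space M. \<forall>i\<in>I. f i w \<in> {a i}}"
      using a by (auto simp: fun_eq_iff PiE_def extensional_def)
    also have "\<dots> \<in> sets M"
    proof (rule sets.sets_Collect_finite_All[OF _ I])
      fix i assume i: "i \<in> I"
      have "{w \<in> space M. f i w \<in> {a i}} = f i -` {a i} \<inter> space M" by auto
      then show "{w \<in> space M. f i w \<in> {a i}} \<in> sets M" using measurable_sets[OF f[OF i], of "{a i}"] by simp
    qed
    finally show "(\<lambda>w. \<lambda>i\<in>I. f i w) -` {a} \<inter> space M \<in> sets M" .
  qed auto
qed

text \<open>A rounded sample is encoded by finitely many integers, and on a countable discrete space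
  every map into the Skorokhod space is measurable. Letting the lattice become finer transfers
  measurability to the field itself.\<close>

lemma (in bridge_kernel) measurable_field_path:
  "(\<lambda>z. path_on_square (field g n z)) \<in> sample n \<rightarrow>\<^sub>M borel_of_topology skorokhod_topology"
proof (rule skorokhod.measurable_mlimit)
  fix k
  define m where "m z = (\<lambda>i\<in>{1..n}. (\<lceil>real (Suc k) * fst z i\<rceil>, \<lceil>real (Suc k) * snd z i\<rceil>))"
    for z :: "(nat \<Rightarrow> real) \<times> (nat \<Rightarrow> real)"
  define h where "h c = path_on_square (field g n
      (\<lambda>i. of_int (fst (c i)) / real (Suc k), \<lambda>i. of_int (snd (c i)) / real (Suc k)))" for c :: "nat \<Rightarrow> int \<times> int"
  have "m \<in> sample n \<rightarrow>\<^sub>M count_space (PiE {1..n} (\<lambda>_. UNIV))"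
    unfolding m_def
  proof (rule measurable_PiE_count_space)
    fix i assume i: "i \<in> {1..n}"
    have c: "(\<lambda>y. \<lceil>real (Suc k) * y\<rceil>) \<in> borel \<rightarrow>\<^sub>M count_space UNIV" by measurable
    have "(\<lambda>z. (\<lceil>real (Suc k) * fst z i\<rceil>, \<lceil>real (Suc k) * snd z i\<rceil>)) \<in> sample n \<rightarrow>\<^sub>M count_space UNIV \<Otimes>\<^sub>M count_space UNIV"
      by (intro measurable_Pair measurable_compose[OF measurable_sample_coordinate(1)[OF i] c]
          measurable_compose[OF measurable_sample_coordinate(2)[OF i] c])
    then show "(\<lambda>z. (\<lceil>real (Suc k) * fst z i\<rceil>, \<lceil>real (Suc k) * snd z i\<rceil>)) \<in> sample n \<rightarrow>\<^sub>M count_space UNIV"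
      by (simp add: pair_measure_countable)
  qed auto
  then have "(\<lambda>z. h (m z)) \<in> sample n \<rightarrow>\<^sub>M borel_of_topology skorokhod_topology"
    by (rule measurable_compose) (auto simp: h_def field_path_in)
  moreover have "h (m z) = path_on_square (field g n (round_sample k z))" for z
    unfolding h_def m_def by (intro arg_cong[where f=path_on_square] field_cong) (auto simp: round_sample_def round_up_def)
  ultimately show "(\<lambda>z. path_on_square (field g n (round_sample k z))) \<in> sample n \<rightarrow>\<^sub>M borel_of_topology skorokhod_topology"
    by simp
next
  show "(\<lambda>k. skorokhod_dist (path_on_square (field g n (round_sample k z))) (path_on_square (field g n z))) \<longlonglongrightarrow> 0" for z
    by (rule round_sample_tendsto)
qed (rule field_path_in)

subsection \<open>The modulus of continuity\<close>

lemma measure_unif2_strips: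
  assumes "0 \<le> a" "a \<le> b" "b \<le> 1"
  shows "measure unif2 ({a<..b} \<times> UNIV) = b - a" "measure unif2 (UNIV \<times> {a<..b}) = b - a"
proof -
  have "emeasure unif2 ({a<..b} \<times> UNIV) = ennreal (b - a)" "emeasure unif2 (UNIV \<times> {a<..b}) = ennreal (b - a)"
    using unif.emeasure_pair_measure_Times[of "{a<..b}" unif UNIV] unif.emeasure_pair_measure_Times[of UNIV unif "{a<..b}"]
      unif.emeasure_space_1 measure_unif_interval[OF assms]
    by (simp_all add: unif2_def unif.emeasure_eq_measure)
  then show "measure unif2 ({a<..b} \<times> UNIV) = b - a" "measure unif2 (UNIV \<times> {a<..b}) = b - a"
    using assms by (simp_all add: measure_def)
qed

lemma measure_unif2_UNIV [simp]: "measure unif2 UNIV = 1"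
  using unif2.prob_space by simp

lemma integrable_unif2_indicator: "A \<in> sets borel \<Longrightarrow> integrable unif2 (indicator A :: _ \<Rightarrow> real)"
  by (intro integrable_real_indicator) (auto simp: unif2.emeasure_eq_measure)

definition strip_count :: "nat \<Rightarrow> (real \<times> real) set \<Rightarrow> (nat \<Rightarrow> real) \<times> (nat \<Rightarrow> real) \<Rightarrow> real" where
  "strip_count n A z = (\<Sum>i=1..n. indicator A (fst z i, snd z i))"

lemma measurable_strip_count: "A \<in> sets borel \<Longrightarrow> strip_count n A \<in> borel_measurable (sample n)"
  unfolding strip_count_def
  by (intro borel_measurable_sum measurable_compose[OF measurable_sample_pair borel_measurable_indicator])

lemma fst_strip_borel [simp]: "{a<..b::real} \<times> (UNIV :: real set) \<in> sets borel"
  unfolding borel_prod[symmetric] by (intro pair_measureI) auto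

lemma snd_strip_borel [simp]: "(UNIV :: real set) \<times> {a<..b::real} \<in> sets borel"
  unfolding borel_prod[symmetric] by (intro pair_measureI) auto

context bridge_kernel
begin

text \<open>A comparison changes between \<open>q\<close> and \<open>p\<close> only if the sample
  point lies in the strip between them; with the comparisons frozen, the remaining change is
  Lipschitz.\<close>

lemma kern_increment:
  assumes p: "p \<in> unit_square" and q: "q \<in> unit_square" and le: "fst q \<le> fst p" "snd q \<le> snd p"
  shows "\<bar>kern g x p - kern g x q\<bar> \<le> indicator ({fst q<..fst p} \<times> UNIV) x + (fst p - fst q) +
    (indicator (UNIV \<times> {snd q<..snd p}) x + (snd p - snd q))"
proof -
  obtain a b where x: "x = (a, b)" by (cases x)
  have p': "fst p \<in> {0..1}" "snd p \<in> {0..1}" and q': "fst q \<in> {0..1}" "snd q \<in> {0..1}"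
    using p q by (auto simp: unit_square_def)
  have "\<bar>g (a \<le> fst p) (b \<le> snd p) (fst p) (snd p) - g (a \<le> fst q) (b \<le> snd q) (fst p) (snd p)\<bar> \<le>
      of_bool ((a \<le> fst p) \<noteq> (a \<le> fst q)) + of_bool ((b \<le> snd p) \<noteq> (b \<le> snd q))"
    by (rule jump[OF p'])
  moreover have "\<bar>g (a \<le> fst q) (b \<le> snd q) (fst p) (snd p) - g (a \<le> fst q) (b \<le> snd q) (fst q) (snd q)\<bar> \<le>
      \<bar>fst p - fst q\<bar> + \<bar>snd p - snd q\<bar>"
    by (rule lip[OF p' q'])
  moreover have "of_bool ((a \<le> fst p) \<noteq> (a \<le> fst q)) = (indicator ({fst q<..fst p} \<times> UNIV) x :: real)"
    "of_bool ((b \<le> snd p) \<noteq> (b \<le> snd q)) = (indicator (UNIV \<times> {snd q<..snd p}) x :: real)"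
    using le by (auto simp: x indicator_def)
  ultimately show ?thesis using le by (simp add: kern_def x)
qed

lemma kern_integrable:
  assumes "p \<in> unit_square" shows "integrable unif2 (\<lambda>x. kern g x p)"
  using kern_bound[OF assms] kern_measurable
  by (intro unif2.integrable_const_bound[of _ 1]) (auto simp: measurable_cong_sets[OF sets_unif2 refl])

text \<open>A summand bounded by \<open>2\<close> has second moment at most twice its first absolute
  moment, and the latter is of order \<open>d\<close> by the strip bound. The condition
  \<open>n * d \<ge> 1\<close> is what makes the Chernoff parameter of order
  \<open>1 / sqrt d\<close> admissible.\<close>

lemma increment_tail:
  assumes p: "p \<in> unit_square" and q: "q \<in> unit_square" and le: "fst q \<le> fst p" "snd q \<le> snd p"
    and d: "fst p \<le> fst q + d" "snd p \<le> snd q + d" "d > 0" "real n * d \<ge> 1"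
  shows "measure (sample n) {z \<in> space (sample n). \<bar>field g n z p - field g n z q\<bar> \<ge> a} \<le> 2 * exp (1 - a / (4 * sqrt d))"
proof -
  define \<eta> where "\<eta> x = kern g x p - kern g x q" for x
  have n: "n > 0" using d by (cases n) auto
  have sq: "0 \<le> fst q" "fst p \<le> 1" "0 \<le> snd q" "snd p \<le> 1" using p q by (auto simp: unit_square_def)
  have m: "\<eta> \<in> borel_measurable borel" unfolding \<eta>_def by (intro borel_measurable_diff kern_measurable)
  have b: "\<bar>\<eta> x\<bar> \<le> 2" for x using kern_bound[OF p, of x] kern_bound[OF q, of x] unfolding \<eta>_def by linarith
  have mean0: "(\<integral>x. \<eta> x \<partial>unif2) = 0"
    unfolding \<eta>_def using kern_integrable[OF p] kern_integrable[OF q] mean[OF p] mean[OF q] by simp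
  have int\<eta>: "integrable unif2 (\<lambda>x. (\<eta> x)\<^sup>2)"
  proof (rule unif2.integrable_const_bound[of _ 4])
    show "AE x in unif2. norm ((\<eta> x)\<^sup>2) \<le> 4"
      using b abs_le_square_iff[of _ "2::real"] by auto
    show "(\<lambda>x. (\<eta> x)\<^sup>2) \<in> borel_measurable unif2" using m by (simp add: measurable_cong_sets[OF sets_unif2 refl])
  qed
  let ?h = "\<lambda>x. 2 * (indicator ({fst q<..fst p} \<times> UNIV) x + (fst p - fst q) +
      (indicator (UNIV \<times> {snd q<..snd p}) x + (snd p - snd q)))"
  have "(\<integral>x. (\<eta> x)\<^sup>2 \<partial>unif2) \<le> (\<integral>x. ?h x \<partial>unif2)"
  proof (rule integral_mono[OF int\<eta>])
    show "integrable unif2 ?h"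
      by (intro integrable_mult_right Bochner_Integration.integrable_add integrable_unif2_indicator unif2.integrable_const) auto
    fix x
    have "(\<eta> x)\<^sup>2 = \<bar>\<eta> x\<bar> * \<bar>\<eta> x\<bar>" by (simp add: power2_eq_square)
    also have "\<dots> \<le> 2 * \<bar>\<eta> x\<bar>" using b by (intro mult_right_mono) auto
    also have "\<dots> \<le> ?h x" using kern_increment[OF p q le, of x] unfolding \<eta>_def by (intro mult_left_mono) auto
    finally show "(\<eta> x)\<^sup>2 \<le> ?h x" .
  qed
  also have "\<dots> = 4 * (fst p - fst q) + 4 * (snd p - snd q)"
    using measure_unif2_strips(1)[of "fst q" "fst p"] measure_unif2_strips(2)[of "snd q" "snd p"] sq le
    by (simp add: integrable_unif2_indicator)
  \<comment> \<open>The bound \<open>8 * d\<close> is relaxed to \<open>16 * d\<close> so that the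
    square root in the next parameter is tidy.\<close>
  also have "\<dots> \<le> 16 * d"
  proof -
    have "fst p - fst q \<le> d" "snd p - snd q \<le> d" using d(1,2) by auto
    then show ?thesis using d(3) by auto
  qed
  finally have var: "(\<integral>x. (\<eta> x)\<^sup>2 \<partial>unif2) \<le> 16 * d" .
  \<comment> \<open>This choice turns the quadratic term \<open>l\<^sup>2 * (16 * d)\<close> of the
    exponent into \<open>1\<close>.\<close>
  define l where "l = 1 / (4 * sqrt d)"
  have "1 \<le> sqrt (real n * d)" using d(4) by simp
  then have "1 / sqrt d \<le> sqrt (real n)" using d(3) by (simp add: real_sqrt_mult field_simps)
  then have l: "l > 0" "l * 2 \<le> sqrt (real n)" using d(3) by (auto simp: l_def field_simps)
  have "measure (sample n) {z \<in> space (sample n). \<bar>real n powr (-1/2) * (\<Sum>i=1..n. \<eta> (fst z i, snd z i))\<bar> \<ge> a} \<le>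
      2 * exp (l\<^sup>2 * (16 * d) - l * a)"
    by (rule sample_sum_tail[OF m b mean0 var l n])
  moreover have "real n powr (-1/2) * (\<Sum>i=1..n. \<eta> (fst z i, snd z i)) = field g n z p - field g n z q" for z
    by (simp add: field_def \<eta>_def sum_subtractf right_diff_distrib)
  moreover have "l\<^sup>2 * (16 * d) - l * a = 1 - a / (4 * sqrt d)"
    using d(3) by (simp add: l_def power_divide power_mult_distrib)
  ultimately show ?thesis by simp
qed

section \<open>Dyadic chaining\<close>

definition dyadic_point :: "nat \<Rightarrow> nat \<Rightarrow> nat \<Rightarrow> real \<times> real" where
  "dyadic_point j a b = (real a / 2 ^ j, real b / 2 ^ j)"

text \<open>At mesh \<open>1 / 2 ^ j\<close> increments have standard deviation of order
  \<open>2 powr (- j / 2)\<close>. The larger threshold \<open>2 powr (- j / 4)\<close> is still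
  summable over the levels, while its tail probability beats the number of neighbouring
  pairs.\<close>

definition dyadic_bad :: "nat \<Rightarrow> nat \<Rightarrow> ((nat \<Rightarrow> real) \<times> (nat \<Rightarrow> real)) set" where
  "dyadic_bad n j = (\<Union>(a, b, a', b')\<in>{(a, b, a', b'). (a, b, a', b') \<in> {..2^j} \<times> {..2^j} \<times> {..2^j} \<times> {..2^j} \<and>
      a' \<le> a \<and> a \<le> a' + 1 \<and> b' \<le> b \<and> b \<le> b' + 1}.
     {z \<in> space (sample n). \<bar>field g n z (dyadic_point j a b) - field g n z (dyadic_point j a' b')\<bar> \<ge> 2 powr (- real j / 4)})"

text \<open>The first factor counts pairs of neighbours in the grid, and the second bounds the
  probability for one pair.\<close>

definition dyadic_rate :: "nat \<Rightarrow> real" where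
  "dyadic_rate j = 4 * (2 ^ j + 1)\<^sup>2 * (2 * exp (1 - 2 powr (real j / 4) / 4))"

lemma dyadic_point_in:
  assumes "a \<le> 2 ^ j" "b \<le> 2 ^ j" shows "dyadic_point j a b \<in> unit_square"
proof -
  have "real a \<le> real (2 ^ j)" "real b \<le> real (2 ^ j)" using assms by (simp_all only: of_nat_le_iff)
  then show ?thesis by (simp add: dyadic_point_def unit_square_def)
qed

lemma increment_event: "{z \<in> space (sample n). a \<le> \<bar>field g n z p - field g n z q\<bar>} \<in> sets (sample n)"
  by (intro borel_measurable_le borel_measurable_const borel_measurable_abs borel_measurable_diff
      measurable_field_coordinate)

lemma dyadic_bad_sets: "dyadic_bad n j \<in> sets (sample n)"
  unfolding dyadic_bad_def
proof (rule sets.finite_UN)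
  let ?I = "{(a, b, a', b'). (a, b, a', b') \<in> {..(2::nat)^j} \<times> {..(2::nat)^j} \<times> {..(2::nat)^j} \<times> {..(2::nat)^j} \<and>
      a' \<le> a \<and> a \<le> a' + 1 \<and> b' \<le> b \<and> b \<le> b' + 1}"
  show "finite ?I" by (rule finite_subset[of _ "{..(2::nat)^j} \<times> {..(2::nat)^j} \<times> {..(2::nat)^j} \<times> {..(2::nat)^j}"]) auto
  show "(case i of (a, b, a', b') \<Rightarrow>
      {z \<in> space (sample n). \<bar>field g n z (dyadic_point j a b) - field g n z (dyadic_point j a' b')\<bar> \<ge> 2 powr (- real j / 4)}) \<in> sets (sample n)"
    for i
    by (cases i) (simp add: increment_event)
qed

lemma measure_dyadic_bad:
  assumes "2 ^ j \<le> n" shows "measure (sample n) (dyadic_bad n j) \<le> dyadic_rate j"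
proof -
  define I :: "(nat \<times> nat \<times> nat \<times> nat) set" where "I = {(a, b, a', b'). (a, b, a', b') \<in> {..(2::nat)^j} \<times> {..(2::nat)^j} \<times> {..(2::nat)^j} \<times> {..(2::nat)^j} \<and>
      a' \<le> a \<and> a \<le> a' + 1 \<and> b' \<le> b \<and> b \<le> b' + 1}"
  define E where "E = (\<lambda>(a, b, a', b').
      {z \<in> space (sample n). \<bar>field g n z (dyadic_point j a b) - field g n z (dyadic_point j a' b')\<bar> \<ge> 2 powr (- real j / 4)})"
  \<comment> \<open>A pair is determined by its lower point and by two steps in
    \<open>{0, 1}\<close>; this yields the count \<open>4 * (2 ^ j + 1)\<^sup>2\<close>.\<close>
  have sub: "I \<subseteq> (\<lambda>((a', b'), (i, i')). (a' + i, b' + i', a', b')) ` (({..2^j} \<times> {..2^j}) \<times> ({..1} \<times> {..1}))"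
  proof
    fix x assume "x \<in> I"
    then obtain a b a' b' where x: "x = (a, b, a', b')" "a' \<le> 2^j" "b' \<le> 2^j" "a' \<le> a" "a \<le> a' + 1" "b' \<le> b" "b \<le> b' + 1"
      by (auto simp: I_def)
    then have "x = (\<lambda>((a', b'), (i, i')). (a' + i, b' + i', a', b')) ((a', b'), (a - a', b - b'))" by simp
    moreover have "((a', b'), (a - a', b - b')) \<in> (({..2^j} \<times> {..2^j}) \<times> ({..1} \<times> {..1}))" using x by auto
    ultimately show "x \<in> (\<lambda>((a', b'), (i, i')). (a' + i, b' + i', a', b')) ` (({..2^j} \<times> {..2^j}) \<times> ({..1} \<times> {..1}))"
      by (rule image_eqI)
  qed
  have fin: "finite I" by (rule finite_subset[OF sub]) auto
  have "card I \<le> card ((({..2^j} \<times> {..2^j}) \<times> ({..1} \<times> {..1})) :: ((nat \<times> nat) \<times> nat \<times> nat) set)"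
    by (rule surj_card_le[OF _ sub]) auto
  also have "\<dots> = 4 * (2 ^ j + 1)\<^sup>2" by (simp add: card_cartesian_product power2_eq_square)
  finally have "real (card I) \<le> real (4 * (2 ^ j + 1)\<^sup>2)" by (simp only: of_nat_le_iff)
  then have card: "real (card I) \<le> 4 * (2 ^ j + 1)\<^sup>2" by (simp add: add.commute)
  have E_sets: "E i \<in> sets (sample n)" for i
    unfolding E_def by (cases i) (simp add: increment_event)
  have rate: "(2 powr (- real j / 4)) / (4 * sqrt (1 / 2 ^ j)) = 2 powr (real j / 4) / 4"
  proof -
    have "(2 powr (- real j / 2))\<^sup>2 = 2 powr (- real j)"
      unfolding power2_eq_square powr_add[symmetric] by simp
    also have "\<dots> = 1 / 2 ^ j" by (simp add: powr_minus_divide powr_realpow)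
    finally have "sqrt (1 / 2 ^ j) = 2 powr (- real j / 2)" by (rule real_sqrt_unique) simp
    moreover have "2 powr (- real j / 4) / 2 powr (- real j / 2) = 2 powr (real j / 4)"
      by (simp add: powr_diff[symmetric])
    ultimately show ?thesis by (simp add: field_simps)
  qed
  have "measure (sample n) (E i) \<le> 2 * exp (1 - 2 powr (real j / 4) / 4)" if i: "i \<in> I" for i
  proof -
    obtain a b a' b' where x: "i = (a, b, a', b')" "a \<le> 2^j" "b \<le> 2^j" "a' \<le> 2^j" "b' \<le> 2^j" "a' \<le> a" "a \<le> a' + 1" "b' \<le> b" "b \<le> b' + 1"
      using i by (auto simp: I_def)
    have le: "real a / 2 ^ j \<le> real a' / 2 ^ j + 1 / 2 ^ j" if "a \<le> a' + 1" for a a' :: nat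
    proof -
      have "real a / 2 ^ j \<le> (real a' + 1) / 2 ^ j" using that by (intro divide_right_mono) auto
      then show ?thesis by (simp add: add_divide_distrib)
    qed
    have n1: "1 \<le> real n * (1 / 2 ^ j)"
    proof -
      have "real (2 ^ j) \<le> real n" using assms by (simp only: of_nat_le_iff)
      then show ?thesis by simp
    qed
    have "measure (sample n) {z \<in> space (sample n). \<bar>field g n z (dyadic_point j a b) - field g n z (dyadic_point j a' b')\<bar> \<ge> 2 powr (- real j / 4)}
        \<le> 2 * exp (1 - (2 powr (- real j / 4)) / (4 * sqrt (1 / 2 ^ j)))"
      by (rule increment_tail[where d="1 / 2 ^ j"])
        (use x n1 le[of a a'] le[of b b'] dyadic_point_in[OF x(2,3)] dyadic_point_in[OF x(4,5)] in
          \<open>auto simp: dyadic_point_def divide_right_mono\<close>)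
    then show ?thesis unfolding rate by (simp add: E_def x(1))
  qed
  then have "measure (sample n) (\<Union>i\<in>I. E i) \<le> (\<Sum>i\<in>I. 2 * exp (1 - 2 powr (real j / 4) / 4))"
    by (intro order_trans[OF measure_UNION_le[OF fin E_sets]] sum_mono)
  also have "\<dots> \<le> dyadic_rate j"
    unfolding dyadic_rate_def using card by (simp add: mult_right_mono)
  also have "(\<Union>i\<in>I. E i) = dyadic_bad n j"
    unfolding dyadic_bad_def I_def E_def ..
  finally show ?thesis .
qed

lemma summable_dyadic_rate: "summable dyadic_rate"
proof (rule summable_comparison_test_bigo)
  show "summable (\<lambda>j. norm ((1 / 2) ^ j :: real))" by (simp add: summable_geometric)
  show "dyadic_rate \<in> O(\<lambda>j. (1 / 2) ^ j)"
    unfolding dyadic_rate_def by real_asymp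
qed

text \<open>For \<open>2 ^ j \<le> n < 2 ^ (j + 1)\<close> a strip of this width contains fewer than
  two points on average, so \<open>e * sqrt n\<close> points in one strip are an extreme
  excess.\<close>

definition count_bad :: "nat \<Rightarrow> nat \<Rightarrow> real \<Rightarrow> ((nat \<Rightarrow> real) \<times> (nat \<Rightarrow> real)) set" where
  "count_bad n j e = (\<Union>a\<in>{..<2^j}.
     {z \<in> space (sample n). strip_count n ({real a / 2^j<..real (Suc a) / 2^j} \<times> UNIV) z \<ge> e * sqrt (real n)} \<union>
     {z \<in> space (sample n). strip_count n (UNIV \<times> {real a / 2^j<..real (Suc a) / 2^j}) z \<ge> e * sqrt (real n)})"

lemma count_bad_sets: "count_bad n j e \<in> sets (sample n)"
  unfolding count_bad_def
  by (intro sets.finite_UN sets.Un borel_measurable_le borel_measurable_const measurable_strip_count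
      fst_strip_borel snd_strip_borel) auto

text \<open>The \<open>4\<close> is a bound for \<open>2 * n / 2 ^ j\<close>, the mean term of the
  Chernoff bound, and \<open>2 * n\<close> bounds the number \<open>2 * 2 ^ j\<close> of
  strips.\<close>

lemma measure_count_bad:
  assumes j: "2 ^ j \<le> n" "n < 2 ^ (j + 1)"
  shows "measure (sample n) (count_bad n j e) \<le> 2 * real n * exp (4 - e * sqrt (real n))"
proof -
  have "real n < real (2 ^ (j + 1))" using j(2) by (simp only: of_nat_less_iff)
  then have n2: "real n / 2 ^ j \<le> 2" by (simp add: field_simps)
  have c: "measure (sample n) {z \<in> space (sample n). strip_count n A z \<ge> e * sqrt (real n)} \<le> exp (4 - e * sqrt (real n))"
    if A: "A \<in> sets borel" "measure unif2 A = 1 / 2 ^ j" for A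
  proof -
    have "measure (sample n) {z \<in> space (sample n). strip_count n A z \<ge> e * sqrt (real n)} \<le> exp (2 * real n * (1 / 2 ^ j) - e * sqrt (real n))"
      unfolding strip_count_def by (rule sample_count_tail) (use A in auto)
    also have "\<dots> \<le> exp (4 - e * sqrt (real n))" using n2 by simp
    finally show ?thesis .
  qed
  have strip: "measure unif2 ({real a / 2^j<..real (Suc a) / 2^j} \<times> UNIV) = 1 / 2 ^ j"
    "measure unif2 (UNIV \<times> {real a / 2^j<..real (Suc a) / 2^j}) = 1 / 2 ^ j" if a: "a < 2 ^ j" for a
  proof -
    have "real (Suc a) \<le> real (2 ^ j)" using a by (simp only: of_nat_le_iff)
    then have 1: "0 \<le> real a / 2^j" "real a / 2^j \<le> real (Suc a) / 2^j" "real (Suc a) / 2^j \<le> 1"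
      by (auto simp: divide_right_mono)
    have 2: "real (Suc a) / 2^j - real a / 2^j = 1 / 2 ^ j" by (simp add: diff_divide_distrib[symmetric])
    show "measure unif2 ({real a / 2^j<..real (Suc a) / 2^j} \<times> UNIV) = 1 / 2 ^ j"
      "measure unif2 (UNIV \<times> {real a / 2^j<..real (Suc a) / 2^j}) = 1 / 2 ^ j"
      using measure_unif2_strips[OF 1] 2 by simp_all
  qed
  let ?E = "\<lambda>a. {z \<in> space (sample n). strip_count n ({real a / 2^j<..real (Suc a) / 2^j} \<times> UNIV) z \<ge> e * sqrt (real n)}"
  let ?F = "\<lambda>a. {z \<in> space (sample n). strip_count n (UNIV \<times> {real a / 2^j<..real (Suc a) / 2^j}) z \<ge> e * sqrt (real n)}"
  have EF: "?E a \<in> sets (sample n)" "?F a \<in> sets (sample n)" for a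
    by (intro borel_measurable_le borel_measurable_const measurable_strip_count fst_strip_borel snd_strip_borel)+
  have "measure (sample n) (count_bad n j e) \<le> (\<Sum>a\<in>{..<2^j}. measure (sample n) (?E a \<union> ?F a))"
    unfolding count_bad_def by (rule measure_UNION_le) (use EF in auto)
  also have "\<dots> \<le> (\<Sum>a\<in>{..<(2::nat)^j}. 2 * exp (4 - e * sqrt (real n)))"
  proof (rule sum_mono)
    fix a :: nat assume "a \<in> {..<2^j}"
    then have a: "a < 2 ^ j" by simp
    have "measure (sample n) (?E a \<union> ?F a) \<le> measure (sample n) (?E a) + measure (sample n) (?F a)"
      by (rule measure_Un_le[OF EF])
    also have "\<dots> \<le> 2 * exp (4 - e * sqrt (real n))"
      using c[OF fst_strip_borel strip(1)[OF a]] c[OF snd_strip_borel strip(2)[OF a]] by linarith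
    finally show "measure (sample n) (?E a \<union> ?F a) \<le> 2 * exp (4 - e * sqrt (real n))" .
  qed
  also have "\<dots> = 2 * real (2 ^ j) * exp (4 - e * sqrt (real n))" by simp
  also have "\<dots> \<le> 2 * real n * exp (4 - e * sqrt (real n))"
    using j(1) by (intro mult_right_mono mult_left_mono) (simp_all only: of_nat_le_iff, auto)
  finally show ?thesis .
qed

definition dyadic_floor :: "nat \<Rightarrow> real \<times> real \<Rightarrow> real \<times> real" where
  "dyadic_floor j p = dyadic_point j (nat \<lfloor>2 ^ j * fst p\<rfloor>) (nat \<lfloor>2 ^ j * snd p\<rfloor>)"

lemma nat_floor_le_power:
  fixes v :: real
  shows "v \<in> {0..1} \<Longrightarrow> nat \<lfloor>2 ^ j * v\<rfloor> \<le> 2 ^ j"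
  using nat_floor_le[of v "2 ^ j"] by simp

lemma nat_floor_bounds:
  fixes v :: real
  assumes "v \<ge> 0"
  shows "real (nat \<lfloor>2 ^ j * v\<rfloor>) / 2 ^ j \<le> v" "v < real (Suc (nat \<lfloor>2 ^ j * v\<rfloor>)) / 2 ^ j"
proof -
  have "real (nat \<lfloor>2 ^ j * v\<rfloor>) = of_int \<lfloor>2 ^ j * v\<rfloor>" using assms by simp
  then have "real (nat \<lfloor>2 ^ j * v\<rfloor>) \<le> 2 ^ j * v" "2 ^ j * v < real (Suc (nat \<lfloor>2 ^ j * v\<rfloor>))" by linarith+
  then show "real (nat \<lfloor>2 ^ j * v\<rfloor>) / 2 ^ j \<le> v" "v < real (Suc (nat \<lfloor>2 ^ j * v\<rfloor>)) / 2 ^ j"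
    by (simp_all add: field_simps)
qed

text \<open>In the next level the index doubles and may gain \<open>1\<close>, so the dyadic floors
  of two consecutive levels are neighbours in the finer grid.\<close>

lemma nat_floor_double:
  fixes v :: real
  assumes "v \<ge> 0"
  shows "2 * nat \<lfloor>2 ^ j * v\<rfloor> \<le> nat \<lfloor>2 ^ Suc j * v\<rfloor>" "nat \<lfloor>2 ^ Suc j * v\<rfloor> \<le> 2 * nat \<lfloor>2 ^ j * v\<rfloor> + 1"
proof -
  define x where "x = 2 ^ j * v"
  have "x \<ge> 0" using assms by (simp add: x_def)
  then have "2 * nat \<lfloor>x\<rfloor> \<le> nat \<lfloor>2 * x\<rfloor> \<and> nat \<lfloor>2 * x\<rfloor> \<le> 2 * nat \<lfloor>x\<rfloor> + 1" by linarith
  then show "2 * nat \<lfloor>2 ^ j * v\<rfloor> \<le> nat \<lfloor>2 ^ Suc j * v\<rfloor>" "nat \<lfloor>2 ^ Suc j * v\<rfloor> \<le> 2 * nat \<lfloor>2 ^ j * v\<rfloor> + 1"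
    by (simp_all add: x_def mult.assoc)
qed

lemma dyadic_increment:
  assumes z: "z \<in> space (sample n)" "z \<notin> dyadic_bad n j"
    and a: "a \<le> 2 ^ j" "b \<le> 2 ^ j" "a' \<le> a" "a \<le> a' + 1" "b' \<le> b" "b \<le> b' + 1"
  shows "\<bar>field g n z (dyadic_point j a b) - field g n z (dyadic_point j a' b')\<bar> \<le> 2 powr (- real j / 4)"
proof (rule ccontr)
  assume "\<not> ?thesis"
  then have "z \<in> dyadic_bad n j"
    unfolding dyadic_bad_def using z(1) a by (intro UN_I[of "(a, b, a', b')"]) auto
  with z(2) show False by blast
qed

text \<open>A telescoping sum over the levels, each step of which joins neighbours in a grid outside
  its bad event.\<close>

lemma chaining:
  assumes z: "z \<in> space (sample n)" and K: "K \<le> J"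
    and bad: "\<And>j. K < j \<Longrightarrow> j \<le> J \<Longrightarrow> z \<notin> dyadic_bad n j" and p: "p \<in> unit_square"
  shows "\<bar>field g n z (dyadic_floor J p) - field g n z (dyadic_floor K p)\<bar> \<le> (\<Sum>j\<in>{Suc K..<Suc J}. 2 powr (- real j / 4))"
  using K bad
proof (induction J rule: dec_induct)
  case (step j)
  have p': "fst p \<in> {0..1}" "snd p \<in> {0..1}" "0 \<le> fst p" "0 \<le> snd p" using p by (auto simp: unit_square_def)
  \<comment> \<open>With doubled indices the coarser point becomes a point of the finer grid, where
    \<open>dyadic_increment\<close> applies.\<close>
  have "dyadic_floor j p = dyadic_point (Suc j) (2 * nat \<lfloor>2 ^ j * fst p\<rfloor>) (2 * nat \<lfloor>2 ^ j * snd p\<rfloor>)"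
    by (simp add: dyadic_floor_def dyadic_point_def)
  moreover have "\<bar>field g n z (dyadic_floor (Suc j) p) -
      field g n z (dyadic_point (Suc j) (2 * nat \<lfloor>2 ^ j * fst p\<rfloor>) (2 * nat \<lfloor>2 ^ j * snd p\<rfloor>))\<bar> \<le> 2 powr (- real (Suc j) / 4)"
    unfolding dyadic_floor_def[of "Suc j"]
    by (rule dyadic_increment[OF z(1) _ nat_floor_le_power[OF p'(1)] nat_floor_le_power[OF p'(2)]
          nat_floor_double[OF p'(3)] nat_floor_double[OF p'(4)]]) (use step in auto)
  ultimately have "\<bar>field g n z (dyadic_floor (Suc j) p) - field g n z (dyadic_floor j p)\<bar> \<le> 2 powr (- real (Suc j) / 4)"
    by (simp only:)
  moreover have "\<bar>field g n z (dyadic_floor j p) - field g n z (dyadic_floor K p)\<bar> \<le> (\<Sum>j\<in>{Suc K..<Suc j}. 2 powr (- real j / 4))"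
    using step by auto
  moreover have "(\<Sum>j\<in>{Suc K..<Suc (Suc j)}. 2 powr (- real j / 4)) =
      (\<Sum>j\<in>{Suc K..<Suc j}. 2 powr (- real j / 4)) + 2 powr (- real (Suc j) / 4)"
    by (rule sum.atLeastLessThan_Suc) (use step in auto)
  ultimately show ?case by linarith
qed simp

text \<open>A pathwise bound replaces the exponential one inside a cell of side about
  \<open>1 / n\<close>. Either strip contributes at most \<open>e\<close> after normalization, and
  the Lipschitz part contributes at most \<open>2 / sqrt n\<close> in either direction.\<close>

lemma finest_level:
  assumes z: "z \<in> space (sample n)" "z \<notin> count_bad n j e" and p: "p \<in> unit_square"
    and j: "2 ^ j \<le> n" "n < 2 ^ (j + 1)" and e: "e \<ge> 0"
  shows "\<bar>field g n z p - field g n z (dyadic_floor j p)\<bar> \<le> 2 * e + 4 / sqrt (real n)"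
proof -
  define q where "q = dyadic_floor j p"
  have p': "fst p \<in> {0..1}" "snd p \<in> {0..1}" "0 \<le> fst p" "0 \<le> snd p" using p by (auto simp: unit_square_def)
  have q: "q \<in> unit_square" unfolding q_def dyadic_floor_def
    by (intro dyadic_point_in nat_floor_le_power p')
  have le: "fst q \<le> fst p" "snd q \<le> snd p" and le': "fst p - fst q \<le> 1 / 2 ^ j" "snd p - snd q \<le> 1 / 2 ^ j"
    using nat_floor_bounds[OF p'(3), of j] nat_floor_bounds[OF p'(4), of j]
    by (auto simp: q_def dyadic_floor_def dyadic_point_def add_divide_distrib)
  have n: "n > 0" using j(1) by (cases n) auto
  have "real n < real (2 ^ (j + 1))" using j(2) by (simp only: of_nat_less_iff)
  then have n2: "real n / 2 ^ j \<le> 2" by (simp add: field_simps)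
  define s where "s = sqrt (real n)"
  have s: "s > 0" "real n powr (-1/2) = 1 / s"
    using n by (auto simp: s_def powr_minus_divide powr_half_sqrt)
  have c1: "strip_count n ({fst q<..fst p} \<times> UNIV) z \<le> e * s"
  proof (cases "nat \<lfloor>2 ^ j * fst p\<rfloor> < 2 ^ j")
    case True
    define a where "a = nat \<lfloor>2 ^ j * fst p\<rfloor>"
    have "strip_count n ({fst q<..fst p} \<times> UNIV) z \<le> strip_count n ({real a / 2^j<..real (Suc a) / 2^j} \<times> UNIV) z"
      unfolding strip_count_def using nat_floor_bounds(2)[OF p'(3), of j]
      by (intro sum_mono) (auto simp: indicator_def q_def dyadic_floor_def dyadic_point_def a_def)
    moreover have "strip_count n ({real a / 2^j<..real (Suc a) / 2^j} \<times> UNIV) z < e * s"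
      using z True by (auto simp: count_bad_def a_def s_def not_le)
    ultimately show ?thesis by linarith
  next
    \<comment> \<open>The index \<open>2 ^ j\<close> is reached only at coordinate \<open>1\<close>;
      no strip of the family starts there, but the strip between \<open>q\<close> and
      \<open>p\<close> is empty.\<close>
    case False
    then have "nat \<lfloor>2 ^ j * fst p\<rfloor> = 2 ^ j" using nat_floor_le_power[OF p'(1), of j] by simp
    then have "fst q = 1" by (simp add: q_def dyadic_floor_def dyadic_point_def)
    then have "{fst q<..fst p} = {}" using p' by auto
    then show ?thesis using e s by (simp add: strip_count_def)
  qed
  have c2: "strip_count n (UNIV \<times> {snd q<..snd p}) z \<le> e * s"
  proof (cases "nat \<lfloor>2 ^ j * snd p\<rfloor> < 2 ^ j")
    case True
    define a where "a = nat \<lfloor>2 ^ j * snd p\<rfloor>"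
    have "strip_count n (UNIV \<times> {snd q<..snd p}) z \<le> strip_count n (UNIV \<times> {real a / 2^j<..real (Suc a) / 2^j}) z"
      unfolding strip_count_def using nat_floor_bounds(2)[OF p'(4), of j]
      by (intro sum_mono) (auto simp: indicator_def q_def dyadic_floor_def dyadic_point_def a_def)
    moreover have "strip_count n (UNIV \<times> {real a / 2^j<..real (Suc a) / 2^j}) z < e * s"
      using z True by (auto simp: count_bad_def a_def s_def not_le)
    ultimately show ?thesis by linarith
  next
    case False
    then have "nat \<lfloor>2 ^ j * snd p\<rfloor> = 2 ^ j" using nat_floor_le_power[OF p'(2), of j] by simp
    then have "snd q = 1" by (simp add: q_def dyadic_floor_def dyadic_point_def)
    then have "{snd q<..snd p} = {}" using p' by auto
    then show ?thesis using e s by (simp add: strip_count_def)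
  qed
  have "field g n z p - field g n z q = 1 / s * (\<Sum>i=1..n. kern g (fst z i, snd z i) p - kern g (fst z i, snd z i) q)"
    unfolding field_def s(2) by (simp only: right_diff_distrib[symmetric] sum_subtractf)
  then have "\<bar>field g n z p - field g n z q\<bar> = 1 / s * \<bar>\<Sum>i=1..n. kern g (fst z i, snd z i) p - kern g (fst z i, snd z i) q\<bar>"
    using s(1) by (simp only: abs_mult) simp
  also have "\<dots> \<le> 1 / s * (\<Sum>i=1..n. (indicator ({fst q<..fst p} \<times> UNIV) (fst z i, snd z i) + (fst p - fst q) +
    (indicator (UNIV \<times> {snd q<..snd p}) (fst z i, snd z i) + (snd p - snd q))))"
    using s(1) by (intro mult_left_mono order_trans[OF sum_abs] sum_mono kern_increment p q le) auto
  also have "\<dots> = 1 / s * (strip_count n ({fst q<..fst p} \<times> UNIV) z + strip_count n (UNIV \<times> {snd q<..snd p}) z +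
      (real n * (fst p - fst q) + real n * (snd p - snd q)))"
    by (simp add: sum.distrib strip_count_def)
  also have "\<dots> \<le> 1 / s * (e * s + e * s + (2 + 2))"
  proof -
    have "real n * (fst p - fst q) \<le> real n * (1 / 2 ^ j)" "real n * (snd p - snd q) \<le> real n * (1 / 2 ^ j)"
      by (intro mult_left_mono le'; simp)+
    then have "real n * (fst p - fst q) \<le> 2" "real n * (snd p - snd q) \<le> 2" using n2 by auto
    then show ?thesis using c1 c2 s(1) by (intro mult_left_mono add_mono) auto
  qed
  also have "\<dots> = 2 * e + 4 / s" using s(1) by (simp add: field_simps)
  finally show ?thesis by (simp add: q_def s_def)
qed

text \<open>The bad events compare only ordered neighbours, and \<open>p\<close> and
  \<open>q\<close> may be ordered differently in the two coordinates. Passing through a mixed corner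
  changes one coordinate at a time, hence the factor \<open>2\<close>.\<close>

lemma coarsest_level:
  assumes z: "z \<in> space (sample n)" "z \<notin> dyadic_bad n j" and p: "p \<in> unit_square" and q: "q \<in> unit_square"
    and pq: "\<bar>fst p - fst q\<bar> \<le> 1 / 2 ^ j" "\<bar>snd p - snd q\<bar> \<le> 1 / 2 ^ j"
  shows "\<bar>field g n z (dyadic_floor j p) - field g n z (dyadic_floor j q)\<bar> \<le> 2 * 2 powr (- real j / 4)"
proof -
  have p': "fst p \<in> {0..1}" "snd p \<in> {0..1}" and q': "fst q \<in> {0..1}" "snd q \<in> {0..1}"
    using p q by (auto simp: unit_square_def)
  have near: "nat \<lfloor>2 ^ j * v\<rfloor> \<le> nat \<lfloor>2 ^ j * w\<rfloor> + 1" if "\<bar>v - w\<bar> \<le> 1 / 2 ^ j" for v w :: real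
  proof -
    have "2 ^ j * (v - w) \<le> 2 ^ j * (1 / 2 ^ j)" using that by (intro mult_left_mono) auto
    then have "2 ^ j * v \<le> 2 ^ j * w + 1" by (simp add: right_diff_distrib)
    then show ?thesis by linarith
  qed
  define a b a' b' where ab: "a = nat \<lfloor>2 ^ j * fst p\<rfloor>" "b = nat \<lfloor>2 ^ j * snd p\<rfloor>" "a' = nat \<lfloor>2 ^ j * fst q\<rfloor>" "b' = nat \<lfloor>2 ^ j * snd q\<rfloor>"
  have le: "a \<le> 2 ^ j" "b \<le> 2 ^ j" "a' \<le> 2 ^ j" "b' \<le> 2 ^ j"
    unfolding ab using nat_floor_le_power p' q' by auto
  have nr: "a \<le> a' + 1" "a' \<le> a + 1" "b \<le> b' + 1" "b' \<le> b + 1"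
    unfolding ab using near pq by (auto simp: abs_minus_commute)
  have "\<bar>field g n z (dyadic_point j a b) - field g n z (dyadic_point j a' b)\<bar> \<le> 2 powr (- real j / 4)"
  proof (cases "a' \<le> a")
    case False
    then have "\<bar>field g n z (dyadic_point j a' b) - field g n z (dyadic_point j a b)\<bar> \<le> 2 powr (- real j / 4)"
      by (intro dyadic_increment z) (use le nr in auto)
    then show ?thesis by linarith
  qed (intro dyadic_increment z, use le nr in auto)
  moreover have "\<bar>field g n z (dyadic_point j a' b) - field g n z (dyadic_point j a' b')\<bar> \<le> 2 powr (- real j / 4)"
  proof (cases "b' \<le> b")
    case False
    then have "\<bar>field g n z (dyadic_point j a' b') - field g n z (dyadic_point j a' b)\<bar> \<le> 2 powr (- real j / 4)"
      by (intro dyadic_increment z) (use le nr in auto)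
    then show ?thesis by linarith
  qed (intro dyadic_increment z, use le nr in auto)
  ultimately show ?thesis unfolding dyadic_floor_def ab[symmetric] by linarith
qed

text \<open>Stochastic equicontinuity with a distance \<open>d\<close> that does not depend on
  \<open>n\<close>. Two nearby points are joined through their floors at a fixed coarse level
  \<open>K\<close>, and each point is joined to its coarse floor by chaining up to the level whose
  mesh is comparable to \<open>1 / n\<close>.\<close>

lemma field_modulus:
  assumes e: "e > 0"
  obtains d n0 where "d > 0" "\<And>n. n \<ge> n0 \<Longrightarrow> \<exists>A\<in>sets (sample n). measure (sample n) A \<ge> 1 - e \<and>
    (\<forall>z\<in>A. \<forall>p\<in>unit_square. \<forall>q\<in>unit_square. \<bar>fst p - fst q\<bar> \<le> d \<longrightarrow> \<bar>snd p - snd q\<bar> \<le> d \<longrightarrow>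
      \<bar>field g n z p - field g n z q\<bar> \<le> e)"
proof -
  have sum_eps: "summable (\<lambda>j. 2 powr (- real j / 4))"
  proof -
    have "(\<lambda>j. 2 powr (- real j / 4)) = (\<lambda>j. (2 powr (-1/4)) ^ j)"
      by (simp add: powr_realpow[symmetric] powr_powr mult.commute)
    moreover have "(2::real) powr (-1/4) < 1" by (rule powr_less_one) auto
    ultimately show ?thesis by (simp add: summable_geometric)
  qed
  obtain K1 where K1: "\<And>m n. m \<ge> K1 \<Longrightarrow> norm (\<Sum>j\<in>{m..<n}. 2 powr (- real j / 4)) < e / 16"
    using sum_eps e unfolding summable_Cauchy by (metis zero_less_divide_iff zero_less_numeral)
  obtain K2 where K2: "\<And>m n. m \<ge> K2 \<Longrightarrow> norm (sum dyadic_rate {m..<n}) < e / 2"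
    using summable_dyadic_rate e unfolding summable_Cauchy by (metis half_gt_zero)
  \<comment> \<open>Beyond \<open>K\<close> the increments along a chain sum to less than
    \<open>e / 16\<close> and the bad events have total probability below
    \<open>e / 2\<close>.\<close>
  define K where "K = max K1 K2"
  \<comment> \<open>The strips of the finest level then contribute
    \<open>2 * e' = e / 16\<close>.\<close>
  define e' where "e' = e / 32"
  have e': "e' > 0" using e by (simp add: e'_def)
  have "(\<lambda>n. 2 * real n * exp (4 - e' * sqrt (real n))) \<longlonglongrightarrow> 0" using e' by real_asymp
  then have "\<forall>\<^sub>F n in sequentially. 2 * real n * exp (4 - e' * sqrt (real n)) < e / 2"
    by (rule order_tendstoD(2)) (use e in auto)
  moreover have "(\<lambda>n. 4 / sqrt (real n)) \<longlonglongrightarrow> 0" by real_asymp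
  then have "\<forall>\<^sub>F n in sequentially. 4 / sqrt (real n) < e / 16"
    by (rule order_tendstoD(2)) (use e in auto)
  moreover have "\<forall>\<^sub>F n in sequentially. n \<ge> 2 ^ K" by (rule eventually_ge_at_top)
  ultimately have "\<forall>\<^sub>F n in sequentially. 2 * real n * exp (4 - e' * sqrt (real n)) < e / 2 \<and> 4 / sqrt (real n) < e / 16 \<and> n \<ge> 2 ^ K"
    by eventually_elim auto
  then obtain n0 where n0: "\<And>n. n \<ge> n0 \<Longrightarrow> 2 * real n * exp (4 - e' * sqrt (real n)) < e / 2 \<and> 4 / sqrt (real n) < e / 16 \<and> n \<ge> 2 ^ K"
    unfolding eventually_sequentially by blast
  show ?thesis
  proof (rule that[of "1 / 2 ^ K"])
    fix n assume n: "n \<ge> n0"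
    have nK: "2 ^ K \<le> n" using n0[OF n] by blast
    then have "1 \<le> n" by (meson one_le_numeral one_le_power order_trans)
    \<comment> \<open>The finest level at which \<open>n / 2 ^ J \<ge> 1\<close>, so that the
      increment bound holds at all levels up to \<open>J\<close>.\<close>
    then obtain J where J: "2 ^ J \<le> n" "n < 2 ^ (J + 1)" using ex_power_ivl1[of 2 n] by auto
    have KJ: "K \<le> J"
    proof (rule ccontr)
      assume "\<not> K \<le> J"
      then have "(2::nat) ^ (J + 1) \<le> 2 ^ K" by (intro power_increasing) auto
      then show False using J(2) nK by linarith
    qed
    define B where "B = (\<Union>j\<in>{K..<Suc J}. dyadic_bad n j) \<union> count_bad n J e'"
    have B: "B \<in> sets (sample n)" unfolding B_def by (intro sets.Un sets.finite_UN dyadic_bad_sets count_bad_sets) auto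
    have "measure (sample n) B \<le> measure (sample n) (\<Union>j\<in>{K..<Suc J}. dyadic_bad n j) + measure (sample n) (count_bad n J e')"
      unfolding B_def by (intro measure_Un_le sets.finite_UN dyadic_bad_sets count_bad_sets) auto
    also have "\<dots> \<le> e / 2 + e / 2"
    proof (rule add_mono)
      have "measure (sample n) (\<Union>j\<in>{K..<Suc J}. dyadic_bad n j) \<le> (\<Sum>j\<in>{K..<Suc J}. measure (sample n) (dyadic_bad n j))"
        by (rule measure_UNION_le) (auto intro: dyadic_bad_sets)
      also have "\<dots> \<le> (\<Sum>j\<in>{K..<Suc J}. dyadic_rate j)"
      proof (rule sum_mono)
        fix j assume "j \<in> {K..<Suc J}"
        then have "(2::nat) ^ j \<le> 2 ^ J" by (intro power_increasing) auto
        then show "measure (sample n) (dyadic_bad n j) \<le> dyadic_rate j" using J(1) by (intro measure_dyadic_bad) linarith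
      qed
      also have "\<dots> \<le> e / 2"
      proof -
        have "norm (sum dyadic_rate {K..<Suc J}) < e / 2" by (rule K2) (simp add: K_def)
        then show ?thesis unfolding real_norm_def by linarith
      qed
      finally show "measure (sample n) (\<Union>j\<in>{K..<Suc J}. dyadic_bad n j) \<le> e / 2" .
      show "measure (sample n) (count_bad n J e') \<le> e / 2"
        using measure_count_bad[OF J, of e'] n0[OF n] by linarith
    qed
    finally have mB: "measure (sample n) B \<le> e" by simp
    show "\<exists>A\<in>sets (sample n). measure (sample n) A \<ge> 1 - e \<and>
      (\<forall>z\<in>A. \<forall>p\<in>unit_square. \<forall>q\<in>unit_square. \<bar>fst p - fst q\<bar> \<le> 1 / 2 ^ K \<longrightarrow> \<bar>snd p - snd q\<bar> \<le> 1 / 2 ^ K \<longrightarrow>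
        \<bar>field g n z p - field g n z q\<bar> \<le> e)"
    proof (intro bexI[of _ "space (sample n) - B"] conjI ballI impI)
      show "measure (sample n) (space (sample n) - B) \<ge> 1 - e"
        using sample.prob_compl[OF B] mB by simp
      fix z p q
      assume z: "z \<in> space (sample n) - B" and p: "p \<in> unit_square" and q: "q \<in> unit_square"
        and pq: "\<bar>fst p - fst q\<bar> \<le> 1 / 2 ^ K" "\<bar>snd p - snd q\<bar> \<le> 1 / 2 ^ K"
      have zB: "z \<in> space (sample n)" "z \<notin> count_bad n J e'" "\<And>j. K \<le> j \<Longrightarrow> j \<le> J \<Longrightarrow> z \<notin> dyadic_bad n j"
        using z by (auto simp: B_def)
      \<comment> \<open>One share of \<open>e / 16\<close> each comes from the chain, from the
        strips and from the Lipschitz part.\<close>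
      have point: "\<bar>field g n z p - field g n z (dyadic_floor K p)\<bar> \<le> 3 * e / 16" if p: "p \<in> unit_square" for p
      proof -
        have "\<bar>field g n z (dyadic_floor J p) - field g n z (dyadic_floor K p)\<bar> \<le> (\<Sum>j\<in>{Suc K..<Suc J}. 2 powr (- real j / 4))"
          by (rule chaining[OF zB(1) KJ zB(3) p]) auto
        moreover have "norm (\<Sum>j\<in>{Suc K..<Suc J}. 2 powr (- real j / 4)) < e / 16" by (rule K1) (simp add: K_def)
        moreover have "\<bar>field g n z p - field g n z (dyadic_floor J p)\<bar> \<le> 2 * e' + 4 / sqrt (real n)"
          by (rule finest_level[OF zB(1,2) p J]) (use e' in simp)
        moreover have "2 * e' = e / 16" by (simp add: e'_def)
        ultimately show ?thesis using n0[OF n] by (auto simp: abs_le_iff)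
      qed
      have "\<bar>field g n z (dyadic_floor K p) - field g n z (dyadic_floor K q)\<bar> \<le> 2 * 2 powr (- real K / 4)"
        by (rule coarsest_level[OF zB(1) zB(3) p q pq]) (use KJ in auto)
      moreover have "norm (\<Sum>j\<in>{K..<Suc K}. 2 powr (- real j / 4)) < e / 16" by (rule K1) (simp add: K_def)
      then have "2 powr (- real K / 4) < e / 16" by simp
      \<comment> \<open>Two joins of \<open>3 * e / 16\<close> and a coarse step below
        \<open>2 * e / 16\<close> add up to less than \<open>e / 2\<close>.\<close>
      ultimately show "\<bar>field g n z p - field g n z q\<bar> \<le> e"
        using point[OF p] point[OF q] e by linarith
    qed (use B in auto)
  qed simp
qed

end

subsection \<open>Convergence of the kernel fields\<close>

context bridge_kernel
begin

lemma kern_lin_integral: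
  assumes I: "finite I" and p: "\<And>i. i \<in> I \<Longrightarrow> p i \<in> unit_square"
  shows "(\<integral>x. (\<Sum>i\<in>I. c i * kern g x (p i)) \<partial>unif2) = 0"
    and "(\<integral>x. (\<Sum>i\<in>I. c i * kern g x (p i))\<^sup>2 \<partial>unif2) = (\<Sum>i\<in>I. \<Sum>j\<in>I. c i * c j * \<Gamma> (p i) (p j))"
proof -
  show "(\<integral>x. (\<Sum>i\<in>I. c i * kern g x (p i)) \<partial>unif2) = 0"
    by (subst Bochner_Integration.integral_sum) (use kern_integrable p mean in auto)
  have int2: "integrable unif2 (\<lambda>x. c i * c j * (kern g x (p i) * kern g x (p j)))" if "i \<in> I" "j \<in> I" for i j
  proof (intro integrable_mult_right unif2.integrable_const_bound[of _ 1])
    show "AE x in unif2. norm (kern g x (p i) * kern g x (p j)) \<le> 1"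
      using kern_bound[OF p[OF that(1)]] kern_bound[OF p[OF that(2)]]
      by (intro AE_I2) (simp add: abs_mult mult_le_one)
    show "(\<lambda>x. kern g x (p i) * kern g x (p j)) \<in> borel_measurable unif2"
      using kern_measurable by (simp add: measurable_cong_sets[OF sets_unif2 refl])
  qed
  have "(\<integral>x. (\<Sum>i\<in>I. c i * kern g x (p i))\<^sup>2 \<partial>unif2) =
      (\<integral>x. (\<Sum>i\<in>I. \<Sum>j\<in>I. c i * c j * (kern g x (p i) * kern g x (p j))) \<partial>unif2)"
    by (simp add: power2_eq_square sum_product ac_simps)
  also have "\<dots> = (\<Sum>i\<in>I. \<integral>x. (\<Sum>j\<in>I. c i * c j * (kern g x (p i) * kern g x (p j))) \<partial>unif2)"
    by (rule Bochner_Integration.integral_sum) (intro Bochner_Integration.integrable_sum int2)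
  also have "\<dots> = (\<Sum>i\<in>I. \<Sum>j\<in>I. c i * c j * \<Gamma> (p i) (p j))"
  proof (rule sum.cong[OF refl])
    fix i assume i: "i \<in> I"
    have "(\<integral>x. (\<Sum>j\<in>I. c i * c j * (kern g x (p i) * kern g x (p j))) \<partial>unif2) =
        (\<Sum>j\<in>I. \<integral>x. c i * c j * (kern g x (p i) * kern g x (p j)) \<partial>unif2)"
      by (rule Bochner_Integration.integral_sum) (rule int2[OF i])
    also have "\<dots> = (\<Sum>j\<in>I. c i * c j * \<Gamma> (p i) (p j))"
      using p i by (intro sum.cong refl) (simp add: cov)
    finally show "(\<integral>x. (\<Sum>j\<in>I. c i * c j * (kern g x (p i) * kern g x (p j))) \<partial>unif2) =
      (\<Sum>j\<in>I. c i * c j * \<Gamma> (p i) (p j))" .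
  qed
  finally show "(\<integral>x. (\<Sum>i\<in>I. c i * kern g x (p i))\<^sup>2 \<partial>unif2) = (\<Sum>i\<in>I. \<Sum>j\<in>I. c i * c j * \<Gamma> (p i) (p j))" .
qed

text \<open>A linear combination of field values is itself a normalized sum of independent copies of
  one bounded centered variable \<eta>, so its characteristic function is an \<open>n\<close>-th
  power. The variance of \<eta> is the quadratic form of \<Gamma> that also occurs in
  \<open>gaussian_process_cos\<close>.\<close>

lemma field_cos:
  assumes I: "finite I" and p: "\<And>i. i \<in> I \<Longrightarrow> p i \<in> unit_square"
  shows "(\<lambda>n. \<integral>z. cos ((\<Sum>i\<in>I. c i * field g n z (p i)) + d) \<partial>sample n) \<longlonglongrightarrow>
    exp (- (\<Sum>i\<in>I. \<Sum>j\<in>I. c i * c j * \<Gamma> (p i) (p j)) / 2) * cos d"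
proof -
  define \<eta> where "\<eta> x = (\<Sum>i\<in>I. c i * kern g x (p i))" for x
  define v where "v = (\<Sum>i\<in>I. \<Sum>j\<in>I. c i * c j * \<Gamma> (p i) (p j))"
  have m: "\<eta> \<in> borel_measurable borel" unfolding \<eta>_def
    by (intro borel_measurable_sum borel_measurable_times borel_measurable_const kern_measurable)
  have b: "\<bar>\<eta> x\<bar> \<le> (\<Sum>i\<in>I. \<bar>c i\<bar>)" for x
    unfolding \<eta>_def using kern_bound p
    by (intro order_trans[OF sum_abs] sum_mono) (simp add: abs_mult mult_left_le)
  have S: "(\<Sum>i\<in>I. c i * field g n z (p i)) = (\<Sum>j\<in>{1..n}. real n powr (-1/2) * \<eta> (fst z j, snd z j))" for n z
  proof -
    have "(\<Sum>i\<in>I. c i * field g n z (p i)) = (\<Sum>i\<in>I. \<Sum>j\<in>{1..n}. real n powr (-1/2) * (c i * kern g (fst z j, snd z j) (p i)))"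
      unfolding field_def sum_distrib_left by (intro sum.cong refl) (simp add: mult.left_commute)
    also have "\<dots> = (\<Sum>j\<in>{1..n}. real n powr (-1/2) * \<eta> (fst z j, snd z j))"
      unfolding \<eta>_def sum_distrib_left by (rule sum.swap)
    finally show ?thesis .
  qed
  have char: "(CLINT z|sample n. iexp (\<Sum>i\<in>I. c i * field g n z (p i))) = (CLINT x|unif2. iexp (real n powr (-1/2) * \<eta> x)) ^ n"
    and int: "integrable (sample n) (\<lambda>z. iexp (\<Sum>i\<in>I. c i * field g n z (p i)))" for n
  proof -
    have prod: "iexp (\<Sum>i\<in>I. c i * field g n z (p i)) = (\<Prod>j\<in>{1..n}. iexp (real n powr (-1/2) * \<eta> (fst z j, snd z j)))" for z
      unfolding S of_real_sum sum_distrib_left by (rule exp_sum) simp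
    have m': "(\<lambda>x. iexp (real n powr (-1/2) * \<eta> x)) \<in> borel_measurable borel" using m by measurable
    show "integrable (sample n) (\<lambda>z. iexp (\<Sum>i\<in>I. c i * field g n z (p i)))"
      unfolding prod by (rule integral_sample_prod(2)[where b=1 and h="\<lambda>_ x. iexp (real n powr (-1/2) * \<eta> x)", OF m']) simp
    have "(CLINT z|sample n. iexp (\<Sum>i\<in>I. c i * field g n z (p i))) = (\<Prod>j\<in>{1..n}. CLINT x|unif2. iexp (real n powr (-1/2) * \<eta> x))"
      unfolding prod by (rule integral_sample_prod(1)[where b=1 and h="\<lambda>_ x. iexp (real n powr (-1/2) * \<eta> x)", OF m']) simp
    then show "(CLINT z|sample n. iexp (\<Sum>i\<in>I. c i * field g n z (p i))) = (CLINT x|unif2. iexp (real n powr (-1/2) * \<eta> x)) ^ n"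
      by simp
  qed
  have "(\<lambda>n. (CLINT x|unif2. iexp (real n powr (-1/2) * \<eta> x)) ^ n) \<longlonglongrightarrow> exp (- (unif2.expectation (\<lambda>x. (\<eta> x)\<^sup>2)) / 2)"
  proof (rule unif2.clt_characteristic_function)
    show "\<eta> \<in> borel_measurable unif2" using m by (simp add: measurable_cong_sets[OF sets_unif2 refl])
    show "unif2.expectation \<eta> = 0" unfolding \<eta>_def by (rule kern_lin_integral(1)[OF I p])
  qed (rule b)
  also have "unif2.expectation (\<lambda>x. (\<eta> x)\<^sup>2) = v"
    unfolding \<eta>_def v_def by (rule kern_lin_integral(2)[OF I p])
  finally have "(\<lambda>n. CLINT z|sample n. iexp (\<Sum>i\<in>I. c i * field g n z (p i))) \<longlonglongrightarrow> complex_of_real (exp (- v / 2))"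
    unfolding char .
  then have "(\<lambda>n. Re (iexp d * (CLINT z|sample n. iexp (\<Sum>i\<in>I. c i * field g n z (p i))))) \<longlonglongrightarrow> Re (iexp d * complex_of_real (exp (- v / 2)))"
    by (intro tendsto_Re tendsto_mult tendsto_const)
  moreover have "Re (iexp d * (CLINT z|sample n. iexp (\<Sum>i\<in>I. c i * field g n z (p i)))) =
      (\<integral>z. cos ((\<Sum>i\<in>I. c i * field g n z (p i)) + d) \<partial>sample n)" for n
  proof -
    have "iexp d * (CLINT z|sample n. iexp (\<Sum>i\<in>I. c i * field g n z (p i))) =
      (CLINT z|sample n. iexp d * iexp (\<Sum>i\<in>I. c i * field g n z (p i)))"
      by (simp only: integral_mult_right_zero)
    also have "Re \<dots> = (\<integral>z. Re (iexp d * iexp (\<Sum>i\<in>I. c i * field g n z (p i))) \<partial>sample n)"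
      by (rule integral_Re[symmetric]) (intro integrable_mult_right int)
    also have "\<dots> = (\<integral>z. cos ((\<Sum>i\<in>I. c i * field g n z (p i)) + d) \<partial>sample n)"
      by (simp only: exp_add[symmetric] distrib_left[symmetric] of_real_add[symmetric]) (simp add: Re_exp add.commute)
    finally show ?thesis .
  qed
  moreover have "Re (iexp d * complex_of_real (exp (- v / 2))) = exp (- v / 2) * cos d" by (simp add: Re_exp)
  ultimately show ?thesis by (simp add: v_def mult.commute)
qed

text \<open>Chernoff parameter \<open>1\<close> with variance bound \<open>1\<close>. The bound does
  not depend on \<open>n\<close> and supplies the tightness in
  \<open>random_vector_convergence\<close>.\<close>

lemma field_tail:
  assumes p: "p \<in> unit_square" and a: "a > 0"
  shows "measure (sample n) {z \<in> space (sample n). \<bar>field g n z p\<bar> \<ge> a} \<le> 2 * exp (1 - a)"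
proof (cases "n = 0")
  case True
  then show ?thesis using a by (simp add: field_def)
next
  case False
  have "measure (sample n) {z \<in> space (sample n). \<bar>real n powr (-1/2) * (\<Sum>i=1..n. kern g (fst z i, snd z i) p)\<bar> \<ge> a'} \<le>
    2 * exp (1\<^sup>2 * 1 - 1 * a')" if "\<And>x. \<bar>kern g x p\<bar> \<le> 1" "(\<integral>x. (kern g x p)\<^sup>2 \<partial>unif2) \<le> 1" for a'
    by (rule sample_sum_tail[OF kern_measurable that(1) mean[OF p] that(2)]) (use False in auto)
  moreover have "(\<integral>x. (kern g x p)\<^sup>2 \<partial>unif2) \<le> (\<integral>x. 1 \<partial>unif2)"
  proof (rule integral_mono)
    have sq: "(kern g x p)\<^sup>2 \<le> 1" for x using kern_bound[OF p, of x] by (simp add: abs_square_le_1)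
    then show "(kern g x p)\<^sup>2 \<le> 1" for x .
    show "integrable unif2 (\<lambda>x. (kern g x p)\<^sup>2)"
      using sq kern_measurable by (intro unif2.integrable_const_bound[of _ 1]) (auto simp: measurable_cong_sets[OF sets_unif2 refl])
  qed auto
  ultimately show ?thesis using kern_bound[OF p] unfolding field_def by simp
qed

text \<open>Composed with \<open>grid_path\<close>, a Lipschitz functional becomes a bounded
  continuous function of finitely many field values, to which the finite-dimensional convergence
  applies.\<close>

lemma field_discretized_limit:
  assumes G: "continuous_centered_gaussian N \<Gamma> G" and k: "k > 0"
    and f: "\<And>x y. x \<in> skorokhod_space \<Longrightarrow> y \<in> skorokhod_space \<Longrightarrow> \<bar>f x - f y\<bar> \<le> L * skorokhod_dist x y"
    and L: "L > 0" and fK: "\<And>x. x \<in> skorokhod_space \<Longrightarrow> \<bar>f x\<bar> \<le> B"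
  shows "(\<lambda>n. \<integral>z. f (path_on_square (discretize k (field g n z))) \<partial>sample n) \<longlonglongrightarrow>
    (\<integral>w. f (path_on_square (discretize k (G w))) \<partial>N)"
  unfolding discretize_def
proof (rule random_vector_convergence[where I="{..k} \<times> {..k}" and K=B and g="\<lambda>u. f (path_on_square (grid_path k u))"])
  have gp: "gaussian_process N unit_square G" using G by (simp add: continuous_centered_gaussian_def)
  then show "prob_space N" by (simp add: gaussian_process_def)
  have "gaussian_variable N (\<lambda>w. \<Sum>q\<in>{p}. 1 * G w q)" if "p \<in> unit_square" for p
    using gp that unfolding gaussian_process_def by (elim conjE allE[of _ "{p}"] allE[of _ "\<lambda>_. 1"]) auto
  then show "(\<lambda>w. G w (grid_point k i)) \<in> borel_measurable N" for i
    by (simp add: gaussian_variable_def)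
  show "prob_space (sample n)" for n by (rule prob_space_sample)
  show "(\<lambda>z. field g n z (grid_point k i)) \<in> borel_measurable (sample n)" for n i by (rule measurable_field_coordinate)
  show "finite ({..k} \<times> {..k})" by simp
  fix c :: "nat \<times> nat \<Rightarrow> real" and d
  have "(\<integral>w. cos ((\<Sum>i\<in>{..k} \<times> {..k}. c i * G w (grid_point k i)) + d) \<partial>N) =
    exp (- (\<Sum>i\<in>{..k} \<times> {..k}. \<Sum>j\<in>{..k} \<times> {..k}. c i * c j * \<Gamma> (grid_point k i) (grid_point k j)) / 2) * cos d"
    by (rule gaussian_process_cos[OF gp]) (use G in \<open>auto simp: continuous_centered_gaussian_def\<close>)
  then show "(\<lambda>n. \<integral>z. cos ((\<Sum>i\<in>{..k} \<times> {..k}. c i * field g n z (grid_point k i)) + d) \<partial>sample n) \<longlonglongrightarrow>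
      (\<integral>w. cos ((\<Sum>i\<in>{..k} \<times> {..k}. c i * G w (grid_point k i)) + d) \<partial>N)"
    by (simp only:) (intro field_cos; simp)
next
  fix e :: real assume e: "e > 0"
  \<comment> \<open>The number of grid points, for the union bound that makes all grid values
    bounded at once.\<close>
  define m where "m = real (card ({..k} \<times> {..k}))"
  have m: "m > 0" unfolding m_def by (simp only: of_nat_0_less_iff card_gt_0_iff) auto
  have "((\<lambda>a. m * (2 * exp (1 - a))) \<longlongrightarrow> 0) at_top" using m by real_asymp
  then have "\<forall>\<^sub>F a in at_top. m * (2 * exp (1 - a)) < e" by (rule order_tendstoD(2)[OF _ e])
  then have "\<forall>\<^sub>F a in at_top. m * (2 * exp (1 - a)) < e \<and> a > 0" by (intro eventually_conj eventually_gt_at_top)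
  then obtain a where a: "m * (2 * exp (1 - a)) < e" "a > 0"
    using eventually_happens'[OF trivial_limit_at_top_linorder] by blast
  show "\<exists>L. \<forall>n. \<exists>A\<in>sets (sample n). 1 - e \<le> measure (sample n) A \<and>
      (\<forall>z\<in>A. \<forall>i\<in>{..k} \<times> {..k}. \<bar>field g n z (grid_point k i)\<bar> \<le> L)"
  proof (intro exI[of _ a] allI)
    fix n
    let ?E = "\<lambda>i. {z \<in> space (sample n). a \<le> \<bar>field g n z (grid_point k i)\<bar>}"
    define S where "S = (\<Union>i\<in>{..k} \<times> {..k}. ?E i)"
    have E: "?E i \<in> sets (sample n)" for i
      by (intro borel_measurable_le borel_measurable_const borel_measurable_abs measurable_field_coordinate)
    have S: "S \<in> sets (sample n)" unfolding S_def by (intro sets.finite_UN E) simp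
    have "measure (sample n) S \<le> (\<Sum>i\<in>{..k} \<times> {..k}. measure (sample n) (?E i))"
      unfolding S_def by (rule measure_UNION_le[OF _ E]) simp
    also have "\<dots> \<le> (\<Sum>i\<in>{..k} \<times> {..k}. 2 * exp (1 - a))"
      by (intro sum_mono field_tail a(2)) simp
    also have "\<dots> = m * (2 * exp (1 - a))" by (simp add: m_def)
    finally have "measure (sample n) S \<le> e" using a(1) by linarith
    then have "1 - e \<le> measure (sample n) (space (sample n) - S)" using sample.prob_compl[OF S] by simp
    moreover have "\<forall>z\<in>space (sample n) - S. \<forall>i\<in>{..k} \<times> {..k}. \<bar>field g n z (grid_point k i)\<bar> \<le> a"
    proof (intro ballI)
      fix z i assume "z \<in> space (sample n) - S" and i: "i \<in> {..k} \<times> {..k}"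
      then have "z \<in> space (sample n)" "z \<notin> ?E i" unfolding S_def by blast+
      then show "\<bar>field g n z (grid_point k i)\<bar> \<le> a" by simp
    qed
    ultimately show "\<exists>A\<in>sets (sample n). 1 - e \<le> measure (sample n) A \<and>
      (\<forall>z\<in>A. \<forall>i\<in>{..k} \<times> {..k}. \<bar>field g n z (grid_point k i)\<bar> \<le> a)"
      using S by (intro bexI[of _ "space (sample n) - S"] conjI sets.compl_sets)
  qed
next
  have in_sk: "path_on_square (grid_path k u) \<in> skorokhod_space" for u
    by (intro path_on_square_in_skorokhod_space quadrant_limits_grid_path k)
  have lip: "\<bar>f (path_on_square (grid_path k u)) - f (path_on_square (grid_path k v))\<bar> \<le> L * (\<Sum>i\<in>{..k} \<times> {..k}. \<bar>u i - v i\<bar>)" for u v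
  proof -
    have "L * skorokhod_dist (path_on_square (grid_path k u)) (path_on_square (grid_path k v)) \<le> L * (\<Sum>i\<in>{..k} \<times> {..k}. \<bar>u i - v i\<bar>)"
      by (rule mult_left_mono[OF grid_path_dist_le[OF k]]) (use L in simp)
    with f[OF in_sk in_sk, of u v] show ?thesis by linarith
  qed
  show "\<bar>f (path_on_square (grid_path k u))\<bar> \<le> B" for u by (rule fK[OF in_sk])
  show "f (path_on_square (grid_path k u)) = f (path_on_square (grid_path k v))"
    if "\<And>i. i \<in> {..k} \<times> {..k} \<Longrightarrow> u i = v i" for u v
    using lip[of u v] that by simp
  show "continuous_on UNIV (\<lambda>u. f (path_on_square (grid_path k u)))"
    unfolding continuous_on_def
  proof
    fix v :: "nat \<times> nat \<Rightarrow> real"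
    have "((\<lambda>u. f (path_on_square (grid_path k u)) - f (path_on_square (grid_path k v))) \<longlongrightarrow> 0) (at v)"
    proof (rule Lim_null_comparison)
      show "\<forall>\<^sub>F u in at v. norm (f (path_on_square (grid_path k u)) - f (path_on_square (grid_path k v))) \<le> L * (\<Sum>i\<in>{..k} \<times> {..k}. \<bar>u i - v i\<bar>)"
        using lip by auto
      have "continuous_on UNIV (\<lambda>u::nat \<times> nat \<Rightarrow> real. L * (\<Sum>i\<in>{..k} \<times> {..k}. \<bar>u i - v i\<bar>))"
        by (intro continuous_on_mult continuous_on_const continuous_on_sum continuous_on_rabs continuous_on_diff
            continuous_on_product_coordinates)
      then have "((\<lambda>u. L * (\<Sum>i\<in>{..k} \<times> {..k}. \<bar>u i - v i\<bar>)) \<longlongrightarrow> L * (\<Sum>i\<in>{..k} \<times> {..k}. \<bar>v i - v i\<bar>)) (at v)"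
        unfolding continuous_on_def by blast
      then show "((\<lambda>u. L * (\<Sum>i\<in>{..k} \<times> {..k}. \<bar>u i - v i\<bar>)) \<longlongrightarrow> 0) (at v)" by simp
    qed
    then show "((\<lambda>u. f (path_on_square (grid_path k u))) \<longlongrightarrow> f (path_on_square (grid_path k v))) (at v within UNIV)"
      using LIM_zero_iff by blast
  qed
qed

text \<open>The discretization error is controlled by \<open>field_modulus\<close> on the side of
  the field, and on the side of the limit by uniform continuity of each path.\<close>

lemma field_converges:
  assumes G: "continuous_centered_gaussian N \<Gamma> G"
  shows "converges_in_distribution skorokhod_topology sample (\<lambda>n z. path_on_square (field g n z)) N (\<lambda>w. path_on_square (G w))"
proof (rule skorokhod.converges_in_distribution_approxI[where X'="\<lambda>k n z. path_on_square (discretize (Suc k) (field g n z))"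
      and Y'="\<lambda>k w. path_on_square (discretize (Suc k) (G w))"])
  have gp: "gaussian_process N unit_square G" and cont: "\<And>w. w \<in> space N \<Longrightarrow> continuous_on unit_square (G w)"
    using G by (auto simp: continuous_centered_gaussian_def)
  then show "prob_space N" by (simp add: gaussian_process_def)
  have "gaussian_variable N (\<lambda>w. \<Sum>q\<in>{p}. 1 * G w q)" if "p \<in> unit_square" for p
    using gp that unfolding gaussian_process_def by (elim conjE allE[of _ "{p}"] allE[of _ "\<lambda>_. 1"]) auto
  then have Gm: "(\<lambda>w. G w p) \<in> borel_measurable N" if "p \<in> unit_square" for p
    using that by (simp add: gaussian_variable_def)
  show "prob_space (sample n)" for n by (rule prob_space_sample)
  show "(\<lambda>z. path_on_square (field g n z)) \<in> sample n \<rightarrow>\<^sub>M borel_of_topology skorokhod_topology" for n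
    by (rule measurable_field_path)
  show "(\<lambda>w. path_on_square (G w)) \<in> N \<rightarrow>\<^sub>M borel_of_topology skorokhod_topology"
    by (rule measurable_continuous_path[OF Gm cont])
  show "(\<lambda>z. path_on_square (discretize (Suc k) (field g n z))) \<in> sample n \<rightarrow>\<^sub>M borel_of_topology skorokhod_topology" for n k
    by (rule measurable_discretize[OF measurable_field_coordinate]) simp
  show "(\<lambda>w. path_on_square (discretize (Suc k) (G w))) \<in> N \<rightarrow>\<^sub>M borel_of_topology skorokhod_topology" for k
    by (rule measurable_discretize[OF Gm]) auto
  show "(\<lambda>k. skorokhod_dist (path_on_square (discretize (Suc k) (G w))) (path_on_square (G w))) \<longlonglongrightarrow> 0"
    if "w \<in> space N" for w
    by (rule discretize_continuous_tendsto[OF cont[OF that]])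
  fix e :: real assume e: "e > 0"
  obtain d n0 where d: "d > 0" "\<And>n. n \<ge> n0 \<Longrightarrow> \<exists>A\<in>sets (sample n). measure (sample n) A \<ge> 1 - e \<and>
    (\<forall>z\<in>A. \<forall>p\<in>unit_square. \<forall>q\<in>unit_square. \<bar>fst p - fst q\<bar> \<le> d \<longrightarrow> \<bar>snd p - snd q\<bar> \<le> d \<longrightarrow>
      \<bar>field g n z p - field g n z q\<bar> \<le> e)"
    using field_modulus[OF e] by blast
  obtain k0 where k0: "1 / real (Suc k0) < d"
    using d(1) reals_Archimedean[of d] by (auto simp: inverse_eq_divide)
  show "\<exists>k0. \<forall>k\<ge>k0. \<exists>n0. \<forall>n\<ge>n0. \<exists>A\<in>sets (sample n). 1 - e \<le> measure (sample n) A \<and>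
      (\<forall>z\<in>A. skorokhod_dist (path_on_square (field g n z)) (path_on_square (discretize (Suc k) (field g n z))) \<le> e)"
  proof (rule exI[of _ k0], intro allI impI, rule exI[of _ n0], intro allI impI)
    fix k n assume k: "k0 \<le> k" and n: "n0 \<le> n"
    obtain A where A: "A \<in> sets (sample n)" "measure (sample n) A \<ge> 1 - e"
      "\<And>z p q. z \<in> A \<Longrightarrow> p \<in> unit_square \<Longrightarrow> q \<in> unit_square \<Longrightarrow> \<bar>fst p - fst q\<bar> \<le> d \<Longrightarrow> \<bar>snd p - snd q\<bar> \<le> d \<Longrightarrow>
        \<bar>field g n z p - field g n z q\<bar> \<le> e"
      using d(2)[OF n] by blast
    have kd: "1 / real (Suc k) \<le> d"
      using k k0 by (intro order_trans[OF _ less_imp_le[OF k0]] divide_left_mono) auto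
    show "\<exists>A\<in>sets (sample n). 1 - e \<le> measure (sample n) A \<and>
      (\<forall>z\<in>A. skorokhod_dist (path_on_square (field g n z)) (path_on_square (discretize (Suc k) (field g n z))) \<le> e)"
    proof (intro bexI[of _ A] conjI ballI A(1,2))
      fix z assume z: "z \<in> A"
      show "skorokhod_dist (path_on_square (field g n z)) (path_on_square (discretize (Suc k) (field g n z))) \<le> e"
      proof (rule skorokhod_dist_le_sup[OF field_path_in])
        show "path_on_square (discretize (Suc k) (field g n z)) \<in> skorokhod_space"
          unfolding discretize_def by (intro path_on_square_in_skorokhod_space quadrant_limits_grid_path) simp
        fix p assume p: "p \<in> unit_square"
        obtain q where q: "q \<in> unit_square" "discretize (Suc k) (field g n z) p = field g n z q"
          "fst q \<le> fst p" "fst p \<le> fst q + 1 / real (Suc k)" "snd q \<le> snd p" "snd p \<le> snd q + 1 / real (Suc k)"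
          using discretize_eq[OF p zero_less_Suc] by blast
        show "\<bar>field g n z p - discretize (Suc k) (field g n z) p\<bar> \<le> e"
          unfolding q(2) by (rule A(3)[OF z p q(1)]) (use q(3-6) kd in linarith)+
      qed
    qed
  qed
next
  fix f :: "(real \<times> real \<Rightarrow> real) \<Rightarrow> real" and L B k
  assume "\<And>x y. x \<in> skorokhod_space \<Longrightarrow> y \<in> skorokhod_space \<Longrightarrow> \<bar>f x - f y\<bar> \<le> L * skorokhod_dist x y" "L > 0"
    "\<And>x. x \<in> skorokhod_space \<Longrightarrow> \<bar>f x\<bar> \<le> B"
  then show "(\<lambda>n. \<integral>z. f (path_on_square (discretize (Suc k) (field g n z))) \<partial>sample n) \<longlonglongrightarrow>
    (\<integral>w. f (path_on_square (discretize (Suc k) (G w))) \<partial>N)"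
    by (intro field_discretized_limit[OF G]) auto
qed

end

subsection \<open>The two kernels\<close>

text \<open>The centered indicator of a rectangle at the origin; its field is the normalized
  bivariate empirical process.\<close>

definition sheet_kernel :: "bool \<Rightarrow> bool \<Rightarrow> real \<Rightarrow> real \<Rightarrow> real" where
  "sheet_kernel a b s t = of_bool (a \<and> b) - s * t"

text \<open>The product of two centered indicators, one for each coordinate. It vanishes in mean
  when either coordinate is averaged, which is why the limit is tied down on the whole
  boundary.\<close>

definition bridge_product :: "bool \<Rightarrow> bool \<Rightarrow> real \<Rightarrow> real \<Rightarrow> real" where
  "bridge_product a b s t = (of_bool a - s) * (of_bool b - t)"

lemma integral_unif2_times:
  fixes f h :: "real \<Rightarrow> real"
  assumes f: "f \<in> borel_measurable borel" "\<And>x. \<bar>f x\<bar> \<le> b" and h: "h \<in> borel_measurable borel" "\<And>x. \<bar>h x\<bar> \<le> b'"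
  shows "(\<integral>x. f (fst x) * h (snd x) \<partial>unif2) = (\<integral>x. f x \<partial>unif) * (\<integral>x. h x \<partial>unif)"
proof -
  interpret UU: pair_sigma_finite unif unif ..
  have m: "(\<lambda>x. f (fst x) * h (snd x)) \<in> borel_measurable (unif \<Otimes>\<^sub>M unif)"
    using f(1) h(1) by measurable
  have b0: "b \<ge> 0" using f(2)[of 0] by linarith
  have "integrable (unif \<Otimes>\<^sub>M unif) (\<lambda>x. f (fst x) * h (snd x))"
    using f(2) h(2) b0 m by (intro unif2.integrable_const_bound[of _ "b * b'", unfolded unif2_def])
      (auto simp: abs_mult intro!: mult_mono)
  then have "(\<integral>x. f (fst x) * h (snd x) \<partial>(unif \<Otimes>\<^sub>M unif)) = (\<integral>x. \<integral>y. f x * h y \<partial>unif \<partial>unif)"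
    using UU.integral_fst'[of "\<lambda>x. f (fst x) * h (snd x)"] by simp
  then show ?thesis by (simp add: unif2_def)
qed

lemma integral_unif_jump:
  assumes "s \<in> {0..1}" shows "(\<integral>x. of_bool (x \<le> s) \<partial>unif) = s"
proof -
  have "(\<integral>x. of_bool (x \<le> s) \<partial>unif) = (\<integral>x. indicator {..s} x \<partial>unif)"
    by (intro Bochner_Integration.integral_cong) (auto simp: indicator_def)
  also have "\<dots> = measure unif {..s}" by simp
  also have "\<dots> = s"
  proof -
    have "{0..1} \<inter> {..s} = {0..s}" using assms by auto
    then show ?thesis using assms by (simp add: unif_def measure_uniform_measure)
  qed
  finally show ?thesis .
qed

lemma of_bool_le_measurable: "(\<lambda>x::real. of_bool (x \<le> s) :: real) \<in> borel_measurable borel"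
proof -
  have "(\<lambda>x::real. of_bool (x \<le> s) :: real) = indicator {..s}" by (auto simp: indicator_def fun_eq_iff)
  then show ?thesis by simp
qed

lemma integrable_unif_jump: "integrable unif (\<lambda>x. of_bool (x \<le> s) :: real)"
  by (rule unif.integrable_const_bound[of _ 1]) (auto simp: of_bool_le_measurable measurable_cong_sets[OF sets_unif refl])

lemma integral_unif_centered:
  assumes "s \<in> {0..1}" "s' \<in> {0..1}"
  shows "(\<integral>x. of_bool (x \<le> s) - s \<partial>unif) = 0"
    "(\<integral>x. (of_bool (x \<le> s) - s) * (of_bool (x \<le> s') - s') \<partial>unif) = min s s' - s * s'"
proof -
  have [simp]: "measure unif UNIV = 1" using unif.prob_space by simp
  show "(\<integral>x. of_bool (x \<le> s) - s \<partial>unif) = 0"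
    using integral_unif_jump[OF assms(1)] integrable_unif_jump[of s] by simp
  have "(\<integral>x. (of_bool (x \<le> s) - s) * (of_bool (x \<le> s') - s') \<partial>unif) =
      (\<integral>x. of_bool (x \<le> min s s') - s' * of_bool (x \<le> s) - s * of_bool (x \<le> s') + s * s' \<partial>unif)"
    by (intro Bochner_Integration.integral_cong) (auto simp: algebra_simps)
  also have "\<dots> = min s s' - s * s'"
    using integral_unif_jump[OF assms(1)] integral_unif_jump[OF assms(2)] integral_unif_jump[of "min s s'"] assms
      integrable_unif_jump[of s] integrable_unif_jump[of s'] integrable_unif_jump[of "min s s'"]
    by (simp del: min.bounded_iff)
  finally show "(\<integral>x. (of_bool (x \<le> s) - s) * (of_bool (x \<le> s') - s') \<partial>unif) = min s s' - s * s'" .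
qed

lemma abs_product_diff_le:
  fixes a b a' b' :: real
  assumes "\<bar>b\<bar> \<le> 1" "\<bar>a'\<bar> \<le> 1"
  shows "\<bar>a * b - a' * b'\<bar> \<le> \<bar>a - a'\<bar> + \<bar>b - b'\<bar>"
proof -
  have "a * b - a' * b' = (a - a') * b + a' * (b - b')" by (simp add: algebra_simps)
  then have "\<bar>a * b - a' * b'\<bar> \<le> \<bar>(a - a') * b\<bar> + \<bar>a' * (b - b')\<bar>" by simp
  also have "\<dots> \<le> \<bar>a - a'\<bar> * 1 + 1 * \<bar>b - b'\<bar>"
    unfolding abs_mult using assms by (intro add_mono mult_mono) auto
  finally show ?thesis by simp
qed

text \<open>Mean and covariance factor over the two independent coordinates, each factor being that
  of a one-dimensional Brownian bridge.\<close>

interpretation bridge: bridge_kernel bridge_product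
  "\<lambda>(s, t) (s', t'). (min s s' - s * s') * (min t t' - t * t')"
proof
  fix s t s' t' :: real and a b a' b' :: bool
  assume st: "s \<in> {0..1}" "t \<in> {0..1}"
  show "\<bar>bridge_product a b s t\<bar> \<le> 1"
    using st unfolding bridge_product_def abs_mult by (intro mult_le_one) auto
  have "\<bar>(of_bool a - s) * (of_bool b - t) - (of_bool a' - s) * (of_bool b' - t)\<bar> \<le>
      \<bar>(of_bool a - s) - (of_bool a' - s)\<bar> + \<bar>(of_bool b - t) - (of_bool b' - t)\<bar>"
    using st by (intro abs_product_diff_le) auto
  then show "\<bar>bridge_product a b s t - bridge_product a' b' s t\<bar> \<le> of_bool (a \<noteq> a') + of_bool (b \<noteq> b')"
    unfolding bridge_product_def by (auto split: if_splits)
  assume st': "s' \<in> {0..1}" "t' \<in> {0..1}"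
  have "\<bar>(of_bool a - s) * (of_bool b - t) - (of_bool a - s') * (of_bool b - t')\<bar> \<le>
      \<bar>(of_bool a - s) - (of_bool a - s')\<bar> + \<bar>(of_bool b - t) - (of_bool b - t')\<bar>"
    using st st' by (intro abs_product_diff_le) auto
  then show "\<bar>bridge_product a b s t - bridge_product a b s' t'\<bar> \<le> \<bar>s - s'\<bar> + \<bar>t - t'\<bar>"
    unfolding bridge_product_def by (simp add: abs_minus_commute)
next
  fix p q :: "real \<times> real" assume p: "p \<in> unit_square"
  obtain s t where st: "p = (s, t)" "s \<in> {0..1}" "t \<in> {0..1}" using p by (auto simp: unit_square_def)
  have m: "(\<lambda>x::real. of_bool (x \<le> s) - s :: real) \<in> borel_measurable borel" for s
    by (intro borel_measurable_diff of_bool_le_measurable borel_measurable_const)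
  have b: "\<bar>of_bool (x \<le> s) - s\<bar> \<le> 1" if "s \<in> {0..1}" for x s :: real using that by auto
  show "(\<integral>x. kern bridge_product x p \<partial>unif2) = 0"
    using integral_unif2_times[of "\<lambda>x. of_bool (x \<le> s) - s" 1 "\<lambda>x. of_bool (x \<le> t) - t" 1] m b st integral_unif_centered(1)[OF st(2) st(2)]
    by (simp add: kern_def bridge_product_def)
  assume q: "q \<in> unit_square"
  obtain s' t' where st': "q = (s', t')" "s' \<in> {0..1}" "t' \<in> {0..1}" using q by (auto simp: unit_square_def)
  have "(\<integral>x. kern bridge_product x p * kern bridge_product x q \<partial>unif2) =
      (\<integral>x. ((of_bool (fst x \<le> s) - s) * (of_bool (fst x \<le> s') - s')) * ((of_bool (snd x \<le> t) - t) * (of_bool (snd x \<le> t') - t')) \<partial>unif2)"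
    by (simp add: kern_def bridge_product_def st(1) st'(1) ac_simps)
  also have "\<dots> = (\<integral>x. (of_bool (x \<le> s) - s) * (of_bool (x \<le> s') - s') \<partial>unif) * (\<integral>x. (of_bool (x \<le> t) - t) * (of_bool (x \<le> t') - t') \<partial>unif)"
    using m b st st' by (intro integral_unif2_times[where b=1 and b'=1] borel_measurable_times) (auto simp: abs_mult intro!: mult_le_one)
  finally show "(\<integral>x. kern bridge_product x p * kern bridge_product x q \<partial>unif2) =
    (\<lambda>(s, t) (s', t'). (min s s' - s * s') * (min t t' - t * t')) p q"
    using integral_unif_centered(2)[OF st(2) st'(2)] integral_unif_centered(2)[OF st(3) st'(3)] by (simp add: st(1) st'(1))
qed

lemma integral_unif2_jump:
  assumes "s \<in> {0..1}" "t \<in> {0..1}"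
  shows "(\<integral>x. of_bool (fst x \<le> s \<and> snd x \<le> t) \<partial>unif2) = s * t"
    "integrable unif2 (\<lambda>x. of_bool (fst x \<le> s \<and> snd x \<le> t) :: real)"
proof -
  have eq: "of_bool (fst x \<le> s \<and> snd x \<le> t) = (of_bool (fst x \<le> s) * of_bool (snd x \<le> t) :: real)" for x :: "real \<times> real" by simp
  show "(\<integral>x. of_bool (fst x \<le> s \<and> snd x \<le> t) \<partial>unif2) = s * t"
    unfolding eq using integral_unif2_times[of "\<lambda>x. of_bool (x \<le> s)" 1 "\<lambda>x. of_bool (x \<le> t)" 1] assms
    by (simp add: of_bool_le_measurable integral_unif_jump)
  have "(\<lambda>x::real \<times> real. of_bool (fst x \<le> s) * of_bool (snd x \<le> t) :: real) \<in> borel_measurable (borel \<Otimes>\<^sub>M borel)"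
    by (intro borel_measurable_times measurable_compose[OF measurable_fst of_bool_le_measurable]
        measurable_compose[OF measurable_snd of_bool_le_measurable])
  then show "integrable unif2 (\<lambda>x. of_bool (fst x \<le> s \<and> snd x \<le> t) :: real)"
    unfolding eq by (intro unif2.integrable_const_bound[of _ 1]) (auto simp: borel_prod measurable_cong_sets[OF sets_unif2 refl])
qed

interpretation sheet: bridge_kernel sheet_kernel
  "\<lambda>(s, t) (s', t'). min s s' * min t t' - s * s' * t * t'"
proof
  fix s t s' t' :: real and a b a' b' :: bool
  assume st: "s \<in> {0..1}" "t \<in> {0..1}"
  have "0 \<le> s * t" "s * t \<le> 1" using st by (auto intro: mult_le_one)
  then show "\<bar>sheet_kernel a b s t\<bar> \<le> 1" by (auto simp: sheet_kernel_def)
  show "\<bar>sheet_kernel a b s t - sheet_kernel a' b' s t\<bar> \<le> of_bool (a \<noteq> a') + of_bool (b \<noteq> b')"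
    by (auto simp: sheet_kernel_def)
  assume st': "s' \<in> {0..1}" "t' \<in> {0..1}"
  have "\<bar>s * t - s' * t'\<bar> \<le> \<bar>s - s'\<bar> + \<bar>t - t'\<bar>"
    using st st' by (intro abs_product_diff_le) auto
  then show "\<bar>sheet_kernel a b s t - sheet_kernel a b s' t'\<bar> \<le> \<bar>s - s'\<bar> + \<bar>t - t'\<bar>"
    unfolding sheet_kernel_def by (simp add: abs_minus_commute)
next
  fix p q :: "real \<times> real" assume p: "p \<in> unit_square"
  obtain s t where st: "p = (s, t)" "s \<in> {0..1}" "t \<in> {0..1}" using p by (auto simp: unit_square_def)
  show "(\<integral>x. kern sheet_kernel x p \<partial>unif2) = 0"
    using integral_unif2_jump[OF st(2,3)] by (simp add: kern_def sheet_kernel_def st(1))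
  assume q: "q \<in> unit_square"
  obtain s' t' where st': "q = (s', t')" "s' \<in> {0..1}" "t' \<in> {0..1}" using q by (auto simp: unit_square_def)
  have mm: "min s s' \<in> {0..1}" "min t t' \<in> {0..1}" using st st' by auto
  have "(\<integral>x. kern sheet_kernel x p * kern sheet_kernel x q \<partial>unif2) =
    (\<integral>x. of_bool (fst x \<le> min s s' \<and> snd x \<le> min t t') - s' * t' * of_bool (fst x \<le> s \<and> snd x \<le> t)
       - s * t * of_bool (fst x \<le> s' \<and> snd x \<le> t') + s * t * (s' * t') \<partial>unif2)"
    by (intro Bochner_Integration.integral_cong) (auto simp: kern_def sheet_kernel_def st(1) st'(1) algebra_simps)
  also have "\<dots> = min s s' * min t t' - s * s' * t * t'"
    using integral_unif2_jump[OF st(2,3)] integral_unif2_jump[OF st'(2,3)] integral_unif2_jump[OF mm] by simp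
  finally show "(\<integral>x. kern sheet_kernel x p * kern sheet_kernel x q \<partial>unif2) =
    (\<lambda>(s, t) (s', t'). min s s' * min t t' - s * s' * t * t') p q" by (simp add: st(1) st'(1))
qed

subsection \<open>The law of the sample seen through the permutation\<close>

text \<open>Convergence in distribution sees only the laws, so a process that is a function of a
  variable with law \<open>P n\<close> may be studied on the canonical space.\<close>

lemma converges_in_distribution_transfer:
  assumes V: "\<And>n. V n \<in> M n \<rightarrow>\<^sub>M P n" and D: "\<And>n. distr (M n) (P n) (V n) = P n"
    and eq: "\<And>n w. w \<in> space (M n) \<Longrightarrow> X n w = H n (V n w)"
    and conv: "converges_in_distribution S P H N Y"
  shows "converges_in_distribution S M X N Y"
proof -
  have H: "H n \<in> P n \<rightarrow>\<^sub>M borel_of_topology S" for n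
    using conv by (simp add: converges_in_distribution_def)
  have "(\<lambda>w. H n (V n w)) \<in> M n \<rightarrow>\<^sub>M borel_of_topology S" for n
    by (rule measurable_compose[OF V H])
  then have X: "X n \<in> M n \<rightarrow>\<^sub>M borel_of_topology S" for n
    by (subst measurable_cong[of "M n" "X n" "\<lambda>w. H n (V n w)"]) (auto simp: eq)
  have int: "(\<integral>w. f (X n w) \<partial>M n) = (\<integral>z. f (H n z) \<partial>P n)" if "continuous_map S euclideanreal f" for f n
  proof -
    have "(\<integral>w. f (X n w) \<partial>M n) = (\<integral>w. f (H n (V n w)) \<partial>M n)"
      by (intro Bochner_Integration.integral_cong) (auto simp: eq)
    also have "\<dots> = (\<integral>z. f (H n z) \<partial>distr (M n) (P n) (V n))"
      by (rule integral_distr[symmetric, OF V measurable_compose[OF H continuous_map_borel_measurable[OF that]]])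
    finally show ?thesis by (simp add: D)
  qed
  show ?thesis
    using conv X unfolding converges_in_distribution_def by (auto simp: int)
qed

text \<open>A product of identical factors is invariant under reindexing, applied to the second
  vector only.\<close>

lemma distr_sample_permute:
  assumes p: "\<sigma> permutes {1..n}"
  shows "(\<lambda>z. (fst z, \<lambda>i\<in>{1..n}. snd z (\<sigma> i))) \<in> sample n \<rightarrow>\<^sub>M sample n"
    and "distr (sample n) (sample n) (\<lambda>z. (fst z, \<lambda>i\<in>{1..n}. snd z (\<sigma> i))) = sample n"
proof -
  let ?P = "Pi\<^sub>M {1..n} (\<lambda>_. unif)" and ?g = "\<lambda>c. \<lambda>i\<in>{1..n}. c (\<sigma> i)"
  have im: "\<sigma> i \<in> {1..n}" if "i \<in> {1..n}" for i using permutes_in_image[OF p] that by blast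
  have g: "?g \<in> ?P \<rightarrow>\<^sub>M ?P"
    by (rule measurable_restrict) (rule measurable_component_singleton[OF im])
  have d: "distr ?P ?P ?g = ?P"
    by (rule distr_PiM_reindex[where K="{1..n}" and M="\<lambda>_. unif"])
      (use prob_space_unif permutes_inj_on[OF p] im in auto)
  interpret P: prob_space ?P by (intro prob_space_PiM prob_space_unif)
  have eq: "(\<lambda>z. (fst z, \<lambda>i\<in>{1..n}. snd z (\<sigma> i))) = (\<lambda>(r, c). (r, ?g c))" by auto
  show "(\<lambda>z. (fst z, \<lambda>i\<in>{1..n}. snd z (\<sigma> i))) \<in> sample n \<rightarrow>\<^sub>M sample n"
    unfolding sample_def by (intro measurable_Pair measurable_fst measurable_compose[OF measurable_snd g])
  have "distr (sample n) (sample n) (\<lambda>(r, c). (r, ?g c)) = distr ?P ?P (\<lambda>r. r) \<Otimes>\<^sub>M distr ?P ?P ?g"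
    unfolding sample_def
  proof (rule pair_measure_distr[symmetric, OF _ g])
    show "(\<lambda>r. r) \<in> ?P \<rightarrow>\<^sub>M ?P" by simp
    show "sigma_finite_measure (distr ?P ?P ?g)"
      unfolding d by (rule prob_space_imp_sigma_finite[OF P.prob_space_axioms])
  qed
  also have "\<dots> = sample n" by (simp only: d distr_id sample_def)
  finally show "distr (sample n) (sample n) (\<lambda>z. (fst z, \<lambda>i\<in>{1..n}. snd z (\<sigma> i))) = sample n" unfolding eq .
qed

lemma (in prob_space) distr_iid_unif:
  assumes ind: "indep_vars (\<lambda>_. borel) X {1..n::nat}"
    and u: "\<And>i. i \<in> {1..n} \<Longrightarrow> distr M borel (X i) = unif"
  shows "distr M (Pi\<^sub>M {1..n} (\<lambda>_. borel)) (\<lambda>w. \<lambda>i\<in>{1..n}. X i w) = Pi\<^sub>M {1..n} (\<lambda>_. unif)"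
proof (cases "n = 0")
  \<comment> \<open>The description of independence by the product law is used for a nonempty index
    set. For the empty one both laws sit on the single function that is \<open>undefined\<close>
    everywhere.\<close>
  case True
  interpret U: prob_space "Pi\<^sub>M ({} :: nat set) (\<lambda>_. unif)" by (intro prob_space_PiM prob_space_unif)
  interpret D: prob_space "distr M (Pi\<^sub>M ({} :: nat set) (\<lambda>_. borel :: real measure)) (\<lambda>w. \<lambda>i\<in>{}. X i w)"
    by (rule prob_space_distr, rule measurable_restrict) simp
  have "distr M (Pi\<^sub>M {} (\<lambda>_. borel)) (\<lambda>w. \<lambda>i\<in>{}. X i w) = Pi\<^sub>M {} (\<lambda>_. unif)"
  proof (rule measure_eqI)
    show "sets (distr M (Pi\<^sub>M {} (\<lambda>_. borel)) (\<lambda>w. \<lambda>i\<in>{}. X i w)) = sets (Pi\<^sub>M {} (\<lambda>_. unif))"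
      by (simp add: sets_PiM_empty)
    fix A assume "A \<in> sets (distr M (Pi\<^sub>M {} (\<lambda>_. borel)) (\<lambda>w. \<lambda>i\<in>{}. X i w))"
    then consider "A = {}" | "A = {\<lambda>_. undefined}" by (auto simp: sets_PiM_empty)
    then show "emeasure (distr M (Pi\<^sub>M {} (\<lambda>_. borel)) (\<lambda>w. \<lambda>i\<in>{}. X i w)) A = emeasure (Pi\<^sub>M {} (\<lambda>_. unif)) A"
      using U.emeasure_space_1 D.emeasure_space_1 by cases (auto simp: space_PiM)
  qed
  then show ?thesis using True by simp
next
  case False
  have "distr M (Pi\<^sub>M {1..n} (\<lambda>_. borel)) (\<lambda>w. \<lambda>i\<in>{1..n}. X i w) = Pi\<^sub>M {1..n} (\<lambda>i. distr M borel (X i))"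
    using indep_vars_iff_distr_eq_PiM'[where I="{1..n}" and M'="\<lambda>_. borel" and X=X] ind False by (auto simp: indep_vars_def)
  also have "\<dots> = Pi\<^sub>M {1..n} (\<lambda>_. unif)" by (intro PiM_cong refl u)
  finally show ?thesis .
qed

text \<open>On the event that the permutation equals a fixed \<sigma>, the vector is the original
  sample with columns permuted by \<sigma>, which has the same law; that event is independent of the
  sample. Summing over the finitely many \<sigma> gives the claim.\<close>

lemma (in prob_space) permuted_sample_law:
  fixes R C :: "nat \<Rightarrow> 'a \<Rightarrow> real" and \<pi> :: "'a \<Rightarrow> nat \<Rightarrow> nat"
  assumes pm: "\<pi> \<in> M \<rightarrow>\<^sub>M count_space {p. p permutes {1..n}}"
    and R: "indep_vars (\<lambda>_. borel) R {1..n}" "\<And>i. i \<in> {1..n} \<Longrightarrow> distr M borel (R i) = unif"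
    and C: "indep_vars (\<lambda>_. borel) C {1..n}" "\<And>i. i \<in> {1..n} \<Longrightarrow> distr M borel (C i) = unif"
    and RC: "indep_var (Pi\<^sub>M {1..n} (\<lambda>_. borel)) (\<lambda>w. \<lambda>i\<in>{1..n}. R i w)
          (Pi\<^sub>M {1..n} (\<lambda>_. borel)) (\<lambda>w. \<lambda>j\<in>{1..n}. C j w)"
    and ind: "independent_variables M
          (Pi\<^sub>M {1..n} (\<lambda>_. borel) \<Otimes>\<^sub>M Pi\<^sub>M {1..n} (\<lambda>_. borel))
          (\<lambda>w. (\<lambda>i\<in>{1..n}. R i w, \<lambda>j\<in>{1..n}. C j w))
          (Pi\<^sub>M ({1..n} \<times> {1..n}) (\<lambda>_. borel))
          (\<lambda>w. \<lambda>(i, j)\<in>{1..n} \<times> {1..n}. perm_matrix (\<pi> w) i j)"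
  shows "(\<lambda>w. (\<lambda>i\<in>{1..n}. R i w, \<lambda>i\<in>{1..n}. C (\<pi> w i) w)) \<in> M \<rightarrow>\<^sub>M sample n"
    and "distr M (sample n) (\<lambda>w. (\<lambda>i\<in>{1..n}. R i w, \<lambda>i\<in>{1..n}. C (\<pi> w i) w)) = sample n"
proof -
  define I where "I = {1..n}"
  define P where "P = {p. p permutes I}"
  define S where "S = Pi\<^sub>M I (\<lambda>_. borel :: real measure)"
  define Z where "Z w = (\<lambda>i\<in>I. R i w, \<lambda>j\<in>I. C j w)" for w
  define V where "V w = (\<lambda>i\<in>I. R i w, \<lambda>i\<in>I. C (\<pi> w i) w)" for w
  define T where "T \<sigma> z = (fst z, \<lambda>i\<in>I. snd z (\<sigma> i))" for \<sigma> :: "nat \<Rightarrow> nat" and z :: "(nat \<Rightarrow> real) \<times> (nat \<Rightarrow> real)"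
  have P: "finite P" unfolding P_def I_def by (rule finite_permutations) simp
  have pi: "\<pi> w \<in> P" if "w \<in> space M" for w
    using measurable_space[OF pm that] by (simp add: P_def I_def)
  have sets_S: "sets (sample n) = sets (S \<Otimes>\<^sub>M S)" unfolding S_def I_def by (rule sets_sample)
  have Zm: "Z \<in> M \<rightarrow>\<^sub>M sample n"
    using ind unfolding independent_variables_def Z_def S_def I_def
    by (simp add: measurable_cong_sets[OF refl sets_sample])
  have "distr M (S \<Otimes>\<^sub>M S) Z = distr M S (\<lambda>w. \<lambda>i\<in>I. R i w) \<Otimes>\<^sub>M distr M S (\<lambda>w. \<lambda>j\<in>I. C j w)"
    using RC unfolding indep_var_distribution_eq Z_def S_def I_def by simp
  also have "\<dots> = sample n"
    using distr_iid_unif[OF R] distr_iid_unif[OF C] by (simp add: S_def I_def sample_def)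
  finally have ZD: "distr M (sample n) Z = sample n"
    using sets_S by (metis distr_cong)
  have TV: "V w = T (\<pi> w) (Z w)" if "w \<in> space M" for w
  proof -
    have "\<pi> w i \<in> I" if "i \<in> I" for i
      using pi[OF \<open>w \<in> space M\<close>] that permutes_in_image[of "\<pi> w" I i] by (simp add: P_def)
    then show ?thesis by (auto simp: V_def T_def Z_def intro!: restrict_ext)
  qed
  have Tm: "T \<sigma> \<in> sample n \<rightarrow>\<^sub>M sample n" and TD: "distr (sample n) (sample n) (T \<sigma>) = sample n" if "\<sigma> \<in> P" for \<sigma>
    using distr_sample_permute[of \<sigma> n] that unfolding T_def[abs_def] P_def I_def by auto
  have pm': "\<pi> \<in> M \<rightarrow>\<^sub>M count_space P" using pm by (simp add: P_def I_def)
  have "(\<lambda>w. T (\<pi> w) (Z w)) \<in> M \<rightarrow>\<^sub>M sample n"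
    by (rule measurable_compose_countable'[where f="\<lambda>\<sigma> w. T \<sigma> (Z w)", OF measurable_compose[OF Zm Tm] pm'])
      (auto intro: countable_finite P)
  then have Vm: "V \<in> M \<rightarrow>\<^sub>M sample n"
    by (subst measurable_cong[of M V "\<lambda>w. T (\<pi> w) (Z w)"]) (auto simp: TV)
  have event: "{w \<in> space M. \<pi> w = \<sigma>} \<in> events" for \<sigma>
  proof (cases "\<sigma> \<in> P")
    case True
    then have "\<pi> -` {\<sigma>} \<inter> space M \<in> events" by (intro measurable_sets[OF pm']) auto
    also have "\<pi> -` {\<sigma>} \<inter> space M = {w \<in> space M. \<pi> w = \<sigma>}" by auto
    finally show ?thesis .
  next
    case False
    then have "{w \<in> space M. \<pi> w = \<sigma>} = {}" using pi by auto
    then show ?thesis by (simp only: sets.empty_sets)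
  qed
  have split: "prob E = (\<Sum>\<sigma>\<in>P. prob (E \<inter> {w \<in> space M. \<pi> w = \<sigma>}))" if E: "E \<in> events" for E
  proof -
    have "E = (\<Union>\<sigma>\<in>P. E \<inter> {w \<in> space M. \<pi> w = \<sigma>})"
      using pi sets.sets_into_space[OF E] by auto
    then have "prob E = prob (\<Union>\<sigma>\<in>P. E \<inter> {w \<in> space M. \<pi> w = \<sigma>})" by (rule arg_cong)
    also have "\<dots> = (\<Sum>\<sigma>\<in>P. prob (E \<inter> {w \<in> space M. \<pi> w = \<sigma>}))"
      by (rule finite_measure_finite_Union[OF P]) (use E event in \<open>auto simp: disjoint_family_on_def\<close>)
    finally show ?thesis .
  qed
  have indep: "prob ({w \<in> space M. Z w \<in> A} \<inter> {w \<in> space M. \<pi> w = \<sigma>}) = prob {w \<in> space M. Z w \<in> A} * prob {w \<in> space M. \<pi> w = \<sigma>}"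
    if A: "A \<in> sets (sample n)" and s: "\<sigma> \<in> P" for A \<sigma>
  proof -
    \<comment> \<open>Independence is assumed for the matrix and not for the permutation. As a
      permutation is determined by its matrix, the event \<open>\<pi> w = \<sigma>\<close> is the
      preimage of this measurable box.\<close>
    define B where "B = (PiE (I \<times> I) (\<lambda>(i, j). {perm_matrix \<sigma> i j}))"
    have B: "B \<in> sets (Pi\<^sub>M (I \<times> I) (\<lambda>_. borel))"
      unfolding B_def by (rule sets_PiM_I_finite) (auto simp: I_def)
    let ?U = "\<lambda>w. \<lambda>(i, j)\<in>I \<times> I. perm_matrix (\<pi> w) i j"
    have "?U w \<in> B \<longleftrightarrow> \<pi> w = \<sigma>" if w: "w \<in> space M" for w
    proof
      assume "?U w \<in> B"
      then have U: "perm_matrix (\<pi> w) i j = perm_matrix \<sigma> i j" if "i \<in> I" "j \<in> I" for i j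
        using that by (auto simp: B_def PiE_iff)
      show "\<pi> w = \<sigma>"
      proof
        fix i
        have p: "\<pi> w permutes I" "\<sigma> permutes I" using pi[OF w] s by (auto simp: P_def)
        show "\<pi> w i = \<sigma> i"
        proof (cases "i \<in> I")
          case True
          then have "\<pi> w i \<in> I" using permutes_in_image[OF p(1)] by blast
          from U[OF True this] show ?thesis by (simp add: perm_matrix_def split: if_splits)
        next
          case False
          then show ?thesis using p by (simp add: permutes_not_in)
        qed
      qed
    next
      assume "\<pi> w = \<sigma>"
      then show "?U w \<in> B" by (auto simp: B_def PiE_iff)
    qed
    then have eq: "{w \<in> space M. \<pi> w = \<sigma>} = ?U -` B \<inter> space M" by auto
    have eq': "{w \<in> space M. Z w \<in> A} = Z -` A \<inter> space M" by auto
    have A': "A \<in> sets (S \<Otimes>\<^sub>M S)" using A sets_S by simp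
    have "indep_set {Z -` A \<inter> space M |A. A \<in> sets (S \<Otimes>\<^sub>M S)} {?U -` A \<inter> space M |A. A \<in> sets (Pi\<^sub>M (I \<times> I) (\<lambda>_. borel))}"
      using ind unfolding independent_variables_def Z_def S_def I_def by blast
    then show ?thesis
      unfolding eq eq' by (rule indep_setD) (use A' B in blast)+
  qed
  show "(\<lambda>w. (\<lambda>i\<in>{1..n}. R i w, \<lambda>i\<in>{1..n}. C (\<pi> w i) w)) \<in> M \<rightarrow>\<^sub>M sample n"
    using Vm unfolding V_def[abs_def] I_def .
  have "distr M (sample n) V = sample n"
  proof (rule measure_eqI)
    fix A assume "A \<in> sets (distr M (sample n) V)"
    then have A: "A \<in> sets (sample n)" by simp
    have prob_T: "prob {w \<in> space M. T \<sigma> (Z w) \<in> A} = measure (sample n) A" if s: "\<sigma> \<in> P" for \<sigma>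
    proof -
      have "prob {w \<in> space M. T \<sigma> (Z w) \<in> A} = measure (distr M (sample n) (\<lambda>w. T \<sigma> (Z w))) A"
        using measurable_compose[OF Zm Tm[OF s]] A by (subst measure_distr) (auto intro!: arg_cong[where f=prob])
      also have "distr M (sample n) (\<lambda>w. T \<sigma> (Z w)) = distr (distr M (sample n) Z) (sample n) (T \<sigma>)"
        using distr_distr[OF Tm[OF s] Zm] by (simp add: o_def)
      finally show ?thesis by (simp add: ZD TD[OF s])
    qed
    have VA: "{w \<in> space M. V w \<in> A} \<in> events" using measurable_sets[OF Vm A] by (simp add: vimage_def Int_def conj_commute)
    have "prob {w \<in> space M. V w \<in> A} = (\<Sum>\<sigma>\<in>P. prob ({w \<in> space M. V w \<in> A} \<inter> {w \<in> space M. \<pi> w = \<sigma>}))"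
      by (rule split[OF VA])
    also have "\<dots> = (\<Sum>\<sigma>\<in>P. measure (sample n) A * prob {w \<in> space M. \<pi> w = \<sigma>})"
    proof (rule sum.cong[OF refl])
      fix \<sigma> assume s: "\<sigma> \<in> P"
      have TA: "T \<sigma> -` A \<inter> space (sample n) \<in> sets (sample n)" by (rule measurable_sets[OF Tm[OF s] A])
      have Zs: "Z w \<in> space (sample n)" if "w \<in> space M" for w using measurable_space[OF Zm that] .
      have "{w \<in> space M. V w \<in> A} \<inter> {w \<in> space M. \<pi> w = \<sigma>} =
          {w \<in> space M. Z w \<in> T \<sigma> -` A \<inter> space (sample n)} \<inter> {w \<in> space M. \<pi> w = \<sigma>}"
        using TV Zs by auto
      then have "prob ({w \<in> space M. V w \<in> A} \<inter> {w \<in> space M. \<pi> w = \<sigma>}) =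
          prob {w \<in> space M. Z w \<in> T \<sigma> -` A \<inter> space (sample n)} * prob {w \<in> space M. \<pi> w = \<sigma>}"
        using indep[OF TA s] by simp
      also have "{w \<in> space M. Z w \<in> T \<sigma> -` A \<inter> space (sample n)} = {w \<in> space M. T \<sigma> (Z w) \<in> A}" using Zs by auto
      finally show "prob ({w \<in> space M. V w \<in> A} \<inter> {w \<in> space M. \<pi> w = \<sigma>}) = measure (sample n) A * prob {w \<in> space M. \<pi> w = \<sigma>}"
        by (simp add: prob_T[OF s])
    qed
    also have "\<dots> = measure (sample n) A * prob (space M)"
      unfolding split[OF sets.top] by (simp add: sum_distrib_left Int_absorb1[of "{w \<in> space M. _ w}"] Int_def)
    also have "\<dots> = measure (sample n) A" by (simp add: prob_space)
    finally have "prob {w \<in> space M. V w \<in> A} = measure (sample n) A" .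
    then show "emeasure (distr M (sample n) V) A = emeasure (sample n) A"
      using A Vm by (simp add: emeasure_distr emeasure_eq_measure sample.emeasure_eq_measure vimage_def Int_def conj_commute)
  qed simp
  then show "distr M (sample n) (\<lambda>w. (\<lambda>i\<in>{1..n}. R i w, \<lambda>i\<in>{1..n}. C (\<pi> w i) w)) = sample n"
    unfolding V_def[abs_def] I_def .
qed

subsection \<open>Ranks\<close>

text \<open>The value \<open>i\<close> outside \<open>{1..n}\<close> is the convention of
  \<open>permutes\<close>. The count includes \<open>i\<close> itself, so ranks start at
  \<open>1\<close>.\<close>

definition rank :: "nat \<Rightarrow> (nat \<Rightarrow> real) \<Rightarrow> nat \<Rightarrow> nat" where
  "rank n r i = (if i \<in> {1..n} then card {j \<in> {1..n}. r j \<le> r i} else i)"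

lemma rank_le_iff:
  assumes "i \<in> {1..n}" "j \<in> {1..n}"
  shows "rank n r i \<le> rank n r j \<longleftrightarrow> r i \<le> r j"
proof -
  have mono: "card {k \<in> {1..n}. r k \<le> a} \<le> card {k \<in> {1..n}. r k \<le> b}" if "a \<le> b" for a b
    using that by (intro card_mono) auto
  have "card {k \<in> {1..n}. r k \<le> r j} < card {k \<in> {1..n}. r k \<le> r i}" if "r j < r i"
  proof (rule psubset_card_mono)
    have "i \<in> {k \<in> {1..n}. r k \<le> r i}" "i \<notin> {k \<in> {1..n}. r k \<le> r j}" using that assms by auto
    moreover have "{k \<in> {1..n}. r k \<le> r j} \<subseteq> {k \<in> {1..n}. r k \<le> r i}" using that by auto
    ultimately show "{k \<in> {1..n}. r k \<le> r j} \<subset> {k \<in> {1..n}. r k \<le> r i}" by blast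
  qed simp
  note strict = this
  show ?thesis
  proof (cases "r i \<le> r j")
    case True
    then show ?thesis using mono[OF True] assms by (simp add: rank_def)
  next
    case False
    then show ?thesis using strict assms by (simp add: rank_def)
  qed
qed

lemma rank_permutes:
  assumes "inj_on r {1..n}" shows "rank n r permutes {1..n}"
proof (rule bij_imp_permutes)
  have "rank n r ` {1..n} \<subseteq> {1..n}"
  proof
    fix k assume "k \<in> rank n r ` {1..n}"
    then obtain i where i: "i \<in> {1..n}" "k = card {j \<in> {1..n}. r j \<le> r i}" by (auto simp: rank_def)
    have "card {j \<in> {1..n}. r j \<le> r i} \<le> card {1..n}" by (rule card_mono) auto
    moreover have "card {j \<in> {1..n}. r j \<le> r i} > 0" using i(1) by (auto simp: card_gt_0_iff)
    ultimately have "k > 0" "k \<le> n" unfolding i(2) by simp_all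
    then show "k \<in> {1..n}" by simp
  qed
  moreover have "inj_on (rank n r) {1..n}"
  proof (rule inj_onI)
    fix i j assume ij: "i \<in> {1..n}" "j \<in> {1..n}" "rank n r i = rank n r j"
    then have "r i = r j" using rank_le_iff[of i n j r] rank_le_iff[of j n i r] by simp
    then show "i = j" by (rule inj_onD[OF assms _ ij(1,2)])
  qed
  ultimately show "bij_betw (rank n r) {1..n} {1..n}"
    by (simp add: bij_betw_def endo_inj_surj)
qed (auto simp: rank_def)

text \<open>A rank counts points below a given one, and a permutation merely renames the points
  counted.\<close>

lemma rank_restrict_permute:
  assumes "\<tau> permutes {1..n}" "i \<in> {1..n}"
  shows "rank n (\<lambda>i\<in>{1..n}. c (\<tau> i)) i = rank n c (\<tau> i)"
proof -
  have ti: "\<tau> i \<in> {1..n}" using permutes_in_image[OF assms(1)] assms(2) by blast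
  have "bij_betw \<tau> {j \<in> {1..n}. c (\<tau> j) \<le> c (\<tau> i)} {j \<in> {1..n}. c j \<le> c (\<tau> i)}"
    unfolding bij_betw_def
  proof
    show "inj_on \<tau> {j \<in> {1..n}. c (\<tau> j) \<le> c (\<tau> i)}" by (rule permutes_inj_on[OF assms(1)])
    show "\<tau> ` {j \<in> {1..n}. c (\<tau> j) \<le> c (\<tau> i)} = {j \<in> {1..n}. c j \<le> c (\<tau> i)}"
    proof (intro equalityI subsetI)
      fix k assume "k \<in> \<tau> ` {j \<in> {1..n}. c (\<tau> j) \<le> c (\<tau> i)}"
      then obtain j where "k = \<tau> j" "j \<in> {1..n}" "c (\<tau> j) \<le> c (\<tau> i)" by blast
      then show "k \<in> {j \<in> {1..n}. c j \<le> c (\<tau> i)}" using permutes_in_image[OF assms(1), of j] by simp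
    next
      fix k assume k: "k \<in> {j \<in> {1..n}. c j \<le> c (\<tau> i)}"
      then have "k \<in> \<tau> ` {1..n}" using permutes_image[OF assms(1)] by simp
      then obtain j where "k = \<tau> j" "j \<in> {1..n}" by (rule imageE)
      then show "k \<in> \<tau> ` {j \<in> {1..n}. c (\<tau> j) \<le> c (\<tau> i)}" using k by (intro image_eqI[of _ _ j]) simp_all
    qed
  qed
  then have "card {j \<in> {1..n}. c (\<tau> j) \<le> c (\<tau> i)} = card {j \<in> {1..n}. c j \<le> c (\<tau> i)}"
    by (rule bij_betw_same_card)
  moreover have "{j \<in> {1..n}. (\<lambda>i\<in>{1..n}. c (\<tau> i)) j \<le> (\<lambda>i\<in>{1..n}. c (\<tau> i)) i} = {j \<in> {1..n}. c (\<tau> j) \<le> c (\<tau> i)}"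
    by (rule Collect_cong) (simp only: restrict_apply' assms(2) cong: conj_cong)
  ultimately show ?thesis by (simp only: rank_def assms(2) ti if_True)
qed

text \<open>The witness \<open>q\<close> is the \<open>k\<close>-th smallest of the \<open>r i\<close>, and \<open>0\<close> for \<open>k = 0\<close>.\<close>

lemma order_statistic:
  assumes inj: "inj_on r {1..n}" and pos: "\<And>i. i \<in> {1..n} \<Longrightarrow> r i \<in> {0<..1}" and k: "k \<le> n"
  obtains q where "q \<in> {0..1}" "\<forall>i\<in>{1..n}. rank n r i \<le> k \<longleftrightarrow> r i \<le> q" "(\<Sum>i=1..n. of_bool (r i \<le> q)) = real k"
proof -
  define S where "S = insert 0 (r ` {i \<in> {1..n}. rank n r i \<le> k})"
  define q where "q = Max S"
  have S: "finite S" "S \<noteq> {}" by (auto simp: S_def)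
  have qS: "q \<in> S" unfolding q_def by (rule Max_in[OF S])
  have q: "q \<in> {0..1}"
  proof (cases "q = 0")
    case False
    then obtain i where "i \<in> {1..n}" "q = r i" using qS unfolding S_def by blast
    then have "q \<in> {0<..1}" using pos by blast
    then show ?thesis by simp
  qed simp
  have iff: "rank n r i \<le> k \<longleftrightarrow> r i \<le> q" if i: "i \<in> {1..n}" for i
  proof
    assume "rank n r i \<le> k"
    then have "r i \<in> S" using i unfolding S_def by blast
    then show "r i \<le> q" unfolding q_def by (rule Max_ge[OF S(1)])
  next
    assume le: "r i \<le> q"
    then have "q \<noteq> 0" using pos[OF i] by auto
    then obtain j where j: "j \<in> {1..n}" "rank n r j \<le> k" "q = r j" using qS unfolding S_def by blast
    then show "rank n r i \<le> k" using le rank_le_iff[OF i j(1), of r] by simp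
  qed
  have "(\<Sum>i=1..n. of_bool (r i \<le> q)) = (\<Sum>i=1..n. of_bool (rank n r i \<le> k) :: real)"
    using iff by (intro sum.cong) auto
  also have "\<dots> = (\<Sum>i=1..n. of_bool (i \<le> k))"
    \<comment> \<open>Without ties the ranks run through \<open>{1..n}\<close> once, so exactly
      \<open>k\<close> of them are at most \<open>k\<close>.\<close>
    by (rule sum.permute[OF rank_permutes[OF inj], symmetric, unfolded o_def])
  also have "\<dots> = (\<Sum>i\<in>{i \<in> {1..n}. i \<le> k}. 1)" unfolding of_bool_def by (rule sum.inter_filter[symmetric]) simp
  also have "\<dots> = real (card {i \<in> {1..n}. i \<le> k})" by simp
  also have "{i \<in> {1..n}. i \<le> k} = {1..k}" using k by auto
  finally have "(\<Sum>i=1..n. of_bool (r i \<le> q)) = real k" by (simp only: card_atLeastAtMost)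
  then show ?thesis using that[of q] q iff by blast
qed

text \<open>The subtracted \<open>k * l / n\<close> is the mean of the count when
  \<open>m i = (i, \<tau> i)\<close> for a uniformly random permutation \<tau>. For such
  \<open>m\<close> the path built from these values is the first process, centered and
  normalized.\<close>

definition rank_grid :: "nat \<Rightarrow> (nat \<Rightarrow> nat \<times> nat) \<Rightarrow> nat \<times> nat \<Rightarrow> real" where
  "rank_grid n m = (\<lambda>(k, l). real n powr (-1/2) *
     ((\<Sum>i=1..n. of_bool (fst (m i) \<le> k \<and> snd (m i) \<le> l)) - real k * real l / real n))"

definition rank_path :: "nat \<Rightarrow> (nat \<Rightarrow> nat \<times> nat) \<Rightarrow> real \<times> real \<Rightarrow> real" where
  "rank_path n m = path_on_square (grid_path n (rank_grid n m))"

lemma rank_path_in: "rank_path n m \<in> skorokhod_space"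
proof (cases "n = 0")
  case True
  have zero: "grid_path n (rank_grid n m) = (\<lambda>_. 0)"
    unfolding True by (auto simp: fun_eq_iff grid_path_def rank_grid_def)
  then show ?thesis
    unfolding rank_path_def zero by (intro path_on_square_in_skorokhod_space quadrant_limits_const)
next
  case False
  then show ?thesis
    unfolding rank_path_def by (intro path_on_square_in_skorokhod_space quadrant_limits_grid_path) simp
qed

lemma rank_path_cong: "(\<And>i. i \<in> {1..n} \<Longrightarrow> m i = m' i) \<Longrightarrow> rank_path n m = rank_path n m'"
proof -
  assume "\<And>i. i \<in> {1..n} \<Longrightarrow> m i = m' i"
  then have "(\<Sum>i=1..n. of_bool (fst (m i) \<le> k \<and> snd (m i) \<le> l)) = (\<Sum>i=1..n. of_bool (fst (m' i) \<le> k \<and> snd (m' i) \<le> l) :: real)" for k l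
    by (intro sum.cong) auto
  then have "rank_grid n m = rank_grid n m'" by (simp only: rank_grid_def)
  then show ?thesis by (simp add: rank_path_def)
qed

text \<open>The counts do not depend on how the points \<open>m i\<close> are labelled.\<close>

lemma rank_path_permute:
  assumes "\<rho> permutes {1..n}" shows "rank_path n (\<lambda>i. m (\<rho> i)) = rank_path n m"
proof -
  have "(\<Sum>i=1..n. of_bool (fst (m (\<rho> i)) \<le> k \<and> snd (m (\<rho> i)) \<le> l)) = (\<Sum>i=1..n. of_bool (fst (m i) \<le> k \<and> snd (m i) \<le> l) :: real)" for k l
    by (rule sum.permute[OF assms, symmetric, unfolded o_def])
  then show ?thesis by (simp only: rank_path_def rank_grid_def)
qed

text \<open>Relabelling the points by the inverse of \<rho> replaces \<tau> by the composition of
  \<kappa>, \<tau> and the inverse of \<rho>, and this is a bijection of the permutations.\<close>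

lemma sum_rank_paths:
  fixes f :: "(real \<times> real \<Rightarrow> real) \<Rightarrow> real"
  assumes r: "\<rho> permutes {1..n}" and k: "\<kappa> permutes {1..n}"
  shows "(\<Sum>\<tau> | \<tau> permutes {1..n}. f (rank_path n (\<lambda>i. (\<rho> i, \<kappa> (\<tau> i))))) =
    (\<Sum>\<tau> | \<tau> permutes {1..n}. f (rank_path n (\<lambda>i. (i, \<tau> i))))"
proof -
  have "(\<Sum>\<tau> | \<tau> permutes {1..n}. f (rank_path n (\<lambda>i. (i, \<tau> i)))) =
      (\<Sum>\<tau> | \<tau> permutes {1..n}. f (rank_path n (\<lambda>i. (i, (\<kappa> \<circ> \<tau>) i))))"
    by (rule setum_permutations_compose_left[OF k])
  also have "\<dots> = (\<Sum>\<tau> | \<tau> permutes {1..n}. f (rank_path n (\<lambda>i. (i, (\<kappa> \<circ> (\<tau> \<circ> inv \<rho>)) i))))"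
    by (rule sum_permutations_compose_right[OF permutes_inv[OF r]])
  also have "\<dots> = (\<Sum>\<tau> | \<tau> permutes {1..n}. f (rank_path n (\<lambda>i. (\<rho> i, \<kappa> (\<tau> i)))))"
  proof (rule sum.cong[OF refl])
    fix \<tau>
    have "rank_path n (\<lambda>i. (i, (\<kappa> \<circ> (\<tau> \<circ> inv \<rho>)) i)) = rank_path n (\<lambda>i. (\<rho> i, (\<kappa> \<circ> (\<tau> \<circ> inv \<rho>)) (\<rho> i)))"
      by (rule rank_path_permute[OF r, symmetric])
    also have "(\<lambda>i. (\<rho> i, (\<kappa> \<circ> (\<tau> \<circ> inv \<rho>)) (\<rho> i))) = (\<lambda>i. (\<rho> i, \<kappa> (\<tau> i)))"
      by (simp only: o_apply permutes_inverses(2)[OF r])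
    finally show "f (rank_path n (\<lambda>i. (i, (\<kappa> \<circ> (\<tau> \<circ> inv \<rho>)) i))) = f (rank_path n (\<lambda>i. (\<rho> i, \<kappa> (\<tau> i))))"
      by (rule arg_cong)
  qed
  finally show ?thesis by (rule sym)
qed

definition sample_ranks :: "nat \<Rightarrow> (nat \<Rightarrow> real) \<times> (nat \<Rightarrow> real) \<Rightarrow> nat \<Rightarrow> nat \<times> nat" where
  "sample_ranks n z = (\<lambda>i. (rank n (fst z) i, rank n (snd z) i))"

lemma measurable_rank:
  assumes X: "\<And>j. j \<in> {1..n} \<Longrightarrow> (\<lambda>z. X z j) \<in> borel_measurable M" and i: "i \<in> {1..n}"
  shows "(\<lambda>z. rank n (X z) i) \<in> M \<rightarrow>\<^sub>M count_space UNIV"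
proof -
  have sum: "real (rank n (X z) i) = (\<Sum>j=1..n. indicator {z \<in> space M. X z j \<le> X z i} z)" if "z \<in> space M" for z
  proof -
    have "(\<Sum>j=1..n. indicator {z \<in> space M. X z j \<le> X z i} z) = (\<Sum>j=1..n. if X z j \<le> X z i then 1 else 0 :: real)"
      using that by (intro sum.cong) (auto simp: indicator_def)
    also have "\<dots> = (\<Sum>j\<in>{j \<in> {1..n}. X z j \<le> X z i}. 1)" by (rule sum.inter_filter[symmetric]) simp
    finally show ?thesis using i by (simp add: rank_def)
  qed
  have m: "(\<lambda>z. \<Sum>j=1..n. indicator {z \<in> space M. X z j \<le> X z i} z :: real) \<in> borel_measurable M"
    by (intro borel_measurable_sum borel_measurable_indicator borel_measurable_le X i)
  have "(\<lambda>z. rank n (X z) i) -` {a} \<inter> space M \<in> sets M" for a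
  proof -
    have "(\<lambda>z. rank n (X z) i) -` {a} \<inter> space M = (\<lambda>z. \<Sum>j=1..n. indicator {z \<in> space M. X z j \<le> X z i} z) -` {real a} \<inter> space M"
    proof (intro equalityI subsetI)
      fix z assume "z \<in> (\<lambda>z. rank n (X z) i) -` {a} \<inter> space M"
      then have "z \<in> space M" "real (rank n (X z) i) = real a" by auto
      then show "z \<in> (\<lambda>z. \<Sum>j=1..n. indicator {z \<in> space M. X z j \<le> X z i} z) -` {real a} \<inter> space M"
        using sum by auto
    next
      fix z assume "z \<in> (\<lambda>z. \<Sum>j=1..n. indicator {z \<in> space M. X z j \<le> X z i} z) -` {real a} \<inter> space M"
      then have "z \<in> space M" "real (rank n (X z) i) = real a" using sum by auto
      then show "z \<in> (\<lambda>z. rank n (X z) i) -` {a} \<inter> space M" by simp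
    qed
    then show ?thesis using measurable_sets[OF m, of "{real a}"] by simp
  qed
  then show ?thesis by (simp add: measurable_count_space_eq2_countable)
qed

lemma measurable_sample_ranks:
  "(\<lambda>z. \<lambda>i\<in>{1..n}. sample_ranks n z i) \<in> sample n \<rightarrow>\<^sub>M count_space (PiE {1..n} (\<lambda>_. UNIV))"
proof (rule measurable_PiE_count_space)
  fix i assume i: "i \<in> {1..n}"
  have "(\<lambda>z. (rank n (fst z) i, rank n (snd z) i)) \<in> sample n \<rightarrow>\<^sub>M count_space UNIV \<Otimes>\<^sub>M count_space UNIV"
    by (intro measurable_Pair measurable_rank i measurable_sample_coordinate)
  then show "(\<lambda>z. sample_ranks n z i) \<in> sample n \<rightarrow>\<^sub>M count_space UNIV"
    by (simp add: sample_ranks_def pair_measure_countable)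
qed simp

lemma measurable_rank_path:
  "(\<lambda>z. rank_path n (sample_ranks n z)) \<in> sample n \<rightarrow>\<^sub>M borel_of_topology skorokhod_topology"
proof -
  have "(\<lambda>z. rank_path n (\<lambda>i\<in>{1..n}. sample_ranks n z i)) \<in> sample n \<rightarrow>\<^sub>M borel_of_topology skorokhod_topology"
    by (rule measurable_compose[OF measurable_sample_ranks]) (auto simp: rank_path_in)
  moreover have "rank_path n (\<lambda>i\<in>{1..n}. sample_ranks n z i) = rank_path n (sample_ranks n z)" for z
    by (rule rank_path_cong) simp
  ultimately show ?thesis by simp
qed

subsection \<open>Samples without ties\<close>

text \<open>Besides ties the value \<open>0\<close> is excluded: the order statistic of index
  \<open>0\<close> is \<open>0\<close> and must lie strictly below all sample points, and the cells
  \<open>{a<..b}\<close> cover only \<open>{0<..1}\<close>.\<close>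

definition regular_sample :: "nat \<Rightarrow> ((nat \<Rightarrow> real) \<times> (nat \<Rightarrow> real)) set" where
  "regular_sample n = {z \<in> space (sample n). (\<forall>i\<in>{1..n}. fst z i \<in> {0<..1} \<and> snd z i \<in> {0<..1}) \<and>
     inj_on (fst z) {1..n} \<and> inj_on (snd z) {1..n}}"

lemma sample_point_event:
  assumes "i \<in> {1..n}" "B \<in> sets borel"
  shows "{z \<in> space (sample n). (fst z i, snd z i) \<in> B} \<in> sets (sample n)"
proof -
  have "(\<lambda>z. (fst z i, snd z i)) -` B \<inter> space (sample n) \<in> sets (sample n)"
    by (rule measurable_sets[OF measurable_sample_pair[OF assms(1)] assms(2)])
  also have "(\<lambda>z. (fst z i, snd z i)) -` B \<inter> space (sample n) = {z \<in> space (sample n). (fst z i, snd z i) \<in> B}" by blast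
  finally show ?thesis .
qed

lemma sample_two_points_event:
  assumes "i \<in> {1..n}" "j \<in> {1..n}" "B \<in> sets borel"
  shows "{z \<in> space (sample n). (fst z i, snd z i) \<in> B \<and> (fst z j, snd z j) \<in> B} \<in> sets (sample n)"
  using sets.Int[OF sample_point_event[OF assms(1,3)] sample_point_event[OF assms(2,3)]]
  by (rule back_subst[where P="\<lambda>A. A \<in> _"]) blast

lemma measure_sample_two_points:
  assumes ij: "i \<in> {1..n}" "j \<in> {1..n}" "i \<noteq> j" and B: "B \<in> sets borel"
  shows "measure (sample n) {z \<in> space (sample n). (fst z i, snd z i) \<in> B \<and> (fst z j, snd z j) \<in> B} = (measure unif2 B)\<^sup>2"
proof -
  let ?h = "\<lambda>k. if k \<in> {i, j} then indicator B else (\<lambda>_. 1) :: real \<times> real \<Rightarrow> real"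
  have prod: "(\<Prod>k\<in>{1..n}. ?h k (x k)) = indicator B (x i) * indicator B (x j)" for x :: "nat \<Rightarrow> real \<times> real"
  proof -
    have "(\<Prod>k\<in>{1..n}. ?h k (x k)) = (\<Prod>k\<in>{i, j}. ?h k (x k))"
      using ij by (intro prod.mono_neutral_right) auto
    then show ?thesis using ij by simp
  qed
  have E: "{z \<in> space (sample n). (fst z i, snd z i) \<in> B \<and> (fst z j, snd z j) \<in> B} \<in> sets (sample n)"
    by (rule sample_two_points_event[OF ij(1,2) B])
  have "measure (sample n) {z \<in> space (sample n). (fst z i, snd z i) \<in> B \<and> (fst z j, snd z j) \<in> B} =
      (\<integral>z. indicator {z \<in> space (sample n). (fst z i, snd z i) \<in> B \<and> (fst z j, snd z j) \<in> B} z \<partial>sample n)"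
    using E by simp
  also have "\<dots> = (\<integral>z. (\<Prod>k\<in>{1..n}. ?h k (fst z k, snd z k)) \<partial>sample n)"
    by (intro Bochner_Integration.integral_cong refl) (simp only: prod, auto simp: indicator_def)
  also have "\<dots> = (\<Prod>k\<in>{1..n}. \<integral>x. ?h k x \<partial>unif2)"
    by (rule integral_sample_prod(1)[where b=1]) (use B in \<open>auto simp: indicator_def\<close>)
  also have "\<dots> = (\<Prod>k\<in>{1..n}. if k \<in> {i, j} then measure unif2 B else 1)"
    using B by (intro prod.cong) auto
  also have "\<dots> = (\<Prod>k\<in>{i, j}. if k \<in> {i, j} then measure unif2 B else 1)"
    using ij by (intro prod.mono_neutral_right) auto
  also have "\<dots> = (measure unif2 B)\<^sup>2" using ij by (simp add: power2_eq_square)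
  finally show ?thesis .
qed

text \<open>Two coordinates fall into a common cell of a partition into \<open>N\<close> cells of measure \<open>1 / N\<close>
  with probability \<open>1 / N\<close>, so ties have probability zero.\<close>

lemma sample_tie_null:
  fixes B :: "nat \<Rightarrow> nat \<Rightarrow> (real \<times> real) set"
  assumes ij: "i \<in> {1..n}" "j \<in> {1..n}" "i \<noteq> j"
    and B: "\<And>N m. m < N \<Longrightarrow> B N m \<in> sets borel" "\<And>N m. m < N \<Longrightarrow> measure unif2 (B N m) = 1 / real N"
    and E: "E \<in> sets (sample n)"
    and cover: "\<And>N z. z \<in> E \<Longrightarrow> N > 0 \<Longrightarrow> \<exists>m<N. (fst z i, snd z i) \<in> B N m \<and> (fst z j, snd z j) \<in> B N m"
  shows "measure (sample n) E = 0"
proof -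
  have le: "measure (sample n) E \<le> 1 / real N" if N: "N > 0" for N
  proof -
    let ?F = "\<lambda>m. {z \<in> space (sample n). (fst z i, snd z i) \<in> B N m \<and> (fst z j, snd z j) \<in> B N m}"
    have F: "?F m \<in> sets (sample n)" if "m < N" for m
      by (rule sample_two_points_event[OF ij(1,2) B(1)[OF that]])
    have "E \<subseteq> (\<Union>m\<in>{..<N}. ?F m)"
      using cover[OF _ N] sets.sets_into_space[OF E] by fastforce
    then have "measure (sample n) E \<le> measure (sample n) (\<Union>m\<in>{..<N}. ?F m)"
      using F by (intro sample.finite_measure_mono sets.finite_UN) auto
    also have "\<dots> \<le> (\<Sum>m\<in>{..<N}. measure (sample n) (?F m))"
      by (rule measure_UNION_le) (use F in auto)
    also have "\<dots> = (\<Sum>m\<in>{..<N}. (1 / real N)\<^sup>2)"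
      using measure_sample_two_points[OF ij B(1)] B(2) by (intro sum.cong) auto
    also have "\<dots> = 1 / real N" using N by (simp add: power2_eq_square)
    finally show ?thesis .
  qed
  have "measure (sample n) E \<le> 0"
  proof (rule LIMSEQ_le_const)
    show "(\<lambda>N. 1 / real N) \<longlonglongrightarrow> 0" by (rule lim_1_over_n)
    show "\<exists>N. \<forall>n'\<ge>N. measure (sample n) E \<le> 1 / real n'" using le by (intro exI[of _ 1]) auto
  qed
  then show ?thesis by (simp add: antisym)
qed

lemma partition_cell:
  fixes x :: real
  assumes "x \<in> {0<..1}" "N > 0"
  obtains m where "m < N" "x \<in> {real m / real N<..real (Suc m) / real N}"
proof -
  \<comment> \<open>The cells are open on the left, hence the ceiling minus one instead of the
    floor.\<close>
  define m where "m = nat (\<lceil>x * real N\<rceil> - 1)"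
  have p: "0 < x * real N" "x * real N \<le> 1 * real N" using assms by (auto intro: mult_right_mono)
  have "of_int \<lceil>x * real N\<rceil> - 1 < x * real N" "x * real N \<le> of_int \<lceil>x * real N\<rceil>" by linarith+
  moreover have "\<lceil>x * real N\<rceil> \<ge> 1" using p(1) by (simp add: one_le_ceiling)
  then have "real m = of_int \<lceil>x * real N\<rceil> - 1" by (simp add: m_def)
  ultimately have m: "real m < x * real N" "x * real N \<le> real (Suc m)" by auto
  have "m < N" using m(1) p(2) by simp
  moreover have "x \<in> {real m / real N<..real (Suc m) / real N}"
    using m assms(2) by (simp add: pos_divide_less_eq pos_le_divide_eq)
  ultimately show ?thesis by (rule that)
qed

text \<open>The complement is a finite union of null events: a coordinate out of range, or two equal
  coordinates of the same kind.\<close>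

lemma regular_sample_sets: "regular_sample n \<in> sets (sample n)"
  and measure_regular_sample: "measure (sample n) (regular_sample n) = 1"
proof -
  let ?I = "{1..n}" and ?S = "space (sample n)"
  define E1 where "E1 i = {z \<in> ?S. fst z i \<notin> {0<..1}}" for i
  define E2 where "E2 i = {z \<in> ?S. snd z i \<notin> {0<..1}}" for i
  \<comment> \<open>Ties are restricted to values in range, which are covered by the cells; ties
    elsewhere are contained in the events \<open>E1\<close> and \<open>E2\<close>.\<close>
  define T1 where "T1 i j = {z \<in> ?S. fst z i \<in> {0<..1} \<and> fst z i = fst z j}" for i j
  define T2 where "T2 i j = {z \<in> ?S. snd z i \<in> {0<..1} \<and> snd z i = snd z j}" for i j
  have range_sets: "{z \<in> ?S. fst z i \<in> {0<..1}} \<in> sets (sample n)" "{z \<in> ?S. snd z i \<in> {0<..1}} \<in> sets (sample n)" if "i \<in> ?I" for i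
  proof -
    have "{z \<in> ?S. fst z i \<in> {0<..1}} = {z \<in> ?S. (fst z i, snd z i) \<in> {0<..1} \<times> UNIV}"
      "{z \<in> ?S. snd z i \<in> {0<..1}} = {z \<in> ?S. (fst z i, snd z i) \<in> UNIV \<times> {0<..1}}" by blast+
    then show "{z \<in> ?S. fst z i \<in> {0<..1}} \<in> sets (sample n)" "{z \<in> ?S. snd z i \<in> {0<..1}} \<in> sets (sample n)"
      using sample_point_event[OF that fst_strip_borel] sample_point_event[OF that snd_strip_borel] by (simp_all only:)
  qed
  have E_eq: "E1 i = ?S - {z \<in> ?S. fst z i \<in> {0<..1}}" "E2 i = ?S - {z \<in> ?S. snd z i \<in> {0<..1}}" for i
    by (auto simp: E1_def E2_def)
  have E: "E1 i \<in> sets (sample n)" "E2 i \<in> sets (sample n)" if "i \<in> ?I" for i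
    unfolding E_eq by (rule sets.compl_sets[OF range_sets(1)[OF that]], rule sets.compl_sets[OF range_sets(2)[OF that]])
  have T: "T1 i j \<in> sets (sample n)" "T2 i j \<in> sets (sample n)" if "i \<in> ?I" "j \<in> ?I" for i j
  proof -
    have "T1 i j = {z \<in> ?S. fst z i \<in> {0<..1}} \<inter> {z \<in> ?S. fst z i = fst z j}"
      "T2 i j = {z \<in> ?S. snd z i \<in> {0<..1}} \<inter> {z \<in> ?S. snd z i = snd z j}"
      unfolding T1_def T2_def by blast+
    moreover have "{z \<in> ?S. fst z i = fst z j} \<in> sets (sample n)" "{z \<in> ?S. snd z i = snd z j} \<in> sets (sample n)"
      by (rule borel_measurable_eq[OF measurable_sample_coordinate(1)[OF that(1)] measurable_sample_coordinate(1)[OF that(2)]],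
          rule borel_measurable_eq[OF measurable_sample_coordinate(2)[OF that(1)] measurable_sample_coordinate(2)[OF that(2)]])
    ultimately show "T1 i j \<in> sets (sample n)" "T2 i j \<in> sets (sample n)"
      using range_sets[OF that(1)] by (simp_all only: sets.Int)
  qed
  have E0: "measure (sample n) (E1 i) = 0" "measure (sample n) (E2 i) = 0" if i: "i \<in> ?I" for i
  proof -
    have *: "measure (sample n) {z \<in> ?S. (fst z i, snd z i) \<in> B} = measure unif2 B" if B: "B \<in> sets borel" for B
    proof -
      have "measure (sample n) {z \<in> ?S. (fst z i, snd z i) \<in> B} = (\<integral>z. indicator {z \<in> ?S. (fst z i, snd z i) \<in> B} z \<partial>sample n)"
        using sample_point_event[OF i B] by simp
      also have "\<dots> = (\<integral>z. indicator B (fst z i, snd z i) \<partial>sample n)"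
        by (intro Bochner_Integration.integral_cong) (auto simp: indicator_def)
      also have "\<dots> = (\<integral>x. indicator B x \<partial>unif2)"
        by (rule integral_sample_coordinate[where b=1, OF _ _ i]) (use B in \<open>auto simp: indicator_def\<close>)
      also have "\<dots> = measure unif2 B" using B by simp
      finally show ?thesis .
    qed
    have "measure (sample n) {z \<in> ?S. fst z i \<in> {0<..1}} = 1" "measure (sample n) {z \<in> ?S. snd z i \<in> {0<..1}} = 1"
      using *[OF fst_strip_borel[of 0 1]] *[OF snd_strip_borel[of 0 1]] measure_unif2_strips[of 0 1] by auto
    then show "measure (sample n) (E1 i) = 0" "measure (sample n) (E2 i) = 0"
      unfolding E_eq
      using sample.prob_compl[OF range_sets(1)[OF i]] sample.prob_compl[OF range_sets(2)[OF i]] by simp_all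
  qed
  have cell: "measure unif2 ({real m / real N<..real (Suc m) / real N} \<times> UNIV) = 1 / real N"
    "measure unif2 (UNIV \<times> {real m / real N<..real (Suc m) / real N}) = 1 / real N" if "m < N" for m N
  proof -
    have 1: "0 \<le> real m / real N" "real m / real N \<le> real (Suc m) / real N" "real (Suc m) / real N \<le> 1"
      using that by (auto simp: divide_right_mono)
    have 2: "real (Suc m) / real N - real m / real N = 1 / real N" by (simp add: diff_divide_distrib[symmetric])
    show "measure unif2 ({real m / real N<..real (Suc m) / real N} \<times> UNIV) = 1 / real N"
      "measure unif2 (UNIV \<times> {real m / real N<..real (Suc m) / real N}) = 1 / real N"
      using measure_unif2_strips[OF 1] 2 by simp_all
  qed
  have T0: "measure (sample n) (T1 i j) = 0" "measure (sample n) (T2 i j) = 0" if ij: "i \<in> ?I" "j \<in> ?I" "i \<noteq> j" for i j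
  proof -
    show "measure (sample n) (T1 i j) = 0"
    proof (rule sample_tie_null[OF ij, where B="\<lambda>N m. {real m / real N<..real (Suc m) / real N} \<times> UNIV"])
      fix N :: nat and z assume z: "z \<in> T1 i j" and N: "N > 0"
      obtain m where "m < N" "fst z i \<in> {real m / real N<..real (Suc m) / real N}"
        by (rule partition_cell[of "fst z i" N]) (use z N in \<open>auto simp: T1_def\<close>)
      then show "\<exists>m<N. (fst z i, snd z i) \<in> {real m / real N<..real (Suc m) / real N} \<times> UNIV \<and>
          (fst z j, snd z j) \<in> {real m / real N<..real (Suc m) / real N} \<times> UNIV"
        using z by (auto simp: T1_def)
    qed (use cell T ij in auto)
    show "measure (sample n) (T2 i j) = 0"
    proof (rule sample_tie_null[OF ij, where B="\<lambda>N m. UNIV \<times> {real m / real N<..real (Suc m) / real N}"])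
      fix N :: nat and z assume z: "z \<in> T2 i j" and N: "N > 0"
      obtain m where "m < N" "snd z i \<in> {real m / real N<..real (Suc m) / real N}"
        by (rule partition_cell[of "snd z i" N]) (use z N in \<open>auto simp: T2_def\<close>)
      then show "\<exists>m<N. (fst z i, snd z i) \<in> UNIV \<times> {real m / real N<..real (Suc m) / real N} \<and>
          (fst z j, snd z j) \<in> UNIV \<times> {real m / real N<..real (Suc m) / real N}"
        using z by (auto simp: T2_def)
    qed (use cell T ij in auto)
  qed
  define J where "J = {(i, j) \<in> ?I \<times> ?I. i \<noteq> j}"
  have J: "finite J" by (rule finite_subset[of _ "?I \<times> ?I"]) (auto simp: J_def)
  define A where "A = (\<Union>i\<in>?I. E1 i \<union> E2 i)"
  define D where "D = (\<Union>p\<in>J. T1 (fst p) (snd p) \<union> T2 (fst p) (snd p))"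
  have A_sets: "A \<in> sets (sample n)" unfolding A_def using E by (intro sets.finite_UN sets.Un) auto
  have D_sets: "D \<in> sets (sample n)" unfolding D_def using T J by (intro sets.finite_UN sets.Un) (auto simp: J_def)
  have "measure (sample n) A \<le> (\<Sum>i\<in>?I. measure (sample n) (E1 i \<union> E2 i))"
    unfolding A_def by (rule measure_UNION_le) (use E in auto)
  also have "\<dots> \<le> (\<Sum>i\<in>?I. 0)"
    using E E0 by (intro sum_mono order_trans[OF measure_Un_le]) auto
  finally have A0: "measure (sample n) A = 0" by (simp add: antisym)
  have "measure (sample n) D \<le> (\<Sum>p\<in>J. measure (sample n) (T1 (fst p) (snd p) \<union> T2 (fst p) (snd p)))"
    unfolding D_def by (rule measure_UNION_le[OF J]) (use T in \<open>auto simp: J_def\<close>)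
  also have "\<dots> \<le> (\<Sum>p\<in>J. 0)"
    using T T0 by (intro sum_mono order_trans[OF measure_Un_le]) (auto simp: J_def)
  finally have D0: "measure (sample n) D = 0" by (simp add: antisym)
  have eq: "regular_sample n = ?S - (A \<union> D)"
  proof (intro equalityI subsetI)
    fix z assume z: "z \<in> regular_sample n"
    then have "z \<notin> A" by (auto simp: regular_sample_def A_def E1_def E2_def)
    moreover have "z \<notin> D" using z by (auto simp: regular_sample_def D_def J_def T1_def T2_def dest: inj_onD)
    ultimately show "z \<in> ?S - (A \<union> D)" using z by (auto simp: regular_sample_def)
  next
    fix z assume z: "z \<in> ?S - (A \<union> D)"
    have 1: "\<forall>i\<in>?I. fst z i \<in> {0<..1} \<and> snd z i \<in> {0<..1}"
      using z unfolding A_def E1_def E2_def by blast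
    have 2: "fst z i \<noteq> fst z j \<and> snd z i \<noteq> snd z j" if "i \<in> ?I" "j \<in> ?I" "i \<noteq> j" for i j
    proof -
      have "z \<notin> T1 i j" "z \<notin> T2 i j" using z that unfolding D_def J_def by force+
      then show ?thesis using 1 z that unfolding T1_def T2_def by blast
    qed
    have "inj_on (fst z) ?I" "inj_on (snd z) ?I" using 2 unfolding inj_on_def by blast+
    with 1 z show "z \<in> regular_sample n" unfolding regular_sample_def by blast
  qed
  show "regular_sample n \<in> sets (sample n)" unfolding eq using A_sets D_sets by auto
  have "measure (sample n) (A \<union> D) \<le> 0"
    using measure_Un_le[OF A_sets D_sets] A0 D0 by simp
  then have "measure (sample n) (A \<union> D) = 0" by (simp add: antisym)
  then show "measure (sample n) (regular_sample n) = 1"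
    unfolding eq using A_sets D_sets by (subst sample.prob_compl) auto
qed

subsection \<open>The rank process of a sample\<close>

text \<open>Permuting the columns preserves the law of the sample, so the integrand may be averaged
  over all permutations. For a sample without ties this average is the mean over all permutations
  and no longer depends on the sample. Hence the rank process has the law of the first
  process.\<close>

lemma integral_rank_path:
  fixes f :: "(real \<times> real \<Rightarrow> real) \<Rightarrow> real"
  assumes f: "f \<in> borel_measurable (borel_of_topology skorokhod_topology)" and K: "\<And>x. x \<in> skorokhod_space \<Longrightarrow> \<bar>f x\<bar> \<le> K"
  shows "(\<integral>z. f (rank_path n (sample_ranks n z)) \<partial>sample n) =
    (\<Sum>\<tau> | \<tau> permutes {1..n}. f (rank_path n (\<lambda>i. (i, \<tau> i)))) / real (card {\<tau>. \<tau> permutes {1..n}})"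
proof -
  define P where "P = {\<tau>. \<tau> permutes {1..n}}"
  have P: "finite P" "card P > 0"
    unfolding P_def by (auto intro: finite_permutations simp: card_permutations[OF _ finite_atLeastAtMost])
  define F where "F z = f (rank_path n (sample_ranks n z))" for z
  define T where "T \<tau> z = (fst z, \<lambda>i\<in>{1..n}. snd z (\<tau> i))" for \<tau> :: "nat \<Rightarrow> nat" and z :: "(nat \<Rightarrow> real) \<times> (nat \<Rightarrow> real)"
  have F: "F \<in> borel_measurable (sample n)" unfolding F_def by (rule measurable_compose[OF measurable_rank_path f])
  have Tm: "T \<tau> \<in> sample n \<rightarrow>\<^sub>M sample n" and TD: "distr (sample n) (sample n) (T \<tau>) = sample n" if "\<tau> \<in> P" for \<tau>
    using distr_sample_permute[of \<tau> n] that unfolding T_def[abs_def] P_def by auto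
  have FT: "(\<integral>z. F (T \<tau> z) \<partial>sample n) = (\<integral>z. F z \<partial>sample n)" if "\<tau> \<in> P" for \<tau>
    using integral_distr[OF Tm[OF that] F] TD[OF that] by simp
  have int: "integrable (sample n) (\<lambda>z. F (T \<tau> z))" if "\<tau> \<in> P" for \<tau>
    by (intro sample.integrable_const_bound[of _ K] measurable_compose[OF Tm[OF that] F])
      (auto simp: F_def intro!: K rank_path_in)
  have AE: "AE z in sample n. z \<in> regular_sample n"
    using measure_regular_sample regular_sample_sets by (intro sample.AE_prob_1)
  have reg: "(\<Sum>\<tau>\<in>P. F (T \<tau> z)) = (\<Sum>\<tau>\<in>P. f (rank_path n (\<lambda>i. (i, \<tau> i))))" if z: "z \<in> regular_sample n" for z
  proof -
    have "F (T \<tau> z) = f (rank_path n (\<lambda>i. (rank n (fst z) i, rank n (snd z) (\<tau> i))))" if t: "\<tau> \<in> P" for \<tau>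
      unfolding F_def
      by (rule arg_cong[where f=f], rule rank_path_cong)
        (use t rank_restrict_permute[of \<tau> n _ "snd z"] in \<open>simp add: sample_ranks_def T_def P_def\<close>)
    then have "(\<Sum>\<tau>\<in>P. F (T \<tau> z)) = (\<Sum>\<tau>\<in>P. f (rank_path n (\<lambda>i. (rank n (fst z) i, rank n (snd z) (\<tau> i)))))"
      by (intro sum.cong) auto
    also have "\<dots> = (\<Sum>\<tau>\<in>P. f (rank_path n (\<lambda>i. (i, \<tau> i))))"
      unfolding P_def using z by (intro sum_rank_paths rank_permutes) (auto simp: regular_sample_def)
    finally show ?thesis .
  qed
  have "real (card P) * (\<integral>z. F z \<partial>sample n) = (\<Sum>\<tau>\<in>P. \<integral>z. F (T \<tau> z) \<partial>sample n)"
    using FT by simp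
  also have "\<dots> = (\<integral>z. (\<Sum>\<tau>\<in>P. F (T \<tau> z)) \<partial>sample n)"
    by (rule Bochner_Integration.integral_sum[symmetric]) (rule int)
  also have "\<dots> = (\<integral>z. (\<Sum>\<tau>\<in>P. f (rank_path n (\<lambda>i. (i, \<tau> i)))) \<partial>sample n)"
  proof (rule integral_cong_AE)
    show "(\<lambda>z. \<Sum>\<tau>\<in>P. F (T \<tau> z)) \<in> borel_measurable (sample n)"
      by (intro borel_measurable_sum measurable_compose[OF Tm F])
    show "AE z in sample n. (\<Sum>\<tau>\<in>P. F (T \<tau> z)) = (\<Sum>\<tau>\<in>P. f (rank_path n (\<lambda>i. (i, \<tau> i))))"
      using AE by eventually_elim (rule reg)
  qed simp
  also have "\<dots> = (\<Sum>\<tau>\<in>P. f (rank_path n (\<lambda>i. (i, \<tau> i))))" by (simp add: sample.prob_space)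
  finally have "(\<integral>z. F z \<partial>sample n) * real (card P) = (\<Sum>\<tau>\<in>P. f (rank_path n (\<lambda>i. (i, \<tau> i))))"
    by (simp only: mult.commute)
  then have "(\<integral>z. F z \<partial>sample n) = (\<Sum>\<tau>\<in>P. f (rank_path n (\<lambda>i. (i, \<tau> i)))) / real (card P)"
    by (rule iffD2[OF nonzero_eq_divide_eq, rotated]) (use P(2) in simp)
  then show ?thesis unfolding F_def P_def .
qed

section \<open>Comparison of the rank process with the bridge field\<close>

text \<open>The point \<open>s\<close> is reached from \<open>0\<close> in \<open>N\<close> equal
  steps of length at most \<open>d\<close>, each changing the value by at most \<open>1\<close>. A
  modulus of continuity thus yields a uniform bound.\<close>

lemma bound_from_modulus:
  fixes x :: "real \<Rightarrow> real"
  assumes x0: "x 0 = 0" and d: "N > 0" "1 / real N \<le> d"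
    and mod: "\<And>s t. s \<in> {0..1} \<Longrightarrow> t \<in> {0..1} \<Longrightarrow> \<bar>s - t\<bar> \<le> d \<Longrightarrow> \<bar>x s - x t\<bar> \<le> 1"
    and s: "s \<in> {0..1}"
  shows "\<bar>x s\<bar> \<le> real N"
proof -
  have "\<bar>x (s * real m / real N)\<bar> \<le> real m" if "m \<le> N" for m
    using that
  proof (induction m)
    case (Suc m)
    have in01: "s * real k / real N \<in> {0..1}" if "k \<le> N" for k
    proof -
      have "s * real k \<le> 1 * real N" using s that by (intro mult_mono) auto
      then show ?thesis using s d(1) by simp
    qed
    have "s * real (Suc m) / real N - s * real m / real N = s / real N"
      by (simp add: diff_divide_distrib[symmetric] algebra_simps)
    also have "\<dots> \<le> 1 / real N" using s by (intro divide_right_mono) auto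
    finally have "\<bar>s * real (Suc m) / real N - s * real m / real N\<bar> \<le> d"
      using d s \<open>s * real (Suc m) / real N - s * real m / real N = s / real N\<close> by simp
    then have "\<bar>x (s * real (Suc m) / real N) - x (s * real m / real N)\<bar> \<le> 1"
      using Suc by (intro mod in01) auto
    then show ?case using Suc by simp
  qed (simp add: x0)
  from this[of N] show ?thesis using d(1) by simp
qed

text \<open>Here \<open>k\<close> and \<open>l\<close> are the empirical counts at \<open>q\<close>
  and \<open>q'\<close>, and the sum of centered products exceeds the count centered by
  \<open>k * l / n\<close> by exactly \<open>(k - n * q) * (l - n * q') / n\<close>. The two factors
  are, up to \<open>sqrt n\<close>, the marginal empirical processes.\<close>

lemma rank_grid_at_order_statistics:
  assumes n: "n > 0" and z: "z \<in> regular_sample n"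
    and q: "\<forall>i\<in>{1..n}. rank n (fst z) i \<le> k \<longleftrightarrow> fst z i \<le> q" "(\<Sum>i=1..n. of_bool (fst z i \<le> q)) = real k"
    and q': "\<forall>i\<in>{1..n}. rank n (snd z) i \<le> l \<longleftrightarrow> snd z i \<le> q'" "(\<Sum>i=1..n. of_bool (snd z i \<le> q')) = real l"
  shows "rank_grid n (sample_ranks n z) (k, l) = field bridge_product n z (q, q') -
      1 / sqrt (real n) * (field sheet_kernel n z (q, 1) * field sheet_kernel n z (1, q'))"
    and "real k / real n - q = 1 / sqrt (real n) * field sheet_kernel n z (q, 1)"
    and "real l / real n - q' = 1 / sqrt (real n) * field sheet_kernel n z (1, q')"
proof -
  define s where "s = sqrt (real n)"
  have s: "s > 0" "s * s = real n" "real n powr (-1/2) = 1 / s"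
    using n by (auto simp: s_def powr_minus_divide powr_half_sqrt)
  define c where "c = (\<Sum>i=1..n. of_bool (fst z i \<le> q \<and> snd z i \<le> q') :: real)"
  have le1: "fst z i \<le> 1" "snd z i \<le> 1" if "i \<in> {1..n}" for i using z that by (auto simp: regular_sample_def)
  \<comment> \<open>At second coordinate \<open>1\<close> the second comparison always holds, so on
    this edge the bivariate field is the one-dimensional empirical process.\<close>
  have "(\<Sum>i=1..n. kern sheet_kernel (fst z i, snd z i) (q, 1)) = (\<Sum>i=1..n. of_bool (fst z i \<le> q) - q)"
    using le1 by (intro sum.cong) (auto simp: kern_def sheet_kernel_def)
  also have "\<dots> = real k - real n * q" unfolding sum_subtractf q(2) by simp
  finally have S1: "field sheet_kernel n z (q, 1) = (real k - real n * q) / s"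
    unfolding field_def s(3) by simp
  have "(\<Sum>i=1..n. kern sheet_kernel (fst z i, snd z i) (1, q')) = (\<Sum>i=1..n. of_bool (snd z i \<le> q') - q')"
    using le1 by (intro sum.cong) (auto simp: kern_def sheet_kernel_def)
  also have "\<dots> = real l - real n * q'" unfolding sum_subtractf q'(2) by simp
  finally have S2: "field sheet_kernel n z (1, q') = (real l - real n * q') / s"
    unfolding field_def s(3) by simp
  have "(\<Sum>i=1..n. kern bridge_product (fst z i, snd z i) (q, q')) =
      (\<Sum>i=1..n. of_bool (fst z i \<le> q \<and> snd z i \<le> q') - q' * of_bool (fst z i \<le> q) - q * of_bool (snd z i \<le> q') + q * q')"
    by (intro sum.cong) (auto simp: kern_def bridge_product_def algebra_simps)
  also have "\<dots> = c - q' * real k - q * real l + real n * (q * q')"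
    by (simp only: sum.distrib sum_subtractf sum_distrib_left[symmetric] q(2) q'(2) c_def[symmetric]) simp
  finally have Z: "field bridge_product n z (q, q') = (c - q' * real k - q * real l + real n * (q * q')) / s"
    unfolding field_def s(3) by simp
  have "(\<Sum>i=1..n. of_bool (fst (sample_ranks n z i) \<le> k \<and> snd (sample_ranks n z i) \<le> l)) = c"
    unfolding c_def using q(1) q'(1) by (intro sum.cong) (auto simp: sample_ranks_def)
  then have G: "rank_grid n (sample_ranks n z) (k, l) = (c - real k * real l / real n) / s"
    unfolding rank_grid_def prod.case s(3) by (simp only:) simp
  have nz: "s \<noteq> 0" "real n \<noteq> 0" using s(1) n by auto
  have "(real k - real n * q) / s * ((real l - real n * q') / s) = (real k * real l / real n - q' * real k - q * real l + real n * (q * q'))"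
  proof -
    have "(real k - real n * q) / s * ((real l - real n * q') / s) = (real k - real n * q) * (real l - real n * q') / real n"
      by (simp add: s(2)[symmetric])
    also have "\<dots> = (real k * real l / real n - q' * real k - q * real l + real n * (q * q'))"
      using nz(2) by (simp add: field_simps)
    finally show ?thesis .
  qed
  then show "rank_grid n (sample_ranks n z) (k, l) = field bridge_product n z (q, q') -
      1 / sqrt (real n) * (field sheet_kernel n z (q, 1) * field sheet_kernel n z (1, q'))"
    unfolding G Z S1 S2 s_def[symmetric] by (simp add: diff_divide_distrib[symmetric])
  have "x / real n - y = 1 / s * ((x - real n * y) / s)" for x y :: real
  proof -
    have "1 / s * ((x - real n * y) / s) = (x - real n * y) / real n" by (simp add: s(2)[symmetric])
    then show ?thesis using nz(2) by (simp add: diff_divide_distrib)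
  qed
  then show "real k / real n - q = 1 / sqrt (real n) * field sheet_kernel n z (q, 1)"
    "real l / real n - q' = 1 / sqrt (real n) * field sheet_kernel n z (1, q')"
    unfolding S1 S2 s_def[symmetric] by blast+
qed

text \<open>The marginal processes are bounded by a constant \<open>b\<close> with high probability.
  So order statistics deviate from their index divided by \<open>n\<close> by at most
  \<open>b / sqrt n\<close>, which the modulus of the bridge field absorbs, and the product
  correction is at most \<open>b * b / sqrt n\<close>.\<close>

lemma rank_process_close:
  assumes e: "e > 0" "e \<le> 1"
  obtains n0 where "\<And>n. n \<ge> n0 \<Longrightarrow> \<exists>A\<in>sets (sample n). measure (sample n) A \<ge> 1 - 2 * e \<and>
    (\<forall>z\<in>A. skorokhod_dist (rank_path n (sample_ranks n z)) (path_on_square (field bridge_product n z)) \<le> 2 * e)"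
proof -
  obtain d n1 where d: "d > 0" "\<And>n. n \<ge> n1 \<Longrightarrow> \<exists>A\<in>sets (sample n). measure (sample n) A \<ge> 1 - e \<and>
    (\<forall>z\<in>A. \<forall>p\<in>unit_square. \<forall>q\<in>unit_square. \<bar>fst p - fst q\<bar> \<le> d \<longrightarrow> \<bar>snd p - snd q\<bar> \<le> d \<longrightarrow>
      \<bar>field bridge_product n z p - field bridge_product n z q\<bar> \<le> e)"
    using bridge.field_modulus[OF e(1)] by blast
  obtain d' n2 where d': "d' > 0" "\<And>n. n \<ge> n2 \<Longrightarrow> \<exists>A\<in>sets (sample n). measure (sample n) A \<ge> 1 - e \<and>
    (\<forall>z\<in>A. \<forall>p\<in>unit_square. \<forall>q\<in>unit_square. \<bar>fst p - fst q\<bar> \<le> d' \<longrightarrow> \<bar>snd p - snd q\<bar> \<le> d' \<longrightarrow>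
      \<bar>field sheet_kernel n z p - field sheet_kernel n z q\<bar> \<le> e)"
    using sheet.field_modulus[OF e(1)] by blast
  obtain N0 where "1 / real (Suc N0) < d'"
    using d'(1) reals_Archimedean[of d'] by (auto simp: inverse_eq_divide)
  then obtain N where N: "N > 0" "1 / real N \<le> d'" by (intro that[of "Suc N0"]) auto
  define b where "b = real N"
  have "(\<lambda>n. b / sqrt (real n) + 1 / real n) \<longlonglongrightarrow> 0" by real_asymp
  then have "\<forall>\<^sub>F n in sequentially. b / sqrt (real n) + 1 / real n < d" by (rule order_tendstoD(2)[OF _ d(1)])
  moreover have "(\<lambda>n. b * b / sqrt (real n)) \<longlonglongrightarrow> 0" by real_asymp
  then have "\<forall>\<^sub>F n in sequentially. b * b / sqrt (real n) < e" by (rule order_tendstoD(2)[OF _ e(1)])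
  ultimately have "\<forall>\<^sub>F n in sequentially. b / sqrt (real n) + 1 / real n < d \<and> b * b / sqrt (real n) < e"
    by (rule eventually_conj)
  then obtain n3 where n3: "\<And>n. n \<ge> n3 \<Longrightarrow> b / sqrt (real n) + 1 / real n < d \<and> b * b / sqrt (real n) < e"
    unfolding eventually_sequentially by blast
  show ?thesis
  proof (rule that[of "max 1 (max n1 (max n2 n3))"])
    fix n assume "max 1 (max n1 (max n2 n3)) \<le> n"
    then have n: "n > 0" "n \<ge> n1" "n \<ge> n2" "n \<ge> n3" by auto
    obtain A where A: "A \<in> sets (sample n)" "measure (sample n) A \<ge> 1 - e"
      "\<And>z p q. z \<in> A \<Longrightarrow> p \<in> unit_square \<Longrightarrow> q \<in> unit_square \<Longrightarrow> \<bar>fst p - fst q\<bar> \<le> d \<Longrightarrow> \<bar>snd p - snd q\<bar> \<le> d \<Longrightarrow>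
        \<bar>field bridge_product n z p - field bridge_product n z q\<bar> \<le> e"
      using d(2)[OF n(2)] by blast
    obtain A' where A': "A' \<in> sets (sample n)" "measure (sample n) A' \<ge> 1 - e"
      "\<And>z p q. z \<in> A' \<Longrightarrow> p \<in> unit_square \<Longrightarrow> q \<in> unit_square \<Longrightarrow> \<bar>fst p - fst q\<bar> \<le> d' \<Longrightarrow> \<bar>snd p - snd q\<bar> \<le> d' \<Longrightarrow>
        \<bar>field sheet_kernel n z p - field sheet_kernel n z q\<bar> \<le> e"
      using d'(2)[OF n(3)] by blast
    define D where "D = A \<inter> A' \<inter> regular_sample n"
    have D: "D \<in> sets (sample n)" unfolding D_def using A(1) A'(1) regular_sample_sets by auto
    have mD: "measure (sample n) D \<ge> 1 - 2 * e"
    proof -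
      have sub: "space (sample n) - D \<subseteq> (space (sample n) - A) \<union> ((space (sample n) - A') \<union> (space (sample n) - regular_sample n))"
        unfolding D_def by blast
      have "1 - measure (sample n) D = measure (sample n) (space (sample n) - D)"
        using sample.prob_compl[OF D] by simp
      also have "\<dots> \<le> measure (sample n) ((space (sample n) - A) \<union> ((space (sample n) - A') \<union> (space (sample n) - regular_sample n)))"
        using A(1) A'(1) regular_sample_sets by (intro sample.finite_measure_mono[OF sub]) auto
      also have "\<dots> \<le> measure (sample n) (space (sample n) - A) + measure (sample n) ((space (sample n) - A') \<union> (space (sample n) - regular_sample n))"
        using A(1) A'(1) regular_sample_sets by (intro measure_Un_le) auto
      also have "measure (sample n) ((space (sample n) - A') \<union> (space (sample n) - regular_sample n)) \<le>
          measure (sample n) (space (sample n) - A') + measure (sample n) (space (sample n) - regular_sample n)"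
        using A'(1) regular_sample_sets by (intro measure_Un_le) auto
      finally show ?thesis
        using sample.prob_compl[OF A(1)] sample.prob_compl[OF A'(1)] sample.prob_compl[OF regular_sample_sets]
          A(2) A'(2) measure_regular_sample[of n] by simp
    qed
    show "\<exists>A\<in>sets (sample n). 1 - 2 * e \<le> measure (sample n) A \<and>
      (\<forall>z\<in>A. skorokhod_dist (rank_path n (sample_ranks n z)) (path_on_square (field bridge_product n z)) \<le> 2 * e)"
    proof (intro bexI[of _ D] conjI ballI D mD)
      fix z assume "z \<in> D"
      then have z: "z \<in> A" "z \<in> A'" "z \<in> regular_sample n" by (auto simp: D_def)
      have pos: "fst z i \<in> {0<..1}" "snd z i \<in> {0<..1}" if "i \<in> {1..n}" for i
        using z(3) that by (auto simp: regular_sample_def)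
      have bd1: "\<bar>field sheet_kernel n z (q, 1)\<bar> \<le> b" if "q \<in> {0..1}" for q
        unfolding b_def
      proof (rule bound_from_modulus[OF _ N _ that, of "\<lambda>q. field sheet_kernel n z (q, 1)"])
        have "(\<Sum>i=1..n. kern sheet_kernel (fst z i, snd z i) (0, 1)) = 0"
          using pos by (intro sum.neutral) (force simp: kern_def sheet_kernel_def)
        then show "field sheet_kernel n z (0, 1) = 0" by (simp add: field_def)
        fix s t :: real assume "s \<in> {0..1}" "t \<in> {0..1}" "\<bar>s - t\<bar> \<le> d'"
        then have "\<bar>field sheet_kernel n z (s, 1) - field sheet_kernel n z (t, 1)\<bar> \<le> e"
          using d'(1) by (intro A'(3)[OF z(2)]) (auto simp: unit_square_def)
        then show "\<bar>field sheet_kernel n z (s, 1) - field sheet_kernel n z (t, 1)\<bar> \<le> 1" using e(2) by linarith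
      qed
      have bd2: "\<bar>field sheet_kernel n z (1, q)\<bar> \<le> b" if "q \<in> {0..1}" for q
        unfolding b_def
      proof (rule bound_from_modulus[OF _ N _ that, of "\<lambda>q. field sheet_kernel n z (1, q)"])
        have "(\<Sum>i=1..n. kern sheet_kernel (fst z i, snd z i) (1, 0)) = 0"
          using pos by (intro sum.neutral) (force simp: kern_def sheet_kernel_def)
        then show "field sheet_kernel n z (1, 0) = 0" by (simp add: field_def)
        fix s t :: real assume "s \<in> {0..1}" "t \<in> {0..1}" "\<bar>s - t\<bar> \<le> d'"
        then have "\<bar>field sheet_kernel n z (1, s) - field sheet_kernel n z (1, t)\<bar> \<le> e"
          using d'(1) by (intro A'(3)[OF z(2)]) (auto simp: unit_square_def)
        then show "\<bar>field sheet_kernel n z (1, s) - field sheet_kernel n z (1, t)\<bar> \<le> 1" using e(2) by linarith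
      qed
      \<comment> \<open>Rounding \<open>v\<close> down to the grid costs \<open>1 / n\<close>, and
        passing from the grid value to the order statistic costs \<open>b / sqrt n\<close>.\<close>
      have near: "\<bar>v - q\<bar> \<le> d" if v: "v \<in> {0..1}" and q: "real (nat \<lfloor>real n * v\<rfloor>) / real n - q = 1 / sqrt (real n) * y" and y: "\<bar>y\<bar> \<le> b" for v q y
      proof -
        have "real (nat \<lfloor>real n * v\<rfloor>) = of_int \<lfloor>real n * v\<rfloor>" using v by simp
        then have "real (nat \<lfloor>real n * v\<rfloor>) \<le> real n * v" "real n * v \<le> real (nat \<lfloor>real n * v\<rfloor>) + 1" by linarith+
        then have "real (nat \<lfloor>real n * v\<rfloor>) / real n \<le> v" "v \<le> real (nat \<lfloor>real n * v\<rfloor>) / real n + 1 / real n"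
          using n(1) by (simp_all add: field_simps)
        then have 1: "\<bar>v - real (nat \<lfloor>real n * v\<rfloor>) / real n\<bar> \<le> 1 / real n" by (auto simp: abs_le_iff)
        have "\<bar>1 / sqrt (real n) * y\<bar> = 1 / sqrt (real n) * \<bar>y\<bar>" by (simp add: abs_mult)
        also have "\<dots> \<le> 1 / sqrt (real n) * b" using y by (intro mult_left_mono) auto
        finally have "\<bar>real (nat \<lfloor>real n * v\<rfloor>) / real n - q\<bar> \<le> b / sqrt (real n)" unfolding q by simp
        then have "\<bar>v - q\<bar> \<le> b / sqrt (real n) + 1 / real n" using 1 by linarith
        then show ?thesis using n3[OF n(4)] by linarith
      qed
      show "skorokhod_dist (rank_path n (sample_ranks n z)) (path_on_square (field bridge_product n z)) \<le> 2 * e"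
        unfolding rank_path_def
      proof (rule skorokhod_dist_le_sup[OF rank_path_in[unfolded rank_path_def] bridge.field_path_in])
        fix p assume "p \<in> unit_square"
        then obtain s t where p: "p = (s, t)" "s \<in> {0..1}" "t \<in> {0..1}" by (auto simp: unit_square_def)
        have "nat \<lfloor>real n * s\<rfloor> \<le> n" "nat \<lfloor>real n * t\<rfloor> \<le> n" using p nat_floor_le by auto
        obtain q where q: "q \<in> {0..1}" "\<forall>i\<in>{1..n}. rank n (fst z) i \<le> nat \<lfloor>real n * s\<rfloor> \<longleftrightarrow> fst z i \<le> q"
          "(\<Sum>i=1..n. of_bool (fst z i \<le> q)) = real (nat \<lfloor>real n * s\<rfloor>)"
          using order_statistic[of "fst z" n "nat \<lfloor>real n * s\<rfloor>"] z(3) pos \<open>nat \<lfloor>real n * s\<rfloor> \<le> n\<close>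
          unfolding regular_sample_def by blast
        obtain q' where q': "q' \<in> {0..1}" "\<forall>i\<in>{1..n}. rank n (snd z) i \<le> nat \<lfloor>real n * t\<rfloor> \<longleftrightarrow> snd z i \<le> q'"
          "(\<Sum>i=1..n. of_bool (snd z i \<le> q')) = real (nat \<lfloor>real n * t\<rfloor>)"
          using order_statistic[of "snd z" n "nat \<lfloor>real n * t\<rfloor>"] z(3) pos \<open>nat \<lfloor>real n * t\<rfloor> \<le> n\<close>
          unfolding regular_sample_def by blast
        note G = rank_grid_at_order_statistics[OF n(1) z(3) q(2,3) q'(2,3)]
        have "\<bar>s - q\<bar> \<le> d" by (rule near[OF p(2) G(2) bd1[OF q(1)]])
        moreover have "\<bar>t - q'\<bar> \<le> d" by (rule near[OF p(3) G(3) bd2[OF q'(1)]])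
        ultimately have 1: "\<bar>field bridge_product n z (q, q') - field bridge_product n z p\<bar> \<le> e"
          using p q(1) q'(1) by (intro A(3)[OF z(1)]) (auto simp: unit_square_def abs_minus_commute)
        have "\<bar>1 / sqrt (real n) * (field sheet_kernel n z (q, 1) * field sheet_kernel n z (1, q'))\<bar> =
            1 / sqrt (real n) * (\<bar>field sheet_kernel n z (q, 1)\<bar> * \<bar>field sheet_kernel n z (1, q')\<bar>)" by (simp add: abs_mult)
        also have "\<dots> \<le> 1 / sqrt (real n) * (b * b)"
          using bd1[OF q(1)] bd2[OF q'(1)] by (intro mult_left_mono mult_mono) (auto simp: b_def)
        also have "\<dots> < e" using n3[OF n(4)] by simp
        finally have 2: "\<bar>1 / sqrt (real n) * (field sheet_kernel n z (q, 1) * field sheet_kernel n z (1, q'))\<bar> < e" .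
        have "grid_path n (rank_grid n (sample_ranks n z)) p = rank_grid n (sample_ranks n z) (nat \<lfloor>real n * s\<rfloor>, nat \<lfloor>real n * t\<rfloor>)"
          by (simp add: grid_path_def p(1))
        from this[unfolded G(1)] 1 2
        show "\<bar>grid_path n (rank_grid n (sample_ranks n z)) p - field bridge_product n z p\<bar> \<le> 2 * e" by linarith
      qed
    qed
  qed
qed

subsection \<open>The three processes\<close>

lemma cmod_perm_matrix: "(cmod (perm_matrix \<tau> i j))\<^sup>2 = of_bool (j = \<tau> i)"
  by (simp add: perm_matrix_def)

lemma T_process_perm_matrix:
  assumes t: "\<tau> permutes {1..n}" and st: "s \<in> {0..1}" "t \<in> {0..1}"
  shows "T_process n (perm_matrix \<tau>) (s, t) =
    (\<Sum>i=1..n. of_bool (i \<le> nat \<lfloor>real n * s\<rfloor> \<and> \<tau> i \<le> nat \<lfloor>real n * t\<rfloor>))"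
proof -
  define k l where "k = nat \<lfloor>real n * s\<rfloor>" and "l = nat \<lfloor>real n * t\<rfloor>"
  have k: "k \<le> n" unfolding k_def by (rule nat_floor_le) (use st in simp)
  have pos: "\<tau> i \<ge> 1" if "i \<in> {1..n}" for i using permutes_in_image[OF t, of i] that by simp
  have "T_process n (perm_matrix \<tau>) (s, t) = (\<Sum>i=1..k. \<Sum>j=1..l. if j = \<tau> i then 1 else 0)"
    unfolding T_process_def prod.case k_def[symmetric] l_def[symmetric] cmod_perm_matrix of_bool_def ..
  also have "\<dots> = (\<Sum>i\<in>{1..k}. of_bool (i \<le> k \<and> \<tau> i \<le> l))"
    using k pos by (intro sum.cong refl) (auto simp: sum.delta')
  also have "\<dots> = (\<Sum>i\<in>{1..n}. of_bool (i \<le> k \<and> \<tau> i \<le> l))"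
    using k by (intro sum.mono_neutral_left) auto
  finally show ?thesis by (simp only: k_def l_def)
qed

text \<open>Composition with the transposition of two values shows that all values at
  \<open>i\<close> are taken equally often, and together they exhaust the permutations.\<close>

lemma sum_permutations_point:
  assumes i: "i \<in> {1..n}" and j: "j \<in> {1..n}"
  shows "real n * (\<Sum>\<tau> | \<tau> permutes {1..n}. of_bool (\<tau> i = j)) = real (card {\<tau>. \<tau> permutes {1..n}})"
proof -
  define a where "a j = (\<Sum>\<tau> | \<tau> permutes {1..n}. of_bool (\<tau> i = j) :: real)" for j
  have eq: "a j' = a j" if j': "j' \<in> {1..n}" for j'
  proof -
    have p: "Transposition.transpose j j' permutes {1..n}" by (rule permutes_swap_id[OF j j'])
    have tr: "Transposition.transpose j j' x = j \<longleftrightarrow> x = j'" for x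
      by (metis transpose_apply_first transpose_apply_second transpose_involutory)
    have "a j = (\<Sum>\<tau> | \<tau> permutes {1..n}. of_bool ((Transposition.transpose j j' \<circ> \<tau>) i = j))"
      unfolding a_def by (rule setum_permutations_compose_left[OF p])
    also have "\<dots> = a j'"
      unfolding a_def o_apply tr ..
    finally show ?thesis ..
  qed
  have "real n * a j = (\<Sum>j'\<in>{1..n}. a j')" using eq by simp
  also have "\<dots> = (\<Sum>\<tau> | \<tau> permutes {1..n}. \<Sum>j'\<in>{1..n}. of_bool (\<tau> i = j'))"
    unfolding a_def by (rule sum.swap)
  also have "\<dots> = (\<Sum>\<tau> | \<tau> permutes {1..n}. 1)"
  proof (rule sum.cong[OF refl])
    fix \<tau> assume "\<tau> \<in> {\<tau>. \<tau> permutes {1..n}}"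
    then have "\<tau> i \<in> {1..n}" using permutes_in_image[of \<tau> "{1..n}" i] i by simp
    then show "(\<Sum>j'\<in>{1..n}. of_bool (\<tau> i = j') :: real) = 1" unfolding of_bool_def by simp
  qed
  finally show ?thesis by (simp add: a_def)
qed

lemma (in prob_space) integral_uniform_permutation:
  fixes h :: "(nat \<Rightarrow> nat) \<Rightarrow> real"
  assumes pm: "\<pi> \<in> M \<rightarrow>\<^sub>M count_space {p. p permutes {1..n}}"
    and u: "distr M (count_space {p. p permutes {1..n}}) \<pi> = uniform_count_measure {p. p permutes {1..n}}"
  shows "expectation (\<lambda>w. h (\<pi> w)) = (\<Sum>\<tau> | \<tau> permutes {1..n}. h \<tau>) / real (card {\<tau>. \<tau> permutes {1..n}})"
proof -
  have "expectation (\<lambda>w. h (\<pi> w)) = (\<integral>\<tau>. h \<tau> \<partial>distr M (count_space {p. p permutes {1..n}}) \<pi>)"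
    by (rule integral_distr[symmetric, OF pm]) simp
  also have "\<dots> = (\<Sum>\<tau> | \<tau> permutes {1..n}. h \<tau>) / real (card {\<tau>. \<tau> permutes {1..n}})"
    unfolding u by (rule integral_uniform_count_measure) (simp add: finite_permutations)
  finally show ?thesis .
qed

text \<open>Each entry of the matrix has mean \<open>1 / n\<close>; the result is the centering
  built into \<open>rank_grid\<close>.\<close>

lemma (in prob_space) expectation_T_process:
  assumes pm: "\<pi> \<in> M \<rightarrow>\<^sub>M count_space {p. p permutes {1..n}}"
    and u: "distr M (count_space {p. p permutes {1..n}}) \<pi> = uniform_count_measure {p. p permutes {1..n}}"
    and n: "n > 0" and st: "s \<in> {0..1}" "t \<in> {0..1}"
  shows "expectation (\<lambda>w. T_process n (perm_matrix (\<pi> w)) (s, t)) =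
    real (nat \<lfloor>real n * s\<rfloor>) * real (nat \<lfloor>real n * t\<rfloor>) / real n"
proof -
  define P where "P = {\<tau>. \<tau> permutes {1..n}}"
  define k l where "k = nat \<lfloor>real n * s\<rfloor>" and "l = nat \<lfloor>real n * t\<rfloor>"
  have kl: "k \<le> n" "l \<le> n" unfolding k_def l_def by (rule nat_floor_le, use st in simp)+
  have "finite P" unfolding P_def by (rule finite_permutations) simp
  moreover have "id \<in> P" by (simp add: P_def permutes_id)
  ultimately have P: "real (card P) \<noteq> 0" by auto
  have pt: "(\<Sum>\<tau>\<in>P. of_bool (\<tau> i = j)) = real (card P) / real n" if "i \<in> {1..n}" "j \<in> {1..n}" for i j
    using sum_permutations_point[OF that] n unfolding P_def by (simp add: eq_divide_eq mult.commute)
  have "(\<Sum>\<tau>\<in>P. T_process n (perm_matrix \<tau>) (s, t)) = (\<Sum>\<tau>\<in>P. \<Sum>i\<in>{1..k}. \<Sum>j\<in>{1..l}. of_bool (\<tau> i = j))"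
    unfolding T_process_def prod.case k_def[symmetric] l_def[symmetric] cmod_perm_matrix by (simp only: eq_commute)
  also have "\<dots> = (\<Sum>i\<in>{1..k}. \<Sum>\<tau>\<in>P. \<Sum>j\<in>{1..l}. of_bool (\<tau> i = j))" by (rule sum.swap)
  also have "\<dots> = (\<Sum>i\<in>{1..k}. \<Sum>j\<in>{1..l}. \<Sum>\<tau>\<in>P. of_bool (\<tau> i = j))" by (intro sum.cong refl sum.swap)
  also have "\<dots> = (\<Sum>i\<in>{1..k}. \<Sum>j\<in>{1..l}. real (card P) / real n)"
    using kl by (intro sum.cong refl pt) auto
  also have "\<dots> = real k * real l * (real (card P) / real n)" by simp
  finally have S: "(\<Sum>\<tau>\<in>P. T_process n (perm_matrix \<tau>) (s, t)) = real k * real l * (real (card P) / real n)" .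
  have "expectation (\<lambda>w. T_process n (perm_matrix (\<pi> w)) (s, t)) =
      (\<Sum>\<tau>\<in>P. T_process n (perm_matrix \<tau>) (s, t)) / real (card P)"
    unfolding P_def by (rule integral_uniform_permutation[OF pm u])
  also have "\<dots> = real k * real l / real n" unfolding S using P by simp
  finally show ?thesis by (simp only: k_def l_def)
qed

lemma path_on_square_cong:
  "(\<And>p. p \<in> unit_square \<Longrightarrow> x p = y p) \<Longrightarrow> path_on_square x = path_on_square y"
  unfolding path_on_square_def by (rule restrict_ext)

text \<open>Expectations of a functional under the permutation and under the ranks of a sample
  coincide exactly, so the comparison with the bridge field can take place on the sample space,
  where both paths are defined together.\<close>

lemma T_process_converges:
  assumes prob: "\<And>n. prob_space (M n)"
    and pm: "\<And>n. \<pi> n \<in> M n \<rightarrow>\<^sub>M count_space {p. p permutes {1..n}}"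
    and u: "\<And>n. distr (M n) (count_space {p. p permutes {1..n}}) (\<pi> n) = uniform_count_measure {p. p permutes {1..n}}"
    and W: "tied_down_bridge N W"
  shows "converges_in_distribution skorokhod_topology
           M (\<lambda>n \<omega>. path_on_square (\<lambda>p. real n powr (-1/2) *
                centered (M n) (\<lambda>\<omega>. T_process n (perm_matrix (\<pi> n \<omega>))) \<omega> p))
           N (\<lambda>\<omega>. path_on_square (W \<omega>))"
proof (rule skorokhod.converges_in_distribution_lipschitzI)
  define X where "X n w = path_on_square (\<lambda>p. real n powr (-1/2) *
                centered (M n) (\<lambda>\<omega>. T_process n (perm_matrix (\<pi> n \<omega>))) w p)" for n w
  have perm: "\<pi> n w permutes {1..n}" if "w \<in> space (M n)" for n w
    using measurable_space[OF pm that] by simp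
  have X: "X n w = rank_path n (\<lambda>i. (i, \<pi> n w i))" if w: "w \<in> space (M n)" for n w
    unfolding X_def rank_path_def
  proof (rule path_on_square_cong)
    fix p assume "p \<in> unit_square"
    then obtain s t where p: "p = (s, t)" "s \<in> {0..1}" "t \<in> {0..1}" by (auto simp: unit_square_def)
    show "real n powr (-1/2) * centered (M n) (\<lambda>\<omega>. T_process n (perm_matrix (\<pi> n \<omega>))) w p =
        grid_path n (rank_grid n (\<lambda>i. (i, \<pi> n w i))) p"
    proof (cases "n = 0")
      \<comment> \<open>Both sides vanish, since \<open>0 powr x = 0\<close>.\<close>
      case True
      then show ?thesis by (simp add: grid_path_def rank_grid_def p(1))
    next
      case False
      then show ?thesis
        using prob_space.expectation_T_process[OF prob pm u, of n s t] p T_process_perm_matrix[OF perm[OF w] p(2,3)]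
        by (simp only: centered_def grid_path_def rank_grid_def prod.case fst_conv snd_conv)
    qed
  qed
  have "(\<lambda>w. rank_path n (\<lambda>i. (i, \<pi> n w i))) \<in> M n \<rightarrow>\<^sub>M borel_of_topology skorokhod_topology" for n
    by (rule measurable_compose[OF pm, of "\<lambda>\<tau>. rank_path n (\<lambda>i. (i, \<tau> i))"]) (auto simp: rank_path_in)
  then have "X n \<in> M n \<rightarrow>\<^sub>M borel_of_topology skorokhod_topology" for n
    by (subst measurable_cong[of "M n" "X n", OF X]) auto
  then show "(\<lambda>\<omega>. path_on_square (\<lambda>p. real n powr (-1/2) * centered (M n) (\<lambda>\<omega>. T_process n (perm_matrix (\<pi> n \<omega>))) \<omega> p))
      \<in> M n \<rightarrow>\<^sub>M borel_of_topology skorokhod_topology" for n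
    unfolding X_def .
  show "prob_space (M n)" for n by (rule prob)
  have conv: "converges_in_distribution skorokhod_topology sample (\<lambda>n z. path_on_square (field bridge_product n z)) N (\<lambda>w. path_on_square (W w))"
    using W unfolding tied_down_bridge_def by (rule bridge.field_converges)
  then show "(\<lambda>\<omega>. path_on_square (W \<omega>)) \<in> N \<rightarrow>\<^sub>M borel_of_topology skorokhod_topology"
    by (simp add: converges_in_distribution_def)
  show "prob_space N" using W by (simp add: tied_down_bridge_def continuous_centered_gaussian_def gaussian_process_def)
  fix f :: "(real \<times> real \<Rightarrow> real) \<Rightarrow> real" and L K
  assume f: "\<And>x y. x \<in> skorokhod_space \<Longrightarrow> y \<in> skorokhod_space \<Longrightarrow> \<bar>f x - f y\<bar> \<le> L * skorokhod_dist x y"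
    and L: "L > 0" and K: "\<And>x. x \<in> skorokhod_space \<Longrightarrow> \<bar>f x\<bar> \<le> K"
  have cont: "continuous_map skorokhod_topology euclideanreal f"
    by (rule skorokhod.lipschitz_continuous_map[OF f])
  have fm: "f \<in> borel_measurable (borel_of_topology skorokhod_topology)"
    by (rule continuous_map_borel_measurable[OF cont])
  have K0: "K \<ge> 0" using K[OF rank_path_in[of 0 undefined]] by linarith
  have EX: "(\<integral>w. f (X n w) \<partial>M n) = (\<integral>z. f (rank_path n (sample_ranks n z)) \<partial>sample n)" for n
  proof -
    have "(\<integral>w. f (X n w) \<partial>M n) = (\<integral>w. f (rank_path n (\<lambda>i. (i, \<pi> n w i))) \<partial>M n)"
      by (intro Bochner_Integration.integral_cong) (auto simp: X)
    also have "\<dots> = (\<Sum>\<tau> | \<tau> permutes {1..n}. f (rank_path n (\<lambda>i. (i, \<tau> i)))) / real (card {\<tau>. \<tau> permutes {1..n}})"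
      by (rule prob_space.integral_uniform_permutation[OF prob pm u])
    also have "\<dots> = (\<integral>z. f (rank_path n (sample_ranks n z)) \<partial>sample n)"
      by (rule integral_rank_path[OF fm K, symmetric])
    finally show ?thesis .
  qed
  have Z: "(\<lambda>n. \<integral>z. f (path_on_square (field bridge_product n z)) \<partial>sample n) \<longlonglongrightarrow> (\<integral>w. f (path_on_square (W w)) \<partial>N)"
  proof -
    have "\<exists>B. \<forall>x\<in>topspace skorokhod_topology. \<bar>f x\<bar> \<le> B" using K by auto
    then show ?thesis using conv cont unfolding converges_in_distribution_def by blast
  qed
  have "(\<lambda>n. \<integral>w. f (X n w) \<partial>M n) \<longlonglongrightarrow> (\<integral>w. f (path_on_square (W w)) \<partial>N)"
    unfolding EX
  proof (rule tendstoI)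
    fix r :: real assume r: "r > 0"
    \<comment> \<open>The distance and the exceptional probability are both \<open>2 * e\<close>, so
      the total error \<open>2 * ((L + 2 * K) * e)\<close> is at most \<open>r / 4\<close>.\<close>
    define e where "e = min 1 (r / (8 * (L + 2 * K + 1)))"
    have e: "e > 0" "e \<le> 1" using r L K0 by (auto simp: e_def)
    have "e * (L + 2 * K + 1) \<le> r / (8 * (L + 2 * K + 1)) * (L + 2 * K + 1)"
      using L K0 by (intro mult_right_mono) (auto simp: e_def)
    also have "\<dots> = r / 8"
    proof -
      have cancel: "r / (8 * c) * c = r / 8" if "c > 0" for c :: real using that by simp
      show ?thesis by (rule cancel) (use L K0 in simp)
    qed
    finally have er: "(L + 2 * K) * e \<le> r / 8" using e by (simp add: algebra_simps)
    obtain n0 where n0: "\<And>n. n \<ge> n0 \<Longrightarrow> \<exists>A\<in>sets (sample n). measure (sample n) A \<ge> 1 - 2 * e \<and>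
      (\<forall>z\<in>A. skorokhod_dist (rank_path n (sample_ranks n z)) (path_on_square (field bridge_product n z)) \<le> 2 * e)"
      using rank_process_close[OF e] by blast
    have "\<forall>\<^sub>F n in sequentially. dist (\<integral>z. f (path_on_square (field bridge_product n z)) \<partial>sample n) (\<integral>w. f (path_on_square (W w)) \<partial>N) < r / 2"
      using Z r by (intro tendstoD) auto
    then show "\<forall>\<^sub>F n in sequentially. dist (\<integral>z. f (rank_path n (sample_ranks n z)) \<partial>sample n) (\<integral>w. f (path_on_square (W w)) \<partial>N) < r"
      using eventually_ge_at_top[of n0]
    proof eventually_elim
      case (elim n)
      obtain A where A: "A \<in> sets (sample n)" "measure (sample n) A \<ge> 1 - 2 * e"
        "\<And>z. z \<in> A \<Longrightarrow> skorokhod_dist (rank_path n (sample_ranks n z)) (path_on_square (field bridge_product n z)) \<le> 2 * e"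
        using n0[OF elim(2)] by blast
      have "\<bar>(\<integral>z. f (rank_path n (sample_ranks n z)) \<partial>sample n) - (\<integral>z. f (path_on_square (field bridge_product n z)) \<partial>sample n)\<bar> \<le>
          L * (2 * e) + 2 * K * (2 * e)"
      proof (rule sample.integral_diff_le_on[OF _ _ _ _ A(1,2)])
        show "(\<lambda>z. f (rank_path n (sample_ranks n z))) \<in> borel_measurable (sample n)"
          by (rule measurable_compose[OF measurable_rank_path fm])
        show "(\<lambda>z. f (path_on_square (field bridge_product n z))) \<in> borel_measurable (sample n)"
          by (rule measurable_compose[OF bridge.measurable_field_path fm])
        show "\<bar>f (rank_path n (sample_ranks n z))\<bar> \<le> K" "\<bar>f (path_on_square (field bridge_product n z))\<bar> \<le> K" for z
          by (intro K rank_path_in bridge.field_path_in)+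
        show "0 \<le> L * (2 * e)" using L e by simp
        fix z assume "z \<in> A"
        have "\<bar>f (rank_path n (sample_ranks n z)) - f (path_on_square (field bridge_product n z))\<bar> \<le>
            L * skorokhod_dist (rank_path n (sample_ranks n z)) (path_on_square (field bridge_product n z))"
          by (rule f[OF rank_path_in bridge.field_path_in])
        also have "\<dots> \<le> L * (2 * e)" using A(3)[OF \<open>z \<in> A\<close>] L by (intro mult_left_mono) auto
        finally show "\<bar>f (rank_path n (sample_ranks n z)) - f (path_on_square (field bridge_product n z))\<bar> \<le> L * (2 * e)" .
      qed
      also have "\<dots> = 2 * ((L + 2 * K) * e)" by (simp add: algebra_simps)
      finally show ?case using elim(1) er r unfolding dist_real_def by linarith
    qed
  qed
  then show "(\<lambda>n. \<integral>\<omega>. f (path_on_square (\<lambda>p. real n powr (-1/2) *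
        centered (M n) (\<lambda>\<omega>. T_process n (perm_matrix (\<pi> n \<omega>))) \<omega> p)) \<partial>M n) \<longlonglongrightarrow> (\<integral>w. f (path_on_square (W w)) \<partial>N)"
    unfolding X_def .
qed

lemma sum_perm_matrix:
  fixes h :: "nat \<Rightarrow> nat \<Rightarrow> real"
  assumes "\<tau> permutes {1..n}"
  shows "(\<Sum>i=1..n. \<Sum>j=1..n. (cmod (perm_matrix \<tau> i j))\<^sup>2 * h i j) = (\<Sum>i=1..n. h i (\<tau> i))"
proof (rule sum.cong[OF refl])
  fix i assume "i \<in> {1..n}"
  then have t: "\<tau> i \<in> {1..n}" using permutes_in_image[OF assms] by blast
  have "(\<Sum>j=1..n. (cmod (perm_matrix \<tau> i j))\<^sup>2 * h i j) = (\<Sum>j\<in>{1..n}. if j = \<tau> i then h i (\<tau> i) else 0)"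
    unfolding cmod_perm_matrix by (intro sum.cong) auto
  also have "\<dots> = h i (\<tau> i)" using t by simp
  finally show "(\<Sum>j=1..n. (cmod (perm_matrix \<tau> i j))\<^sup>2 * h i j) = h i (\<tau> i)" .
qed

lemma sample_jump_count_integral:
  assumes "s \<in> {0..1}" "t \<in> {0..1}"
  shows "(\<lambda>z. \<Sum>i=1..n. of_bool (fst z i \<le> s \<and> snd z i \<le> t) :: real) \<in> borel_measurable (sample n)"
    and "(\<integral>z. (\<Sum>i=1..n. of_bool (fst z i \<le> s \<and> snd z i \<le> t)) \<partial>sample n) = real n * (s * t)"
proof -
  define h where "h x = (of_bool (fst x \<le> s \<and> snd x \<le> t) :: real)" for x :: "real \<times> real"
  have h: "h \<in> borel_measurable borel" "\<bar>h x\<bar> \<le> 1" "(\<integral>x. h x \<partial>unif2) = s * t" for x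
    using integral_unif2_jump[OF assms] unfolding h_def
    by (auto simp: measurable_cong_sets[OF sets_unif2 refl] dest: borel_measurable_integrable)
  have hz: "of_bool (fst z i \<le> s \<and> snd z i \<le> t) = h (fst z i, snd z i)" for z :: "(nat \<Rightarrow> real) \<times> (nat \<Rightarrow> real)" and i
    by (simp add: h_def)
  have m: "(\<lambda>z. h (fst z i, snd z i)) \<in> borel_measurable (sample n)" if "i \<in> {1..n}" for i
    by (rule measurable_compose[OF measurable_sample_pair[OF that] h(1)])
  show "(\<lambda>z. \<Sum>i=1..n. of_bool (fst z i \<le> s \<and> snd z i \<le> t) :: real) \<in> borel_measurable (sample n)"
    unfolding hz by (intro borel_measurable_sum m)
  have "(\<integral>z. (\<Sum>i=1..n. h (fst z i, snd z i)) \<partial>sample n) = (\<Sum>i=1..n. \<integral>z. h (fst z i, snd z i) \<partial>sample n)"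
    by (rule Bochner_Integration.integral_sum) (use h(2) m in \<open>auto intro!: sample.integrable_const_bound[of _ 1]\<close>)
  also have "\<dots> = (\<Sum>i=1..n. s * t)"
    using integral_sample_coordinate[OF h(1,2)] h(3) by (intro sum.cong) auto
  finally show "(\<integral>z. (\<Sum>i=1..n. of_bool (fst z i \<le> s \<and> snd z i \<le> t)) \<partial>sample n) = real n * (s * t)"
    unfolding hz by simp
qed

theorem theorem3p6:
  fixes M :: "nat \<Rightarrow> 'a measure"
    and \<pi> :: "nat \<Rightarrow> 'a \<Rightarrow> nat \<Rightarrow> nat"
    and R C :: "nat \<Rightarrow> nat \<Rightarrow> 'a \<Rightarrow> real"
    and U :: "nat \<Rightarrow> 'a \<Rightarrow> nat \<Rightarrow> nat \<Rightarrow> complex"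
    and N :: "'b measure" and W :: "'b \<Rightarrow> real \<times> real \<Rightarrow> real"
    and N' :: "'c measure" and B :: "'c \<Rightarrow> real \<times> real \<Rightarrow> real"
  assumes prob: "\<And>n. prob_space (M n)"
    and perm_measurable: "\<And>n. \<pi> n \<in> M n \<rightarrow>\<^sub>M count_space {p. p permutes {1..n}}"
    and perm_uniform: "\<And>n. distr (M n) (count_space {p. p permutes {1..n}}) (\<pi> n) =
          uniform_count_measure {p. p permutes {1..n}}"
    and U_def: "\<And>n \<omega>. U n \<omega> = perm_matrix (\<pi> n \<omega>)"
    and R_uniform: "\<And>n i. i \<in> {1..n} \<Longrightarrow> distr (M n) borel (R n i) = uniform_measure lborel {0..1}"
    and C_uniform: "\<And>n j. j \<in> {1..n} \<Longrightarrow> distr (M n) borel (C n j) = uniform_measure lborel {0..1}"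
    and R_indep: "\<And>n. prob_space.indep_vars (M n) (\<lambda>_. borel) (R n) {1..n}"
    and C_indep: "\<And>n. prob_space.indep_vars (M n) (\<lambda>_. borel) (C n) {1..n}"
    and RC_indep: "\<And>n. prob_space.indep_var (M n)
          (Pi\<^sub>M {1..n} (\<lambda>_. borel)) (\<lambda>\<omega>. \<lambda>i\<in>{1..n}. R n i \<omega>)
          (Pi\<^sub>M {1..n} (\<lambda>_. borel)) (\<lambda>\<omega>. \<lambda>j\<in>{1..n}. C n j \<omega>)"
    and RC_U_indep: "\<And>n. independent_variables (M n)
          (Pi\<^sub>M {1..n} (\<lambda>_. borel) \<Otimes>\<^sub>M Pi\<^sub>M {1..n} (\<lambda>_. borel))
          (\<lambda>\<omega>. (\<lambda>i\<in>{1..n}. R n i \<omega>, \<lambda>j\<in>{1..n}. C n j \<omega>))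
          (Pi\<^sub>M ({1..n} \<times> {1..n}) (\<lambda>_. borel))
          (\<lambda>\<omega>. \<lambda>(i, j)\<in>{1..n} \<times> {1..n}. U n \<omega> i j)"
    and W: "tied_down_bridge N W"
    and B: "bivariate_bridge N' B"
  shows "(converges_in_distribution skorokhod_topology
           M (\<lambda>n \<omega>. path_on_square (\<lambda>p. real n powr (-1/2) *
                centered (M n) (\<lambda>\<omega>. T_process n (U n \<omega>)) \<omega> p))
           N (\<lambda>\<omega>. path_on_square (W \<omega>)))
    \<and> (converges_in_distribution skorokhod_topology
           M (\<lambda>n \<omega>. path_on_square (\<lambda>p. real n powr (-1/2) *
                centered (M n) (\<lambda>\<omega>. calT_process n (U n \<omega>) (\<lambda>i. R n i \<omega>) (\<lambda>j. C n j \<omega>)) \<omega> p))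
           N' (\<lambda>\<omega>. path_on_square (B \<omega>)))
    \<and> (converges_in_distribution skorokhod_topology
           M (\<lambda>n \<omega>. path_on_square (\<lambda>p. real n powr (-1/2) *
                calZ_process n (U n \<omega>) (\<lambda>i. R n i \<omega>) (\<lambda>j. C n j \<omega>) p))
           N (\<lambda>\<omega>. path_on_square (W \<omega>)))"
proof (intro conjI)
  \<comment> \<open>Reading the columns along the permutation collapses the double sums over the
    matrix to single sums over \<open>i\<close>. The second and third processes become pathwise
    functions of \<open>V n\<close>, whose law is \<open>sample n\<close>.\<close>
  define V where "V n \<omega> = (\<lambda>i\<in>{1..n}. R n i \<omega>, \<lambda>i\<in>{1..n}. C n (\<pi> n \<omega> i) \<omega>)" for n \<omega>
  have V: "V n \<in> M n \<rightarrow>\<^sub>M sample n" "distr (M n) (sample n) (V n) = sample n" for n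
    using prob_space.permuted_sample_law[OF prob perm_measurable R_indep _ C_indep _ RC_indep
        RC_U_indep[unfolded U_def]] R_uniform C_uniform
    unfolding V_def[abs_def] unif_def by auto
  have perm: "\<pi> n \<omega> permutes {1..n}" if "\<omega> \<in> space (M n)" for n \<omega>
    using measurable_space[OF perm_measurable that] by simp
  show "converges_in_distribution skorokhod_topology
           M (\<lambda>n \<omega>. path_on_square (\<lambda>p. real n powr (-1/2) *
                centered (M n) (\<lambda>\<omega>. T_process n (U n \<omega>)) \<omega> p))
           N (\<lambda>\<omega>. path_on_square (W \<omega>))"
    unfolding U_def by (rule T_process_converges[OF prob perm_measurable perm_uniform W])
  have calT: "calT_process n (U n \<omega>) (\<lambda>i. R n i \<omega>) (\<lambda>j. C n j \<omega>) (s, t) =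
      (\<Sum>i=1..n. of_bool (fst (V n \<omega>) i \<le> s \<and> snd (V n \<omega>) i \<le> t))"
    if w: "\<omega> \<in> space (M n)" for n \<omega> s t
  proof -
    have "calT_process n (U n \<omega>) (\<lambda>i. R n i \<omega>) (\<lambda>j. C n j \<omega>) (s, t) =
        (\<Sum>i=1..n. of_bool (R n i \<omega> \<le> s) * of_bool (C n (\<pi> n \<omega> i) \<omega> \<le> t))"
      unfolding calT_process_def prod.case U_def mult.assoc by (rule sum_perm_matrix[OF perm[OF w]])
    also have "\<dots> = (\<Sum>i=1..n. of_bool (fst (V n \<omega>) i \<le> s \<and> snd (V n \<omega>) i \<le> t))"
      by (intro sum.cong) (auto simp: V_def)
    finally show ?thesis .
  qed
  have mean: "(\<integral>\<omega>. calT_process n (U n \<omega>) (\<lambda>i. R n i \<omega>) (\<lambda>j. C n j \<omega>) (s, t) \<partial>M n) = real n * (s * t)"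
    if st: "s \<in> {0..1}" "t \<in> {0..1}" for n s t
  proof -
    have "(\<integral>\<omega>. calT_process n (U n \<omega>) (\<lambda>i. R n i \<omega>) (\<lambda>j. C n j \<omega>) (s, t) \<partial>M n) =
        (\<integral>\<omega>. (\<Sum>i=1..n. of_bool (fst (V n \<omega>) i \<le> s \<and> snd (V n \<omega>) i \<le> t)) \<partial>M n)"
      by (intro Bochner_Integration.integral_cong refl calT)
    also have "\<dots> = (\<integral>z. (\<Sum>i=1..n. of_bool (fst z i \<le> s \<and> snd z i \<le> t)) \<partial>distr (M n) (sample n) (V n))"
      by (rule integral_distr[symmetric, OF V(1) sample_jump_count_integral(1)[OF st]])
    finally show ?thesis by (simp only: V(2) sample_jump_count_integral(2)[OF st])
  qed
  show "converges_in_distribution skorokhod_topology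
           M (\<lambda>n \<omega>. path_on_square (\<lambda>p. real n powr (-1/2) *
                centered (M n) (\<lambda>\<omega>. calT_process n (U n \<omega>) (\<lambda>i. R n i \<omega>) (\<lambda>j. C n j \<omega>)) \<omega> p))
           N' (\<lambda>\<omega>. path_on_square (B \<omega>))"
  proof (rule converges_in_distribution_transfer[OF V])
    show "converges_in_distribution skorokhod_topology sample (\<lambda>n z. path_on_square (field sheet_kernel n z)) N' (\<lambda>\<omega>. path_on_square (B \<omega>))"
      using B unfolding bivariate_bridge_def by (rule sheet.field_converges)
    fix n \<omega> assume w: "\<omega> \<in> space (M n)"
    show "path_on_square (\<lambda>p. real n powr (-1/2) *
        centered (M n) (\<lambda>\<omega>. calT_process n (U n \<omega>) (\<lambda>i. R n i \<omega>) (\<lambda>j. C n j \<omega>)) \<omega> p) =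
      path_on_square (field sheet_kernel n (V n \<omega>))"
    proof (rule path_on_square_cong)
      fix p assume "p \<in> unit_square"
      then obtain s t where p: "p = (s, t)" "s \<in> {0..1}" "t \<in> {0..1}" by (auto simp: unit_square_def)
      have "(\<Sum>i=1..n. kern sheet_kernel (fst (V n \<omega>) i, snd (V n \<omega>) i) (s, t)) =
          (\<Sum>i=1..n. of_bool (fst (V n \<omega>) i \<le> s \<and> snd (V n \<omega>) i \<le> t)) - real n * (s * t)"
        by (simp add: kern_def sheet_kernel_def sum_subtractf del: of_bool_conj)
      then show "real n powr (-1/2) *
          centered (M n) (\<lambda>\<omega>. calT_process n (U n \<omega>) (\<lambda>i. R n i \<omega>) (\<lambda>j. C n j \<omega>)) \<omega> p =
        field sheet_kernel n (V n \<omega>) p"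
        unfolding centered_def p(1) calT[OF w] mean[OF p(2,3)] field_def by (simp only:)
    qed
  qed
  show "converges_in_distribution skorokhod_topology
           M (\<lambda>n \<omega>. path_on_square (\<lambda>p. real n powr (-1/2) *
                calZ_process n (U n \<omega>) (\<lambda>i. R n i \<omega>) (\<lambda>j. C n j \<omega>) p))
           N (\<lambda>\<omega>. path_on_square (W \<omega>))"
  proof (rule converges_in_distribution_transfer[OF V])
    show "converges_in_distribution skorokhod_topology sample (\<lambda>n z. path_on_square (field bridge_product n z)) N (\<lambda>\<omega>. path_on_square (W \<omega>))"
      using W unfolding tied_down_bridge_def by (rule bridge.field_converges)
    fix n \<omega> assume w: "\<omega> \<in> space (M n)"
    show "path_on_square (\<lambda>p. real n powr (-1/2) *
        calZ_process n (U n \<omega>) (\<lambda>i. R n i \<omega>) (\<lambda>j. C n j \<omega>) p) =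
      path_on_square (field bridge_product n (V n \<omega>))"
    \<comment> \<open>No mean has to be computed in this case, and the identity holds for all real
      \<open>s\<close> and \<open>t\<close>.\<close>
    proof (rule arg_cong[where f=path_on_square], rule ext)
      fix p :: "real \<times> real"
      obtain s t where p: "p = (s, t)" by (cases p)
      have "calZ_process n (U n \<omega>) (\<lambda>i. R n i \<omega>) (\<lambda>j. C n j \<omega>) (s, t) =
          (\<Sum>i=1..n. (of_bool (R n i \<omega> \<le> s) - s) * (of_bool (C n (\<pi> n \<omega> i) \<omega> \<le> t) - t))"
        unfolding calZ_process_def prod.case U_def mult.assoc by (rule sum_perm_matrix[OF perm[OF w]])
      also have "\<dots> = (\<Sum>i=1..n. kern bridge_product (fst (V n \<omega>) i, snd (V n \<omega>) i) (s, t))"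
        by (intro sum.cong) (auto simp: V_def kern_def bridge_product_def)
      finally show "real n powr (-1/2) * calZ_process n (U n \<omega>) (\<lambda>i. R n i \<omega>) (\<lambda>j. C n j \<omega>) p =
        field bridge_product n (V n \<omega>) p"
        unfolding p field_def by (rule arg_cong)
    qed
  qed
qed

end
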